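(* In the setting described in the context (with the norm $|\cdot|_\infty$ on $\mathbb{R}^n$), suppose $\gamma>0$ and let $\bar u\in BV(\omega)\cap L^2(\omega)$ satisfy the first order condition: there exists $\bar\lambda\in\partial g(\nabla\bar u)$ with $$\alpha\langle\bar\lambda,\nabla v\rangle_{[M(\omega)^n]^*,M(\omega)^n}+\int_\omega\Big(\bar\varphi+\gamma\bar u+\beta\int_\omega\bar u\,dz\Big)v\,dx=0\quad\forall v\in BV(\omega)\cap L^2(\omega),$$ where $\bar\varphi$ is the adjoint state of $\bar u$. Assume moreover that there exist $\delta>0$ and $\tau>0$ such that $$F''(\bar u)v^2\ge\delta\|v\|^2_{L^2(\omega)}\quad\forall v\in C^\tau_{\bar u}:=\{v\in BV(\omega)\cap L^2(\omega):F'(\bar u)v+\alpha G'(\bar u;v)\le\tau\|z_v\|_{L^2(\Omega)}\},$$ where $z_v=S'(\bar u)v$. Then there exist $\kappa>0$ and $\varepsilon>0$ such that $$J(\bar u)+\frac\kappa2\|u-\bar u\|^2_{L^2(\omega)}\le J(u)\quad\forall u\in BV(\omega)\cap L^2(\omega)\text{ with }\|u-\bar u\|_{L^2(\omega)}\le\varepsilon.$$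
   Context: $\Omega\subset\mathbb{R}^n$, $n\in\{2,3\}$, bounded domain with Lipschitz boundary $\Gamma$; $\omega\subset\Omega$ open; $\alpha>0$, $\beta\ge0$, $y_d\in L^2(\Omega)$. $f:\Omega\times\mathbb{R}\to\mathbb{R}$ Borel, $C^2$ in $y$, with for a.e. $x$: $f(\cdot,0)\in L^{\hat p}(\Omega)$, $\hat p>n/2$; $\partial_yf\ge0$; for every $M$ there is $C_M$ with $|\partial_yf(x,y)|+|\partial^2_{yy}f(x,y)|\le C_M$ for $|y|\le M$; for every $M,\rho>0$ there is $\varepsilon>0$ with $|\partial^2_{yy}f(x,y_2)-\partial^2_{yy}f(x,y_1)|\le\rho$ if $|y_2-y_1|<\varepsilon$, $|y_i|\le M$. $S(u)=y_u\in C(\bar\Omega)\cap H_0^1(\Omega)$ solves $-\Delta y+f(x,y)=u\chi_\omega$ in $\Omega$, $y=0$ on $\Gamma$; $z_v=S'(\bar u)v$ solves $-\Delta z+\partial_yf(x,\bar y)z=v\chi_\omega$, $z=0$ on $\Gamma$, with $\bar y=S(\bar u)$; the adjoint state $\bar\varphi$ solves $-\Delta\varphi+\partial_yf(x,\bar y)\varphi=\bar y-y_d$, $\varphi=0$ on $\Gamma$. $F(u)=\frac12\int_\Omega|y_u-y_d|^2dx+\frac\beta2(\int_\omega u\,dx)^2+\frac\gamma2\int_\omega u^2dx$ ($C^2$ on $L^2(\omega)$). $M(\omega)$: real regular Borel measures; $C_0(\omega)$: continuous functions on $\bar\omega$ vanishing on $\partial\omega$; with $|\cdot|_\infty$ on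 $\mathbb{R}^n$, $\|\mu\|_{M(\omega)^n}=\sup\{\int_\omega z\cdot d\mu: z\in C_0(\omega)^n, |z(x)|_\infty\le1\}$, $g(\mu)=\|\mu\|_{M(\omega)^n}$ with convex subdifferential $\partial g$; $G(u)=g(\nabla u)$ for $u\in BV(\omega)$; $G'(\bar u;v)$ is the one-sided directional derivative; $J=F+\alpha G$. *)

theory Defs
  imports "HOL-Analysis.Analysis"
begin

text \<open>Bounded domain (open, connected, bounded) with Lipschitz boundary: near each boundary
 point the domain is, in a suitably rotated coordinate system (direction e), the subgraph of a
 Lipschitz function of the remaining coordinates.\<close>
definition lipschitz_domain :: "'a::euclidean_space set \<Rightarrow> bool" where
  "lipschitz_domain \<Omega> \<longleftrightarrow> open \<Omega> \<and> connected \<Omega> \<and> bounded \<Omega> \<and> \<Omega> \<noteq> {} \<and>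
     (\<forall>p\<in>frontier \<Omega>. \<exists>r>0. \<exists>e::'a. \<exists>h::'a \<Rightarrow> real. \<exists>L.
        norm e = 1 \<and> L-lipschitz_on UNIV h \<and>
        \<Omega> \<inter> ball p r = {x \<in> ball p r. x \<bullet> e < h (x - (x \<bullet> e) *\<^sub>R e)})"

definition L2 :: "'a::euclidean_space set \<Rightarrow> ('a \<Rightarrow> real) \<Rightarrow> bool" where
  "L2 U u \<longleftrightarrow> set_borel_measurable lebesgue U u \<and> set_integrable lebesgue U (\<lambda>x. (u x)\<^sup>2)"

definition l2n :: "'a::euclidean_space set \<Rightarrow> ('a \<Rightarrow> real) \<Rightarrow> real" where
  "l2n U u = sqrt (LINT x:U|lebesgue. (u x)\<^sup>2)"

definition test_fun :: "'a::euclidean_space set \<Rightarrow> ('a \<Rightarrow> real) \<Rightarrow> ('a \<Rightarrow> 'a) \<Rightarrow> bool" where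
  "test_fun U \<phi> D\<phi> \<longleftrightarrow> (\<forall>x. (\<phi> has_derivative (\<lambda>h. D\<phi> x \<bullet> h)) (at x)) \<and>
     continuous_on UNIV D\<phi> \<and> compact (closure {x. \<phi> x \<noteq> 0}) \<and> closure {x. \<phi> x \<noteq> 0} \<subseteq> U"

definition H1 :: "'a::euclidean_space set \<Rightarrow> ('a \<Rightarrow> real) \<Rightarrow> ('a \<Rightarrow> 'a) \<Rightarrow> bool" where
  "H1 U u G \<longleftrightarrow> L2 U u \<and> (\<forall>b\<in>Basis. L2 U (\<lambda>x. G x \<bullet> b)) \<and>
     (\<forall>\<phi> D\<phi>. test_fun U \<phi> D\<phi> \<longrightarrow> (\<forall>b\<in>Basis.
        (LINT x:U|lebesgue. u x * (D\<phi> x \<bullet> b)) = - (LINT x:U|lebesgue. (G x \<bullet> b) * \<phi> x)))"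

definition H01 :: "'a::euclidean_space set \<Rightarrow> ('a \<Rightarrow> real) \<Rightarrow> ('a \<Rightarrow> 'a) \<Rightarrow> bool" where
  "H01 U u G \<longleftrightarrow> H1 U u G \<and>
     (\<exists>\<phi> D\<phi>. (\<forall>k::nat. test_fun U (\<phi> k) (D\<phi> k)) \<and>
        (\<lambda>k. l2n U (\<lambda>x. \<phi> k x - u x)) \<longlonglongrightarrow> 0 \<and>
        (\<lambda>k. l2n U (\<lambda>x. norm (D\<phi> k x - G x))) \<longlonglongrightarrow> 0)"

definition bsets :: "'a::euclidean_space set \<Rightarrow> 'a set set" where
  "bsets \<omega> = {A. A \<in> sets borel \<and> A \<subseteq> \<omega>}"

definition vmeasure :: "'a::euclidean_space set \<Rightarrow> ('a set \<Rightarrow> 'a) \<Rightarrow> bool" where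
  "vmeasure \<omega> \<mu> \<longleftrightarrow> (\<forall>A. A \<notin> bsets \<omega> \<longrightarrow> \<mu> A = 0) \<and>
     (\<forall>F::nat \<Rightarrow> 'a set. range F \<subseteq> bsets \<omega> \<and> disjoint_family F \<longrightarrow>
        (\<lambda>i. \<mu> (F i)) sums \<mu> (\<Union>i. F i))"

definition spos :: "'a::euclidean_space set \<Rightarrow> ('a set \<Rightarrow> real) \<Rightarrow> 'a set \<Rightarrow> real" where
  "spos \<omega> \<nu> A = Sup {\<nu> B | B. B \<in> bsets \<omega> \<and> B \<subseteq> A}"

definition spos_measure :: "'a::euclidean_space set \<Rightarrow> ('a set \<Rightarrow> real) \<Rightarrow> 'a measure" where
  "spos_measure \<omega> \<nu> = measure_of \<omega> (bsets \<omega>) (\<lambda>A. ennreal (spos \<omega> \<nu> A))"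

definition sint :: "'a::euclidean_space set \<Rightarrow> ('a set \<Rightarrow> real) \<Rightarrow> ('a \<Rightarrow> real) \<Rightarrow> real" where
  "sint \<omega> \<nu> h = integral\<^sup>L (spos_measure \<omega> \<nu>) h - integral\<^sup>L (spos_measure \<omega> (\<lambda>A. - \<nu> A)) h"

definition vint :: "'a::euclidean_space set \<Rightarrow> ('a set \<Rightarrow> 'a) \<Rightarrow> ('a \<Rightarrow> 'a) \<Rightarrow> real" where
  "vint \<omega> \<mu> z = (\<Sum>b\<in>Basis. sint \<omega> (\<lambda>A. \<mu> A \<bullet> b) (\<lambda>x. z x \<bullet> b))"

definition C0 :: "'a::euclidean_space set \<Rightarrow> ('a \<Rightarrow> 'a) \<Rightarrow> bool" where
  "C0 \<omega> z \<longleftrightarrow> continuous_on (closure \<omega>) z \<and> (\<forall>x\<in>frontier \<omega>. z x = 0)"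

definition gnorm :: "'a::euclidean_space set \<Rightarrow> ('a set \<Rightarrow> 'a) \<Rightarrow> real" where
  "gnorm \<omega> \<mu> = Sup {vint \<omega> \<mu> z | z. C0 \<omega> z \<and> (\<forall>x\<in>closure \<omega>. infnorm (z x) \<le> 1)}"

definition vdual :: "'a::euclidean_space set \<Rightarrow> (('a set \<Rightarrow> 'a) \<Rightarrow> real) \<Rightarrow> bool" where
  "vdual \<omega> L \<longleftrightarrow>
     (\<forall>\<mu> \<nu>. vmeasure \<omega> \<mu> \<and> vmeasure \<omega> \<nu> \<longrightarrow> L (\<lambda>A. \<mu> A + \<nu> A) = L \<mu> + L \<nu>) \<and>
     (\<forall>c \<mu>. vmeasure \<omega> \<mu> \<longrightarrow> L (\<lambda>A. c *\<^sub>R \<mu> A) = c * L \<mu>) \<and>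
     (\<exists>C. \<forall>\<mu>. vmeasure \<omega> \<mu> \<longrightarrow> \<bar>L \<mu>\<bar> \<le> C * gnorm \<omega> \<mu>)"

definition subdiff_g :: "'a::euclidean_space set \<Rightarrow> ('a set \<Rightarrow> 'a) \<Rightarrow> (('a set \<Rightarrow> 'a) \<Rightarrow> real) \<Rightarrow> bool" where
  "subdiff_g \<omega> \<mu>0 L \<longleftrightarrow> vdual \<omega> L \<and>
     (\<forall>\<mu>. vmeasure \<omega> \<mu> \<longrightarrow> gnorm \<omega> \<mu>0 + L (\<lambda>A. \<mu> A - \<mu>0 A) \<le> gnorm \<omega> \<mu>)"

definition is_grad_meas :: "'a::euclidean_space set \<Rightarrow> ('a \<Rightarrow> real) \<Rightarrow> ('a set \<Rightarrow> 'a) \<Rightarrow> bool" where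
  "is_grad_meas \<omega> u \<mu> \<longleftrightarrow> vmeasure \<omega> \<mu> \<and>
     (\<forall>\<phi> D\<phi>. test_fun \<omega> \<phi> D\<phi> \<longrightarrow> (\<forall>b\<in>Basis.
        (LINT x:\<omega>|lebesgue. u x * (D\<phi> x \<bullet> b)) = - sint \<omega> (\<lambda>A. \<mu> A \<bullet> b) \<phi>))"

definition BV :: "'a::euclidean_space set \<Rightarrow> ('a \<Rightarrow> real) \<Rightarrow> bool" where
  "BV \<omega> u \<longleftrightarrow> set_borel_measurable lebesgue \<omega> u \<and> set_integrable lebesgue \<omega> u \<and>
     (\<exists>\<mu>. is_grad_meas \<omega> u \<mu>)"

definition BVL2 :: "'a::euclidean_space set \<Rightarrow> ('a \<Rightarrow> real) \<Rightarrow> bool" where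
  "BVL2 \<omega> u \<longleftrightarrow> BV \<omega> u \<and> L2 \<omega> u"

definition grad_meas :: "'a::euclidean_space set \<Rightarrow> ('a \<Rightarrow> real) \<Rightarrow> ('a set \<Rightarrow> 'a)" where
  "grad_meas \<omega> u = (THE \<mu>. is_grad_meas \<omega> u \<mu>)"

definition Gfun :: "'a::euclidean_space set \<Rightarrow> ('a \<Rightarrow> real) \<Rightarrow> real" where
  "Gfun \<omega> u = gnorm \<omega> (grad_meas \<omega> u)"

definition Gdir :: "'a::euclidean_space set \<Rightarrow> ('a \<Rightarrow> real) \<Rightarrow> ('a \<Rightarrow> real) \<Rightarrow> real" where
  "Gdir \<omega> u v = Lim (at_right 0) (\<lambda>t. (Gfun \<omega> (\<lambda>x. u x + t * v x) - Gfun \<omega> u) / t)"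

definition fy :: "('a \<Rightarrow> real \<Rightarrow> real) \<Rightarrow> 'a \<Rightarrow> real \<Rightarrow> real" where
  "fy f x y = deriv (f x) y"

definition fyy :: "('a \<Rightarrow> real \<Rightarrow> real) \<Rightarrow> 'a \<Rightarrow> real \<Rightarrow> real" where
  "fyy f x y = deriv (deriv (f x)) y"

text \<open>y \<in> C(closure \<Omega>) \<inter> H^1_0(\<Omega>) weak solution of -\<Delta>y + f(x,y) = u \<chi>_\<omega>, y = 0 on \<Gamma>
  (the representative is taken continuous on the closure and 0 outside \<Omega>).\<close>
definition state_sol :: "'a::euclidean_space set \<Rightarrow> 'a set \<Rightarrow> ('a \<Rightarrow> real \<Rightarrow> real)
    \<Rightarrow> ('a \<Rightarrow> real) \<Rightarrow> ('a \<Rightarrow> real) \<Rightarrow> bool" where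
  "state_sol \<Omega> \<omega> f u y \<longleftrightarrow> continuous_on (closure \<Omega>) y \<and> (\<forall>x. x \<notin> \<Omega> \<longrightarrow> y x = 0) \<and>
     (\<exists>G. H01 \<Omega> y G \<and> (\<forall>\<phi> D\<phi>. test_fun \<Omega> \<phi> D\<phi> \<longrightarrow>
        (LINT x:\<Omega>|lebesgue. G x \<bullet> D\<phi> x + f x (y x) * \<phi> x) = (LINT x:\<omega>|lebesgue. u x * \<phi> x)))"

definition Sop :: "'a::euclidean_space set \<Rightarrow> 'a set \<Rightarrow> ('a \<Rightarrow> real \<Rightarrow> real)
    \<Rightarrow> ('a \<Rightarrow> real) \<Rightarrow> ('a \<Rightarrow> real)" where
  "Sop \<Omega> \<omega> f u = (THE y. state_sol \<Omega> \<omega> f u y)"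

text \<open>z = S'(ubar) v: -\<Delta>z + f_y(x,ybar) z = v \<chi>_\<omega>, z \<in> H^1_0(\<Omega>).\<close>
definition lin_sol :: "'a::euclidean_space set \<Rightarrow> 'a set \<Rightarrow> ('a \<Rightarrow> real \<Rightarrow> real)
    \<Rightarrow> ('a \<Rightarrow> real) \<Rightarrow> ('a \<Rightarrow> real) \<Rightarrow> ('a \<Rightarrow> real) \<Rightarrow> bool" where
  "lin_sol \<Omega> \<omega> f ybar v z \<longleftrightarrow>
     (\<exists>G. H01 \<Omega> z G \<and> (\<forall>\<phi> D\<phi>. test_fun \<Omega> \<phi> D\<phi> \<longrightarrow>
        (LINT x:\<Omega>|lebesgue. G x \<bullet> D\<phi> x + fy f x (ybar x) * z x * \<phi> x) = (LINT x:\<omega>|lebesgue. v x * \<phi> x)))"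

definition adj_sol :: "'a::euclidean_space set \<Rightarrow> ('a \<Rightarrow> real \<Rightarrow> real)
    \<Rightarrow> ('a \<Rightarrow> real) \<Rightarrow> ('a \<Rightarrow> real) \<Rightarrow> ('a \<Rightarrow> real) \<Rightarrow> bool" where
  "adj_sol \<Omega> f ybar yd p \<longleftrightarrow>
     (\<exists>G. H01 \<Omega> p G \<and> (\<forall>\<phi> D\<phi>. test_fun \<Omega> \<phi> D\<phi> \<longrightarrow>
        (LINT x:\<Omega>|lebesgue. G x \<bullet> D\<phi> x + fy f x (ybar x) * p x * \<phi> x)
          = (LINT x:\<Omega>|lebesgue. (ybar x - yd x) * \<phi> x)))"

definition Fcost :: "'a::euclidean_space set \<Rightarrow> 'a set \<Rightarrow> ('a \<Rightarrow> real \<Rightarrow> real) \<Rightarrow> ('a \<Rightarrow> real)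
    \<Rightarrow> real \<Rightarrow> real \<Rightarrow> ('a \<Rightarrow> real) \<Rightarrow> real" where
  "Fcost \<Omega> \<omega> f yd \<beta> \<gamma> u =
     1/2 * (LINT x:\<Omega>|lebesgue. (Sop \<Omega> \<omega> f u x - yd x)\<^sup>2)
     + \<beta>/2 * (LINT x:\<omega>|lebesgue. u x)\<^sup>2 + \<gamma>/2 * (LINT x:\<omega>|lebesgue. (u x)\<^sup>2)"

definition Jcost :: "'a::euclidean_space set \<Rightarrow> 'a set \<Rightarrow> ('a \<Rightarrow> real \<Rightarrow> real) \<Rightarrow> ('a \<Rightarrow> real)
    \<Rightarrow> real \<Rightarrow> real \<Rightarrow> real \<Rightarrow> ('a \<Rightarrow> real) \<Rightarrow> real" where
  "Jcost \<Omega> \<omega> f yd \<alpha> \<beta> \<gamma> u = Fcost \<Omega> \<omega> f yd \<beta> \<gamma> u + \<alpha> * Gfun \<omega> u"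

text \<open>F'(u)v and F''(u)v^2 (F is C^2 on L^2(\<omega>), so these are the first and second derivatives
  of t \<mapsto> F(u + t v) at 0).\<close>
definition F1 :: "'a::euclidean_space set \<Rightarrow> 'a set \<Rightarrow> ('a \<Rightarrow> real \<Rightarrow> real) \<Rightarrow> ('a \<Rightarrow> real)
    \<Rightarrow> real \<Rightarrow> real \<Rightarrow> ('a \<Rightarrow> real) \<Rightarrow> ('a \<Rightarrow> real) \<Rightarrow> real" where
  "F1 \<Omega> \<omega> f yd \<beta> \<gamma> u v = deriv (\<lambda>t. Fcost \<Omega> \<omega> f yd \<beta> \<gamma> (\<lambda>x. u x + t * v x)) 0"

definition F2 :: "'a::euclidean_space set \<Rightarrow> 'a set \<Rightarrow> ('a \<Rightarrow> real \<Rightarrow> real) \<Rightarrow> ('a \<Rightarrow> real)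
    \<Rightarrow> real \<Rightarrow> real \<Rightarrow> ('a \<Rightarrow> real) \<Rightarrow> ('a \<Rightarrow> real) \<Rightarrow> real" where
  "F2 \<Omega> \<omega> f yd \<beta> \<gamma> u v = deriv (deriv (\<lambda>t. Fcost \<Omega> \<omega> f yd \<beta> \<gamma> (\<lambda>x. u x + t * v x))) 0"

end

theory Submission
  imports Defs
begin

text \<open>Write \<open>v = u - ubar\<close>. The subgradient inequality turns the first order condition into
  \<open>F'(ubar)v + \<alpha> (G u - G ubar) \<ge> 0\<close>, and convexity of \<open>G\<close> gives \<open>G'(ubar; v) \<le> G u - G ubar\<close>. The key
  estimate is \<open>F u = F ubar + F'(ubar)v + F''(ubar)v\<^sup>2 / 2 + o(\<parallel>v\<parallel>\<^sup>2)\<close> in \<open>L\<^sup>2(\<omega>)\<close>. If \<open>v\<close> lies in the extended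
  cone, the coercivity assumption concludes. Otherwise \<open>F'(ubar)v + \<alpha> (G u - G ubar) > \<tau> \<parallel>z\<^sub>v\<parallel>\<close>, which for small \<open>v\<close>
  absorbs the only possibly negative contribution \<open>- C \<parallel>z\<^sub>v\<parallel>\<^sup>2\<close> to \<open>F''(ubar)v\<^sup>2 \<ge> \<gamma> \<parallel>v\<parallel>\<^sup>2 - C \<parallel>z\<^sub>v\<parallel>\<^sup>2\<close>.

  The expansion rests on \<open>\<parallel>z\<parallel>\<^sub>\<infinity> \<le> C \<parallel>g\<parallel>\<^sub>2\<close> for \<open>- \<Delta>z + c z = g\<close> with \<open>c \<ge> 0\<close>, valid because \<open>n \<le> 3\<close>. Kato's
  inequality reduces this bound to an approximate mean value inequality for \<open>- \<Delta>U \<le> g\<close> with \<open>g\<close> in a Morrey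
  space; together with the exterior thickness of a Lipschitz domain the same inequality yields continuity
  of the states up to the boundary.\<close>

section \<open>Square integrable functions\<close>

text \<open>Function spaces are handled through representatives: an element of H^1_0 is a pair of a
  function and its gradient, and every equation becomes a relation \<open>weq\<close> between a
  gradient and a right-hand side. Two obstacles shape the work. First, F is expanded in L^2, while
  the Taylor remainder of f is quadratic only as long as the states stay in a fixed interval. Hence
  sup norms must be bounded by L^2 norms of the data, with constants that see the zero order term
  only through its sign. Morrey spaces enter because they contain both L^2 (here n \<le> 3 matters)
  and L^p with p > n/2, where \<open>f x 0\<close> lives. Second, \<open>Sop\<close>,
  \<open>grad_meas\<close>, \<open>Gdir\<close>, \<open>F1\<close> and \<open>F2\<close> are defined
  by description operators, limits and derivatives, so each must be shown to denote the intended
  object: by uniqueness of states, uniqueness of the gradient measure, monotone difference quotients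
  of a convex function, and adjoint states along the whole line u + t v. Since \<gamma> > 0, growth
  is obtained in the same L^2 norm in which the expansion of F holds.\<close>

definition sqi :: "'c measure \<Rightarrow> ('c \<Rightarrow> 'b::euclidean_space) \<Rightarrow> bool" where
  "sqi M u \<longleftrightarrow> u \<in> borel_measurable M \<and> integrable M (\<lambda>x. (norm (u x))\<^sup>2)"

definition nrm2 :: "'c measure \<Rightarrow> ('c \<Rightarrow> 'b::euclidean_space) \<Rightarrow> real" where
  "nrm2 M u = sqrt (\<integral>x. (norm (u x))\<^sup>2 \<partial>M)"

lemma sqi_meas: "sqi M u \<Longrightarrow> u \<in> borel_measurable M"
  and sqi_integrable: "sqi M u \<Longrightarrow> integrable M (\<lambda>x. (norm (u x))\<^sup>2)"
  by (auto simp: sqi_def)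

declare sqi_meas [measurable_dest]

lemma nrm2_nonneg [simp]: "0 \<le> nrm2 M u"
  by (simp add: nrm2_def)

lemma nrm2_power2: "(nrm2 M u)\<^sup>2 = (\<integral>x. (norm (u x))\<^sup>2 \<partial>M)"
  by (simp add: nrm2_def)

lemma sqi_norm: "sqi M u \<Longrightarrow> sqi M (\<lambda>x. norm (u x))"
  by (auto simp: sqi_def)

lemma nrm2_norm [simp]: "nrm2 M (\<lambda>x. norm (u x)) = nrm2 M u"
  by (simp add: nrm2_def)

text \<open>The constant C may have any sign: the pointwise bound is squared before integration, and
  the absolute value reappears when the root is taken.\<close>

lemma sqi_bound:
  assumes "sqi M u" "v \<in> borel_measurable M" "AE x in M. norm (v x) \<le> C * norm (u x)"
  shows "sqi M v" "nrm2 M v \<le> \<bar>C\<bar> * nrm2 M u"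
proof -
  have I: "integrable M (\<lambda>x. C\<^sup>2 * (norm (u x))\<^sup>2)" using assms(1) by (auto simp: sqi_def)
  have B: "AE x in M. (norm (v x))\<^sup>2 \<le> C\<^sup>2 * (norm (u x))\<^sup>2"
    using assms(3)
  proof eventually_elim
    case (elim x)
    then show ?case
      using power_mono[of "norm (v x)" "C * norm (u x)" 2] by (simp add: power_mult_distrib)
  qed
  have "integrable M (\<lambda>x. (norm (v x))\<^sup>2)"
    by (rule Bochner_Integration.integrable_bound[OF I]) (use B assms(2) in \<open>auto intro: order_trans\<close>)
  then show *: "sqi M v" using assms(2) by (auto simp: sqi_def)
  have "(\<integral>x. (norm (v x))\<^sup>2 \<partial>M) \<le> (\<integral>x. C\<^sup>2 * (norm (u x))\<^sup>2 \<partial>M)"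
    by (rule integral_mono_AE) (use * I B in \<open>auto simp: sqi_def\<close>)
  then have "(nrm2 M v)\<^sup>2 \<le> (\<bar>C\<bar> * nrm2 M u)\<^sup>2"
    by (simp add: nrm2_power2 power_mult_distrib)
  then show "nrm2 M v \<le> \<bar>C\<bar> * nrm2 M u"
    by (rule power2_le_imp_le) simp
qed

lemma sqi_0 [simp]: "sqi M (\<lambda>x. 0)" by (auto simp: sqi_def)

lemma nrm2_0 [simp]: "nrm2 M (\<lambda>x. 0) = 0" by (auto simp: nrm2_def)

lemma sqi_scaleR: "sqi M u \<Longrightarrow> sqi M (\<lambda>x. c *\<^sub>R u x)"
  by (rule sqi_bound(1)[of M u _ "\<bar>c\<bar>"]) (auto simp: sqi_def)

lemma sqi_mult: "sqi M u \<Longrightarrow> sqi M (\<lambda>x. c * u x :: real)"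
  using sqi_scaleR[of M u c] by simp

lemma sqi_uminus: "sqi M u \<Longrightarrow> sqi M (\<lambda>x. - u x)"
  by (auto simp: sqi_def)

lemma nrm2_scaleR: "nrm2 M (\<lambda>x. c *\<^sub>R u x) = \<bar>c\<bar> * nrm2 M u"
  by (simp add: nrm2_def power_mult_distrib real_sqrt_mult)

lemma nrm2_mult: "nrm2 M (\<lambda>x. c * u x :: real) = \<bar>c\<bar> * nrm2 M u"
  using nrm2_scaleR[of M c u] by simp

lemma nrm2_uminus: "nrm2 M (\<lambda>x. - u x) = nrm2 M u"
  by (simp add: nrm2_def)

lemma nrm2_minus_commute: "nrm2 M (\<lambda>x. u x - v x) = nrm2 M (\<lambda>x. v x - u x)"
  by (simp add: nrm2_def norm_minus_commute)

lemma sqi_inner_integrable: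
  assumes "sqi M u" "sqi M v"
  shows "integrable M (\<lambda>x. u x \<bullet> v x)"
proof (rule Bochner_Integration.integrable_bound)
  show "integrable M (\<lambda>x. (norm (u x))\<^sup>2 + (norm (v x))\<^sup>2)" using assms by (auto simp: sqi_def)
  show "(\<lambda>x. u x \<bullet> v x) \<in> borel_measurable M" using assms by (auto simp: sqi_def)
  show "AE x in M. norm (u x \<bullet> v x) \<le> norm ((norm (u x))\<^sup>2 + (norm (v x))\<^sup>2)"
  proof (intro AE_I2)
    fix x
    have "\<bar>u x \<bullet> v x\<bar> \<le> norm (u x) * norm (v x)" by (rule Cauchy_Schwarz_ineq2)
    also have "\<dots> \<le> (norm (u x))\<^sup>2 + (norm (v x))\<^sup>2"
      using sum_squares_bound[of "norm (u x)" "norm (v x)"]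
        mult_nonneg_nonneg[OF norm_ge_zero[of "u x"] norm_ge_zero[of "v x"]] by linarith
    finally show "norm (u x \<bullet> v x) \<le> norm ((norm (u x))\<^sup>2 + (norm (v x))\<^sup>2)" by simp
  qed
qed

lemma sqi_mult_integrable:
  "sqi M u \<Longrightarrow> sqi M v \<Longrightarrow> integrable M (\<lambda>x. u x * v x :: real)"
  using sqi_inner_integrable[of M u v] by simp

lemma norm_add_power2: "(norm (a + b))\<^sup>2 = (norm a)\<^sup>2 + 2 * (a \<bullet> b) + (norm (b::'b::real_inner))\<^sup>2"
  by (simp add: power2_norm_eq_inner inner_add_left inner_add_right inner_commute)

lemma sqi_add:
  assumes "sqi M u" "sqi M v"
  shows "sqi M (\<lambda>x. u x + v x)"
  using assms sqi_inner_integrable[OF assms] by (auto simp: sqi_def norm_add_power2)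

lemma sqi_diff: "sqi M u \<Longrightarrow> sqi M v \<Longrightarrow> sqi M (\<lambda>x. u x - v x)"
  using sqi_add[of M u "\<lambda>x. - v x"] sqi_uminus[of M v] by simp

lemma nrm2_add_power2:
  assumes "sqi M u" "sqi M v"
  shows "(nrm2 M (\<lambda>x. u x + v x))\<^sup>2 = (nrm2 M u)\<^sup>2 + 2 * (\<integral>x. u x \<bullet> v x \<partial>M) + (nrm2 M v)\<^sup>2"
  using assms sqi_inner_integrable[OF assms] unfolding nrm2_power2 norm_add_power2
  by (auto simp: sqi_def)

text \<open>The discriminant criterion, including the degenerate case c = 0. Besides Cauchy-Schwarz
  it yields Euler equations: with a = 0 it forces b = 0.\<close>

lemma quadratic_nonneg_imp:
  fixes a b c :: real
  assumes "\<And>t. 0 \<le> a + 2 * t * b + t\<^sup>2 * c"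
  shows "b\<^sup>2 \<le> a * c"
proof (cases "c = 0")
  case True
  have "b = 0"
  proof (rule ccontr)
    assume "b \<noteq> 0"
    \<comment> \<open>This t makes the affine function equal to -1.\<close>
    then show False using assms[of "- (a + 1) / (2 * b)"] True by (simp add: field_simps)
  qed
  then show ?thesis using True by simp
next
  case False
  have "c \<ge> 0"
  proof (rule ccontr)
    assume "\<not> 0 \<le> c"
    then have c: "c < 0" by simp
    \<comment> \<open>At this t the quadratic term outweighs the other two; t \<ge> 1 is used to
      compare \<bar>a\<bar> with t * \<bar>a\<bar>.\<close>
    define t where "t = (\<bar>a\<bar> + 2 * \<bar>b\<bar> + 1) / \<bar>c\<bar> + 1"
    have t1: "t \<ge> 1" by (simp add: t_def)
    have "\<bar>c\<bar> * t = \<bar>a\<bar> + 2 * \<bar>b\<bar> + 1 + \<bar>c\<bar>" using c by (simp add: t_def field_simps)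
    then have "\<bar>c\<bar> * t > \<bar>a\<bar> + 2 * \<bar>b\<bar>" by simp
    then have "t * (\<bar>c\<bar> * t) > t * (\<bar>a\<bar> + 2 * \<bar>b\<bar>)" using t1 by (intro mult_strict_left_mono) auto
    moreover have "t * \<bar>a\<bar> \<ge> a" using t1 mult_right_mono[of 1 t "\<bar>a\<bar>"] by (smt (verit) abs_ge_zero)
    moreover have "t * \<bar>b\<bar> \<ge> t * b" using t1 by simp
    ultimately have "a + 2 * t * b + t\<^sup>2 * c < 0" using c by (simp add: power2_eq_square algebra_simps)
    then show False using assms[of t] by simp
  qed
  then have c: "c > 0" using False by simp
  \<comment> \<open>Evaluation at the minimiser of the quadratic.\<close>
  have "0 \<le> a + 2 * (- b / c) * b + (- b / c)\<^sup>2 * c" by (rule assms)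
  also have "\<dots> = a - b\<^sup>2 / c" using c by (simp add: power2_eq_square field_simps)
  finally show ?thesis using c by (simp add: field_simps)
qed

text \<open>The squared norm of u + t v is a nonnegative quadratic in t, which bounds its
  discriminant.\<close>

lemma sqi_CS:
  assumes "sqi M u" "sqi M v"
  shows "\<bar>\<integral>x. u x \<bullet> v x \<partial>M\<bar> \<le> nrm2 M u * nrm2 M v"
proof -
  have "0 \<le> (nrm2 M u)\<^sup>2 + 2 * t * (\<integral>x. u x \<bullet> v x \<partial>M) + t\<^sup>2 * (nrm2 M v)\<^sup>2" for t
    using nrm2_add_power2[OF assms(1) sqi_scaleR[OF assms(2), of t]]
    by (simp add: nrm2_scaleR power_mult_distrib mult.assoc) (metis zero_le_power2)
  then have "(\<integral>x. u x \<bullet> v x \<partial>M)\<^sup>2 \<le> (nrm2 M u)\<^sup>2 * (nrm2 M v)\<^sup>2"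
    by (rule quadratic_nonneg_imp)
  then have "\<bar>\<integral>x. u x \<bullet> v x \<partial>M\<bar>\<^sup>2 \<le> (nrm2 M u * nrm2 M v)\<^sup>2" by (simp add: power_mult_distrib)
  then show ?thesis by (rule power2_le_imp_le) simp
qed

lemma sqi_CS_mult:
  "sqi M u \<Longrightarrow> sqi M v \<Longrightarrow> \<bar>\<integral>x. u x * v x \<partial>M\<bar> \<le> nrm2 M u * nrm2 M (v :: _ \<Rightarrow> real)"
  using sqi_CS[of M u v] by simp

lemma nrm2_triangle:
  assumes "sqi M u" "sqi M v"
  shows "nrm2 M (\<lambda>x. u x + v x) \<le> nrm2 M u + nrm2 M v"
proof -
  have "(nrm2 M (\<lambda>x. u x + v x))\<^sup>2 \<le> (nrm2 M u + nrm2 M v)\<^sup>2"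
    using nrm2_add_power2[OF assms] sqi_CS[OF assms] by (simp add: power2_sum)
  then show ?thesis by (rule power2_le_imp_le) simp
qed

lemma nrm2_triangle3:
  assumes "sqi M u" "sqi M v" "sqi M w"
  shows "nrm2 M (\<lambda>x. u x - w x) \<le> nrm2 M (\<lambda>x. u x - v x) + nrm2 M (\<lambda>x. v x - w x)"
  using nrm2_triangle[of M "\<lambda>x. u x - v x" "\<lambda>x. v x - w x"] assms by (simp add: sqi_diff)

lemma nrm2_diff_abs:
  assumes "sqi M u" "sqi M v"
  shows "\<bar>nrm2 M u - nrm2 M v\<bar> \<le> nrm2 M (\<lambda>x. u x - v x)"
  using nrm2_triangle3[OF assms sqi_0] nrm2_triangle3[OF assms(2,1) sqi_0]
    nrm2_minus_commute[of M u v] by simp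

lemma nrm2_eq_0_iff: "sqi M u \<Longrightarrow> nrm2 M u = 0 \<longleftrightarrow> (AE x in M. u x = 0)"
  using integral_nonneg_eq_0_iff_AE[of M "\<lambda>x. (norm (u x))\<^sup>2"] by (auto simp: sqi_def nrm2_def)

lemma sqi_cong_AE:
  assumes "sqi M u" "v \<in> borel_measurable M" "AE x in M. u x = v x"
  shows "sqi M v" "nrm2 M v = nrm2 M u"
proof -
  have *: "AE x in M. norm (v x) \<le> 1 * norm (u x)" using assms(3) by eventually_elim auto
  then show v: "sqi M v" using assms sqi_bound(1) by blast
  have "(\<integral>x. (norm (v x))\<^sup>2 \<partial>M) = (\<integral>x. (norm (u x))\<^sup>2 \<partial>M)"
    by (rule integral_cong_AE) (use assms in \<open>auto simp: sqi_def\<close>)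
  then show "nrm2 M v = nrm2 M u" by (simp add: nrm2_def)
qed

lemma sqi_bounded_mult:
  assumes "sqi M u" "c \<in> borel_measurable M" "AE x in M. \<bar>c x\<bar> \<le> C"
  shows "sqi M (\<lambda>x. c x *\<^sub>R u x)" "nrm2 M (\<lambda>x. c x *\<^sub>R u x) \<le> \<bar>C\<bar> * nrm2 M u"
proof -
  have m: "(\<lambda>x. c x *\<^sub>R u x) \<in> borel_measurable M" using assms by (auto simp: sqi_def)
  have "AE x in M. norm (c x *\<^sub>R u x) \<le> C * norm (u x)"
    using assms(3) by eventually_elim (auto intro: mult_right_mono)
  then show "sqi M (\<lambda>x. c x *\<^sub>R u x)" "nrm2 M (\<lambda>x. c x *\<^sub>R u x) \<le> \<bar>C\<bar> * nrm2 M u"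
    using sqi_bound[OF assms(1) m] by auto
qed

lemma sqi_bounded_mult_real:
  assumes "sqi M u" "c \<in> borel_measurable M" "AE x in M. \<bar>c x\<bar> \<le> C"
  shows "sqi M (\<lambda>x. c x * u x :: real)" "nrm2 M (\<lambda>x. c x * u x) \<le> \<bar>C\<bar> * nrm2 M u"
  using sqi_bounded_mult[OF assms] by auto

context finite_measure
begin

lemma sqi_AE_bounded:
  assumes "u \<in> borel_measurable M" "AE x in M. norm (u x) \<le> C"
  shows "sqi M u" "nrm2 M u \<le> \<bar>C\<bar> * sqrt (measure M (space M))"
proof -
  have 1: "sqi M (\<lambda>x. 1::real)" by (auto simp: sqi_def)
  have "nrm2 M (\<lambda>x. 1::real) = sqrt (measure M (space M))" by (simp add: nrm2_def)
  then show "sqi M u" "nrm2 M u \<le> \<bar>C\<bar> * sqrt (measure M (space M))"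
    using sqi_bound[OF 1 assms(1), of C] assms(2) by auto
qed

lemma sqi_const [simp]: "sqi M (\<lambda>x. c)"
  by (auto simp: sqi_def)

lemma sqi_integrable_L1:
  assumes "sqi M u"
  shows "integrable M u" "(\<integral>x. norm (u x) \<partial>M) \<le> sqrt (measure M (space M)) * nrm2 M u"
proof -
  have *: "integrable M (\<lambda>x. norm (u x))"
    using sqi_mult_integrable[OF sqi_norm[OF assms] sqi_const[of 1]] by simp
  then show "integrable M u" using assms integrable_norm_cancel by (auto simp: sqi_def)
  have "nrm2 M (\<lambda>x. 1::real) = sqrt (measure M (space M))" by (simp add: nrm2_def)
  then show "(\<integral>x. norm (u x) \<partial>M) \<le> sqrt (measure M (space M)) * nrm2 M u"
    using sqi_CS_mult[OF sqi_norm[OF assms] sqi_const[of 1]] by (simp add: mult.commute)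
qed

text \<open>Riesz--Fischer, via absolute convergence in \<open>L\<^sup>1\<close> of a rapidly convergent subsequence.\<close>
lemma sqi_complete:
  fixes u :: "nat \<Rightarrow> 'a \<Rightarrow> 'b::euclidean_space"
  assumes u: "\<And>k. sqi M (u k)"
    and C: "\<And>e. e > 0 \<Longrightarrow> \<exists>N. \<forall>k\<ge>N. \<forall>l\<ge>N. nrm2 M (\<lambda>x. u k x - u l x) \<le> e"
  obtains v where "sqi M v" "(\<lambda>k. nrm2 M (\<lambda>x. u k x - v x)) \<longlonglongrightarrow> 0"
proof -
  have "\<exists>N. \<forall>k\<ge>N. \<forall>l\<ge>N. nrm2 M (\<lambda>x. u k x - u l x) \<le> (1/2)^j" for j
    by (rule C) simp
  then obtain N where N: "\<And>j k l. k \<ge> N j \<Longrightarrow> l \<ge> N j \<Longrightarrow> nrm2 M (\<lambda>x. u k x - u l x) \<le> (1/2)^j"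
    by metis
  \<comment> \<open>The indices increase strictly and stay beyond N j, so consecutive members of the
    subsequence differ by at most (1/2)^j.\<close>
  define r where "r = rec_nat (N 0) (\<lambda>j m. max (Suc m) (N (Suc j)))"
  have rN: "r j \<ge> N j" for j by (cases j) (auto simp: r_def)
  have rS: "r (Suc j) > r j" for j by (auto simp: r_def)
  have sm: "strict_mono r" using rS by (simp add: strict_mono_Suc_iff)
  define d where "d j x = u (r (Suc j)) x - u (r j) x" for j x
  have dsq: "sqi M (d j)" for j unfolding d_def by (rule sqi_diff[OF u u])
  have dn: "nrm2 M (d j) \<le> (1/2)^j" for j
    unfolding d_def using N[of j "r (Suc j)" "r j"] rN[of j] rS[of j] by simp
  have dI: "integrable M (\<lambda>x. norm (d j x))" for j using sqi_integrable_L1(1)[OF dsq] by simp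
  have dL1: "(\<integral>x. norm (d j x) \<partial>M) \<le> sqrt (measure M (space M)) * (1/2)^j" for j
    using sqi_integrable_L1(2)[OF dsq[of j]] mult_left_mono[OF dn[of j], of "sqrt (measure M (space M))"]
    by (simp add: order_trans)
  have sumd: "summable (\<lambda>j. \<integral>x. norm (d j x) \<partial>M)"
  proof (rule summable_comparison_test'[where N=0])
    show "summable (\<lambda>j. sqrt (measure M (space M)) * (1/2)^j)"
      by (intro summable_mult summable_geometric) simp
    show "norm (\<integral>x. norm (d j x) \<partial>M) \<le> sqrt (measure M (space M)) * (1/2)^j" for j
      using dL1[of j] by simp
  qed
  have "(\<integral>\<^sup>+x. (\<Sum>j. ennreal (norm (d j x))) \<partial>M) = (\<Sum>j. \<integral>\<^sup>+x. ennreal (norm (d j x)) \<partial>M)"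
    by (rule nn_integral_suminf) (use sqi_meas[OF dsq] in measurable)
  also have "\<dots> = (\<Sum>j. ennreal (\<integral>x. norm (d j x) \<partial>M))"
    by (intro suminf_cong nn_integral_eq_integral dI) auto
  also have "\<dots> = ennreal (\<Sum>j. \<integral>x. norm (d j x) \<partial>M)"
    by (rule suminf_ennreal_eq[OF _ summable_sums[OF sumd]]) simp
  finally have "(\<integral>\<^sup>+x. (\<Sum>j. ennreal (norm (d j x))) \<partial>M) \<noteq> \<infinity>" by simp
  then have "AE x in M. (\<Sum>j. ennreal (norm (d j x))) \<noteq> \<infinity>"
    by (intro nn_integral_PInf_AE) (use sqi_meas[OF dsq] in measurable)
  then have AEs: "AE x in M. summable (\<lambda>j. norm (d j x))"
    by eventually_elim (auto intro!: summable_suminf_not_top)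
  \<comment> \<open>Where the subsequence diverges, \<open>lim\<close> is an unspecified value; that
    set is null, and v is measurable all the same.\<close>
  define v where "v x = lim (\<lambda>j. u (r j) x)" for x
  have lim: "AE x in M. (\<lambda>j. u (r j) x) \<longlonglongrightarrow> v x"
    using AEs
  proof eventually_elim
    case (elim x)
    then have "summable (\<lambda>j. d j x)" by (rule summable_norm_cancel)
    then have "(\<lambda>n. \<Sum>j<n. d j x) \<longlonglongrightarrow> (\<Sum>j. d j x)" by (rule summable_LIMSEQ)
    moreover have "(\<Sum>j<n. d j x) = u (r n) x - u (r 0) x" for n
      unfolding d_def by (rule sum_lessThan_telescope)
    ultimately have "(\<lambda>n. (u (r n) x - u (r 0) x) + u (r 0) x) \<longlonglongrightarrow> (\<Sum>j. d j x) + u (r 0) x"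
      by (intro tendsto_intros) simp
    then have "convergent (\<lambda>n. u (r n) x)" by (auto simp: convergent_def)
    then show ?case by (simp add: v_def convergent_LIMSEQ_iff)
  qed
  have vm: "v \<in> borel_measurable M" unfolding v_def
    by (rule borel_measurable_lim_metric) (use u[THEN sqi_meas] in measurable)
  \<comment> \<open>Fatou's lemma in the subsequence index, with k fixed, transfers the Cauchy bound
    to the limit.\<close>
  have key: "sqi M (\<lambda>x. u k x - v x) \<and> nrm2 M (\<lambda>x. u k x - v x) \<le> (1/2)^j" if k: "k \<ge> N j" for j k
  proof -
    have m: "(\<lambda>x. u k x - v x) \<in> borel_measurable M" using u[THEN sqi_meas] vm by measurable
    have "(\<integral>\<^sup>+x. ennreal ((norm (u k x - v x))\<^sup>2) \<partial>M)
        = (\<integral>\<^sup>+x. liminf (\<lambda>i. ennreal ((norm (u k x - u (r i) x))\<^sup>2)) \<partial>M)"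
    proof (rule nn_integral_cong_AE, use lim in eventually_elim)
      fix x assume *: "(\<lambda>i. u (r i) x) \<longlonglongrightarrow> v x"
      have "(\<lambda>i. ennreal ((norm (u k x - u (r i) x))\<^sup>2)) \<longlonglongrightarrow> ennreal ((norm (u k x - v x))\<^sup>2)"
        by (intro tendsto_intros *)
      then show "ennreal ((norm (u k x - v x))\<^sup>2) = liminf (\<lambda>i. ennreal ((norm (u k x - u (r i) x))\<^sup>2))"
        using lim_imp_Liminf[OF sequentially_bot] by metis
    qed
    also have "\<dots> \<le> liminf (\<lambda>i. \<integral>\<^sup>+x. ennreal ((norm (u k x - u (r i) x))\<^sup>2) \<partial>M)"
      by (rule nn_integral_liminf) (use u[THEN sqi_meas] in measurable)
    also have "\<dots> \<le> ennreal (((1/2)^j)\<^sup>2)"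
    proof (rule Liminf_le)
      show "\<forall>\<^sub>F i in sequentially. (\<integral>\<^sup>+x. ennreal ((norm (u k x - u (r i) x))\<^sup>2) \<partial>M) \<le> ennreal (((1/2)^j)\<^sup>2)"
      proof (rule eventually_sequentiallyI[of j])
        fix i assume "j \<le> i"
        then have "r i \<ge> N j" using rN[of j] sm strict_mono_less_eq[OF sm, of j i] by linarith
        then have "nrm2 M (\<lambda>x. u k x - u (r i) x) \<le> (1/2)^j" using N k by auto
        then have "(nrm2 M (\<lambda>x. u k x - u (r i) x))\<^sup>2 \<le> ((1/2)^j)\<^sup>2" by (intro power_mono) auto
        then show "(\<integral>\<^sup>+x. ennreal ((norm (u k x - u (r i) x))\<^sup>2) \<partial>M) \<le> ennreal (((1/2)^j)\<^sup>2)"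
          using sqi_integrable[OF sqi_diff[OF u[of k] u[of "r i"]]]
          by (subst nn_integral_eq_integral) (auto simp: nrm2_power2)
      qed
    qed simp
    finally have F: "(\<integral>\<^sup>+x. ennreal ((norm (u k x - v x))\<^sup>2) \<partial>M) \<le> ennreal (((1/2)^j)\<^sup>2)" .
    have I: "integrable M (\<lambda>x. (norm (u k x - v x))\<^sup>2)"
      by (rule integrableI_nonneg) (use m F in \<open>auto simp: top_unique less_top intro: le_less_trans\<close>)
    then have "ennreal (\<integral>x. (norm (u k x - v x))\<^sup>2 \<partial>M) \<le> ennreal (((1/2)^j)\<^sup>2)"
      using F by (subst (asm) nn_integral_eq_integral) auto
    then have "(nrm2 M (\<lambda>x. u k x - v x))\<^sup>2 \<le> ((1/2)^j)\<^sup>2" by (simp add: nrm2_power2)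
    then have "nrm2 M (\<lambda>x. u k x - v x) \<le> (1/2)^j" by (rule power2_le_imp_le) simp
    then show ?thesis using m I by (auto simp: sqi_def)
  qed
  have "sqi M (\<lambda>x. u (N 0) x - (u (N 0) x - v x))"
    by (rule sqi_diff[OF u]) (use key[of 0 "N 0"] in auto)
  then have "sqi M v" by simp
  moreover have "(\<lambda>k. nrm2 M (\<lambda>x. u k x - v x)) \<longlonglongrightarrow> 0"
  proof (rule LIMSEQ_I)
    fix e :: real assume "e > 0"
    then obtain j where j: "(1/2)^j < e" using real_arch_pow_inv[of e "1/2"] by auto
    show "\<exists>no. \<forall>n\<ge>no. norm (nrm2 M (\<lambda>x. u n x - v x) - 0) < e"
      using key[of j] j by (intro exI[of _ "N j"]) (auto intro: le_less_trans)
  qed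
  ultimately show ?thesis by (rule that)
qed

end

lemma nrm2_inner_tendsto:
  assumes u: "\<And>k. sqi M (u k)" "sqi M v" "(\<lambda>k. nrm2 M (\<lambda>x. u k x - v x)) \<longlonglongrightarrow> 0" and w: "sqi M w"
  shows "(\<lambda>k. \<integral>x. u k x \<bullet> w x \<partial>M) \<longlonglongrightarrow> (\<integral>x. v x \<bullet> w x \<partial>M)"
proof -
  have "(\<lambda>k. (\<integral>x. u k x \<bullet> w x \<partial>M) - (\<integral>x. v x \<bullet> w x \<partial>M)) \<longlonglongrightarrow> 0"
  proof (rule tendsto_rabs_zero_cancel, rule tendsto_sandwich[OF _ _ tendsto_const])
    show "\<forall>\<^sub>F k in sequentially. 0 \<le> \<bar>(\<integral>x. u k x \<bullet> w x \<partial>M) - (\<integral>x. v x \<bullet> w x \<partial>M)\<bar>" by simp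
    show "(\<lambda>k. nrm2 M (\<lambda>x. u k x - v x) * nrm2 M w) \<longlonglongrightarrow> 0"
      using tendsto_mult_right[OF assms(3), of "nrm2 M w"] by simp
    have "\<bar>(\<integral>x. u k x \<bullet> w x \<partial>M) - (\<integral>x. v x \<bullet> w x \<partial>M)\<bar> \<le> nrm2 M (\<lambda>x. u k x - v x) * nrm2 M w" for k
      using sqi_CS[OF sqi_diff[OF u(1)[of k] u(2)] w] sqi_inner_integrable[OF u(1)[of k] w]
        sqi_inner_integrable[OF u(2) w]
      by (simp add: inner_diff_left)
    then show "\<forall>\<^sub>F k in sequentially. \<bar>(\<integral>x. u k x \<bullet> w x \<partial>M) - (\<integral>x. v x \<bullet> w x \<partial>M)\<bar>
        \<le> nrm2 M (\<lambda>x. u k x - v x) * nrm2 M w" by simp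
  qed
  then show ?thesis by (simp add: LIM_zero_iff)
qed

lemma nrm2_tendsto:
  assumes u: "\<And>k. sqi M (u k)" "sqi M v" "(\<lambda>k. nrm2 M (\<lambda>x. u k x - v x)) \<longlonglongrightarrow> 0"
  shows "(\<lambda>k. nrm2 M (u k)) \<longlonglongrightarrow> nrm2 M v"
proof -
  have "(\<lambda>k. nrm2 M (u k) - nrm2 M v) \<longlonglongrightarrow> 0"
    by (rule Lim_null_comparison[OF _ assms(3)]) (simp add: nrm2_diff_abs[OF u(1,2)])
  then show ?thesis by (simp add: LIM_zero_iff)
qed

text \<open>The mean value theorem dominates every difference quotient by G, and dominated
  convergence is applied along sequences. Measurability of the derivative is a conclusion: it is a
  limit of measurable quotients.\<close>

lemma has_field_derivative_integral_param:
  fixes F F' :: "'c \<Rightarrow> real \<Rightarrow> real"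
  assumes ab: "a < t0" "t0 < b"
    and D: "\<And>x t. x \<in> space M \<Longrightarrow> a < t \<Longrightarrow> t < b \<Longrightarrow> (F x has_real_derivative F' x t) (at t)"
    and B: "\<And>x t. x \<in> space M \<Longrightarrow> a < t \<Longrightarrow> t < b \<Longrightarrow> \<bar>F' x t\<bar> \<le> G x"
    and G: "integrable M G"
    and I: "\<And>t. a < t \<Longrightarrow> t < b \<Longrightarrow> integrable M (\<lambda>x. F x t)"
  shows "((\<lambda>t. \<integral>x. F x t \<partial>M) has_real_derivative (\<integral>x. F' x t0 \<partial>M)) (at t0)"
    "integrable M (\<lambda>x. F' x t0)"
proof -
  define e where "e = min (t0 - a) (b - t0)"
  have e: "e > 0" using ab by (simp add: e_def)
  have q: "\<bar>(F x (t0 + h) - F x t0) / h\<bar> \<le> G x" if x: "x \<in> space M" and h: "h \<noteq> 0" "\<bar>h\<bar> < e" for x h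
  proof -
    have in1: "a < t0 + h" "t0 + h < b" using h by (auto simp: e_def)
    have bd: "\<bar>F x s - F x r\<bar> \<le> G x * \<bar>s - r\<bar>" if "a < r" "r < s" "s < b" for r s
    proof -
      have "(F x has_real_derivative F' x t) (at t)" if "r \<le> t" "t \<le> s" for t
        by (rule D[OF x]) (use that \<open>a < r\<close> \<open>s < b\<close> in auto)
      then obtain z where z: "r < z" "z < s" "F x s - F x r = (s - r) * F' x z"
        using MVT2[of r s "F x" "F' x"] \<open>r < s\<close> by blast
      then have "\<bar>F x s - F x r\<bar> = \<bar>s - r\<bar> * \<bar>F' x z\<bar>" by (simp add: abs_mult)
      also have "\<dots> \<le> \<bar>s - r\<bar> * G x" using B[OF x, of z] z that by (intro mult_left_mono) auto
      finally show ?thesis by (simp add: mult.commute)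
    qed
    have "\<bar>F x (t0 + h) - F x t0\<bar> \<le> G x * \<bar>h\<bar>"
      using bd[of t0 "t0 + h"] bd[of "t0 + h" t0] in1 ab h(1)
      by (cases "h > 0") (auto simp: abs_minus_commute)
    then show ?thesis using h(1) by (simp add: abs_divide field_simps)
  qed
  have main: "((\<lambda>k. ((\<integral>x. F x (t0 + h k) \<partial>M) - (\<integral>x. F x t0 \<partial>M)) / h k) \<longlonglongrightarrow> (\<integral>x. F' x t0 \<partial>M))
      \<and> integrable M (\<lambda>x. F' x t0)"
    if h0: "\<And>k. h k \<noteq> 0" and hl: "h \<longlonglongrightarrow> 0" for h :: "nat \<Rightarrow> real"
  proof -
    have "\<forall>\<^sub>F k in sequentially. \<bar>h k\<bar> < e"
      using hl e by (auto simp: tendsto_iff dist_real_def)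
    then obtain N where N: "\<And>k. k \<ge> N \<Longrightarrow> \<bar>h k\<bar> < e" by (auto simp: eventually_sequentially)
    \<comment> \<open>Dropping finitely many terms keeps the points inside the interval where the
      hypotheses hold, and does not change the limit.\<close>
    define g where "g k = h (k + N)" for k
    have g: "g k \<noteq> 0" "\<bar>g k\<bar> < e" for k using h0 N by (auto simp: g_def)
    have gl: "g \<longlonglongrightarrow> 0" unfolding g_def using hl by (rule LIMSEQ_ignore_initial_segment)
    have in1: "a < t0 + g k" "t0 + g k < b" for k using g(2)[of k] by (auto simp: e_def)
    have Ii: "integrable M (\<lambda>x. (F x (t0 + g k) - F x t0) / g k)" for k
      using I[OF in1[of k]] I[OF ab] by auto
    have lim: "(\<lambda>k. (F x (t0 + g k) - F x t0) / g k) \<longlonglongrightarrow> F' x t0" if x: "x \<in> space M" for x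
    proof -
      have "((\<lambda>h. (F x (t0 + h) - F x t0) / h) \<longlongrightarrow> F' x t0) (at 0)"
        using D[OF x ab] by (simp add: DERIV_def)
      moreover have "filterlim g (at 0) sequentially"
        using gl g(1) by (auto simp: filterlim_at)
      ultimately show ?thesis by (rule filterlim_compose)
    qed
    have m: "(\<lambda>x. F' x t0) \<in> borel_measurable M"
      by (rule borel_measurable_LIMSEQ_metric[OF _ lim]) (use Ii in auto)
    have A: "AE x in M. (\<lambda>k. (F x (t0 + g k) - F x t0) / g k) \<longlonglongrightarrow> F' x t0" using lim by auto
    have Bd: "AE x in M. norm ((F x (t0 + g k) - F x t0) / g k) \<le> G x" for k using q g by auto
    have "(\<lambda>k. \<integral>x. (F x (t0 + g k) - F x t0) / g k \<partial>M) \<longlonglongrightarrow> (\<integral>x. F' x t0 \<partial>M)"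
      by (rule integral_dominated_convergence[OF m _ G A Bd]) (use Ii in auto)
    moreover have "(\<integral>x. (F x (t0 + g k) - F x t0) / g k \<partial>M)
        = ((\<integral>x. F x (t0 + g k) \<partial>M) - (\<integral>x. F x t0 \<partial>M)) / g k" for k
      using Bochner_Integration.integral_diff[OF I[OF in1[of k]] I[OF ab]] g(1)[of k] by simp
    ultimately have "(\<lambda>k. ((\<integral>x. F x (t0 + g k) \<partial>M) - (\<integral>x. F x t0 \<partial>M)) / g k) \<longlonglongrightarrow> (\<integral>x. F' x t0 \<partial>M)"
      by (simp only:)
    then have "(\<lambda>k. ((\<integral>x. F x (t0 + h k) \<partial>M) - (\<integral>x. F x t0 \<partial>M)) / h k) \<longlonglongrightarrow> (\<integral>x. F' x t0 \<partial>M)"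
      unfolding g_def by (rule LIMSEQ_offset)
    moreover have "integrable M (\<lambda>x. F' x t0)"
      by (rule Bochner_Integration.integrable_bound[OF G m]) (use B[OF _ ab] in \<open>auto intro!: AE_I2 intro: order_trans[OF _ abs_ge_self]\<close>)
    ultimately show ?thesis by simp
  qed
  show "integrable M (\<lambda>x. F' x t0)"
    using main[of "\<lambda>k. inverse (real (Suc k))"] LIMSEQ_inverse_real_of_nat by auto
  show "((\<lambda>t. \<integral>x. F x t \<partial>M) has_real_derivative (\<integral>x. F' x t0 \<partial>M)) (at t0)"
    unfolding DERIV_def
  proof (subst tendsto_at_iff_sequentially, intro allI impI)
    fix X :: "nat \<Rightarrow> real" assume "\<forall>i. X i \<in> UNIV - {0}" "X \<longlonglongrightarrow> 0"
    then show "((\<lambda>h. ((\<integral>x. F x (t0 + h) \<partial>M) - (\<integral>x. F x t0 \<partial>M)) / h) \<circ> X) \<longlonglongrightarrow> (\<integral>x. F' x t0 \<partial>M)"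
      using main[of X] by (simp add: comp_def)
  qed
qed

section \<open>Test functions and the energy space\<close>

lemma test_funD:
  assumes "test_fun U \<phi> D\<phi>"
  shows "(\<phi> has_derivative (\<lambda>h. D\<phi> x \<bullet> h)) (at x)" "continuous_on UNIV \<phi>" "continuous_on UNIV D\<phi>"
    "compact (closure {x. \<phi> x \<noteq> 0})" "closure {x. \<phi> x \<noteq> 0} \<subseteq> U"
  using assms unfolding test_fun_def
  by (auto simp: continuous_on_eq_continuous_at intro: has_derivative_continuous)

text \<open>Any compact K inside U off which \<phi> vanishes will do, so the support itself need not
  be computed.\<close>

lemma test_funI:
  assumes "\<And>x. (\<phi> has_derivative (\<lambda>h. D\<phi> x \<bullet> h)) (at x)" "continuous_on UNIV D\<phi>"
    "compact K" "K \<subseteq> U" "\<And>x. x \<notin> K \<Longrightarrow> \<phi> x = 0"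
  shows "test_fun U \<phi> D\<phi>"
proof -
  have "closure {x. \<phi> x \<noteq> 0} \<subseteq> K"
    using assms(3,5) by (intro closure_minimal) (auto intro: compact_imp_closed)
  moreover have "compact (closure {x. \<phi> x \<noteq> 0})"
    using compact_Int_closed[OF assms(3) closed_closure[of "{x. \<phi> x \<noteq> 0}"]]
    unfolding Int_absorb1[OF calculation] .
  ultimately show ?thesis using assms(1,2) order_trans[OF _ assms(4)] unfolding test_fun_def by simp
qed

text \<open>Off the closed support \<phi> is locally zero, and derivatives are unique; hence the
  gradient vanishes there as well.\<close>

lemma test_fun_zero_supp:
  assumes "test_fun U \<phi> D\<phi>" "x \<notin> closure {x. \<phi> x \<noteq> 0}"
  shows "\<phi> x = 0" "D\<phi> x = 0"
proof -
  show "\<phi> x = 0" using assms(2) closure_subset[of "{x. \<phi> x \<noteq> 0}"] by auto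
  have "((\<lambda>x. 0) has_derivative (\<lambda>h. D\<phi> x \<bullet> h)) (at x)"
  proof (rule has_derivative_transform_within_open[OF test_funD(1)[OF assms(1)]])
    show "open (- closure {x. \<phi> x \<noteq> 0})" by auto
    show "\<phi> y = 0" if "y \<in> - closure {x. \<phi> x \<noteq> 0}" for y
      using that closure_subset[of "{x. \<phi> x \<noteq> 0}"] by auto
  qed (use assms(2) in auto)
  then have "(\<lambda>h. D\<phi> x \<bullet> h) = (\<lambda>h. 0)"
    by (rule has_derivative_unique) simp
  then have "D\<phi> x \<bullet> D\<phi> x = 0" by metis
  then show "D\<phi> x = 0" by simp
qed

lemma test_fun_zero:
  assumes "test_fun U \<phi> D\<phi>" "x \<notin> U"
  shows "\<phi> x = 0" "D\<phi> x = 0"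
  using test_fun_zero_supp[OF assms(1)] test_funD(5)[OF assms(1)] assms(2) by blast+

lemma test_fun_bounded:
  assumes "test_fun U \<phi> D\<phi>"
  obtains C where "C \<ge> 0" "\<And>x. \<bar>\<phi> x\<bar> \<le> C" "\<And>x. norm (D\<phi> x) \<le> C"
proof -
  let ?K = "closure {x. \<phi> x \<noteq> 0}"
  have K: "compact ?K" by (rule test_funD(4)[OF assms])
  have "bounded (\<phi> ` ?K)" "bounded (D\<phi> ` ?K)"
    using K test_funD(2,3)[OF assms] by (auto intro!: compact_imp_bounded compact_continuous_image intro: continuous_on_subset)
  then obtain a b where ab: "\<And>x. x \<in> ?K \<Longrightarrow> \<bar>\<phi> x\<bar> \<le> a" "\<And>x. x \<in> ?K \<Longrightarrow> norm (D\<phi> x) \<le> b"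
    by (auto simp: bounded_iff)
  show ?thesis
  proof (rule that[of "\<bar>a\<bar> + \<bar>b\<bar>"])
    show "\<bar>\<phi> x\<bar> \<le> \<bar>a\<bar> + \<bar>b\<bar>" for x
      using ab(1)[of x] test_fun_zero_supp(1)[OF assms, of x] by (cases "x \<in> ?K") auto
    show "norm (D\<phi> x) \<le> \<bar>a\<bar> + \<bar>b\<bar>" for x
      using ab(2)[of x] test_fun_zero_supp(2)[OF assms, of x] by (cases "x \<in> ?K") auto
  qed simp
qed

lemma test_fun_add:
  assumes "test_fun U \<phi> D\<phi>" "test_fun U \<psi> D\<psi>"
  shows "test_fun U (\<lambda>x. \<phi> x + \<psi> x) (\<lambda>x. D\<phi> x + D\<psi> x)"
proof (rule test_funI[where K = "closure {x. \<phi> x \<noteq> 0} \<union> closure {x. \<psi> x \<noteq> 0}"])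
  show "((\<lambda>x. \<phi> x + \<psi> x) has_derivative (\<lambda>h. (D\<phi> x + D\<psi> x) \<bullet> h)) (at x)" for x
    using has_derivative_add[OF test_funD(1)[OF assms(1)] test_funD(1)[OF assms(2)]]
    by (simp add: inner_add_left)
  show "continuous_on UNIV (\<lambda>x. D\<phi> x + D\<psi> x)"
    by (intro continuous_intros test_funD(3)[OF assms(1)] test_funD(3)[OF assms(2)])
  show "\<phi> x + \<psi> x = 0" if "x \<notin> closure {x. \<phi> x \<noteq> 0} \<union> closure {x. \<psi> x \<noteq> 0}" for x
    using that test_fun_zero_supp(1)[OF assms(1), of x] test_fun_zero_supp(1)[OF assms(2), of x] by simp
qed (simp_all only: test_funD(4,5)[OF assms(1)] test_funD(4,5)[OF assms(2)] compact_Un Un_least)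

lemma test_fun_mult:
  assumes "test_fun U \<phi> D\<phi>"
    and d: "\<And>x. (\<psi> has_derivative (\<lambda>h. D\<psi> x \<bullet> h)) (at x)" and c: "continuous_on UNIV D\<psi>"
  shows "test_fun U (\<lambda>x. \<phi> x * \<psi> x) (\<lambda>x. \<phi> x *\<^sub>R D\<psi> x + \<psi> x *\<^sub>R D\<phi> x)"
proof (rule test_funI[where K = "closure {x. \<phi> x \<noteq> 0}"])
  show "((\<lambda>x. \<phi> x * \<psi> x) has_derivative (\<lambda>h. (\<phi> x *\<^sub>R D\<psi> x + \<psi> x *\<^sub>R D\<phi> x) \<bullet> h)) (at x)" for x
    using has_derivative_mult[OF test_funD(1)[OF assms(1)] d]
    by (simp add: inner_add_left mult.commute)
  have "continuous_on UNIV \<psi>"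
    using d by (auto simp: continuous_on_eq_continuous_at intro: has_derivative_continuous)
  then show "continuous_on UNIV (\<lambda>x. \<phi> x *\<^sub>R D\<psi> x + \<psi> x *\<^sub>R D\<phi> x)"
    by (intro continuous_intros test_funD(2,3)[OF assms(1)] c)
  show "\<phi> x * \<psi> x = 0" if "x \<notin> closure {x. \<phi> x \<noteq> 0}" for x
    using test_fun_zero_supp(1)[OF assms(1) that] by simp
qed (simp_all only: test_funD(4,5)[OF assms(1)])

lemma test_fun_scale:
  assumes "test_fun U \<phi> D\<phi>"
  shows "test_fun U (\<lambda>x. c * \<phi> x) (\<lambda>x. c *\<^sub>R D\<phi> x)"
  using test_fun_mult[OF assms, of "\<lambda>_. c" "\<lambda>_. 0"] by (simp add: mult.commute)

text \<open>The condition \<open>\<beta> 0 = 0\<close> is what preserves the compact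
  support.\<close>

lemma test_fun_compose:
  assumes "test_fun U \<phi> D\<phi>"
    and b: "\<And>t. (\<beta> has_real_derivative \<beta>' t) (at t)" "continuous_on UNIV \<beta>'" "\<beta> 0 = 0"
  shows "test_fun U (\<lambda>x. \<beta> (\<phi> x)) (\<lambda>x. \<beta>' (\<phi> x) *\<^sub>R D\<phi> x)"
proof (rule test_funI[where K = "closure {x. \<phi> x \<noteq> 0}"])
  show "((\<lambda>x. \<beta> (\<phi> x)) has_derivative (\<lambda>h. (\<beta>' (\<phi> x) *\<^sub>R D\<phi> x) \<bullet> h)) (at x)" for x
    using has_derivative_compose[OF test_funD(1)[OF assms(1)] b(1)[of "\<phi> x", unfolded has_field_derivative_def]]
    by (simp add: mult.commute)
  have "continuous_on UNIV (\<lambda>x. \<beta>' (\<phi> x))"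
    by (rule continuous_on_compose2[OF b(2) test_funD(2)[OF assms(1)]]) auto
  then show "continuous_on UNIV (\<lambda>x. \<beta>' (\<phi> x) *\<^sub>R D\<phi> x)"
    by (intro continuous_intros test_funD(2,3)[OF assms(1)])
  show "\<beta> (\<phi> x) = 0" if "x \<notin> closure {x. \<phi> x \<noteq> 0}" for x
    using test_fun_zero_supp(1)[OF assms(1) that] b(3) by simp
qed (simp_all only: test_funD(4,5)[OF assms(1)])

lemma test_fun_0: "test_fun U (\<lambda>x. 0) (\<lambda>x. 0)"
  by (rule test_funI[where K="{}"]) auto

section \<open>Integration of compactly supported functions\<close>

lemma continuous_compact_support_integrable:
  fixes f :: "'a::euclidean_space \<Rightarrow> 'b::euclidean_space"
  assumes "continuous_on UNIV f" "compact K" "\<And>x. x \<notin> K \<Longrightarrow> f x = 0"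
  shows "integrable lebesgue f" "integrable lborel f"
proof -
  have c: "continuous_on K f" using assms(1) continuous_on_subset by blast
  have "integrable lborel (\<lambda>x. indicator K x *\<^sub>R f x)"
    by (rule borel_integrable_compact[OF assms(2) c])
  moreover have "(\<lambda>x. indicator K x *\<^sub>R f x) = f" using assms(3) by (auto simp: indicator_def)
  ultimately show "integrable lborel f" by simp
  then show "integrable lebesgue f"
    using integrable_completion[of f lborel] by (auto simp: borel_measurable_integrable)
qed

lemma integral_lebesgue_eq_lborel:
  fixes f :: "'a::euclidean_space \<Rightarrow> 'b::euclidean_space"
  assumes "f \<in> borel_measurable borel"
  shows "integral\<^sup>L lebesgue f = integral\<^sup>L lborel f"
  using assms by (intro integral_completion) auto

lemma lborel_integral_translation:
  fixes f :: "'a::euclidean_space \<Rightarrow> real"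
  assumes "f \<in> borel_measurable borel"
  shows "(\<integral>x. f (x + c) \<partial>lborel) = (\<integral>x. f x \<partial>lborel)"
proof -
  have "(\<integral>x. f x \<partial>distr lborel borel ((+) c)) = (\<integral>x. f (c + x) \<partial>lborel)"
    using assms by (intro integral_distr) auto
  then show ?thesis by (simp add: lborel_distr_plus add.commute)
qed

text \<open>By translation invariance the integral of \<phi> (x + t b) over x does not depend on t;
  differentiation under the integral at t = 0 gives the claim.\<close>

lemma test_fun_integral_derivative:
  fixes \<phi> :: "'a::euclidean_space \<Rightarrow> real"
  assumes t: "test_fun U \<phi> D\<phi>"
  shows "(\<integral>x. D\<phi> x \<bullet> b \<partial>lebesgue) = 0"
proof -
  obtain C where C: "C \<ge> 0" "\<And>x. norm (D\<phi> x) \<le> C" using test_fun_bounded[OF t] by metis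
  have "bounded (closure {x. \<phi> x \<noteq> 0})" using test_funD(4)[OF t] compact_imp_bounded by blast
  then obtain R where R: "\<And>x. x \<in> closure {x. \<phi> x \<noteq> 0} \<Longrightarrow> norm x \<le> R" by (auto simp: bounded_iff)
  \<comment> \<open>This ball contains the supports of all translates with \<bar>t\<bar> < 1, so its
    indicator can serve as the dominating function.\<close>
  let ?B = "cball (0::'a) (R + norm b)"
  have z: "D\<phi> (x + t *\<^sub>R b) = 0" if "x \<notin> ?B" "\<bar>t\<bar> < 1" for x t
  proof -
    have "norm x \<le> norm (x + t *\<^sub>R b) + norm (t *\<^sub>R b)" using norm_triangle_ineq4[of "x + t *\<^sub>R b" "t *\<^sub>R b"] by simp
    also have "norm (t *\<^sub>R b) \<le> norm b" using that(2) by (simp add: mult_left_le_one_le)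
    finally have "norm (x + t *\<^sub>R b) > R" using that(1) by simp
    then show ?thesis using R test_fun_zero_supp(2)[OF t] by force
  qed
  have pc: "continuous_on UNIV \<phi>" "continuous_on UNIV D\<phi>" by (rule test_funD[OF t])+
  have pb: "\<phi> \<in> borel_measurable borel" using pc by (auto intro: borel_measurable_continuous_onI)
  have "((\<lambda>t. \<integral>x. \<phi> (x + t *\<^sub>R b) \<partial>lborel) has_real_derivative (\<integral>x. D\<phi> (x + 0 *\<^sub>R b) \<bullet> b \<partial>lborel)) (at 0)"
  proof (rule has_field_derivative_integral_param(1)[where a="-1" and b="1" and G="\<lambda>x. C * norm b * indicator ?B x"
        and F = "\<lambda>x t. \<phi> (x + t *\<^sub>R b)" and F' = "\<lambda>x t. D\<phi> (x + t *\<^sub>R b) \<bullet> b"])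
    show "((\<lambda>t. \<phi> (x + t *\<^sub>R b)) has_real_derivative D\<phi> (x + t *\<^sub>R b) \<bullet> b) (at t)" for x t
    proof -
      have "((\<lambda>t. x + t *\<^sub>R b) has_derivative (\<lambda>h. h *\<^sub>R b)) (at t)"
        by (auto intro!: derivative_eq_intros)
      then have "((\<lambda>t. \<phi> (x + t *\<^sub>R b)) has_derivative (\<lambda>h. D\<phi> (x + t *\<^sub>R b) \<bullet> (h *\<^sub>R b))) (at t)"
        using has_derivative_compose[OF _ test_funD(1)[OF t]] by blast
      then show ?thesis unfolding has_field_derivative_def
        by (rule has_derivative_eq_rhs) (simp add: fun_eq_iff)
    qed
    show "\<bar>D\<phi> (x + t *\<^sub>R b) \<bullet> b\<bar> \<le> C * norm b * indicator ?B x" if "- 1 < t" "t < 1" for x t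
    proof (cases "x \<in> ?B")
      case True
      have "\<bar>D\<phi> (x + t *\<^sub>R b) \<bullet> b\<bar> \<le> norm (D\<phi> (x + t *\<^sub>R b)) * norm b" by (rule Cauchy_Schwarz_ineq2)
      also have "\<dots> \<le> C * norm b" using C by (intro mult_right_mono) auto
      finally show ?thesis using True by simp
    next
      case False
      then show ?thesis using z[of x t] that by simp
    qed
    have "integrable lborel (indicator ?B :: 'a \<Rightarrow> real)"
      using emeasure_lborel_cball_finite[of "0::'a" "R + norm b"] by (intro integrable_real_indicator) auto
    then show "integrable lborel (\<lambda>x. C * norm b * indicator ?B x)" by auto
    show "integrable lborel (\<lambda>x. \<phi> (x + t *\<^sub>R b))" for t
    proof (rule continuous_compact_support_integrable(2)[where K = "(\<lambda>y. y - t *\<^sub>R b) ` closure {x. \<phi> x \<noteq> 0}"])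
      show "continuous_on UNIV (\<lambda>x. \<phi> (x + t *\<^sub>R b))"
        by (intro continuous_on_compose2[OF pc(1)] continuous_intros) auto
      show "compact ((\<lambda>y. y - t *\<^sub>R b) ` closure {x. \<phi> x \<noteq> 0})"
        using test_funD(4)[OF t] by (intro compact_continuous_image continuous_intros) auto
      show "\<phi> (x + t *\<^sub>R b) = 0" if "x \<notin> (\<lambda>y. y - t *\<^sub>R b) ` closure {x. \<phi> x \<noteq> 0}" for x
      proof (rule test_fun_zero_supp(1)[OF t])
        show "x + t *\<^sub>R b \<notin> closure {x. \<phi> x \<noteq> 0}"
          using that by (metis (no_types, lifting) add_diff_cancel image_eqI)
      qed
    qed
  qed auto
  moreover have "(\<lambda>t. \<integral>x. \<phi> (x + t *\<^sub>R b) \<partial>lborel) = (\<lambda>t. \<integral>x. \<phi> x \<partial>lborel)"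
    by (rule ext, rule lborel_integral_translation[OF pb])
  ultimately have "((\<lambda>t::real. \<integral>x. \<phi> x \<partial>lborel) has_real_derivative (\<integral>x. D\<phi> x \<bullet> b \<partial>lborel)) (at 0)"
    by simp
  then have "(\<integral>x. D\<phi> x \<bullet> b \<partial>lborel) = 0" using DERIV_unique DERIV_const by blast
  moreover have "(\<lambda>x. D\<phi> x \<bullet> b) \<in> borel_measurable borel"
    by (intro borel_measurable_continuous_onI continuous_intros pc)
  ultimately show ?thesis using integral_lebesgue_eq_lborel by metis
qed

lemma set_integral_eq_lebesgue_on:
  fixes f :: "'a::euclidean_space \<Rightarrow> 'b::{banach, second_countable_topology}"
  shows "U \<in> sets lebesgue \<Longrightarrow> (LINT x:U|lebesgue. f x) = (\<integral>x. f x \<partial>lebesgue_on U)"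
  by (simp add: set_lebesgue_integral_def integral_restrict_space)

lemma set_integrable_eq_lebesgue_on:
  fixes f :: "'a::euclidean_space \<Rightarrow> 'b::{banach, second_countable_topology}"
  shows "U \<in> sets lebesgue \<Longrightarrow> set_integrable lebesgue U f \<longleftrightarrow> integrable (lebesgue_on U) f"
  by (simp add: set_integrable_def integrable_restrict_space)

lemma L2_iff_sqi: "U \<in> sets lebesgue \<Longrightarrow> L2 U u \<longleftrightarrow> sqi (lebesgue_on U) u"
  by (simp add: L2_def sqi_def set_integrable_eq_lebesgue_on set_borel_measurable_def
      borel_measurable_restrict_space_iff)

lemma l2n_eq_nrm2: "U \<in> sets lebesgue \<Longrightarrow> l2n U u = nrm2 (lebesgue_on U) u"
  by (simp add: l2n_def nrm2_def set_integral_eq_lebesgue_on)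

lemma continuous_measurable_lebesgue_on:
  fixes f :: "'a::euclidean_space \<Rightarrow> 'b::euclidean_space"
  assumes "continuous_on UNIV f" "U \<in> sets lebesgue"
  shows "f \<in> borel_measurable (lebesgue_on U)"
  using continuous_imp_measurable_on_sets_lebesgue[OF continuous_on_subset[OF assms(1) subset_UNIV] assms(2)] .

section \<open>The energy space H^1_0 as a closure of test functions\<close>

locale bounded_open =
  fixes \<Omega> :: "'a::euclidean_space set"
  assumes open_\<Omega>: "open \<Omega>" and bounded_\<Omega>: "bounded \<Omega>"
begin

lemma sets_\<Omega> [simp]: "\<Omega> \<in> sets lebesgue" "\<Omega> \<in> sets borel"
  using open_\<Omega> by auto

abbreviation M where "M \<equiv> lebesgue_on \<Omega>"

sublocale finite_measure M
proof -
  have "emeasure lebesgue \<Omega> < \<infinity>"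
    using emeasure_bounded_finite[OF bounded_\<Omega>] by simp
  then show "finite_measure M"
    by (intro finite_measureI) (simp add: emeasure_restrict_space)
qed

lemma integral_M_zero_ext:
  fixes f :: "'a \<Rightarrow> 'b::{banach, second_countable_topology}"
  assumes "\<And>x. x \<notin> \<Omega> \<Longrightarrow> f x = 0"
  shows "(\<integral>x. f x \<partial>lebesgue) = (\<integral>x. f x \<partial>M)"
proof -
  have "(\<lambda>x. indicator \<Omega> x *\<^sub>R f x) = f" using assms by (auto simp: indicator_def)
  then show ?thesis by (simp add: integral_restrict_space)
qed

lemma continuous_meas_M: "continuous_on UNIV f \<Longrightarrow> f \<in> borel_measurable M"
  for f :: "'a \<Rightarrow> 'b::euclidean_space"
  by (rule continuous_measurable_lebesgue_on) auto

lemma test_fun_sqi: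
  assumes "test_fun U \<phi> D\<phi>"
  shows "sqi M \<phi>" "sqi M D\<phi>"
proof -
  obtain C where C: "\<And>x. \<bar>\<phi> x\<bar> \<le> C" "\<And>x. norm (D\<phi> x) \<le> C" using test_fun_bounded[OF assms] by metis
  show "sqi M \<phi>" using C test_funD(2)[OF assms]
    by (intro sqi_AE_bounded(1)[where C=C] continuous_meas_M) auto
  show "sqi M D\<phi>" using C test_funD(3)[OF assms]
    by (intro sqi_AE_bounded(1)[where C=C] continuous_meas_M) auto
qed

text \<open>H^1_0 with the gradient carried along as data: the L^2 closure of the graph of the
  classical gradient on test functions. That G is the weak gradient is a consequence, see
  \<open>W_ibp\<close>.\<close>

definition W :: "('a \<Rightarrow> real) \<Rightarrow> ('a \<Rightarrow> 'a) \<Rightarrow> bool" where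
  "W u G \<longleftrightarrow> sqi M u \<and> sqi M G \<and> (\<exists>\<phi> D\<phi>. (\<forall>k::nat. test_fun \<Omega> (\<phi> k) (D\<phi> k)) \<and>
     (\<lambda>k. nrm2 M (\<lambda>x. \<phi> k x - u x)) \<longlonglongrightarrow> 0 \<and> (\<lambda>k. nrm2 M (\<lambda>x. D\<phi> k x - G x)) \<longlonglongrightarrow> 0)"

lemma W_sqi: "W u G \<Longrightarrow> sqi M u" "W u G \<Longrightarrow> sqi M G"
  by (auto simp: W_def)

lemma W_test: "test_fun \<Omega> \<phi> D\<phi> \<Longrightarrow> W \<phi> D\<phi>"
  unfolding W_def using test_fun_sqi by (auto intro!: exI[of _ "\<lambda>_. \<phi>"] exI[of _ "\<lambda>_. D\<phi>"])

lemma W_approx: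
  assumes "W u G" "e > 0"
  obtains \<phi> D\<phi> where "test_fun \<Omega> \<phi> D\<phi>" "nrm2 M (\<lambda>x. \<phi> x - u x) < e" "nrm2 M (\<lambda>x. D\<phi> x - G x) < e"
proof -
  obtain \<phi> D\<phi> where *: "\<And>k::nat. test_fun \<Omega> (\<phi> k) (D\<phi> k)"
    "(\<lambda>k. nrm2 M (\<lambda>x. \<phi> k x - u x)) \<longlonglongrightarrow> 0" "(\<lambda>k. nrm2 M (\<lambda>x. D\<phi> k x - G x)) \<longlonglongrightarrow> 0"
    using assms(1) unfolding W_def by blast
  have "\<forall>\<^sub>F k in sequentially. nrm2 M (\<lambda>x. \<phi> k x - u x) < e \<and> nrm2 M (\<lambda>x. D\<phi> k x - G x) < e"
    using order_tendstoD(2)[OF *(2) assms(2)] order_tendstoD(2)[OF *(3) assms(2)] by eventually_elim auto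
  then obtain k where "nrm2 M (\<lambda>x. \<phi> k x - u x) < e" "nrm2 M (\<lambda>x. D\<phi> k x - G x) < e"
    by (auto simp: eventually_sequentially)
  then show ?thesis using that *(1) by blast
qed

text \<open>Closedness of \<open>W\<close>: approximants may themselves come from \<open>W\<close>,
  since each can be replaced by a test function at the cost of half the error.\<close>

lemma WI_approx:
  assumes "sqi M u" "sqi M G"
    and "\<And>e. e > 0 \<Longrightarrow> \<exists>\<phi> D\<phi>. W \<phi> D\<phi> \<and> nrm2 M (\<lambda>x. \<phi> x - u x) < e \<and> nrm2 M (\<lambda>x. D\<phi> x - G x) < e"
  shows "W u G"
proof -
  have "\<exists>\<phi> D\<phi>. test_fun \<Omega> \<phi> D\<phi> \<and> nrm2 M (\<lambda>x. \<phi> x - u x) < inverse (real (Suc k))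
      \<and> nrm2 M (\<lambda>x. D\<phi> x - G x) < inverse (real (Suc k))" for k
  proof -
    let ?e = "inverse (real (Suc k)) / 2"
    obtain \<phi> D\<phi> where 1: "W \<phi> D\<phi>" "nrm2 M (\<lambda>x. \<phi> x - u x) < ?e" "nrm2 M (\<lambda>x. D\<phi> x - G x) < ?e"
      using assms(3)[of ?e] by auto
    obtain \<psi> D\<psi> where 2: "test_fun \<Omega> \<psi> D\<psi>" "nrm2 M (\<lambda>x. \<psi> x - \<phi> x) < ?e" "nrm2 M (\<lambda>x. D\<psi> x - D\<phi> x) < ?e"
      using W_approx[OF 1(1), of ?e] by auto
    have "nrm2 M (\<lambda>x. \<psi> x - u x) < inverse (real (Suc k))" "nrm2 M (\<lambda>x. D\<psi> x - G x) < inverse (real (Suc k))"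
      using nrm2_triangle3[OF test_fun_sqi(1)[OF 2(1)] W_sqi(1)[OF 1(1)] assms(1)]
        nrm2_triangle3[OF test_fun_sqi(2)[OF 2(1)] W_sqi(2)[OF 1(1)] assms(2)] 1 2 by auto
    then show ?thesis using 2(1) by blast
  qed
  then obtain \<phi> D\<phi> where *: "\<And>k. test_fun \<Omega> (\<phi> k) (D\<phi> k)"
      "\<And>k. nrm2 M (\<lambda>x. \<phi> k x - u x) < inverse (real (Suc k))"
      "\<And>k. nrm2 M (\<lambda>x. D\<phi> k x - G x) < inverse (real (Suc k))" by metis
  have "(\<lambda>k. nrm2 M (\<lambda>x. \<phi> k x - u x)) \<longlonglongrightarrow> 0" "(\<lambda>k. nrm2 M (\<lambda>x. D\<phi> k x - G x)) \<longlonglongrightarrow> 0"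
    by (rule Lim_null_comparison[OF _ LIMSEQ_inverse_real_of_nat];
        use *(2,3) in \<open>simp add: less_imp_le del: of_nat_Suc\<close>)+
  then show ?thesis unfolding W_def using assms(1,2) *(1) by blast
qed

lemma W_add:
  assumes "W u G" "W v H"
  shows "W (\<lambda>x. u x + v x) (\<lambda>x. G x + H x)"
proof (rule WI_approx)
  show "sqi M (\<lambda>x. u x + v x)" "sqi M (\<lambda>x. G x + H x)" using assms by (auto intro: sqi_add W_sqi)
  fix e :: real assume e: "e > 0"
  obtain \<phi> D\<phi> where 1: "test_fun \<Omega> \<phi> D\<phi>" "nrm2 M (\<lambda>x. \<phi> x - u x) < e/2" "nrm2 M (\<lambda>x. D\<phi> x - G x) < e/2"
    using W_approx[OF assms(1), of "e/2"] e by auto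
  obtain \<psi> D\<psi> where 2: "test_fun \<Omega> \<psi> D\<psi>" "nrm2 M (\<lambda>x. \<psi> x - v x) < e/2" "nrm2 M (\<lambda>x. D\<psi> x - H x) < e/2"
    using W_approx[OF assms(2), of "e/2"] e by auto
  note s = test_fun_sqi[OF 1(1)] test_fun_sqi[OF 2(1)] W_sqi[OF assms(1)] W_sqi[OF assms(2)]
  have "nrm2 M (\<lambda>x. (\<phi> x + \<psi> x) - (u x + v x)) < e"
    using nrm2_triangle[of M "\<lambda>x. \<phi> x - u x" "\<lambda>x. \<psi> x - v x"] s 1 2 by (simp add: sqi_diff algebra_simps)
  moreover have "nrm2 M (\<lambda>x. (D\<phi> x + D\<psi> x) - (G x + H x)) < e"
    using nrm2_triangle[of M "\<lambda>x. D\<phi> x - G x" "\<lambda>x. D\<psi> x - H x"] s 1 2 by (simp add: sqi_diff algebra_simps)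
  ultimately show "\<exists>\<phi> D\<phi>. W \<phi> D\<phi> \<and> nrm2 M (\<lambda>x. \<phi> x - (u x + v x)) < e \<and> nrm2 M (\<lambda>x. D\<phi> x - (G x + H x)) < e"
    using W_test[OF test_fun_add[OF 1(1) 2(1)]] by blast
qed

lemma W_scale:
  assumes "W u G"
  shows "W (\<lambda>x. c * u x) (\<lambda>x. c *\<^sub>R G x)"
proof (rule WI_approx)
  show "sqi M (\<lambda>x. c * u x)" "sqi M (\<lambda>x. c *\<^sub>R G x)" using assms by (auto intro: sqi_mult sqi_scaleR W_sqi)
  fix e :: real assume e: "e > 0"
  then have "e / (\<bar>c\<bar> + 1) > 0" by simp
  then obtain \<phi> D\<phi> where 1: "test_fun \<Omega> \<phi> D\<phi>" "nrm2 M (\<lambda>x. \<phi> x - u x) < e/(\<bar>c\<bar>+1)" "nrm2 M (\<lambda>x. D\<phi> x - G x) < e/(\<bar>c\<bar>+1)"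
    using W_approx[OF assms] by metis
  have *: "\<bar>c\<bar> * a < e" if "a < e/(\<bar>c\<bar>+1)" "a \<ge> 0" for a
  proof -
    have "\<bar>c\<bar> * a \<le> (\<bar>c\<bar> + 1) * a" using that by (simp add: algebra_simps)
    also have "\<dots> < e" using that(1) by (simp add: field_simps)
    finally show ?thesis .
  qed
  have "nrm2 M (\<lambda>x. c * \<phi> x - c * u x) < e" "nrm2 M (\<lambda>x. c *\<^sub>R D\<phi> x - c *\<^sub>R G x) < e"
    using *[OF 1(2)] *[OF 1(3)] nrm2_mult[of M c "\<lambda>x. \<phi> x - u x"] nrm2_scaleR[of M c "\<lambda>x. D\<phi> x - G x"]
    by (auto simp: algebra_simps)
  then show "\<exists>\<phi> D\<phi>. W \<phi> D\<phi> \<and> nrm2 M (\<lambda>x. \<phi> x - c * u x) < e \<and> nrm2 M (\<lambda>x. D\<phi> x - c *\<^sub>R G x) < e"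
    using W_test[OF test_fun_scale[OF 1(1), of c]] by blast
qed

lemma W_diff: "W u G \<Longrightarrow> W v H \<Longrightarrow> W (\<lambda>x. u x - v x) (\<lambda>x. G x - H x)"
  using W_add[of u G "\<lambda>x. (-1) * v x" "\<lambda>x. (-1) *\<^sub>R H x"] W_scale[of v H "-1"] by simp

lemma W_cong_AE:
  assumes "W u G" "v \<in> borel_measurable M" "AE x in M. u x = v x"
  shows "W v G"
proof (rule WI_approx)
  show v: "sqi M v" using sqi_cong_AE(1)[OF W_sqi(1)[OF assms(1)] assms(2,3)] .
  show "sqi M G" using assms W_sqi by auto
  fix e :: real assume "e > 0"
  then obtain \<phi> D\<phi> where 1: "test_fun \<Omega> \<phi> D\<phi>" "nrm2 M (\<lambda>x. \<phi> x - u x) < e" "nrm2 M (\<lambda>x. D\<phi> x - G x) < e"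
    using W_approx[OF assms(1)] by metis
  have "nrm2 M (\<lambda>x. \<phi> x - v x) = nrm2 M (\<lambda>x. \<phi> x - u x)"
  proof (rule sqi_cong_AE(2))
    show "sqi M (\<lambda>x. \<phi> x - u x)" using 1 assms by (auto intro: sqi_diff W_sqi test_fun_sqi)
    show "(\<lambda>x. \<phi> x - v x) \<in> borel_measurable M"
      using sqi_meas[OF v] sqi_meas[OF test_fun_sqi(1)[OF 1(1)]] by measurable
    show "AE x in M. \<phi> x - u x = \<phi> x - v x" using assms(3) by eventually_elim simp
  qed
  then show "\<exists>\<phi> D\<phi>. W \<phi> D\<phi> \<and> nrm2 M (\<lambda>x. \<phi> x - v x) < e \<and> nrm2 M (\<lambda>x. D\<phi> x - G x) < e"
    using 1 W_test by metis
qed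

text \<open>Both integrals are continuous in the pair under L^2 convergence, so the identity extends
  from test functions to their closure. This is how equations come to be tested with arbitrary
  elements of H^1_0.\<close>

lemma W_dense:
  assumes "sqi M G0" "sqi M k0"
    and "\<And>\<phi> D\<phi>. test_fun \<Omega> \<phi> D\<phi> \<Longrightarrow> (\<integral>x. G0 x \<bullet> D\<phi> x \<partial>M) + (\<integral>x. k0 x * \<phi> x \<partial>M) = 0"
    and "W u G"
  shows "(\<integral>x. G0 x \<bullet> G x \<partial>M) + (\<integral>x. k0 x * u x \<partial>M) = 0"
proof -
  obtain \<phi> D\<phi> where *: "\<And>k::nat. test_fun \<Omega> (\<phi> k) (D\<phi> k)"
    "(\<lambda>k. nrm2 M (\<lambda>x. \<phi> k x - u x)) \<longlonglongrightarrow> 0" "(\<lambda>k. nrm2 M (\<lambda>x. D\<phi> k x - G x)) \<longlonglongrightarrow> 0"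
    using assms(4) unfolding W_def by blast
  have "(\<lambda>k. (\<integral>x. D\<phi> k x \<bullet> G0 x \<partial>M) + (\<integral>x. \<phi> k x \<bullet> k0 x \<partial>M))
      \<longlonglongrightarrow> (\<integral>x. G x \<bullet> G0 x \<partial>M) + (\<integral>x. u x \<bullet> k0 x \<partial>M)"
    by (intro tendsto_add nrm2_inner_tendsto * assms W_sqi[OF assms(4)] test_fun_sqi[OF *(1)])
  moreover have "(\<integral>x. D\<phi> k x \<bullet> G0 x \<partial>M) + (\<integral>x. \<phi> k x \<bullet> k0 x \<partial>M) = 0" for k
    using assms(3)[OF *(1), of k] by (simp add: inner_commute mult.commute)
  ultimately have "(\<lambda>k. 0) \<longlonglongrightarrow> (\<integral>x. G x \<bullet> G0 x \<partial>M) + (\<integral>x. u x \<bullet> k0 x \<partial>M)" by simp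
  then have "(\<integral>x. G x \<bullet> G0 x \<partial>M) + (\<integral>x. u x \<bullet> k0 x \<partial>M) = 0" by (simp add: LIMSEQ_const_iff)
  then show ?thesis by (simp add: inner_commute mult.commute)
qed

lemma test_fun_ibp:
  assumes "test_fun \<Omega> \<phi> D\<phi>" "\<And>x. (\<psi> has_derivative (\<lambda>h. D\<psi> x \<bullet> h)) (at x)" "continuous_on UNIV D\<psi>"
  shows "(\<integral>x. \<phi> x * (D\<psi> x \<bullet> b) \<partial>M) = - (\<integral>x. (D\<phi> x \<bullet> b) * \<psi> x \<partial>M)"
proof -
  note t = test_fun_mult[OF assms]
  have pc: "continuous_on UNIV \<psi>"
    using assms(2) by (auto simp: continuous_on_eq_continuous_at intro: has_derivative_continuous)
  have I: "integrable M f" if "continuous_on UNIV f" "\<And>x. x \<notin> closure {x. \<phi> x \<noteq> 0} \<Longrightarrow> f x = 0" for f :: "'a \<Rightarrow> real"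
    using continuous_compact_support_integrable(1)[OF that(1) test_funD(4)[OF assms(1)] that(2)]
    using integrable_mult_indicator[of \<Omega> lebesgue f] by (simp add: integrable_restrict_space)
  have I1: "integrable M (\<lambda>x. \<phi> x * (D\<psi> x \<bullet> b))"
  proof (rule I)
    show "continuous_on UNIV (\<lambda>x. \<phi> x * (D\<psi> x \<bullet> b))"
      by (intro continuous_intros test_funD(2)[OF assms(1)] assms(3))
    show "\<phi> x * (D\<psi> x \<bullet> b) = 0" if "x \<notin> closure {x. \<phi> x \<noteq> 0}" for x
      unfolding test_fun_zero_supp(1)[OF assms(1) that] by simp
  qed
  have I2: "integrable M (\<lambda>x. (D\<phi> x \<bullet> b) * \<psi> x)"
  proof (rule I)
    show "continuous_on UNIV (\<lambda>x. (D\<phi> x \<bullet> b) * \<psi> x)"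
      by (intro continuous_intros test_funD(3)[OF assms(1)] pc)
    show "(D\<phi> x \<bullet> b) * \<psi> x = 0" if "x \<notin> closure {x. \<phi> x \<noteq> 0}" for x
      unfolding test_fun_zero_supp(2)[OF assms(1) that] by simp
  qed
  have "0 = (\<integral>x. (\<phi> x *\<^sub>R D\<psi> x + \<psi> x *\<^sub>R D\<phi> x) \<bullet> b \<partial>M)"
    using test_fun_integral_derivative[OF t, of b]
      integral_M_zero_ext[of "\<lambda>x. (\<phi> x *\<^sub>R D\<psi> x + \<psi> x *\<^sub>R D\<phi> x) \<bullet> b"] test_fun_zero(2)[OF t] by simp
  also have "\<dots> = (\<integral>x. \<phi> x * (D\<psi> x \<bullet> b) \<partial>M) + (\<integral>x. (D\<phi> x \<bullet> b) * \<psi> x \<partial>M)"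
    using I1 I2 by (simp add: inner_add_left mult.commute[of "\<psi> _"])
  finally show ?thesis by simp
qed

text \<open>The support of \<psi> may lie anywhere, not only in \<Omega>. This encodes the zero
  boundary condition: u extended by zero has G extended by zero as its weak gradient on the whole
  space. The mean value argument near the boundary rests on it.\<close>

lemma W_ibp:
  assumes "W u G" "test_fun U \<psi> D\<psi>"
  shows "(\<integral>x. u x * (D\<psi> x \<bullet> b) \<partial>M) = - (\<integral>x. (G x \<bullet> b) * \<psi> x \<partial>M)"
proof -
  have s: "sqi M (\<lambda>x. \<psi> x *\<^sub>R b)" "sqi M (\<lambda>x. D\<psi> x \<bullet> b)"
  proof -
    have m: "D\<psi> \<in> borel_measurable M" "\<psi> \<in> borel_measurable M" using test_fun_sqi[OF assms(2)] by auto
    show "sqi M (\<lambda>x. \<psi> x *\<^sub>R b)"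
      by (rule sqi_bound(1)[OF test_fun_sqi(1)[OF assms(2)], of _ "norm b"]) (use m in \<open>auto simp: mult.commute\<close>)
    show "sqi M (\<lambda>x. D\<psi> x \<bullet> b)"
      by (rule sqi_bound(1)[OF test_fun_sqi(2)[OF assms(2)], of _ "norm b"])
        (use m Cauchy_Schwarz_ineq2[of "D\<psi> _" b] in \<open>auto simp: mult.commute[of "norm b"]\<close>)
  qed
  have "(\<integral>x. (\<psi> x *\<^sub>R b) \<bullet> G x \<partial>M) + (\<integral>x. (D\<psi> x \<bullet> b) * u x \<partial>M) = 0"
  proof (rule W_dense[OF s _ assms(1)])
    fix \<phi> D\<phi> assume t: "test_fun \<Omega> \<phi> D\<phi>"
    show "(\<integral>x. (\<psi> x *\<^sub>R b) \<bullet> D\<phi> x \<partial>M) + (\<integral>x. (D\<psi> x \<bullet> b) * \<phi> x \<partial>M) = 0"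
      using test_fun_ibp[OF t test_funD(1,3)[OF assms(2)], of b] by (simp add: mult.commute inner_commute)
  qed
  then show ?thesis by (simp add: mult.commute inner_commute)
qed

definition CP :: real where
  "CP = 2 * (SOME R. R > 0 \<and> (\<forall>x\<in>\<Omega>. norm x \<le> R))"

lemma CP: "CP > 0" "x \<in> \<Omega> \<Longrightarrow> norm x \<le> CP / 2"
proof -
  have "\<exists>R. R > 0 \<and> (\<forall>x\<in>\<Omega>. norm x \<le> R)" using bounded_\<Omega> bounded_pos by blast
  from someI_ex[OF this] show "CP > 0" "x \<in> \<Omega> \<Longrightarrow> norm x \<le> CP / 2" by (auto simp: CP_def)
qed

text \<open>In one basis direction b, the square of \<phi> times the derivative of
  \<open>x \<bullet> b\<close> is integrated by parts. The factor 2 from differentiating the square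
  meets a bound R for \<open>x \<bullet> b\<close> on \<Omega>, which explains the constant 2 R in
  \<open>CP\<close>.\<close>

lemma W_poincare:
  assumes "W u G"
  shows "nrm2 M u \<le> CP * nrm2 M G"
proof -
  have test: "nrm2 M \<phi> \<le> CP * nrm2 M D\<phi>" if t: "test_fun \<Omega> \<phi> D\<phi>" for \<phi> D\<phi>
  proof -
    obtain b :: 'a where b: "b \<in> Basis" using nonempty_Basis by blast
    have "(\<integral>x. \<phi> x * ((\<phi> x *\<^sub>R b + (x \<bullet> b) *\<^sub>R D\<phi> x) \<bullet> b) \<partial>M) = - (\<integral>x. (D\<phi> x \<bullet> b) * (\<phi> x * (x \<bullet> b)) \<partial>M)"
    proof (rule test_fun_ibp[OF t])
      show "((\<lambda>x. \<phi> x * (x \<bullet> b)) has_derivative (\<lambda>h. (\<phi> x *\<^sub>R b + (x \<bullet> b) *\<^sub>R D\<phi> x) \<bullet> h)) (at x)" for x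
        by (auto intro!: derivative_eq_intros test_funD(1)[OF t] simp: inner_add_left algebra_simps inner_commute)
      show "continuous_on UNIV (\<lambda>x. \<phi> x *\<^sub>R b + (x \<bullet> b) *\<^sub>R D\<phi> x)"
        by (intro continuous_intros test_funD[OF t])
    qed
    moreover have "\<phi> x * ((\<phi> x *\<^sub>R b + (x \<bullet> b) *\<^sub>R D\<phi> x) \<bullet> b)
        = (norm (\<phi> x))\<^sup>2 + \<phi> x * ((x \<bullet> b) * (D\<phi> x \<bullet> b))" for x
      using b by (simp add: inner_add_left power2_eq_square algebra_simps)
    moreover have v: "sqi M (\<lambda>x. (x \<bullet> b) * (D\<phi> x \<bullet> b))" "nrm2 M (\<lambda>x. (x \<bullet> b) * (D\<phi> x \<bullet> b)) \<le> \<bar>CP/2\<bar> * nrm2 M D\<phi>"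
    proof -
      have m: "(\<lambda>x. (x \<bullet> b) * (D\<phi> x \<bullet> b)) \<in> borel_measurable M"
        by (intro continuous_meas_M continuous_intros test_funD[OF t])
      have "AE x in M. norm ((x \<bullet> b) * (D\<phi> x \<bullet> b)) \<le> CP/2 * norm (D\<phi> x)"
      proof (rule AE_I2)
        fix x assume "x \<in> space M"
        then have "x \<in> \<Omega>" by simp
        then have "norm x \<le> CP/2" by (rule CP)
        moreover have "\<bar>x \<bullet> b\<bar> \<le> norm x" "\<bar>D\<phi> x \<bullet> b\<bar> \<le> norm (D\<phi> x)" using b by (auto simp: Basis_le_norm)
        ultimately show "norm ((x \<bullet> b) * (D\<phi> x \<bullet> b)) \<le> CP/2 * norm (D\<phi> x)"
          unfolding real_norm_def abs_mult by (intro mult_mono) auto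
      qed
      from sqi_bound[OF test_fun_sqi(2)[OF t] m this]
      show "sqi M (\<lambda>x. (x \<bullet> b) * (D\<phi> x \<bullet> b))" "nrm2 M (\<lambda>x. (x \<bullet> b) * (D\<phi> x \<bullet> b)) \<le> \<bar>CP/2\<bar> * nrm2 M D\<phi>" .
    qed
    ultimately have "(nrm2 M \<phi>)\<^sup>2 = - 2 * (\<integral>x. \<phi> x * ((x \<bullet> b) * (D\<phi> x \<bullet> b)) \<partial>M)"
      using sqi_integrable[OF test_fun_sqi(1)[OF t]] sqi_mult_integrable[OF test_fun_sqi(1)[OF t] v(1)]
      by (simp add: nrm2_power2 mult.commute mult.left_commute)
    also have "\<dots> \<le> 2 * (nrm2 M \<phi> * nrm2 M (\<lambda>x. (x \<bullet> b) * (D\<phi> x \<bullet> b)))"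
      using sqi_CS_mult[OF test_fun_sqi(1)[OF t] v(1)] by linarith
    also have "\<dots> \<le> 2 * (nrm2 M \<phi> * (CP/2 * nrm2 M D\<phi>))"
      using v(2) CP(1) by (intro mult_left_mono) auto
    finally have "nrm2 M \<phi> * nrm2 M \<phi> \<le> nrm2 M \<phi> * (CP * nrm2 M D\<phi>)" by (simp add: power2_eq_square)
    then show ?thesis
      using CP(1) by (cases "nrm2 M \<phi> = 0") (auto simp: mult_le_cancel_left less_le)
  qed
  obtain \<phi> D\<phi> where *: "\<And>k::nat. test_fun \<Omega> (\<phi> k) (D\<phi> k)"
    "(\<lambda>k. nrm2 M (\<lambda>x. \<phi> k x - u x)) \<longlonglongrightarrow> 0" "(\<lambda>k. nrm2 M (\<lambda>x. D\<phi> k x - G x)) \<longlonglongrightarrow> 0"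
    using assms unfolding W_def by blast
  show ?thesis
  proof (rule LIMSEQ_le)
    show "(\<lambda>k. nrm2 M (\<phi> k)) \<longlonglongrightarrow> nrm2 M u"
      by (rule nrm2_tendsto[OF test_fun_sqi(1)[OF *(1)] W_sqi(1)[OF assms] *(2)])
    show "(\<lambda>k. CP * nrm2 M (D\<phi> k)) \<longlonglongrightarrow> CP * nrm2 M G"
      by (intro tendsto_intros nrm2_tendsto[OF test_fun_sqi(2)[OF *(1)] W_sqi(2)[OF assms] *(3)])
    show "\<exists>N. \<forall>n\<ge>N. nrm2 M (\<phi> n) \<le> CP * nrm2 M (D\<phi> n)" using test[OF *(1)] by blast
  qed
qed

text \<open>By the Poincare inequality, Cauchy gradients force the functions to be Cauchy
  too.\<close>

lemma W_complete:
  assumes "\<And>k. W (u k) (G k)"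
    and C: "\<And>e. e > 0 \<Longrightarrow> \<exists>N. \<forall>k\<ge>N. \<forall>l\<ge>N. nrm2 M (\<lambda>x. G k x - G l x) \<le> e"
  obtains v H where "W v H" "(\<lambda>k. nrm2 M (\<lambda>x. u k x - v x)) \<longlonglongrightarrow> 0" "(\<lambda>k. nrm2 M (\<lambda>x. G k x - H x)) \<longlonglongrightarrow> 0"
proof -
  have C': "\<exists>N. \<forall>k\<ge>N. \<forall>l\<ge>N. nrm2 M (\<lambda>x. u k x - u l x) \<le> e" if "e > 0" for e
  proof -
    have "e / CP > 0" using that CP by simp
    then obtain N where N: "\<forall>k\<ge>N. \<forall>l\<ge>N. nrm2 M (\<lambda>x. G k x - G l x) \<le> e / CP" using C by blast
    have "nrm2 M (\<lambda>x. u k x - u l x) \<le> e" if "k \<ge> N" "l \<ge> N" for k l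
    proof -
      have "nrm2 M (\<lambda>x. u k x - u l x) \<le> CP * nrm2 M (\<lambda>x. G k x - G l x)"
        by (rule W_poincare[OF W_diff[OF assms(1) assms(1)]])
      also have "\<dots> \<le> CP * (e / CP)" using N that CP by (intro mult_left_mono) auto
      finally show ?thesis using CP by simp
    qed
    then show ?thesis by blast
  qed
  obtain v where v: "sqi M v" "(\<lambda>k. nrm2 M (\<lambda>x. u k x - v x)) \<longlonglongrightarrow> 0"
    using sqi_complete[OF W_sqi(1)[OF assms(1)] C'] by blast
  obtain H where H: "sqi M H" "(\<lambda>k. nrm2 M (\<lambda>x. G k x - H x)) \<longlonglongrightarrow> 0"
    using sqi_complete[OF W_sqi(2)[OF assms(1)] C] by blast
  have "W v H"
  proof (rule WI_approx[OF v(1) H(1)])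
    fix e :: real assume e: "e > 0"
    have "\<forall>\<^sub>F k in sequentially. nrm2 M (\<lambda>x. u k x - v x) < e \<and> nrm2 M (\<lambda>x. G k x - H x) < e"
      using order_tendstoD(2)[OF v(2) e] order_tendstoD(2)[OF H(2) e] by eventually_elim auto
    then obtain k where "nrm2 M (\<lambda>x. u k x - v x) < e" "nrm2 M (\<lambda>x. G k x - H x) < e"
      by (auto simp: eventually_sequentially)
    then show "\<exists>\<phi> D\<phi>. W \<phi> D\<phi> \<and> nrm2 M (\<lambda>x. \<phi> x - v x) < e \<and> nrm2 M (\<lambda>x. D\<phi> x - H x) < e"
      using assms(1) by blast
  qed
  then show ?thesis using that v H by blast
qed

lemma sqi_vec_iff: "sqi M G \<longleftrightarrow> (\<forall>b\<in>Basis. sqi M (\<lambda>x. G x \<bullet> b))" for G :: "'a \<Rightarrow> 'a"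
proof
  assume G: "sqi M G"
  then have m: "G \<in> borel_measurable M" by auto
  show "\<forall>b\<in>Basis. sqi M (\<lambda>x. G x \<bullet> b)"
    by (intro ballI sqi_bound(1)[OF G, of _ 1]) (use m in \<open>auto simp: Basis_le_norm\<close>)
next
  assume *: "\<forall>b\<in>Basis. sqi M (\<lambda>x. G x \<bullet> b)"
  then have "G \<in> borel_measurable M"
    by (subst borel_measurable_euclidean_space) (auto simp: sqi_def)
  moreover have "(norm (G x))\<^sup>2 = (\<Sum>b\<in>Basis. (norm (G x \<bullet> b))\<^sup>2)" for x
    by (subst power2_norm_eq_inner, subst euclidean_inner) (simp add: power2_eq_square)
  ultimately show "sqi M G" using * by (auto simp: sqi_def)
qed

text \<open>From right to left, the weak derivative identity in \<open>H1\<close> is inherited from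
  the approximating test functions through \<open>W_ibp\<close>.\<close>

lemma H01_iff_W: "H01 \<Omega> u G \<longleftrightarrow> W u G"
proof
  assume "H01 \<Omega> u G"
  then show "W u G" unfolding H01_def H1_def W_def L2_iff_sqi[OF sets_\<Omega>(1)] l2n_eq_nrm2[OF sets_\<Omega>(1)]
      nrm2_norm sqi_vec_iff by blast
next
  assume *: "W u G"
  then have "H1 \<Omega> u G" unfolding H1_def L2_iff_sqi[OF sets_\<Omega>(1)] set_integral_eq_lebesgue_on[OF sets_\<Omega>(1)]
    using W_ibp[OF *] W_sqi[OF *] sqi_vec_iff by auto
  then show "H01 \<Omega> u G" using * unfolding H01_def W_def l2n_eq_nrm2[OF sets_\<Omega>(1)] nrm2_norm by blast
qed

end

section \<open>Weak solutions of elliptic equations\<close>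

context bounded_open
begin

text \<open>Distributional form of - div G = k. All terms of order zero are collected in k, so that
  linear, semilinear and truncated equations share one relation; as test functions are bounded,
  integrable k are meaningful.\<close>

definition weq :: "('a \<Rightarrow> 'a) \<Rightarrow> ('a \<Rightarrow> real) \<Rightarrow> bool" where
  "weq G k \<longleftrightarrow> (\<forall>\<phi> D\<phi>. test_fun \<Omega> \<phi> D\<phi> \<longrightarrow> (\<integral>x. G x \<bullet> D\<phi> x \<partial>M) = (\<integral>x. k x * \<phi> x \<partial>M))"

lemma weqD: "weq G k \<Longrightarrow> test_fun \<Omega> \<phi> D\<phi> \<Longrightarrow> (\<integral>x. G x \<bullet> D\<phi> x \<partial>M) = (\<integral>x. k x * \<phi> x \<partial>M)"
  unfolding weq_def by blast

lemma integrable_mult_test: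
  assumes "integrable M k" "test_fun U \<phi> D\<phi>"
  shows "integrable M (\<lambda>x. k x * \<phi> x :: real)"
proof -
  obtain C where C: "\<And>x. \<bar>\<phi> x\<bar> \<le> C" using test_fun_bounded[OF assms(2)] by metis
  show ?thesis
  proof (rule Bochner_Integration.integrable_bound)
    show "integrable M (\<lambda>x. C * norm (k x))" using assms(1) by auto
    show "(\<lambda>x. k x * \<phi> x) \<in> borel_measurable M"
      using assms(1) sqi_meas[OF test_fun_sqi(1)[OF assms(2)]] by measurable
    have "\<bar>\<phi> x\<bar> * \<bar>k x\<bar> \<le> \<bar>C\<bar> * \<bar>k x\<bar>" for x
      using C[of x] by (intro mult_right_mono) auto
    then show "AE x in M. norm (k x * \<phi> x) \<le> norm (C * norm (k x))" by (simp add: abs_mult mult.commute)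
  qed
qed

lemma weq_add:
  assumes "sqi M G" "sqi M H" "integrable M k" "integrable M l" "weq G k" "weq H l"
  shows "weq (\<lambda>x. G x + H x) (\<lambda>x. k x + l x)"
  unfolding weq_def
proof (intro allI impI)
  fix \<phi> D\<phi> assume t: "test_fun \<Omega> \<phi> D\<phi>"
  show "(\<integral>x. (G x + H x) \<bullet> D\<phi> x \<partial>M) = (\<integral>x. (k x + l x) * \<phi> x \<partial>M)"
    using weqD[OF assms(5) t] weqD[OF assms(6) t] integrable_mult_test[OF assms(3) t]
      integrable_mult_test[OF assms(4) t] sqi_inner_integrable[OF assms(1) test_fun_sqi(2)[OF t]]
      sqi_inner_integrable[OF assms(2) test_fun_sqi(2)[OF t]]
    by (simp add: inner_add_left distrib_right)
qed

lemma weq_scale: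
  assumes "weq G k" shows "weq (\<lambda>x. c *\<^sub>R G x) (\<lambda>x. c * k x)"
  using assms unfolding weq_def by (auto simp: mult.assoc)

lemma weq_diff:
  assumes "sqi M G" "sqi M H" "integrable M k" "integrable M l" "weq G k" "weq H l"
  shows "weq (\<lambda>x. G x - H x) (\<lambda>x. k x - l x)"
  using weq_add[OF assms(1) sqi_scaleR[OF assms(2), of "-1"] assms(3) _ assms(5) weq_scale[OF assms(6), of "-1"]]
    assms(4) by simp

lemma weq_cong_AE:
  assumes "weq G k" "integrable M k" "integrable M l" "AE x in M. k x = l x"
  shows "weq G l"
  unfolding weq_def
proof (intro allI impI)
  fix \<phi> D\<phi> assume t: "test_fun \<Omega> \<phi> D\<phi>"
  have "(\<integral>x. k x * \<phi> x \<partial>M) = (\<integral>x. l x * \<phi> x \<partial>M)"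
    by (rule integral_cong_AE)
      (use integrable_mult_test[OF assms(2) t] integrable_mult_test[OF assms(3) t] assms(4) in auto)
  then show "(\<integral>x. G x \<bullet> D\<phi> x \<partial>M) = (\<integral>x. l x * \<phi> x \<partial>M)" using weqD[OF assms(1) t] by simp
qed

text \<open>Testing with elements of H^1_0 costs square integrability of k, a property that the
  datum \<open>f x 0\<close> may lack.\<close>

lemma weq_W:
  assumes "weq G k" "sqi M G" "sqi M k" "W v H"
  shows "(\<integral>x. G x \<bullet> H x \<partial>M) = (\<integral>x. k x * v x \<partial>M)"
proof -
  have "(\<integral>x. G x \<bullet> H x \<partial>M) + (\<integral>x. (- k x) * v x \<partial>M) = 0"
    by (rule W_dense[OF assms(2) sqi_uminus[OF assms(3)] _ assms(4)]) (simp add: weqD[OF assms(1)])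
  then show ?thesis by simp
qed

text \<open>Direct method for the Dirichlet energy over test functions, without weak compactness:
  comparing two almost minimisers with their midpoint shows that a minimising sequence has Cauchy
  gradients, and its limit satisfies the Euler equation.\<close>

lemma solve_linear:
  assumes lam: "\<mu> \<ge> 0" and g: "sqi M g"
  obtains u G where "W u G" "weq G (\<lambda>x. g x - \<mu> * u x)"
proof -
  \<comment> \<open>\<open>L\<close> is the first variation of the energy \<open>E\<close>, and
    \<open>a\<close> its quadratic part; the expansion below is exact because \<open>E\<close> is
    quadratic.\<close>
  define E where "E \<phi> D\<phi> = (nrm2 M D\<phi>)\<^sup>2 / 2 + \<mu> * (nrm2 M \<phi>)\<^sup>2 / 2 - (\<integral>x. g x * \<phi> x \<partial>M)"
    for \<phi> :: "'a \<Rightarrow> real" and D\<phi> :: "'a \<Rightarrow> 'a"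
  define a where "a \<phi> D\<phi> = (nrm2 M D\<phi>)\<^sup>2 + \<mu> * (nrm2 M \<phi>)\<^sup>2"
    for \<phi> :: "'a \<Rightarrow> real" and D\<phi> :: "'a \<Rightarrow> 'a"
  define L where "L \<phi> D\<phi> \<psi> D\<psi> = (\<integral>x. D\<phi> x \<bullet> D\<psi> x \<partial>M) + \<mu> * (\<integral>x. \<phi> x \<bullet> \<psi> x \<partial>M) - (\<integral>x. g x * \<psi> x \<partial>M)"
    for \<phi> \<psi> :: "'a \<Rightarrow> real" and D\<phi> D\<psi> :: "'a \<Rightarrow> 'a"
  have exp: "E (\<lambda>x. \<phi> x + t * \<psi> x) (\<lambda>x. D\<phi> x + t *\<^sub>R D\<psi> x) = E \<phi> D\<phi> + t * L \<phi> D\<phi> \<psi> D\<psi> + t\<^sup>2 / 2 * a \<psi> D\<psi>"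
    if "sqi M \<phi>" "sqi M D\<phi>" "sqi M \<psi>" "sqi M D\<psi>" for \<phi> \<psi> D\<phi> D\<psi> t
  proof -
    have "(\<integral>x. g x * (\<phi> x + t * \<psi> x) \<partial>M) = (\<integral>x. g x * \<phi> x \<partial>M) + t * (\<integral>x. g x * \<psi> x \<partial>M)"
      using sqi_mult_integrable[OF g that(1)] sqi_mult_integrable[OF g that(3)]
      by (simp add: distrib_left mult.left_commute)
    then show ?thesis
      unfolding E_def a_def L_def
      using nrm2_add_power2[OF that(2) sqi_scaleR[OF that(4), of t]] nrm2_add_power2[OF that(1) sqi_mult[OF that(3), of t]]
      by (simp add: nrm2_scaleR nrm2_mult power_mult_distrib) (simp add: field_simps)
  qed
  \<comment> \<open>By Poincare and Young the linear term is at most half the squared gradient norm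
    plus a constant.\<close>
  have Elow: "- (CP * nrm2 M g)\<^sup>2 / 2 \<le> E \<phi> D\<phi>" if t: "test_fun \<Omega> \<phi> D\<phi>" for \<phi> D\<phi>
  proof -
    have "(\<integral>x. g x * \<phi> x \<partial>M) \<le> nrm2 M g * nrm2 M \<phi>"
      using sqi_CS_mult[OF g test_fun_sqi(1)[OF t]] by simp
    also have "\<dots> \<le> nrm2 M g * (CP * nrm2 M D\<phi>)"
      by (intro mult_left_mono W_poincare W_test[OF t]) simp
    also have "\<dots> \<le> (CP * nrm2 M g)\<^sup>2 / 2 + (nrm2 M D\<phi>)\<^sup>2 / 2"
      using sum_squares_bound[of "CP * nrm2 M g" "nrm2 M D\<phi>"] by (simp add: algebra_simps)
    finally have "(\<integral>x. g x * \<phi> x \<partial>M) \<le> (CP * nrm2 M g)\<^sup>2 / 2 + (nrm2 M D\<phi>)\<^sup>2 / 2" .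
    moreover have "0 \<le> \<mu> * (nrm2 M \<phi>)\<^sup>2 / 2" using lam by simp
    ultimately show ?thesis unfolding E_def by linarith
  qed
  define S where "S = {E \<phi> D\<phi> | \<phi> D\<phi>. test_fun \<Omega> \<phi> D\<phi>}"
  have Sb: "bdd_below S" using Elow unfolding S_def bdd_below_def by blast
  have Sn: "S \<noteq> {}" using test_fun_0 unfolding S_def by blast
  define m where "m = Inf S"
  have mE: "m \<le> E \<phi> D\<phi>" if "test_fun \<Omega> \<phi> D\<phi>" for \<phi> D\<phi>
    unfolding m_def using that Sb by (intro cInf_lower) (auto simp: S_def)
  have "\<exists>\<phi> D\<phi>. test_fun \<Omega> \<phi> D\<phi> \<and> E \<phi> D\<phi> < m + inverse (real (Suc k))" for k
  proof -
    have "\<exists>x\<in>S. x < m + inverse (real (Suc k))"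
      using cInf_lessD[OF Sn, of "m + inverse (real (Suc k))"] unfolding m_def by simp
    then show ?thesis unfolding S_def by blast
  qed
  then obtain \<phi> D\<phi> where tf: "\<And>k. test_fun \<Omega> (\<phi> k) (D\<phi> k)"
      and Ek: "\<And>k. E (\<phi> k) (D\<phi> k) < m + inverse (real (Suc k))" by metis
  note s = test_fun_sqi[OF tf]
  have C: "\<exists>N. \<forall>k\<ge>N. \<forall>l\<ge>N. nrm2 M (\<lambda>x. D\<phi> k x - D\<phi> l x) \<le> e" if e: "e > 0" for e
  proof -
    obtain N where N: "inverse (real (Suc N)) < e\<^sup>2 / 8" using reals_Archimedean[of "e\<^sup>2/8"] e by auto
    have "nrm2 M (\<lambda>x. D\<phi> k x - D\<phi> l x) \<le> e" if kl: "k \<ge> N" "l \<ge> N" for k l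
    proof -
      let ?q = "\<lambda>x. \<phi> k x - \<phi> l x" and ?Dq = "\<lambda>x. D\<phi> k x - D\<phi> l x"
      have sq: "sqi M ?q" "sqi M ?Dq" using s by (auto intro: sqi_diff)
      \<comment> \<open>The midpoint is admissible, so its energy is at least m. Expanding the
        energies of the midpoint and of \<phi> k about \<phi> l, with steps 1/2 and 1, and
        eliminating the first variation bounds \<open>a\<close> by the two excess energies.\<close>
      have "test_fun \<Omega> (\<lambda>x. \<phi> l x + (1/2) * ?q x) (\<lambda>x. D\<phi> l x + (1/2) *\<^sub>R ?Dq x)"
        using test_fun_add[OF test_fun_scale[OF tf[of k], of "1/2"] test_fun_scale[OF tf[of l], of "1/2"]]
        by (rule back_subst[of "\<lambda>p. test_fun \<Omega> (fst p) (snd p)" "(_,_)" "(_,_)", simplified])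
          (auto simp: fun_eq_iff scaleR_diff_right algebra_simps simp flip: scaleR_add_left)
      from mE[OF this] have "m \<le> E (\<phi> l) (D\<phi> l) + (1/2) * L (\<phi> l) (D\<phi> l) ?q ?Dq + (1/2)\<^sup>2 / 2 * a ?q ?Dq"
        by (subst (asm) exp[OF s(1) s(2) sq]) simp
      moreover have "E (\<phi> k) (D\<phi> k) = E (\<phi> l) (D\<phi> l) + 1 * L (\<phi> l) (D\<phi> l) ?q ?Dq + 1\<^sup>2 / 2 * a ?q ?Dq"
        using exp[OF s(1)[of l] s(2)[of l] sq, of 1] by simp
      ultimately have "a ?q ?Dq \<le> 4 * (E (\<phi> k) (D\<phi> k) + E (\<phi> l) (D\<phi> l) - 2 * m)"
        by (simp add: power2_eq_square field_simps)
      also have "\<dots> \<le> 4 * (inverse (real (Suc k)) + inverse (real (Suc l)))"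
        using Ek[of k] Ek[of l] by simp
      also have "\<dots> \<le> 4 * (inverse (real (Suc N)) + inverse (real (Suc N)))"
        using kl by (intro mult_left_mono add_mono le_imp_inverse_le) auto
      also have "\<dots> \<le> e\<^sup>2" using N by simp
      finally have "(nrm2 M ?Dq)\<^sup>2 \<le> e\<^sup>2"
        using lam unfolding a_def by (smt (verit) mult_nonneg_nonneg zero_le_power2)
      then show ?thesis by (rule power2_le_imp_le) (use e in simp)
    qed
    then show ?thesis by blast
  qed
  obtain u G where uG: "W u G" "(\<lambda>k. nrm2 M (\<lambda>x. \<phi> k x - u x)) \<longlonglongrightarrow> 0" "(\<lambda>k. nrm2 M (\<lambda>x. D\<phi> k x - G x)) \<longlonglongrightarrow> 0"
    using W_complete[OF W_test[OF tf] C] by blast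
  have "weq G (\<lambda>x. g x - \<mu> * u x)"
    unfolding weq_def
  proof (intro allI impI)
    fix \<psi> D\<psi> assume t: "test_fun \<Omega> \<psi> D\<psi>"
    note st = test_fun_sqi[OF t]
    have Ll: "(\<lambda>k. L (\<phi> k) (D\<phi> k) \<psi> D\<psi>) \<longlonglongrightarrow> L u G \<psi> D\<psi>"
      unfolding L_def by (intro tendsto_intros nrm2_inner_tendsto s uG W_sqi[OF uG(1)] st)
    \<comment> \<open>Each \<phi> k is minimal up to 1/(k+1), so a perturbation lowers its energy by
      no more than that. In the limit a quadratic in t without constant term is nonnegative, and its
      linear coefficient must vanish.\<close>
    have "0 \<le> 0 + 2 * t * (L u G \<psi> D\<psi> / 2) + t\<^sup>2 * (a \<psi> D\<psi> / 2)" for t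
    proof (rule LIMSEQ_le[of "\<lambda>k. 0"])
      show "(\<lambda>k. inverse (real (Suc k)) + 2 * t * (L (\<phi> k) (D\<phi> k) \<psi> D\<psi> / 2) + t\<^sup>2 * (a \<psi> D\<psi> / 2))
          \<longlonglongrightarrow> 0 + 2 * t * (L u G \<psi> D\<psi> / 2) + t\<^sup>2 * (a \<psi> D\<psi> / 2)"
        by (intro tendsto_intros Ll LIMSEQ_inverse_real_of_nat) simp
      have "0 \<le> inverse (real (Suc k)) + 2 * t * (L (\<phi> k) (D\<phi> k) \<psi> D\<psi> / 2) + t\<^sup>2 * (a \<psi> D\<psi> / 2)" for k
        using mE[OF test_fun_add[OF tf[of k] test_fun_scale[OF \<open>test_fun \<Omega> \<psi> D\<psi>\<close>, of t]]]
          exp[OF s(1) s(2) st, of k t] Ek[of k] by simp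
      then show "\<exists>N. \<forall>n\<ge>N. 0 \<le> inverse (real (Suc n)) + 2 * t * (L (\<phi> n) (D\<phi> n) \<psi> D\<psi> / 2) + t\<^sup>2 * (a \<psi> D\<psi> / 2)"
        by blast
    qed simp
    from quadratic_nonneg_imp[OF this] have "L u G \<psi> D\<psi> = 0" by simp
    then show "(\<integral>x. G x \<bullet> D\<psi> x \<partial>M) = (\<integral>x. (g x - \<mu> * u x) * \<psi> x \<partial>M)"
      using sqi_mult_integrable[OF g st(1)] sqi_mult_integrable[OF W_sqi(1)[OF uG(1)] st(1)]
      unfolding L_def by (simp add: left_diff_distrib mult.assoc)
  qed
  then show ?thesis using that uG(1) by blast
qed

text \<open>Since \<open>s \<mapsto> \<mu> s - h x s\<close> has slopes in \<open>[0, \<mu>]\<close>, the map sending \<open>w\<close> to the solution \<open>u\<close> of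
  \<open>- \<Delta> u + \<mu> u = g + \<mu> w - h x w\<close> is a contraction of \<open>L\<^sup>2\<close> by the Poincare inequality.\<close>
lemma solve_monotone:
  assumes lam: "\<mu> \<ge> 0" and g: "sqi M g"
    and hm: "\<And>w. w \<in> borel_measurable M \<Longrightarrow> (\<lambda>x. h x (w x)) \<in> borel_measurable M"
    and hl: "AE x in M. \<forall>s t. s \<le> t \<longrightarrow> 0 \<le> h x t - h x s \<and> h x t - h x s \<le> \<mu> * (t - s)"
    and h0: "AE x in M. h x 0 = 0"
  obtains w G where "W w G" "weq G (\<lambda>x. g x - h x (w x))"
proof -
  have habs: "AE x in M. \<forall>s. \<bar>h x s\<bar> \<le> \<mu> * \<bar>s\<bar>"
    using hl h0
  proof eventually_elim
    case (elim x)
    show ?case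
    proof
      fix s show "\<bar>h x s\<bar> \<le> \<mu> * \<bar>s\<bar>"
        using elim(1)[rule_format, of 0 s] elim(1)[rule_format, of s 0] elim(2) by (cases "s \<ge> 0") auto
    qed
  qed
  have hsq: "sqi M (\<lambda>x. h x (w x))" if "sqi M w" for w
    by (rule sqi_bound(1)[OF that hm[OF sqi_meas[OF that]], of \<mu>]) (use habs in \<open>eventually_elim, auto\<close>)
  define N where "N w x = \<mu> * w x - h x (w x)" for w x
  have Nsq: "sqi M (N w)" if "sqi M w" for w
    unfolding N_def by (intro sqi_diff sqi_mult hsq that)
  have NL: "nrm2 M (\<lambda>x. N v x - N w x) \<le> \<mu> * nrm2 M (\<lambda>x. v x - w x)" if v: "sqi M v" and w: "sqi M w" for v w
  proof -
    have "AE x in M. norm (N v x - N w x) \<le> \<mu> * norm (v x - w x)"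
      using hl
    proof eventually_elim
      case (elim x)
      show ?case unfolding N_def
        using elim[rule_format, of "v x" "w x"] elim[rule_format, of "w x" "v x"]
        by (cases "v x \<le> w x") (auto simp: abs_if algebra_simps)
    qed
    from sqi_bound(2)[OF sqi_diff[OF v w] sqi_meas[OF sqi_diff[OF Nsq[OF v] Nsq[OF w]]] this]
    show ?thesis using lam by simp
  qed
  have "\<forall>w. \<exists>u G. sqi M w \<longrightarrow> W u G \<and> weq G (\<lambda>x. (g x + N w x) - \<mu> * u x)"
    using solve_linear[OF lam sqi_add[OF g Nsq]] by metis
  then obtain T TG where T: "\<And>w. sqi M w \<Longrightarrow> W (T w) (TG w)"
      "\<And>w. sqi M w \<Longrightarrow> weq (TG w) (\<lambda>x. (g x + N w x) - \<mu> * T w x)" by metis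
  \<comment> \<open>The energy identity for a difference controls its gradient and \<mu> times the
    function; the Poincare inequality turns the gradient part into a further
    \<open>1 / CP\<^sup>2\<close>, which pushes the ratio below 1.\<close>
  define q where "q = \<mu> / (\<mu> + 1 / CP\<^sup>2)"
  have CP2: "1 / CP\<^sup>2 > 0" using CP(1) by simp
  have q: "0 \<le> q" "q < 1"
  proof -
    have pos: "\<mu> + 1 / CP\<^sup>2 > 0" using lam CP2 by linarith
    show "0 \<le> q" unfolding q_def using lam pos by (intro divide_nonneg_pos)
    show "q < 1" unfolding q_def pos_divide_less_eq[OF pos]
      using CP2 by (simp only: mult_1_left less_add_same_cancel1)
  qed
  have contr: "nrm2 M (\<lambda>x. T v x - T w x) \<le> q * nrm2 M (\<lambda>x. v x - w x)" if v: "sqi M v" and w: "sqi M w" for v w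
  proof -
    let ?d = "\<lambda>x. T v x - T w x" and ?D = "\<lambda>x. TG v x - TG w x"
    note sT = W_sqi[OF T(1)[OF v]] W_sqi[OF T(1)[OF w]]
    have Wd: "W ?d ?D" by (rule W_diff[OF T(1)[OF v] T(1)[OF w]])
    have sv: "sqi M (\<lambda>x. (g x + N v x) - \<mu> * T v x)" "sqi M (\<lambda>x. (g x + N w x) - \<mu> * T w x)"
      by (intro sqi_diff sqi_add g Nsq sqi_mult sT v w)+
    have "weq ?D (\<lambda>x. ((g x + N v x) - \<mu> * T v x) - ((g x + N w x) - \<mu> * T w x))"
      by (intro weq_diff sT T v w sv sqi_integrable_L1(1))
    from weq_W[OF this W_sqi(2)[OF Wd] sqi_diff[OF sv] Wd]
    have "(nrm2 M ?D)\<^sup>2 = (\<integral>x. (((g x + N v x) - \<mu> * T v x) - ((g x + N w x) - \<mu> * T w x)) * ?d x \<partial>M)"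
      by (simp add: nrm2_power2 power2_norm_eq_inner)
    also have "\<dots> = (\<integral>x. (N v x - N w x) * ?d x - \<mu> * (norm (?d x))\<^sup>2 \<partial>M)"
      by (intro arg_cong[where f="integral\<^sup>L M"] ext) (simp add: power2_eq_square algebra_simps)
    also have "\<dots> = (\<integral>x. (N v x - N w x) * ?d x \<partial>M) - \<mu> * (nrm2 M ?d)\<^sup>2"
      using sqi_mult_integrable[OF sqi_diff[OF Nsq[OF v] Nsq[OF w]] W_sqi(1)[OF Wd]]
        sqi_integrable[OF W_sqi(1)[OF Wd]] by (simp add: nrm2_power2)
    finally have e: "(nrm2 M ?D)\<^sup>2 + \<mu> * (nrm2 M ?d)\<^sup>2 = (\<integral>x. (N v x - N w x) * ?d x \<partial>M)" by simp
    have "(nrm2 M ?d)\<^sup>2 \<le> (CP * nrm2 M ?D)\<^sup>2"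
      by (rule power_mono[OF W_poincare[OF Wd]]) simp
    then have "(nrm2 M ?d)\<^sup>2 / CP\<^sup>2 \<le> (nrm2 M ?D)\<^sup>2" using CP(1) by (simp add: field_simps power_mult_distrib)
    then have "(\<mu> + 1 / CP\<^sup>2) * (nrm2 M ?d)\<^sup>2 \<le> (\<integral>x. (N v x - N w x) * ?d x \<partial>M)"
      using e by (simp add: algebra_simps)
    also have "\<dots> \<le> nrm2 M (\<lambda>x. N v x - N w x) * nrm2 M ?d"
      using sqi_CS_mult[OF sqi_diff[OF Nsq[OF v] Nsq[OF w]] W_sqi(1)[OF Wd]] by simp
    also have "\<dots> \<le> (\<mu> * nrm2 M (\<lambda>x. v x - w x)) * nrm2 M ?d"
      by (intro mult_right_mono NL v w) simp
    finally have *: "nrm2 M ?d * ((\<mu> + 1 / CP\<^sup>2) * nrm2 M ?d) \<le> nrm2 M ?d * (\<mu> * nrm2 M (\<lambda>x. v x - w x))"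
      by (simp add: power2_eq_square algebra_simps)
    have "(\<mu> + 1 / CP\<^sup>2) * nrm2 M ?d \<le> \<mu> * nrm2 M (\<lambda>x. v x - w x)"
    proof (cases "nrm2 M ?d = 0")
      case True then show ?thesis using lam by (simp only: True) simp
    next
      case False
      then have "nrm2 M ?d > 0" using nrm2_nonneg[of M ?d] by linarith
      then show ?thesis using * mult_le_cancel_left_pos by blast
    qed
    moreover have "\<mu> + 1 / CP\<^sup>2 > 0" using lam CP2 by linarith
    ultimately show ?thesis unfolding q_def by (simp add: field_simps)
  qed
  define w where "w k = (T ^^ k) (\<lambda>x. 0)" for k
  have wS: "w (Suc k) = T (w k)" for k by (simp add: w_def)
  have wsq: "sqi M (w k)" for k
    by (induction k) (auto simp: wS W_sqi[OF T(1)], simp add: w_def)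
  \<comment> \<open>Sum of the geometric series: \<open>A\<close> bounds the distance of every
    iterate from the initial one.\<close>
  define A where "A = nrm2 M (w 1) / (1 - q)"
  have A: "nrm2 M (w 1) + q * A = A" "A \<ge> 0" using q by (auto simp: A_def field_simps)
  have bA: "nrm2 M (\<lambda>x. w j x - w 0 x) \<le> A" for j
  proof (induction j)
    case 0 then show ?case using A by simp
  next
    case (Suc j)
    have "nrm2 M (\<lambda>x. w (Suc j) x - w 0 x) \<le> nrm2 M (\<lambda>x. w (Suc j) x - w 1 x) + nrm2 M (\<lambda>x. w 1 x - w 0 x)"
      by (rule nrm2_triangle3[OF wsq wsq wsq])
    also have "nrm2 M (\<lambda>x. w (Suc j) x - w 1 x) \<le> q * A"
      using contr[OF wsq[of j] wsq[of 0]] mult_left_mono[OF Suc q(1)] wS[of 0] wS[of j] by simp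
    also have "nrm2 M (\<lambda>x. w 1 x - w 0 x) = nrm2 M (w 1)" by (simp add: w_def)
    finally show ?case using A by simp
  qed
  have bq: "nrm2 M (\<lambda>x. w (k + j) x - w k x) \<le> q ^ k * A" for k j
  proof (induction k)
    case 0 then show ?case using bA by simp
  next
    case (Suc k)
    have "nrm2 M (\<lambda>x. w (Suc (k + j)) x - w (Suc k) x) \<le> q * nrm2 M (\<lambda>x. w (k + j) x - w k x)"
      using contr[OF wsq wsq] by (simp add: wS)
    also have "\<dots> \<le> q * (q ^ k * A)" using Suc q by (intro mult_left_mono) auto
    finally show ?case by simp
  qed
  have C: "\<exists>N. \<forall>k\<ge>N. \<forall>l\<ge>N. nrm2 M (\<lambda>x. w k x - w l x) \<le> e" if e: "e > 0" for e
  proof -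
    have "(\<lambda>k. q ^ k * A) \<longlonglongrightarrow> 0 * A" using q by (intro tendsto_intros LIMSEQ_power_zero) auto
    then have "\<forall>\<^sub>F k in sequentially. q ^ k * A < e" using e by (intro order_tendstoD) auto
    then obtain N where N: "\<And>k. k \<ge> N \<Longrightarrow> q ^ k * A < e" by (auto simp: eventually_sequentially)
    have "nrm2 M (\<lambda>x. w k x - w l x) \<le> e" if "k \<ge> N" "l \<ge> N" for k l
    proof (cases "k \<le> l")
      case True
      then show ?thesis using bq[of k "l - k"] N[OF that(1)] nrm2_minus_commute[of M "w k" "w l"] by simp
    next
      case False
      then show ?thesis using bq[of l "k - l"] N[OF that(2)] by simp
    qed
    then show ?thesis by blast
  qed
  obtain v where v: "sqi M v" "(\<lambda>k. nrm2 M (\<lambda>x. w k x - v x)) \<longlonglongrightarrow> 0"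
    using sqi_complete[OF wsq C] by blast
  \<comment> \<open>The limit v is a fixed point only almost everywhere. The solution returned is T
    v, which lies in \<open>W\<close>.\<close>
  note Tv = T[OF v(1)]
  have "nrm2 M (\<lambda>x. v x - T v x) \<le> 0"
  proof (rule LIMSEQ_le_const)
    show "(\<lambda>k. nrm2 M (\<lambda>x. w (Suc k) x - v x) + q * nrm2 M (\<lambda>x. w k x - v x)) \<longlonglongrightarrow> 0"
      using tendsto_add[OF LIMSEQ_Suc[OF v(2)] tendsto_mult_left[OF v(2), of q]] by simp
    have "nrm2 M (\<lambda>x. v x - T v x) \<le> nrm2 M (\<lambda>x. w (Suc k) x - v x) + q * nrm2 M (\<lambda>x. w k x - v x)" for k
      using nrm2_triangle3[OF v(1) wsq[of "Suc k"] W_sqi(1)[OF Tv(1)]] contr[OF wsq[of k] v(1)]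
        nrm2_minus_commute[of M v "w (Suc k)"] by (simp add: wS)
    then show "\<exists>N. \<forall>k\<ge>N. nrm2 M (\<lambda>x. v x - T v x) \<le> nrm2 M (\<lambda>x. w (Suc k) x - v x) + q * nrm2 M (\<lambda>x. w k x - v x)"
      by blast
  qed
  then have "nrm2 M (\<lambda>x. v x - T v x) = 0" using nrm2_nonneg[of M "\<lambda>x. v x - T v x"] by linarith
  then have ae: "AE x in M. v x = T v x"
    using nrm2_eq_0_iff[OF sqi_diff[OF v(1) W_sqi(1)[OF Tv(1)]]] by simp
  have "weq (TG v) (\<lambda>x. g x - h x (T v x))"
  proof (rule weq_cong_AE[OF Tv(2)])
    show "integrable M (\<lambda>x. g x + N v x - \<mu> * T v x)"
      by (intro sqi_integrable_L1(1) sqi_diff sqi_add g Nsq v sqi_mult W_sqi(1)[OF Tv(1)])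
    show "integrable M (\<lambda>x. g x - h x (T v x))"
      by (intro sqi_integrable_L1(1) sqi_diff hsq g W_sqi(1)[OF Tv(1)])
    show "AE x in M. g x + N v x - \<mu> * T v x = g x - h x (T v x)"
      using ae by eventually_elim (simp add: N_def)
  qed
  then show ?thesis using that Tv(1) by blast
qed

end

section \<open>Mean value inequality\<close>

text \<open>An exponent of at least two makes the one-sided derivatives at 0 agree; hence the double
  successor.\<close>

lemma DERIV_max0_power:
  "((\<lambda>t::real. (max 0 t) ^ Suc (Suc k)) has_real_derivative real (Suc (Suc k)) * (max 0 t) ^ Suc k) (at t)"
proof (cases t "0::real" rule: linorder_cases)
  case less
  have "((\<lambda>t. 0) has_real_derivative 0) (at t)" by simp
  then have "((\<lambda>t::real. (max 0 t) ^ Suc (Suc k)) has_real_derivative 0) (at t)"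
    by (rule has_field_derivative_transform_within_open[of _ _ _ "{..<0}"]) (use less in auto)
  then show ?thesis using less by simp
next
  case greater
  have "((\<lambda>t. t ^ Suc (Suc k)) has_real_derivative real (Suc (Suc k)) * t ^ Suc k) (at t)"
    using DERIV_pow[of "Suc (Suc k)" t] by simp
  then have "((\<lambda>t::real. (max 0 t) ^ Suc (Suc k)) has_real_derivative real (Suc (Suc k)) * t ^ Suc k) (at t)"
    by (rule has_field_derivative_transform_within_open[of _ _ _ "{0<..}"]) (use greater in auto)
  then show ?thesis using greater by simp
next
  case equal
  have "((\<lambda>h::real. ((max 0 (0 + h)) ^ Suc (Suc k) - (max 0 0) ^ Suc (Suc k)) / h) \<longlongrightarrow> 0) (at 0)"
  proof (rule Lim_null_comparison)
    have "norm (((max 0 (0 + h)) ^ Suc (Suc k) - (max 0 0) ^ Suc (Suc k)) / h) \<le> \<bar>h\<bar> ^ Suc k" for h :: real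
    proof (cases "h > 0")
      case False
      then have "max 0 (0 + h) = 0" by simp
      then show ?thesis by (simp del: power_Suc)
    qed auto
    then show "\<forall>\<^sub>F h in at 0. norm (((max 0 (0 + h)) ^ Suc (Suc k) - (max 0 0) ^ Suc (Suc k)) / h) \<le> \<bar>h\<bar> ^ Suc k"
      by simp
    have "((\<lambda>h::real. \<bar>h\<bar> ^ Suc k) \<longlongrightarrow> \<bar>0\<bar> ^ Suc k) (at 0)" by (intro tendsto_intros)
    then show "((\<lambda>h::real. \<bar>h\<bar> ^ Suc k) \<longlongrightarrow> 0) (at 0)" by simp
  qed
  then show ?thesis using equal by (simp add: DERIV_def)
qed

text \<open>A polynomial kernel: differentiation in the position or in the radius produces the
  kernel of the next lower exponent, which keeps the mean value computation explicit. Exponent 2 is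
  the lowest one that is continuously differentiable.\<close>

definition bump :: "nat \<Rightarrow> 'a::euclidean_space \<Rightarrow> real \<Rightarrow> 'a \<Rightarrow> real" where
  "bump k x s \<xi> = (max 0 (s\<^sup>2 - (norm (\<xi> - x))\<^sup>2)) ^ k"

lemma bump_nonneg [simp]: "0 \<le> bump k x s \<xi>" by (simp add: bump_def)

lemma bump_le: "bump k x s \<xi> \<le> s ^ (2 * k)"
proof -
  have "bump k x s \<xi> \<le> (s\<^sup>2) ^ k" unfolding bump_def by (intro power_mono) auto
  then show ?thesis by (simp add: power_mult)
qed

lemma bump_zero:
  assumes "s > 0" "k > 0" "\<xi> \<notin> ball x s"
  shows "bump k x s \<xi> = 0"
proof -
  have "s\<^sup>2 \<le> (norm (\<xi> - x))\<^sup>2"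
    using assms by (intro power_mono) (auto simp: dist_norm norm_minus_commute)
  then show ?thesis using assms by (simp add: bump_def)
qed

lemma bump_le_ind:
  assumes "s > 0" "k > 0" shows "bump k x s \<xi> \<le> s ^ (2 * k) * indicator (ball x s) \<xi>"
  using bump_le[of k x s \<xi>] bump_zero[OF assms, of \<xi> x] by (cases "\<xi> \<in> ball x s") auto

lemma continuous_bump: "continuous_on UNIV (bump k x s)"
  unfolding bump_def by (intro continuous_intros)

lemma bump_has_derivative:
  "(bump (Suc (Suc k)) x s has_derivative
     (\<lambda>h. (- (2 * real (Suc (Suc k)) * bump (Suc k) x s \<xi>) *\<^sub>R (\<xi> - x)) \<bullet> h)) (at \<xi>)"
proof -
  have "((\<lambda>\<xi>. s\<^sup>2 - (norm (\<xi> - x))\<^sup>2) has_derivative (\<lambda>h. - (2 * ((\<xi> - x) \<bullet> h)))) (at \<xi>)"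
    unfolding power2_norm_eq_inner by (auto intro!: derivative_eq_intros simp: inner_commute)
  from has_derivative_compose[OF this DERIV_max0_power[of k, unfolded has_field_derivative_def]]
  show ?thesis unfolding bump_def
    by (rule has_derivative_eq_rhs) (auto simp: fun_eq_iff algebra_simps)
qed

lemma bump_DERIV_radius:
  "((\<lambda>s. bump (Suc (Suc k)) x s \<xi>) has_real_derivative (2 * real (Suc (Suc k)) * s * bump (Suc k) x s \<xi>)) (at s)"
proof -
  have "((\<lambda>s. s\<^sup>2 - (norm (\<xi> - x))\<^sup>2) has_real_derivative (2 * s)) (at s)"
    by (auto intro!: derivative_eq_intros)
  from DERIV_chain2[OF DERIV_max0_power[of k] this]
  show ?thesis unfolding bump_def by (rule DERIV_cong) (simp add: algebra_simps)
qed

text \<open>\<open>bump 3 / 6\<close> is a potential of the radial field \<open>(\<xi> - x) bump 2\<close>, whose divergence is what one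
  gets by differentiating the rescaled mean of \<open>bump 2\<close> in the radius.\<close>

lemma test_fun_bump3:
  assumes "s > 0" "cball x s \<subseteq> U"
  shows "test_fun U (\<lambda>\<xi>. bump 3 x s \<xi> / 6) (\<lambda>\<xi>. - (bump 2 x s \<xi> *\<^sub>R (\<xi> - x)))"
proof (rule test_funI[where K = "cball x s"])
  have "(bump 3 x s has_derivative (\<lambda>h. (- (6 * bump 2 x s \<xi>) *\<^sub>R (\<xi> - x)) \<bullet> h)) (at \<xi>)" for \<xi>
    using bump_has_derivative[of 1 x s \<xi>] by (simp add: numeral_eq_Suc)
  from has_derivative_mult_right[OF this, of "1/6"]
  show "((\<lambda>\<xi>. bump 3 x s \<xi> / 6) has_derivative (\<lambda>h. (- (bump 2 x s \<xi> *\<^sub>R (\<xi> - x))) \<bullet> h)) (at \<xi>)" for \<xi>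
    by simp
  show "continuous_on UNIV (\<lambda>\<xi>. - (bump 2 x s \<xi> *\<^sub>R (\<xi> - x)))"
    by (intro continuous_intros continuous_bump)
  show "bump 3 x s \<xi> / 6 = 0" if "\<xi> \<notin> cball x s" for \<xi>
    using bump_zero[OF assms(1), of 3 \<xi> x] that by auto
qed (use assms in auto)

lemma test_fun_bump2_field:
  assumes "s > 0" "cball x s \<subseteq> U"
  shows "test_fun U (\<lambda>\<xi>. ((\<xi> - x) \<bullet> b) * bump 2 x s \<xi>)
    (\<lambda>\<xi>. bump 2 x s \<xi> *\<^sub>R b - (4 * ((\<xi> - x) \<bullet> b) * bump 1 x s \<xi>) *\<^sub>R (\<xi> - x))"
proof (rule test_funI[where K = "cball x s"])
  show "((\<lambda>\<xi>. ((\<xi> - x) \<bullet> b) * bump 2 x s \<xi>) has_derivative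
     (\<lambda>h. (bump 2 x s \<xi> *\<^sub>R b - (4 * ((\<xi> - x) \<bullet> b) * bump 1 x s \<xi>) *\<^sub>R (\<xi> - x)) \<bullet> h)) (at \<xi>)" for \<xi>
  proof -
    have 1: "((\<lambda>\<xi>. (\<xi> - x) \<bullet> b) has_derivative (\<lambda>h. h \<bullet> b)) (at \<xi>)"
      by (auto intro!: derivative_eq_intros)
    have 2: "(bump 2 x s has_derivative (\<lambda>h. (- (4 * bump 1 x s \<xi>) *\<^sub>R (\<xi> - x)) \<bullet> h)) (at \<xi>)"
      using bump_has_derivative[of 0 x s \<xi>] by (simp add: numeral_eq_Suc)
    show ?thesis
      by (rule has_derivative_eq_rhs[OF has_derivative_mult[OF 1 2]])
        (auto simp: fun_eq_iff inner_simps inner_commute algebra_simps)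
  qed
  show "continuous_on UNIV (\<lambda>\<xi>. bump 2 x s \<xi> *\<^sub>R b - (4 * ((\<xi> - x) \<bullet> b) * bump 1 x s \<xi>) *\<^sub>R (\<xi> - x))"
    by (intro continuous_intros continuous_bump)
  show "((\<xi> - x) \<bullet> b) * bump 2 x s \<xi> = 0" if "\<xi> \<notin> cball x s" for \<xi>
    using bump_zero[OF assms(1), of 2 \<xi> x] that by auto
qed (use assms in auto)

text \<open>The product rule gives n bump 2 minus 4 \<bar>\<xi> - x\<bar>^2 bump 1, and on the
  support \<bar>\<xi> - x\<bar>^2 is s^2 minus the base of the power. The resulting n + 4 is the
  degree of homogeneity of the integral of bump 2 in s.\<close>

lemma bump2_field_divergence:
  fixes x :: "'a::euclidean_space"
  shows "(\<Sum>b\<in>Basis. (bump 2 x s \<xi> *\<^sub>R b - (4 * ((\<xi> - x) \<bullet> b) * bump 1 x s \<xi>) *\<^sub>R (\<xi> - x)) \<bullet> b)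
    = real (DIM('a) + 4) * bump 2 x s \<xi> - 4 * s\<^sup>2 * bump 1 x s \<xi>"
proof -
  let ?m = "max 0 (s\<^sup>2 - (norm (\<xi> - x))\<^sup>2)"
  have "(\<Sum>b\<in>Basis. (bump 2 x s \<xi> *\<^sub>R b - (4 * ((\<xi> - x) \<bullet> b) * bump 1 x s \<xi>) *\<^sub>R (\<xi> - x)) \<bullet> b)
    = (\<Sum>b\<in>(Basis::'a set). bump 2 x s \<xi> - 4 * bump 1 x s \<xi> * (((\<xi> - x) \<bullet> b) * ((\<xi> - x) \<bullet> b)))"
    by (intro sum.cong) (auto simp: inner_diff_left)
  also have "\<dots> = real DIM('a) * bump 2 x s \<xi> - 4 * bump 1 x s \<xi> * (norm (\<xi> - x))\<^sup>2"
    unfolding sum_subtractf sum_distrib_left[symmetric] power2_norm_eq_inner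
    by (subst (2) euclidean_inner) simp
  also have "bump 1 x s \<xi> * (norm (\<xi> - x))\<^sup>2 = s\<^sup>2 * bump 1 x s \<xi> - bump 2 x s \<xi>"
    by (simp add: bump_def max_def power2_eq_square[of "_ - _"] algebra_simps)
  then have "4 * bump 1 x s \<xi> * (norm (\<xi> - x))\<^sup>2 = 4 * (s\<^sup>2 * bump 1 x s \<xi> - bump 2 x s \<xi>)" by (simp only: mult.assoc)
  finally show ?thesis by (simp add: algebra_simps)
qed

definition bump_mass :: "'a::euclidean_space itself \<Rightarrow> real" where
  "bump_mass _ = (\<integral>\<xi>. bump 2 (0::'a) 1 \<xi> \<partial>lborel)"

lemma bump_integrable: "s > 0 \<Longrightarrow> k > 0 \<Longrightarrow> integrable lborel (bump k x s)"
  by (rule continuous_compact_support_integrable(2)[OF continuous_bump compact_cball[of x s]])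
    (auto intro!: bump_zero)

text \<open>Scaling: the substitution contributes the power n of s, the kernel itself the power
  4.\<close>

lemma bump_integral:
  fixes x :: "'a::euclidean_space"
  assumes "s > 0"
  shows "(\<integral>\<xi>. bump 2 x s \<xi> \<partial>lborel) = s ^ (DIM('a) + 4) * bump_mass TYPE('a)"
proof -
  have e: "bump 2 x s (x + s *\<^sub>R \<xi>) = s ^ 4 * bump 2 0 1 \<xi>" for \<xi>
  proof -
    have "max 0 (s\<^sup>2 - (s * norm \<xi>)\<^sup>2) = s\<^sup>2 * max 0 (1 - (norm \<xi>)\<^sup>2)"
      using max_mult_distrib_left[of "s\<^sup>2" 0 "1 - (norm \<xi>)\<^sup>2"] by (simp add: power_mult_distrib algebra_simps)
    then show ?thesis using assms by (simp add: bump_def power_mult_distrib)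
  qed
  have m: "bump 2 x s \<in> borel_measurable borel"
    by (intro borel_measurable_continuous_onI continuous_bump)
  have "(\<integral>\<xi>. bump 2 x s \<xi> \<partial>lborel) = (\<integral>\<xi>. bump 2 x s \<xi> \<partial>density (distr lborel borel (\<lambda>\<xi>. x + s *\<^sub>R \<xi>)) (\<lambda>_. ennreal (\<bar>s\<bar> ^ DIM('a))))"
    using lborel_affine[of s x] assms by simp
  also have "\<dots> = (\<integral>\<xi>. \<bar>s\<bar> ^ DIM('a) * bump 2 x s \<xi> \<partial>distr lborel borel (\<lambda>\<xi>. x + s *\<^sub>R \<xi>))"
    using m by (subst integral_density) auto
  also have "\<dots> = (\<integral>\<xi>. \<bar>s\<bar> ^ DIM('a) * bump 2 x s (x + s *\<^sub>R \<xi>) \<partial>lborel)"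
    using m by (subst integral_distr) auto
  also have "\<dots> = s ^ (DIM('a) + 4) * bump_mass TYPE('a)"
    using assms unfolding e by (simp add: bump_mass_def power_add)
  finally show ?thesis .
qed

text \<open>Otherwise the closed complement of the unit ball would have full measure and therefore
  contain 0.\<close>

lemma bump_mass_pos: "bump_mass TYPE('a::euclidean_space) > 0"
proof -
  have "bump_mass TYPE('a) \<noteq> 0"
  proof
    assume "bump_mass TYPE('a) = 0"
    then have "AE \<xi> in lborel. bump 2 (0::'a) 1 \<xi> = 0"
      unfolding bump_mass_def
      by (subst (asm) integral_nonneg_eq_0_iff_AE) (auto intro!: bump_integrable)
    then have "AE \<xi> in lebesgue. \<xi> \<in> - ball (0::'a) 1"
    proof (intro AE_completion, eventually_elim)
      case (elim \<xi>)
      have "bump 2 (0::'a) 1 \<xi> \<noteq> 0" if "\<xi> \<in> ball 0 1"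
      proof -
        have "(norm \<xi>)\<^sup>2 < 1" using that by (simp add: power_less_one_iff abs_square_less_1)
        then show ?thesis by (simp add: bump_def)
      qed
      then show ?case using elim by auto
    qed
    moreover have "closed (- ball (0::'a) 1)" by auto
    ultimately have "(0::'a) \<in> - ball 0 1" by (intro mem_closed_if_AE_lebesgue)
    then show False by simp
  qed
  moreover have "bump_mass TYPE('a) \<ge> 0" unfolding bump_mass_def by (intro integral_nonneg_AE) auto
  ultimately show ?thesis by simp
qed

section \<open>Weighted means and Morrey data\<close>

context bounded_open
begin

text \<open>The mean is not normalised: for small radii it tends to \<open>bump_mass\<close> times
  u. Integrating over \<Omega> alone amounts to extending u by zero.\<close>

definition Av :: "('a \<Rightarrow> real) \<Rightarrow> real \<Rightarrow> 'a \<Rightarrow> real" where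
  "Av u s x = (\<integral>\<xi>. u \<xi> * bump 2 x s \<xi> \<partial>M) / s ^ (DIM('a) + 4)"

text \<open>Morrey condition: the mass on a ball of radius s is of order
  \<open>s powr (n - 2 + \<theta>)\<close>, n being the dimension. For \<theta> > 0 this makes the
  bound on the radial decrease of the means integrable at 0.\<close>

definition morrey :: "real \<Rightarrow> ('a \<Rightarrow> real) \<Rightarrow> real \<Rightarrow> bool" where
  "morrey \<theta> g K \<longleftrightarrow> integrable M g \<and>
     (\<forall>x s. 0 < s \<longrightarrow> s \<le> 1 \<longrightarrow> (\<integral>\<xi>. indicator (ball x s) \<xi> * \<bar>g \<xi>\<bar> \<partial>M) \<le> K * s ^ DIM('a) * s powr (\<theta> - 2))"

lemma bump_meas_M [measurable]: "bump k x s \<in> borel_measurable M"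
  by (rule continuous_meas_M[OF continuous_bump])

lemma ball_indicator_meas_M [measurable]: "indicat_real (ball x s) \<in> borel_measurable M"
  by (intro measurable_restrict_space1 borel_measurable_indicator) auto

lemma integrable_bump:
  assumes "integrable M u"
  shows "integrable M (\<lambda>\<xi>. u \<xi> * bump k x s \<xi>)"
proof (rule Bochner_Integration.integrable_bound)
  show "integrable M (\<lambda>\<xi>. s ^ (2 * k) * norm (u \<xi>))" using assms by auto
  have "norm (u \<xi> * bump k x s \<xi>) \<le> norm (s ^ (2 * k) * norm (u \<xi>))" for \<xi>
    using mult_left_mono[OF bump_le[of k x s \<xi>], of "\<bar>u \<xi>\<bar>"]
    by (simp add: abs_mult power_mult mult.commute)
  then show "AE \<xi> in M. norm (u \<xi> * bump k x s \<xi>) \<le> norm (s ^ (2 * k) * norm (u \<xi>))" by simp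
qed (use assms in measurable)

text \<open>Differentiating the kernel and the power of s together produces, up to a power of s,
  minus the divergence of (\<xi> - x) bump 2, and the weak gradient V of u absorbs that divergence.
  The set U is \<Omega> for interior balls and the whole space for functions extended by
  zero.\<close>

lemma DERIV_Av:
  assumes u: "integrable M u" and V: "sqi M V" and s: "s > 0" "cball x s \<subseteq> U"
    and wg: "\<And>\<psi> D\<psi> b. test_fun U \<psi> D\<psi> \<Longrightarrow> (\<integral>x. u x * (D\<psi> x \<bullet> b) \<partial>M) = - (\<integral>x. (V x \<bullet> b) * \<psi> x \<partial>M)"
  shows "((\<lambda>s. Av u s x) has_real_derivative
    - (\<integral>\<xi>. V \<xi> \<bullet> (- (bump 2 x s \<xi> *\<^sub>R (\<xi> - x))) \<partial>M) / s ^ (DIM('a) + 5)) (at s)"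
proof -
  let ?n = "DIM('a) + 4"
  have D1: "((\<lambda>s. \<integral>\<xi>. u \<xi> * bump 2 x s \<xi> \<partial>M) has_real_derivative (\<integral>\<xi>. u \<xi> * (4 * s * bump 1 x s \<xi>) \<partial>M)) (at s)"
  \<comment> \<open>For t between s/2 and 2 s the radial derivative 4 t bump 1 is at most 4 (2 s) (2
    s)^2.\<close>
  proof (rule has_field_derivative_integral_param(1)[where a="s/2" and b="2 * s" and G="\<lambda>\<xi>. 32 * s^3 * \<bar>u \<xi>\<bar>"])
    show "((\<lambda>t. u \<xi> * bump 2 x t \<xi>) has_real_derivative u \<xi> * (4 * t * bump 1 x t \<xi>)) (at t)" for \<xi> t
      using DERIV_cmult[OF bump_DERIV_radius[of 0 x \<xi> t], of "u \<xi>"] by (simp add: numeral_eq_Suc)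
    show "\<bar>u \<xi> * (4 * t * bump 1 x t \<xi>)\<bar> \<le> 32 * s^3 * \<bar>u \<xi>\<bar>" if "s/2 < t" "t < 2 * s" for \<xi> t
    proof -
      have "4 * t * bump 1 x t \<xi> \<le> 4 * (2 * s) * (2 * s)\<^sup>2"
        using that s bump_le[of 1 x t \<xi>] power_mono[of t "2 * s" 2] by (intro mult_mono) auto
      then have "4 * t * bump 1 x t \<xi> \<le> 32 * s^3" by (simp add: power2_eq_square power3_eq_cube)
      then have "\<bar>u \<xi>\<bar> * (4 * t * bump 1 x t \<xi>) \<le> \<bar>u \<xi>\<bar> * (32 * s^3)" by (intro mult_left_mono) auto
      then show ?thesis using that s by (simp add: abs_mult mult.commute mult.left_commute)
    qed
  qed (use s u in \<open>auto intro: integrable_bump\<close>)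
  have I: "integrable M (\<lambda>\<xi>. u \<xi> * bump k x s \<xi>)" for k using integrable_bump[OF u] .
  have It: "integrable M (\<lambda>\<xi>. u \<xi> * (D\<psi> \<xi> \<bullet> b))" if t: "test_fun U \<psi> D\<psi>" for \<psi> D\<psi> b
  proof -
    obtain C where C: "C \<ge> 0" "\<And>x. norm (D\<psi> x) \<le> C" using test_fun_bounded[OF t] by metis
    show ?thesis
    proof (rule Bochner_Integration.integrable_bound)
      show "integrable M (\<lambda>\<xi>. (C * norm b) * \<bar>u \<xi>\<bar>)" using u by auto
      show "(\<lambda>\<xi>. u \<xi> * (D\<psi> \<xi> \<bullet> b)) \<in> borel_measurable M" using u sqi_meas[OF test_fun_sqi(2)[OF t]] by measurable
      have "\<bar>D\<psi> \<xi> \<bullet> b\<bar> \<le> \<bar>C * norm b\<bar>" for \<xi>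
        using Cauchy_Schwarz_ineq2[of "D\<psi> \<xi>" b] mult_right_mono[OF C(2)[of \<xi>], of "norm b"] C(1) by (simp add: abs_mult)
      then show "AE \<xi> in M. norm (u \<xi> * (D\<psi> \<xi> \<bullet> b)) \<le> norm ((C * norm b) * \<bar>u \<xi>\<bar>)"
        by (auto simp: abs_mult mult.commute intro!: mult_left_mono)
    qed
  qed
  define P :: "'a \<Rightarrow> 'a \<Rightarrow> 'a" where
    "P b \<xi> = bump 2 x s \<xi> *\<^sub>R b - (4 * ((\<xi> - x) \<bullet> b) * bump 1 x s \<xi>) *\<^sub>R (\<xi> - x)" for b \<xi>
  have t: "test_fun U (\<lambda>\<xi>. ((\<xi> - x) \<bullet> b) * bump 2 x s \<xi>) (P b)" for b
    unfolding P_def by (rule test_fun_bump2_field[OF s])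
  have Vi: "integrable M (\<lambda>\<xi>. (V \<xi> \<bullet> b) * (((\<xi> - x) \<bullet> b) * bump 2 x s \<xi>))" if b: "b \<in> Basis" for b
    by (rule integrable_mult_test[OF _ t[of b]])
      (use sqi_integrable_L1(1)[OF V] in auto)
  have "real ?n * (\<integral>\<xi>. u \<xi> * bump 2 x s \<xi> \<partial>M) - 4 * s\<^sup>2 * (\<integral>\<xi>. u \<xi> * bump 1 x s \<xi> \<partial>M)
      = (\<integral>\<xi>. u \<xi> * (real ?n * bump 2 x s \<xi> - 4 * s\<^sup>2 * bump 1 x s \<xi>) \<partial>M)"
  proof -
    have "(\<integral>\<xi>. u \<xi> * (real ?n * bump 2 x s \<xi> - 4 * s\<^sup>2 * bump 1 x s \<xi>) \<partial>M)
        = (\<integral>\<xi>. real ?n * (u \<xi> * bump 2 x s \<xi>) - 4 * s\<^sup>2 * (u \<xi> * bump 1 x s \<xi>) \<partial>M)"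
      by (intro arg_cong[where f="integral\<^sup>L M"] ext) (simp add: algebra_simps)
    also have "\<dots> = (\<integral>\<xi>. real ?n * (u \<xi> * bump 2 x s \<xi>) \<partial>M) - (\<integral>\<xi>. 4 * s\<^sup>2 * (u \<xi> * bump 1 x s \<xi>) \<partial>M)"
      by (intro Bochner_Integration.integral_diff integrable_mult_right I)
    finally show ?thesis by (simp only: integral_mult_right_zero)
  qed
  also have "\<dots> = (\<integral>\<xi>. (\<Sum>b\<in>Basis. u \<xi> * (P b \<xi> \<bullet> b)) \<partial>M)"
    unfolding P_def bump2_field_divergence[symmetric] sum_distrib_left ..
  also have "\<dots> = (\<Sum>b\<in>Basis. \<integral>\<xi>. u \<xi> * (P b \<xi> \<bullet> b) \<partial>M)"
    by (intro Bochner_Integration.integral_sum It[OF t])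
  also have "\<dots> = (\<Sum>b\<in>Basis. - (\<integral>\<xi>. (V \<xi> \<bullet> b) * (((\<xi> - x) \<bullet> b) * bump 2 x s \<xi>) \<partial>M))"
    by (intro sum.cong refl wg t)
  also have "\<dots> = - (\<integral>\<xi>. (\<Sum>b\<in>Basis. (V \<xi> \<bullet> b) * (((\<xi> - x) \<bullet> b) * bump 2 x s \<xi>)) \<partial>M)"
    using Vi by (simp add: sum_negf Bochner_Integration.integral_sum)
  also have "\<dots> = (\<integral>\<xi>. V \<xi> \<bullet> (- (bump 2 x s \<xi> *\<^sub>R (\<xi> - x))) \<partial>M)"
    by (subst euclidean_inner) (simp add: sum_distrib_left mult.commute mult.left_commute sum_negf)
  finally have key: "real ?n * (\<integral>\<xi>. u \<xi> * bump 2 x s \<xi> \<partial>M) - 4 * s\<^sup>2 * (\<integral>\<xi>. u \<xi> * bump 1 x s \<xi> \<partial>M)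
    = (\<integral>\<xi>. V \<xi> \<bullet> (- (bump 2 x s \<xi> *\<^sub>R (\<xi> - x))) \<partial>M)" .
  define I2 I1 where "I2 = (\<integral>\<xi>. u \<xi> * bump 2 x s \<xi> \<partial>M)" and "I1 = (\<integral>\<xi>. u \<xi> * bump 1 x s \<xi> \<partial>M)"
  have D2: "((\<lambda>s. s ^ ?n) has_real_derivative real ?n * s ^ (?n - 1)) (at s)"
    by (auto intro!: derivative_eq_intros)
  have e1: "(\<integral>\<xi>. u \<xi> * (4 * s * bump 1 x s \<xi>) \<partial>M) = 4 * s * I1"
    unfolding I1_def integral_mult_right_zero[symmetric]
    by (intro arg_cong[where f="integral\<^sup>L M"] ext) (simp only: mult_ac)
  have sp: "s ^ ?n \<noteq> 0" using s by simp
  have "((\<lambda>s. Av u s x) has_real_derivative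
      (4 * s * I1 * s ^ ?n - I2 * (real ?n * s ^ (?n - 1))) / (s ^ ?n * s ^ ?n)) (at s)"
    unfolding Av_def using DERIV_divide[OF D1 D2 sp] unfolding e1 I2_def by simp
  moreover have "(4 * s * I1 * s ^ ?n - I2 * (real ?n * s ^ (?n - 1))) / (s ^ ?n * s ^ ?n)
      = - (real ?n * I2 - 4 * s\<^sup>2 * I1) / s ^ (DIM('a) + 5)"
  proof -
    have "s ^ ?n = s * s ^ (?n - 1)"
      by (subst power_Suc[symmetric]) (rule arg_cong[where f="power s"], simp)
    moreover have "s ^ (DIM('a) + 5) = s * s ^ ?n"
      by (subst power_Suc[symmetric]) (rule arg_cong[where f="power s"], simp)
    moreover have "s ^ (?n - 1) \<noteq> 0" using s by simp
    ultimately show ?thesis using s by (simp add: divide_simps) (simp add: power2_eq_square algebra_simps)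
  qed
  ultimately show ?thesis by (simp only: key[folded I1_def I2_def])
qed

text \<open>Inserting the potential bump 3 / 6, which is at most s^6 / 6, in the inequality for V
  bounds the derivative of the mean below by - K/6 times \<open>s powr (\<theta> - 1)\<close>.
  Adding the primitive of the missing amount restores monotonicity.\<close>

lemma Av_le_mono:
  assumes u: "integrable M u" and V: "sqi M V" and x: "cball x r \<subseteq> U"
    and wg: "\<And>\<psi> D\<psi> b. test_fun U \<psi> D\<psi> \<Longrightarrow> (\<integral>x. u x * (D\<psi> x \<bullet> b) \<partial>M) = - (\<integral>x. (V x \<bullet> b) * \<psi> x \<partial>M)"
    and sub: "\<And>\<psi> D\<psi>. test_fun U \<psi> D\<psi> \<Longrightarrow> (\<And>x. 0 \<le> \<psi> x) \<Longrightarrow> (\<integral>x. V x \<bullet> D\<psi> x \<partial>M) \<le> (\<integral>x. \<bar>g x\<bar> * \<psi> x \<partial>M)"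
    and g: "morrey \<theta> g K" and th: "\<theta> > 0" and e: "0 < \<epsilon>" "\<epsilon> \<le> r" "r \<le> 1"
  shows "Av u \<epsilon> x \<le> Av u r x + K / (6 * \<theta>) * r powr \<theta>"
proof -
  have gI: "integrable M g" using g by (simp add: morrey_def)
  have K0: "K \<ge> 0"
  proof -
    have "0 \<le> (\<integral>\<xi>. indicator (ball x 1) \<xi> * \<bar>g \<xi>\<bar> \<partial>M)" by (intro integral_nonneg_AE) auto
    also have "\<dots> \<le> K * 1 ^ DIM('a) * 1 powr (\<theta> - 2)" using g unfolding morrey_def by (metis less_numeral_extra(1) order_refl)
    finally show ?thesis by simp
  qed
  have "Av u \<epsilon> x + K / (6 * \<theta>) * \<epsilon> powr \<theta> \<le> Av u r x + K / (6 * \<theta>) * r powr \<theta>"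
  proof (rule DERIV_nonneg_imp_nondecreasing[OF e(2)])
    fix s assume s: "\<epsilon> \<le> s" "s \<le> r"
    then have s0: "s > 0" "s \<le> 1" using e by auto
    have c: "cball x s \<subseteq> U" using x s by (auto intro: order_trans)
    let ?I = "\<integral>\<xi>. V \<xi> \<bullet> (- (bump 2 x s \<xi> *\<^sub>R (\<xi> - x))) \<partial>M"
    have "?I \<le> (\<integral>\<xi>. \<bar>g \<xi>\<bar> * (bump 3 x s \<xi> / 6) \<partial>M)"
      by (rule sub[OF test_fun_bump3[OF s0(1) c]]) simp
    also have "\<dots> \<le> (\<integral>\<xi>. s^6/6 * (indicator (ball x s) \<xi> * \<bar>g \<xi>\<bar>) \<partial>M)"
    proof (rule integral_mono)
      show "integrable M (\<lambda>\<xi>. \<bar>g \<xi>\<bar> * (bump 3 x s \<xi> / 6))"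
        using integrable_bump[of "\<lambda>\<xi>. \<bar>g \<xi>\<bar> / 6" 3 x s] gI by (simp add: mult.commute)
      show "integrable M (\<lambda>\<xi>. s^6/6 * (indicator (ball x s) \<xi> * \<bar>g \<xi>\<bar>))"
        by (intro integrable_mult_right Bochner_Integration.integrable_bound[OF integrable_abs[OF gI]] AE_I2)
          (use gI in \<open>measurable, auto simp: indicator_def\<close>)
      show "\<bar>g \<xi>\<bar> * (bump 3 x s \<xi> / 6) \<le> s^6/6 * (indicator (ball x s) \<xi> * \<bar>g \<xi>\<bar>)" for \<xi>
        using mult_left_mono[OF bump_le_ind[OF s0(1), of 3 x \<xi>], of "\<bar>g \<xi>\<bar>/6"] by (simp add: mult_ac)
    qed
    also have "\<dots> = s^6/6 * (\<integral>\<xi>. indicator (ball x s) \<xi> * \<bar>g \<xi>\<bar> \<partial>M)" by simp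
    also have "\<dots> \<le> s^6/6 * (K * s ^ DIM('a) * s powr (\<theta> - 2))"
      by (rule mult_left_mono) (use g s0 in \<open>auto simp: morrey_def\<close>)
    finally have "?I / s ^ (DIM('a) + 5) \<le> s^6/6 * (K * s ^ DIM('a) * s powr (\<theta> - 2)) / s ^ (DIM('a) + 5)"
      using s0 by (intro divide_right_mono) auto
    also have "s^6/6 * (K * s ^ DIM('a) * s powr (\<theta> - 2)) / s ^ (DIM('a) + 5) = K / 6 * (s * s powr (\<theta> - 2))"
    proof -
      have "s ^ (DIM('a) + 5) = s ^ DIM('a) * s ^ 5" by (simp add: power_add)
      moreover have "s ^ 6 = s * s ^ 5" by (simp flip: power_Suc)
      ultimately show ?thesis using s0 by (simp add: field_simps)
    qed
    also have "s * s powr (\<theta> - 2) = s powr (\<theta> - 1)"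
      using s0 powr_mult_base[of s "\<theta> - 2"] by simp
    finally have le: "?I / s ^ (DIM('a) + 5) \<le> K / 6 * s powr (\<theta> - 1)" .
    have "((\<lambda>s. Av u s x + K / (6 * \<theta>) * s powr \<theta>) has_real_derivative
       - ?I / s ^ (DIM('a) + 5) + K / (6 * \<theta>) * (\<theta> * s powr (\<theta> - 1))) (at s)"
      by (intro DERIV_add DERIV_Av[OF u V s0(1) c wg] DERIV_cmult has_real_derivative_powr s0(1))
    moreover have "0 \<le> - ?I / s ^ (DIM('a) + 5) + K / (6 * \<theta>) * (\<theta> * s powr (\<theta> - 1))"
      using le th by (simp add: field_simps)
    ultimately show "\<exists>y. ((\<lambda>s. Av u s x + K / (6 * \<theta>) * s powr \<theta>) has_real_derivative y) (at s) \<and> 0 \<le> y" by blast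
  qed
  moreover have "0 \<le> K / (6 * \<theta>) * \<epsilon> powr \<theta>" using K0 th by simp
  ultimately show ?thesis by linarith
qed

lemma continuous_Av:
  assumes u: "integrable M u"
  shows "continuous_on UNIV (Av u s)"
proof -
  have "(\<lambda>k. \<integral>\<xi>. u \<xi> * bump 2 (X k) s \<xi> \<partial>M) \<longlonglongrightarrow> (\<integral>\<xi>. u \<xi> * bump 2 x s \<xi> \<partial>M)"
    if X: "X \<longlonglongrightarrow> x" for X x
  proof (rule integral_dominated_convergence)
    show "integrable M (\<lambda>\<xi>. s^4 * \<bar>u \<xi>\<bar>)" using u by auto
    show "AE \<xi> in M. (\<lambda>k. u \<xi> * bump 2 (X k) s \<xi>) \<longlonglongrightarrow> u \<xi> * bump 2 x s \<xi>"
      unfolding bump_def by (intro AE_I2 tendsto_intros X)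
    show "AE \<xi> in M. norm (u \<xi> * bump 2 (X k) s \<xi>) \<le> s^4 * \<bar>u \<xi>\<bar>" for k
      using bump_le[of 2 "X k" s] by (auto simp: abs_mult mult.commute intro!: mult_left_mono)
    show "(\<lambda>\<xi>. u \<xi> * bump 2 x s \<xi>) \<in> borel_measurable M"
      "(\<lambda>\<xi>. u \<xi> * bump 2 (X k) s \<xi>) \<in> borel_measurable M" for k
      using integrable_bump[OF u] by auto
  qed
  then have "(\<lambda>k. Av u s (X k)) \<longlonglongrightarrow> Av u s x" if "X \<longlonglongrightarrow> x" for X x
    unfolding Av_def divide_inverse using that by (intro tendsto_mult_right) blast
  then show ?thesis by (auto simp: continuous_on_sequentially comp_def)
qed

lemma Av_diff:
  assumes "integrable M u" "integrable M v"
  shows "Av (\<lambda>x. u x - v x) s x = Av u s x - Av v s x"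
  unfolding Av_def using integrable_bump[OF assms(1), of 2 x s] integrable_bump[OF assms(2), of 2 x s]
  by (simp add: left_diff_distrib diff_divide_distrib)

lemma Av_mono:
  assumes "integrable M u" "integrable M v" "AE x in M. u x \<le> v x" "s > 0"
  shows "Av u s x \<le> Av v s x"
proof -
  have "(\<integral>\<xi>. u \<xi> * bump 2 x s \<xi> \<partial>M) \<le> (\<integral>\<xi>. v \<xi> * bump 2 x s \<xi> \<partial>M)"
    by (rule integral_mono_AE[OF integrable_bump[OF assms(1)] integrable_bump[OF assms(2)]])
      (use assms(3) in \<open>eventually_elim, auto intro: mult_right_mono\<close>)
  then show ?thesis unfolding Av_def using assms(4) by (intro divide_right_mono) auto
qed

lemma Av_abs:
  assumes "integrable M u" "s > 0"
  shows "\<bar>Av u s x\<bar> \<le> Av (\<lambda>x. \<bar>u x\<bar>) s x"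
proof -
  have "\<bar>\<integral>\<xi>. u \<xi> * bump 2 x s \<xi> \<partial>M\<bar> \<le> (\<integral>\<xi>. \<bar>u \<xi> * bump 2 x s \<xi>\<bar> \<partial>M)"
    using integral_norm_bound[of M "\<lambda>\<xi>. u \<xi> * bump 2 x s \<xi>"] by simp
  then show ?thesis unfolding Av_def using assms(2) by (simp add: abs_mult divide_right_mono)
qed

lemma integral_bump_M_le:
  assumes "s > 0"
  shows "(\<integral>\<xi>. bump 2 x s \<xi> \<partial>M) \<le> s ^ (DIM('a) + 4) * bump_mass TYPE('a)"
proof -
  have "(\<integral>\<xi>. bump 2 x s \<xi> \<partial>M) = (\<integral>\<xi>. indicator \<Omega> \<xi> * bump 2 x s \<xi> \<partial>lborel)"
    using integral_lebesgue_eq_lborel[OF borel_measurable_times[OF borel_measurable_indicator[OF sets_\<Omega>(2)]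
      borel_measurable_continuous_onI[OF continuous_bump[of 2 x s]]]]
    by (simp add: integral_restrict_space)
  also have "\<dots> \<le> (\<integral>\<xi>. bump 2 x s \<xi> \<partial>lborel)"
  proof (rule integral_mono)
    show "integrable lborel (bump 2 x s)" using assms by (intro bump_integrable) auto
    then show "integrable lborel (\<lambda>\<xi>. indicator \<Omega> \<xi> * bump 2 x s \<xi>)"
      using integrable_mult_indicator[of \<Omega> lborel "bump 2 x s"] by simp
  qed (auto simp: indicator_def)
  finally show ?thesis using bump_integral[OF assms, of x] by simp
qed

lemma Av_const_le:
  assumes "AE x in M. \<bar>u x\<bar> \<le> C" "C \<ge> 0" "integrable M u" "s > 0"
  shows "Av (\<lambda>x. \<bar>u x\<bar>) s x \<le> C * bump_mass TYPE('a)"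
proof -
  have "Av (\<lambda>x. \<bar>u x\<bar>) s x \<le> Av (\<lambda>x. C) s x"
    using assms by (intro Av_mono) auto
  also have "Av (\<lambda>x. C) s x = C * (\<integral>\<xi>. bump 2 x s \<xi> \<partial>M) / s ^ (DIM('a) + 4)" by (simp add: Av_def)
  also have "\<dots> \<le> C * (s ^ (DIM('a) + 4) * bump_mass TYPE('a)) / s ^ (DIM('a) + 4)"
    using assms by (intro divide_right_mono mult_left_mono integral_bump_M_le) auto
  finally show ?thesis using assms by simp
qed

text \<open>The kernel is symmetric in its two points, so Fubini bounds averaging on L^1 by the mass
  of the kernel.\<close>

lemma Av_L1:
  assumes w: "integrable M w" and s: "s > 0"
  shows "integrable M (Av w s)" "(\<integral>x. \<bar>Av w s x\<bar> \<partial>M) \<le> bump_mass TYPE('a) * (\<integral>x. \<bar>w x\<bar> \<partial>M)"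
proof -
  let ?c = "bump_mass TYPE('a)" and ?p = "s ^ (DIM('a) + 4)"
  interpret P: pair_sigma_finite M M ..
  have p: "?p > 0" using s by simp
  have c: "?c > 0" by (rule bump_mass_pos)
  have m [measurable]: "w \<in> borel_measurable M" "(\<lambda>x. x) \<in> borel_measurable M"
    using w id_borel_measurable_lebesgue_on[of \<Omega>] by (auto simp: id_def)
  have m1 [measurable]: "Av w s \<in> borel_measurable M" by (rule continuous_meas_M[OF continuous_Av[OF w]])
  have nn: "ennreal (Av (\<lambda>x. \<bar>w x\<bar>) s x) = (\<integral>\<^sup>+\<xi>. ennreal (\<bar>w \<xi>\<bar> * bump 2 x s \<xi> / ?p) \<partial>M)" for x
    unfolding Av_def
    using p integrable_bump[OF integrable_abs[OF w], of 2 x s] by (subst nn_integral_eq_integral) auto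
  have nn2: "(\<integral>\<^sup>+x. ennreal (\<bar>w \<xi>\<bar> * bump 2 x s \<xi> / ?p) \<partial>M) \<le> ennreal (?c * \<bar>w \<xi>\<bar>)" for \<xi>
  proof -
    have sym: "bump 2 x s \<xi> = bump 2 \<xi> s x" for x by (simp add: bump_def norm_minus_commute)
    have "(\<integral>\<^sup>+x. ennreal (\<bar>w \<xi>\<bar> * bump 2 x s \<xi> / ?p) \<partial>M) = ennreal (\<integral>x. \<bar>w \<xi>\<bar> * bump 2 x s \<xi> / ?p \<partial>M)"
      using p integrable_bump[of "\<lambda>_. \<bar>w \<xi>\<bar>" 2 \<xi> s] unfolding sym by (subst nn_integral_eq_integral) auto
    also have "(\<integral>x. \<bar>w \<xi>\<bar> * bump 2 x s \<xi> / ?p \<partial>M) = \<bar>w \<xi>\<bar> * (\<integral>x. bump 2 \<xi> s x \<partial>M) / ?p"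
      unfolding sym by simp
    also have "\<dots> \<le> \<bar>w \<xi>\<bar> * (?p * ?c) / ?p"
      using p by (intro divide_right_mono mult_left_mono integral_bump_M_le s) auto
    also have "\<dots> = ?c * \<bar>w \<xi>\<bar>" using s by simp
    finally show ?thesis by (simp add: ennreal_leI)
  qed
  have "(\<integral>\<^sup>+x. ennreal (norm (Av w s x)) \<partial>M) \<le> (\<integral>\<^sup>+x. ennreal (Av (\<lambda>x. \<bar>w x\<bar>) s x) \<partial>M)"
    using Av_abs[OF w s] by (intro nn_integral_mono ennreal_leI) auto
  also have "\<dots> = (\<integral>\<^sup>+x. \<integral>\<^sup>+\<xi>. ennreal (\<bar>w \<xi>\<bar> * bump 2 x s \<xi> / ?p) \<partial>M \<partial>M)" unfolding nn ..
  also have "\<dots> = (\<integral>\<^sup>+\<xi>. \<integral>\<^sup>+x. ennreal (\<bar>w \<xi>\<bar> * bump 2 x s \<xi> / ?p) \<partial>M \<partial>M)"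
    unfolding bump_def by (rule P.Fubini'[symmetric]) measurable
  also have "\<dots> \<le> (\<integral>\<^sup>+\<xi>. ennreal (?c * \<bar>w \<xi>\<bar>) \<partial>M)" by (intro nn_integral_mono nn2)
  also have "\<dots> = ennreal (?c * (\<integral>x. \<bar>w x\<bar> \<partial>M))"
    using w c by (subst nn_integral_eq_integral) auto
  finally have f: "(\<integral>\<^sup>+x. ennreal (norm (Av w s x)) \<partial>M) \<le> ennreal (?c * (\<integral>x. \<bar>w x\<bar> \<partial>M))" .
  show I: "integrable M (Av w s)"
    by (rule integrableI_bounded[OF m1]) (use f in \<open>auto intro: le_less_trans\<close>)
  have "ennreal (\<integral>x. \<bar>Av w s x\<bar> \<partial>M) \<le> ennreal (?c * (\<integral>x. \<bar>w x\<bar> \<partial>M))"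
    using f I by (subst nn_integral_eq_integral[symmetric]) auto
  moreover have "0 \<le> ?c * (\<integral>x. \<bar>w x\<bar> \<partial>M)" using c by (intro mult_nonneg_nonneg integral_nonneg_AE) auto
  ultimately show "(\<integral>x. \<bar>Av w s x\<bar> \<partial>M) \<le> ?c * (\<integral>x. \<bar>w x\<bar> \<partial>M)" by (subst (asm) ennreal_le_iff) auto
qed

text \<open>A test function is Lipschitz, so it oscillates little on small balls, uniformly in the
  centre. It vanishes off \<Omega>, which lets the integral run over the whole space, where the mass
  of the kernel is exact.\<close>

lemma Av_test_uniform:
  assumes t: "test_fun \<Omega> \<phi> D\<phi>" and e: "e > 0"
  obtains d where "d > 0" "\<And>s x. 0 < s \<Longrightarrow> s < d \<Longrightarrow> \<bar>Av \<phi> s x - bump_mass TYPE('a) * \<phi> x\<bar> \<le> bump_mass TYPE('a) * e"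
proof -
  let ?c = "bump_mass TYPE('a)"
  have c: "?c > 0" by (rule bump_mass_pos)
  obtain C where C: "C \<ge> 0" "\<And>x. norm (D\<phi> x) \<le> C" using test_fun_bounded[OF t] by metis
  have lip: "\<bar>\<phi> \<xi> - \<phi> x\<bar> \<le> C * norm (\<xi> - x)" for \<xi> x
  proof -
    have "norm (\<phi> \<xi> - \<phi> x) \<le> C * norm (\<xi> - x)"
    proof (rule differentiable_bound[where S=UNIV])
      show "(\<phi> has_derivative (\<lambda>h. D\<phi> y \<bullet> h)) (at y within UNIV)" for y using test_funD(1)[OF t] by simp
      show "onorm (\<lambda>h. D\<phi> y \<bullet> h) \<le> C" for y
      proof (rule onorm_bound[OF C(1)])
        show "norm (D\<phi> y \<bullet> h) \<le> C * norm h" for h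
          using Cauchy_Schwarz_ineq2[of "D\<phi> y" h] mult_right_mono[OF C(2)[of y] norm_ge_zero[of h]] by simp
      qed
    qed auto
    then show ?thesis by simp
  qed
  show ?thesis
  proof (rule that[of "e / (C + 1)"])
    show "e / (C + 1) > 0" using e C by simp
    fix s :: real and x :: 'a assume s: "0 < s" "s < e / (C + 1)"
    have sC: "C * s \<le> e"
    proof -
      have "C * s \<le> (C + 1) * s" using s by (intro mult_right_mono) auto
      also have "\<dots> \<le> e" using s C by (simp add: field_simps)
      finally show ?thesis .
    qed
    let ?p = "s ^ (DIM('a) + 4)"
    have p: "?p > 0" using s by simp
    have pb: "\<phi> \<in> borel_measurable borel" "bump 2 x s \<in> borel_measurable borel"
      using test_funD(2)[OF t] by (auto intro: borel_measurable_continuous_onI continuous_bump)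
    have bI: "integrable lborel (bump 2 x s)" using s by (intro bump_integrable) auto
    have pI: "integrable lborel (\<lambda>\<xi>. \<phi> \<xi> * bump 2 x s \<xi>)"
      by (rule continuous_compact_support_integrable(2)[where K="cball x s"])
        (use s bump_zero[of s 2 _ x] in \<open>auto intro!: continuous_intros test_funD(2)[OF t] continuous_bump\<close>)
    have "(\<integral>\<xi>. \<phi> \<xi> * bump 2 x s \<xi> \<partial>M) = (\<integral>\<xi>. \<phi> \<xi> * bump 2 x s \<xi> \<partial>lborel)"
      using integral_M_zero_ext[of "\<lambda>\<xi>. \<phi> \<xi> * bump 2 x s \<xi>"] test_fun_zero(1)[OF t] pb
      by (subst integral_lebesgue_eq_lborel[symmetric]) auto
    then have "Av \<phi> s x - ?c * \<phi> x = (\<integral>\<xi>. \<phi> \<xi> * bump 2 x s \<xi> \<partial>lborel) / ?p - \<phi> x * (\<integral>\<xi>. bump 2 x s \<xi> \<partial>lborel) / ?p"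
      unfolding Av_def bump_integral[OF s(1)] using s(1) by simp
    also have "\<dots> = (\<integral>\<xi>. (\<phi> \<xi> - \<phi> x) * bump 2 x s \<xi> \<partial>lborel) / ?p"
      using bI pI by (simp add: left_diff_distrib diff_divide_distrib)
    finally have eq: "Av \<phi> s x - ?c * \<phi> x = (\<integral>\<xi>. (\<phi> \<xi> - \<phi> x) * bump 2 x s \<xi> \<partial>lborel) / ?p" .
    have "\<bar>\<integral>\<xi>. (\<phi> \<xi> - \<phi> x) * bump 2 x s \<xi> \<partial>lborel\<bar> \<le> (\<integral>\<xi>. e * bump 2 x s \<xi> \<partial>lborel)"
    proof (rule integral_abs_bound_integral)
      show "integrable lborel (\<lambda>\<xi>. (\<phi> \<xi> - \<phi> x) * bump 2 x s \<xi>)" using bI pI by (simp add: left_diff_distrib)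
      show "integrable lborel (\<lambda>\<xi>. e * bump 2 x s \<xi>)" using bI by simp
      fix \<xi>
      show "\<bar>(\<phi> \<xi> - \<phi> x) * bump 2 x s \<xi>\<bar> \<le> e * bump 2 x s \<xi>"
      proof (cases "\<xi> \<in> ball x s")
        case True
        then have "norm (\<xi> - x) \<le> s" by (simp add: dist_norm norm_minus_commute)
        then have "\<bar>\<phi> \<xi> - \<phi> x\<bar> \<le> e"
          using lip[of \<xi> x] mult_left_mono[of "norm (\<xi> - x)" s C] C(1) sC by linarith
        then show ?thesis by (auto simp: abs_mult intro: mult_right_mono)
      next
        case False
        then show ?thesis using bump_zero[OF s(1), of 2 \<xi> x] by simp
      qed
    qed
    also have "\<dots> = e * (?p * ?c)" using bump_integral[OF s(1), of x] by simp
    finally show "\<bar>Av \<phi> s x - ?c * \<phi> x\<bar> \<le> ?c * e"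
      unfolding eq using p by (simp add: abs_divide field_simps)
  qed
qed

text \<open>The means converge in L^1 along suitable radii, by density of test functions and the
  uniform L^1 bound for averaging; a subsequence then converges almost everywhere, which suffices
  for what follows.\<close>

lemma Av_AE_tendsto:
  assumes "W u G"
  obtains s :: "nat \<Rightarrow> real" where "\<And>k. 0 < s k" "s \<longlonglongrightarrow> 0"
    "AE x in M. (\<lambda>k. Av u (s k) x) \<longlonglongrightarrow> bump_mass TYPE('a) * u x"
proof -
  let ?c = "bump_mass TYPE('a)"
  have c: "?c > 0" by (rule bump_mass_pos)
  have uI: "integrable M u" using sqi_integrable_L1(1)[OF W_sqi(1)[OF assms]] .
  define m where "m = sqrt (measure M (space M))"
  have m0: "m \<ge> 0" by (simp add: m_def)
  \<comment> \<open>Here \<open>m\<^sup>2\<close> is the measure of \<Omega>. The L^1 error of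
    replacing u by \<phi> enters twice, once through the means, and the uniform error for the means
    of \<phi> is integrated over \<Omega>.\<close>
  have "\<exists>s>0. s < inverse (real (Suc k)) \<and> (\<integral>x. \<bar>Av u s x - ?c * u x\<bar> \<partial>M) \<le> ?c * (2 * m + m\<^sup>2) * inverse (real (Suc k))" for k
  proof -
    let ?e = "inverse (real (Suc k))"
    have e: "?e > 0" by simp
    obtain \<phi> D\<phi> where t: "test_fun \<Omega> \<phi> D\<phi>" and n: "nrm2 M (\<lambda>x. \<phi> x - u x) < ?e"
      using W_approx[OF assms e] by metis
    obtain d where d: "d > 0" "\<And>s x. 0 < s \<Longrightarrow> s < d \<Longrightarrow> \<bar>Av \<phi> s x - ?c * \<phi> x\<bar> \<le> ?c * ?e"
      using Av_test_uniform[OF t e] by metis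
    define s where "s = min d ?e / 2"
    have s: "s > 0" "s < d" "s < ?e" using d(1) e unfolding s_def by linarith+
    have pI: "integrable M \<phi>" using sqi_integrable_L1(1)[OF test_fun_sqi(1)[OF t]] .
    have l1: "(\<integral>x. \<bar>u x - \<phi> x\<bar> \<partial>M) \<le> m * ?e"
      using sqi_integrable_L1(2)[OF sqi_diff[OF W_sqi(1)[OF assms] test_fun_sqi(1)[OF t]]] n m0
        mult_left_mono[of "nrm2 M (\<lambda>x. \<phi> x - u x)" ?e m] nrm2_minus_commute[of M u \<phi>]
      unfolding m_def by auto
    have dI: "integrable M (\<lambda>x. u x - \<phi> x)" using uI pI by auto
    have "(\<integral>x. \<bar>Av u s x - ?c * u x\<bar> \<partial>M) \<le> (\<integral>x. \<bar>Av (\<lambda>x. u x - \<phi> x) s x\<bar> + ?c * ?e + ?c * \<bar>u x - \<phi> x\<bar> \<partial>M)"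
    proof (rule integral_mono)
      show "integrable M (\<lambda>x. \<bar>Av u s x - ?c * u x\<bar>)" using Av_L1(1)[OF uI s(1)] uI by auto
      show "integrable M (\<lambda>x. \<bar>Av (\<lambda>x. u x - \<phi> x) s x\<bar> + ?c * ?e + ?c * \<bar>u x - \<phi> x\<bar>)"
        using Av_L1(1)[OF dI s(1)] dI by auto
      fix x
      have "\<bar>?c * \<phi> x - ?c * u x\<bar> = ?c * \<bar>u x - \<phi> x\<bar>"
        using c by (simp add: abs_mult abs_minus_commute flip: right_diff_distrib)
      then show "\<bar>Av u s x - ?c * u x\<bar> \<le> \<bar>Av (\<lambda>x. u x - \<phi> x) s x\<bar> + ?c * ?e + ?c * \<bar>u x - \<phi> x\<bar>"
        using d(2)[OF s(1,2), of x] unfolding Av_diff[OF uI pI] by linarith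
    qed
    also have "\<dots> = (\<integral>x. \<bar>Av (\<lambda>x. u x - \<phi> x) s x\<bar> \<partial>M) + ?c * ?e * m\<^sup>2 + ?c * (\<integral>x. \<bar>u x - \<phi> x\<bar> \<partial>M)"
      using Av_L1(1)[OF dI s(1)] dI by (simp add: m_def)
    also have "\<dots> \<le> ?c * (m * ?e) + ?c * ?e * m\<^sup>2 + ?c * (m * ?e)"
      using Av_L1(2)[OF dI s(1)] mult_left_mono[OF l1, of ?c] c by linarith
    also have "\<dots> = ?c * (2 * m + m\<^sup>2) * ?e" by (simp add: algebra_simps)
    finally show ?thesis using s by blast
  qed
  then obtain s where s: "\<And>k. s k > 0" "\<And>k. s k < inverse (real (Suc k))"
    "\<And>k. (\<integral>x. \<bar>Av u (s k) x - ?c * u x\<bar> \<partial>M) \<le> ?c * (2 * m + m\<^sup>2) * inverse (real (Suc k))" by metis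
  have s0: "s \<longlonglongrightarrow> 0"
    by (rule tendsto_sandwich[OF _ _ tendsto_const LIMSEQ_inverse_real_of_nat];
        intro always_eventually allI less_imp_le s)
  have "(\<lambda>k. ?c * (2 * m + m\<^sup>2) * inverse (real (Suc k))) \<longlonglongrightarrow> ?c * (2 * m + m\<^sup>2) * 0"
    by (intro tendsto_intros LIMSEQ_inverse_real_of_nat)
  then have L0: "(\<lambda>k. ?c * (2 * m + m\<^sup>2) * inverse (real (Suc k))) \<longlonglongrightarrow> 0" by (simp only: mult_zero_right)
  have "(\<lambda>k. \<integral>x. norm (Av u (s k) x - ?c * u x) \<partial>M) \<longlonglongrightarrow> 0"
  proof (rule tendsto_sandwich[OF _ _ tendsto_const L0])
    show "\<forall>\<^sub>F k in sequentially. 0 \<le> (\<integral>x. norm (Av u (s k) x - ?c * u x) \<partial>M)"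
      by (intro always_eventually allI integral_nonneg_AE) simp
    show "\<forall>\<^sub>F k in sequentially. (\<integral>x. norm (Av u (s k) x - ?c * u x) \<partial>M) \<le> ?c * (2 * m + m\<^sup>2) * inverse (real (Suc k))"
      unfolding real_norm_def by (intro always_eventually allI s(3))
  qed
  then obtain r :: "nat \<Rightarrow> nat" where r: "strict_mono r" "AE x in M. (\<lambda>n. Av u (s (r n)) x - ?c * u x) \<longlonglongrightarrow> 0"
    using tendsto_L1_AE_subseq[of M "\<lambda>k x. Av u (s k) x - ?c * u x"] Av_L1(1)[OF uI s(1)] uI by auto
  show ?thesis
  proof (rule that[of "s \<circ> r"])
    show "(s \<circ> r) \<longlonglongrightarrow> 0" by (rule LIMSEQ_subseq_LIMSEQ[OF s0 r(1)])
    show "AE x in M. (\<lambda>k. Av u ((s \<circ> r) k) x) \<longlonglongrightarrow> ?c * u x"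
      using r(2) by eventually_elim (simp add: LIM_zero_iff)
  qed (use s in auto)
qed

end

section \<open>Kato's inequality and boundedness\<close>

context bounded_open
begin

lemma tendsto_comp_continuous:
  fixes b :: "real \<Rightarrow> real"
  assumes "continuous_on UNIV b" "X \<longlonglongrightarrow> l"
  shows "(\<lambda>k. b (X k)) \<longlonglongrightarrow> b l"
  using assms(1) isCont_tendsto_compose[OF _ assms(2), of b] by (simp add: continuous_on_eq_continuous_at)

text \<open>Regularised absolute value: \<open>rabs\<close> is shifted so as to vanish at 0, hence
  maps test functions to test functions; \<open>rsgn\<close> and \<open>rsgn'\<close> are its first
  two derivatives.\<close>

definition srt :: "real \<Rightarrow> real \<Rightarrow> real" where "srt \<epsilon> t = sqrt (t\<^sup>2 + \<epsilon>\<^sup>2)"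
definition rabs :: "real \<Rightarrow> real \<Rightarrow> real" where "rabs \<epsilon> t = srt \<epsilon> t - \<epsilon>"
definition rsgn :: "real \<Rightarrow> real \<Rightarrow> real" where "rsgn \<epsilon> t = t / srt \<epsilon> t"
definition rsgn' :: "real \<Rightarrow> real \<Rightarrow> real" where "rsgn' \<epsilon> t = \<epsilon>\<^sup>2 / (srt \<epsilon> t) ^ 3"

context
  fixes \<epsilon> :: real assumes \<epsilon>: "\<epsilon> > 0"
begin

lemma srt_pos: "srt \<epsilon> t > 0"
  unfolding srt_def using \<epsilon> by (intro real_sqrt_gt_zero add_nonneg_pos) auto

lemma srt_ge: "\<epsilon> \<le> srt \<epsilon> t" "\<bar>t\<bar> \<le> srt \<epsilon> t"
  unfolding srt_def using \<epsilon> by (auto intro!: real_le_rsqrt)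

lemma srt_le: "srt \<epsilon> t \<le> \<bar>t\<bar> + \<epsilon>"
  unfolding srt_def using \<epsilon> by (intro real_le_lsqrt) (auto simp: power2_sum)

lemma srt_sq: "(srt \<epsilon> t)\<^sup>2 = t\<^sup>2 + \<epsilon>\<^sup>2"
  unfolding srt_def by simp

lemma DERIV_srt: "(srt \<epsilon> has_real_derivative rsgn \<epsilon> t) (at t)"
proof -
  have p: "t\<^sup>2 + \<epsilon>\<^sup>2 > 0" using \<epsilon> by (intro add_nonneg_pos) auto
  have "((\<lambda>t. sqrt (t\<^sup>2 + \<epsilon>\<^sup>2)) has_real_derivative inverse (sqrt (t\<^sup>2 + \<epsilon>\<^sup>2)) / 2 * (2 * t)) (at t)"
    by (rule DERIV_chain2[where f=sqrt and g="\<lambda>t. t\<^sup>2 + \<epsilon>\<^sup>2", OF DERIV_real_sqrt[OF p]]) (auto intro!: derivative_eq_intros)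
  then show ?thesis unfolding rsgn_def srt_def[abs_def] by (simp add: field_simps)
qed

lemma DERIV_rabs: "(rabs \<epsilon> has_real_derivative rsgn \<epsilon> t) (at t)"
  unfolding rabs_def[abs_def] using DERIV_diff[OF DERIV_srt[of t] DERIV_const[of \<epsilon>]] by simp

lemma DERIV_rsgn: "(rsgn \<epsilon> has_real_derivative rsgn' \<epsilon> t) (at t)"
proof -
  have "((\<lambda>t. t / srt \<epsilon> t) has_real_derivative (1 * srt \<epsilon> t - t * rsgn \<epsilon> t) / (srt \<epsilon> t * srt \<epsilon> t)) (at t)"
    using srt_pos[of t] by (intro DERIV_divide DERIV_ident DERIV_srt) auto
  moreover have "(1 * srt \<epsilon> t - t * rsgn \<epsilon> t) / (srt \<epsilon> t * srt \<epsilon> t) = rsgn' \<epsilon> t"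
  proof -
    have "srt \<epsilon> t * srt \<epsilon> t = t * t + \<epsilon> * \<epsilon>" using srt_sq[of t] by (simp add: power2_eq_square)
    then have "(1 * srt \<epsilon> t - t * rsgn \<epsilon> t) = \<epsilon>\<^sup>2 / srt \<epsilon> t"
      using srt_pos[of t] by (simp add: rsgn_def field_simps power2_eq_square)
    then show ?thesis using srt_pos[of t] by (simp add: rsgn'_def power3_eq_cube)
  qed
  ultimately show ?thesis unfolding rsgn_def[abs_def] by simp
qed

lemma rabs_0: "rabs \<epsilon> 0 = 0" and rsgn_0: "rsgn \<epsilon> 0 = 0"
  using \<epsilon> by (auto simp: rabs_def rsgn_def srt_def)

lemma rsgn_abs_le: "\<bar>rsgn \<epsilon> t\<bar> \<le> 1"
  unfolding rsgn_def using srt_ge(2)[of t] srt_pos[of t] by (simp add: abs_divide divide_le_eq)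

lemma rsgn'_bounds: "0 \<le> rsgn' \<epsilon> t" "rsgn' \<epsilon> t \<le> 1 / \<epsilon>"
proof -
  show "0 \<le> rsgn' \<epsilon> t" using srt_pos[of t] by (simp add: rsgn'_def)
  have "\<epsilon> ^ 3 \<le> (srt \<epsilon> t) ^ 3" using srt_ge(1)[of t] \<epsilon> by (intro power_mono) auto
  then show "rsgn' \<epsilon> t \<le> 1 / \<epsilon>"
    using srt_pos[of t] \<epsilon> by (simp add: rsgn'_def field_simps power2_eq_square power3_eq_cube)
qed

lemma rsgn_mult_nonneg: "0 \<le> k * t \<Longrightarrow> 0 \<le> k * rsgn \<epsilon> t"
  unfolding rsgn_def using srt_pos[of t] by (simp add: less_imp_le)

lemma continuous_srt: "continuous_on UNIV (srt \<epsilon>)"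
  unfolding srt_def[abs_def] by (intro continuous_intros)

lemma continuous_rsgn: "continuous_on UNIV (rsgn \<epsilon>)"
  unfolding rsgn_def[abs_def] using srt_pos by (intro continuous_intros continuous_srt) (auto simp: less_imp_neq[symmetric])

lemma continuous_rsgn': "continuous_on UNIV (rsgn' \<epsilon>)"
  unfolding rsgn'_def[abs_def] using srt_pos by (intro continuous_intros continuous_srt) (auto simp: less_imp_neq[symmetric])

lemma continuous_rabs: "continuous_on UNIV (rabs \<epsilon>)"
  unfolding rabs_def[abs_def] by (intro continuous_intros continuous_srt)

lemma rabs_lip: "\<bar>rabs \<epsilon> s - rabs \<epsilon> t\<bar> \<le> \<bar>s - t\<bar>"
proof -
  have "norm (rabs \<epsilon> s - rabs \<epsilon> t) \<le> 1 * norm (s - t)"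
    by (rule field_differentiable_bound[where S=UNIV and f'="rsgn \<epsilon>"])
      (use DERIV_rabs rsgn_abs_le in auto)
  then show ?thesis by simp
qed

lemma rabs_bounds: "\<bar>t\<bar> - \<epsilon> \<le> rabs \<epsilon> t" "rabs \<epsilon> t \<le> \<bar>t\<bar>" "0 \<le> rabs \<epsilon> t"
  using srt_ge[of t] srt_le[of t] by (auto simp: rabs_def)

text \<open>Nonlinear compositions need pointwise convergence, which a subsequence of the L^2
  approximation provides.\<close>

lemma W_approx_AE:
  assumes "W u G"
  shows "\<exists>\<phi> D\<phi>. (\<forall>k::nat. test_fun \<Omega> (\<phi> k) (D\<phi> k)) \<and>
    (\<lambda>k. nrm2 M (\<lambda>x. \<phi> k x - u x)) \<longlonglongrightarrow> 0 \<and> (\<lambda>k. nrm2 M (\<lambda>x. D\<phi> k x - G x)) \<longlonglongrightarrow> 0 \<and>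
    (AE x in M. (\<lambda>k. \<phi> k x) \<longlonglongrightarrow> u x)"
proof -
  obtain \<phi> D\<phi> where *: "\<And>k::nat. test_fun \<Omega> (\<phi> k) (D\<phi> k)"
    "(\<lambda>k. nrm2 M (\<lambda>x. \<phi> k x - u x)) \<longlonglongrightarrow> 0" "(\<lambda>k. nrm2 M (\<lambda>x. D\<phi> k x - G x)) \<longlonglongrightarrow> 0"
    using assms unfolding W_def by blast
  note s = sqi_integrable_L1[OF sqi_diff[OF test_fun_sqi(1)[OF *(1)] W_sqi(1)[OF assms]]]
  have L0: "(\<lambda>k. sqrt (measure M (space M)) * nrm2 M (\<lambda>x. \<phi> k x - u x)) \<longlonglongrightarrow> 0"
    using tendsto_mult_left[OF *(2), of "sqrt (measure M (space M))"] by simp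
  have "(\<lambda>k. \<integral>x. norm (\<phi> k x - u x) \<partial>M) \<longlonglongrightarrow> 0"
  proof (rule tendsto_sandwich[OF _ _ tendsto_const L0])
    show "\<forall>\<^sub>F k in sequentially. 0 \<le> (\<integral>x. norm (\<phi> k x - u x) \<partial>M)"
      by (intro always_eventually allI integral_nonneg_AE) simp
    show "\<forall>\<^sub>F k in sequentially. (\<integral>x. norm (\<phi> k x - u x) \<partial>M) \<le> sqrt (measure M (space M)) * nrm2 M (\<lambda>x. \<phi> k x - u x)"
      by (intro always_eventually allI s(2))
  qed
  then obtain r :: "nat \<Rightarrow> nat" where r: "strict_mono r" "AE x in M. (\<lambda>n. \<phi> (r n) x - u x) \<longlonglongrightarrow> 0"
    using tendsto_L1_AE_subseq[of M "\<lambda>k x. \<phi> k x - u x"] s(1) by blast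
  have "AE x in M. (\<lambda>k. \<phi> (r k) x) \<longlonglongrightarrow> u x" using r(2) by eventually_elim (simp add: LIM_zero_iff)
  then show ?thesis
    using *(1) LIMSEQ_subseq_LIMSEQ[OF *(2) r(1)] LIMSEQ_subseq_LIMSEQ[OF *(3) r(1)]
    by (intro exI[of _ "\<lambda>k. \<phi> (r k)"] exI[of _ "\<lambda>k. D\<phi> (r k)"]) (simp add: comp_def)
qed

lemma nrm2_mult_tendsto_0:
  assumes c: "\<And>k. c k \<in> borel_measurable M" "\<And>k x. \<bar>c k x\<bar> \<le> C" "AE x in M. (\<lambda>k. c k x) \<longlonglongrightarrow> 0"
    and G: "sqi M G"
  shows "(\<lambda>k. nrm2 M (\<lambda>x. c k x *\<^sub>R G x)) \<longlonglongrightarrow> 0"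
proof -
  have C0: "C \<ge> 0" using c(2)[of 0 undefined] abs_ge_zero order_trans by blast
  have "(\<lambda>k. \<integral>x. (norm (c k x *\<^sub>R G x))\<^sup>2 \<partial>M) \<longlonglongrightarrow> (\<integral>x. 0 \<partial>M)"
  proof (rule integral_dominated_convergence)
    show "integrable M (\<lambda>x. C\<^sup>2 * (norm (G x))\<^sup>2)" using sqi_integrable[OF G] by auto
    show "AE x in M. (\<lambda>k. (norm (c k x *\<^sub>R G x))\<^sup>2) \<longlonglongrightarrow> 0"
      using c(3)
    proof eventually_elim
      case (elim x)
      then have "(\<lambda>k. (norm (c k x *\<^sub>R G x))\<^sup>2) \<longlonglongrightarrow> (norm (0 *\<^sub>R G x))\<^sup>2" by (intro tendsto_intros)
      then show ?case by simp
    qed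
    show "AE x in M. norm ((norm (c k x *\<^sub>R G x))\<^sup>2) \<le> C\<^sup>2 * (norm (G x))\<^sup>2" for k
      using c(2)[of k] power_mono[OF c(2)[of k], of _ 2]
      by (intro AE_I2) (auto simp: power_mult_distrib intro!: mult_right_mono)
    show "(\<lambda>x. (norm (c k x *\<^sub>R G x))\<^sup>2) \<in> borel_measurable M" for k
      using c(1)[of k] sqi_meas[OF G] by measurable
  qed simp
  then have "(\<lambda>k. sqrt (\<integral>x. (norm (c k x *\<^sub>R G x))\<^sup>2 \<partial>M)) \<longlonglongrightarrow> sqrt 0"
    by (intro tendsto_real_sqrt) simp
  then show ?thesis by (simp add: nrm2_def)
qed

lemma comp_meas_M:
  fixes b :: "real \<Rightarrow> real"
  assumes "continuous_on UNIV b" "w \<in> borel_measurable M"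
  shows "(\<lambda>x. b (w x)) \<in> borel_measurable M"
  using measurable_compose[OF assms(2) borel_measurable_continuous_onI[OF assms(1)]] .

text \<open>The chain rule in the energy space. The error of the gradients splits into a bounded
  factor times an L^2 null sequence, and a bounded factor tending to 0 almost everywhere times the
  fixed G, to which dominated convergence applies.\<close>

lemma W_rabs:
  assumes "W u G"
  shows "W (\<lambda>x. rabs \<epsilon> (u x)) (\<lambda>x. rsgn \<epsilon> (u x) *\<^sub>R G x)"
proof -
  obtain \<phi> D\<phi> where *: "\<And>k::nat. test_fun \<Omega> (\<phi> k) (D\<phi> k)"
    "(\<lambda>k. nrm2 M (\<lambda>x. \<phi> k x - u x)) \<longlonglongrightarrow> 0" "(\<lambda>k. nrm2 M (\<lambda>x. D\<phi> k x - G x)) \<longlonglongrightarrow> 0"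
    "AE x in M. (\<lambda>k. \<phi> k x) \<longlonglongrightarrow> u x"
    using W_approx_AE[OF assms] by blast
  note sp = test_fun_sqi[OF *(1)] and su = W_sqi[OF assms]
  have t: "test_fun \<Omega> (\<lambda>x. rabs \<epsilon> (\<phi> k x)) (\<lambda>x. rsgn \<epsilon> (\<phi> k x) *\<^sub>R D\<phi> k x)" for k
    by (rule test_fun_compose[OF *(1) DERIV_rabs continuous_rsgn rabs_0])
  have s1: "sqi M (\<lambda>x. rabs \<epsilon> (u x))"
    by (rule sqi_bound(1)[OF su(1), of _ 1])
      (use comp_meas_M[OF continuous_rabs sqi_meas[OF su(1)]] rabs_bounds in auto)
  have s2: "sqi M (\<lambda>x. rsgn \<epsilon> (u x) *\<^sub>R G x)"
    by (rule sqi_bounded_mult(1)[OF su(2), of _ 1])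
      (use comp_meas_M[OF continuous_rsgn sqi_meas[OF su(1)]] rsgn_abs_le in auto)
  have l1: "(\<lambda>k. nrm2 M (\<lambda>x. rabs \<epsilon> (\<phi> k x) - rabs \<epsilon> (u x))) \<longlonglongrightarrow> 0"
  proof (rule tendsto_sandwich[OF _ _ tendsto_const *(2)])
    have "nrm2 M (\<lambda>x. rabs \<epsilon> (\<phi> k x) - rabs \<epsilon> (u x)) \<le> \<bar>1\<bar> * nrm2 M (\<lambda>x. \<phi> k x - u x)" for k
      by (rule sqi_bound(2)[OF sqi_diff[OF sp(1) su(1)] sqi_meas[OF sqi_diff[OF test_fun_sqi(1)[OF t] s1]]])
        (use rabs_lip in auto)
    then show "\<forall>\<^sub>F k in sequentially. nrm2 M (\<lambda>x. rabs \<epsilon> (\<phi> k x) - rabs \<epsilon> (u x)) \<le> nrm2 M (\<lambda>x. \<phi> k x - u x)"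
      by simp
  qed simp
  have l2: "(\<lambda>k. nrm2 M (\<lambda>x. rsgn \<epsilon> (\<phi> k x) *\<^sub>R D\<phi> k x - rsgn \<epsilon> (u x) *\<^sub>R G x)) \<longlonglongrightarrow> 0"
  proof -
    let ?c = "\<lambda>k x. rsgn \<epsilon> (\<phi> k x) - rsgn \<epsilon> (u x)"
    have cm: "?c k \<in> borel_measurable M" for k
      by (rule borel_measurable_diff[OF comp_meas_M[OF continuous_rsgn sqi_meas[OF sp(1)]]
            comp_meas_M[OF continuous_rsgn sqi_meas[OF su(1)]]])
    have cb: "\<bar>?c k x\<bar> \<le> 2" for k x using rsgn_abs_le[of "\<phi> k x"] rsgn_abs_le[of "u x"] by linarith
    have cl: "AE x in M. (\<lambda>k. ?c k x) \<longlonglongrightarrow> 0"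
      using *(4)
    proof eventually_elim
      case (elim x)
      have "(\<lambda>k. rsgn \<epsilon> (\<phi> k x)) \<longlonglongrightarrow> rsgn \<epsilon> (u x)"
        by (rule tendsto_comp_continuous[OF continuous_rsgn elim])
      then show ?case by (simp add: LIM_zero_iff)
    qed
    have L: "(\<lambda>k. nrm2 M (\<lambda>x. D\<phi> k x - G x) + nrm2 M (\<lambda>x. ?c k x *\<^sub>R G x)) \<longlonglongrightarrow> 0"
      using tendsto_add[OF *(3) nrm2_mult_tendsto_0[OF cm cb cl su(2)]] by simp
    show ?thesis
    proof (rule tendsto_sandwich[OF _ _ tendsto_const L])
      have "nrm2 M (\<lambda>x. rsgn \<epsilon> (\<phi> k x) *\<^sub>R D\<phi> k x - rsgn \<epsilon> (u x) *\<^sub>R G x)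
          \<le> nrm2 M (\<lambda>x. D\<phi> k x - G x) + nrm2 M (\<lambda>x. ?c k x *\<^sub>R G x)" for k
      proof -
        have m: "(\<lambda>x. rsgn \<epsilon> (\<phi> k x)) \<in> borel_measurable M"
          by (rule comp_meas_M[OF continuous_rsgn sqi_meas[OF sp(1)]])
        have "AE x in M. \<bar>rsgn \<epsilon> (\<phi> k x)\<bar> \<le> 1" using rsgn_abs_le by simp
        note a = sqi_bounded_mult[OF sqi_diff[OF sp(2)[of k] su(2)] m this]
        have b: "sqi M (\<lambda>x. ?c k x *\<^sub>R G x)"
          by (rule sqi_bounded_mult(1)[OF su(2) cm, of _ 2]) (use cb in simp)
        have "(\<lambda>x. rsgn \<epsilon> (\<phi> k x) *\<^sub>R D\<phi> k x - rsgn \<epsilon> (u x) *\<^sub>R G x)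
            = (\<lambda>x. rsgn \<epsilon> (\<phi> k x) *\<^sub>R (D\<phi> k x - G x) + ?c k x *\<^sub>R G x)"
          by (simp add: fun_eq_iff scaleR_diff_right scaleR_diff_left)
        then show ?thesis using nrm2_triangle[OF a(1) b] a(2) by simp
      qed
      then show "\<forall>\<^sub>F k in sequentially. nrm2 M (\<lambda>x. rsgn \<epsilon> (\<phi> k x) *\<^sub>R D\<phi> k x - rsgn \<epsilon> (u x) *\<^sub>R G x)
          \<le> nrm2 M (\<lambda>x. D\<phi> k x - G x) + nrm2 M (\<lambda>x. ?c k x *\<^sub>R G x)" by simp
    qed simp
  qed
  show ?thesis unfolding W_def using s1 s2 t l1 l2
    by (intro conjI exI[of _ "\<lambda>k x. rabs \<epsilon> (\<phi> k x)"] exI[of _ "\<lambda>k x. rsgn \<epsilon> (\<phi> k x) *\<^sub>R D\<phi> k x"]) auto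
qed

text \<open>Kato's inequality \<open>- \<Delta> |u| \<le> |g|\<close> on the whole space, with \<open>|u|\<close> smoothed; the test function
  is \<open>rsgn \<epsilon> u \<psi>\<close>, and the absorption term \<open>k\<close> drops out because \<open>k u \<ge> 0\<close>.\<close>
lemma kato:
  assumes W: "W u G" and eq: "weq G (\<lambda>x. g x - k x)" and gk: "integrable M g" "integrable M k"
    and sg: "AE x in M. 0 \<le> k x * u x"
    and t: "test_fun UNIV \<psi> D\<psi>" and pos: "\<And>x. 0 \<le> \<psi> x"
  shows "(\<integral>x. (rsgn \<epsilon> (u x) *\<^sub>R G x) \<bullet> D\<psi> x \<partial>M) \<le> (\<integral>x. \<bar>g x\<bar> * \<psi> x \<partial>M)"
proof -
  obtain \<phi> D\<phi> where *: "\<And>j::nat. test_fun \<Omega> (\<phi> j) (D\<phi> j)"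
    "(\<lambda>j. nrm2 M (\<lambda>x. \<phi> j x - u x)) \<longlonglongrightarrow> 0" "(\<lambda>j. nrm2 M (\<lambda>x. D\<phi> j x - G x)) \<longlonglongrightarrow> 0"
    "AE x in M. (\<lambda>j. \<phi> j x) \<longlonglongrightarrow> u x"
    using W_approx_AE[OF W] by blast
  note sp = test_fun_sqi[OF *(1)] and su = W_sqi[OF W] and st = test_fun_sqi[OF t]
  obtain C where C: "C \<ge> 0" "\<And>x. \<bar>\<psi> x\<bar> \<le> C" "\<And>x. norm (D\<psi> x) \<le> C" using test_fun_bounded[OF t] by metis
  define b b' where "b = rsgn \<epsilon>" and "b' = rsgn' \<epsilon>"
  have bm: "(\<lambda>x. b (w x)) \<in> borel_measurable M" "(\<lambda>x. b' (w x)) \<in> borel_measurable M" if "w \<in> borel_measurable M" for w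
    unfolding b_def b'_def by (rule comp_meas_M[OF continuous_rsgn that], rule comp_meas_M[OF continuous_rsgn' that])
  have pm: "\<phi> j \<in> borel_measurable M" "u \<in> borel_measurable M" "\<psi> \<in> borel_measurable M" "D\<psi> \<in> borel_measurable M"
    "D\<phi> j \<in> borel_measurable M" "G \<in> borel_measurable M" for j
    using sp su st by auto
  note bms [measurable] = bm[OF pm(1)] bm[OF pm(2)] pm
  have bb: "\<bar>b s\<bar> \<le> 1" "0 \<le> b' s" "b' s \<le> 1/\<epsilon>" for s
    unfolding b_def b'_def using rsgn_abs_le rsgn'_bounds by auto
  have bl: "AE x in M. (\<lambda>j. b (\<phi> j x)) \<longlonglongrightarrow> b (u x) \<and> (\<lambda>j. b' (\<phi> j x)) \<longlonglongrightarrow> b' (u x)"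
    using *(4) unfolding b_def b'_def
    by eventually_elim (intro conjI tendsto_comp_continuous[OF continuous_rsgn] tendsto_comp_continuous[OF continuous_rsgn'])
  \<comment> \<open>The factor b (\<phi> j) confines the support to \<Omega>, so \<psi> may reach
    across the boundary. Using \<phi> j in place of u keeps the product continuously
    differentiable.\<close>
  have tf: "test_fun \<Omega> (\<lambda>x. b (\<phi> j x) * \<psi> x) (\<lambda>x. b (\<phi> j x) *\<^sub>R D\<psi> x + \<psi> x *\<^sub>R (b' (\<phi> j x) *\<^sub>R D\<phi> j x))" for j
    unfolding b_def b'_def
    by (rule test_fun_mult[OF test_fun_compose[OF *(1) DERIV_rsgn continuous_rsgn' rsgn_0] test_funD(1,3)[OF t]])
  have sD: "sqi M (\<lambda>x. b (\<phi> j x) *\<^sub>R D\<psi> x)" for j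
    by (rule sqi_bounded_mult(1)[OF st(2), of _ 1]) (use bb in auto)
  have spb: "sqi M (\<lambda>x. (\<psi> x * b' (\<phi> j x)) *\<^sub>R w x)" if "sqi M w" for w :: "'a \<Rightarrow> 'a" and j
  proof (rule sqi_bounded_mult(1)[OF that, of _ "C * (1/\<epsilon>)"])
    have "\<bar>\<psi> x\<bar> * \<bar>b' (\<phi> j x)\<bar> \<le> C * (1/\<epsilon>)" for x
      using C bb(2,3) by (intro mult_mono) (auto simp: abs_of_nonneg)
    then show "AE x in M. \<bar>\<psi> x * b' (\<phi> j x)\<bar> \<le> C * (1/\<epsilon>)" by (simp add: abs_mult)
  qed simp
  \<comment> \<open>The gradient of \<phi> j is compared with G. The middle term is nonnegative and
    will be dropped before the limit is taken; the last one is an error tending to 0.\<close>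
  have e1: "(\<integral>x. G x \<bullet> (b (\<phi> j x) *\<^sub>R D\<psi> x) \<partial>M) + (\<integral>x. (\<psi> x * b' (\<phi> j x)) * (norm (G x))\<^sup>2 \<partial>M)
      + (\<integral>x. G x \<bullet> ((\<psi> x * b' (\<phi> j x)) *\<^sub>R (D\<phi> j x - G x)) \<partial>M) = (\<integral>x. (g x - k x) * (b (\<phi> j x) * \<psi> x) \<partial>M)" for j
  proof -
    have "(\<integral>x. (g x - k x) * (b (\<phi> j x) * \<psi> x) \<partial>M)
        = (\<integral>x. G x \<bullet> (b (\<phi> j x) *\<^sub>R D\<psi> x + \<psi> x *\<^sub>R (b' (\<phi> j x) *\<^sub>R D\<phi> j x)) \<partial>M)"
      using weqD[OF eq tf] by simp
    also have "\<dots> = (\<integral>x. G x \<bullet> (b (\<phi> j x) *\<^sub>R D\<psi> x) + (G x \<bullet> ((\<psi> x * b' (\<phi> j x)) *\<^sub>R G x)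
        + G x \<bullet> ((\<psi> x * b' (\<phi> j x)) *\<^sub>R (D\<phi> j x - G x))) \<partial>M)"
      by (intro arg_cong[where f="integral\<^sup>L M"] ext)
        (simp add: inner_add_right inner_diff_right algebra_simps)
    also have "\<dots> = (\<integral>x. G x \<bullet> (b (\<phi> j x) *\<^sub>R D\<psi> x) \<partial>M) + ((\<integral>x. G x \<bullet> ((\<psi> x * b' (\<phi> j x)) *\<^sub>R G x) \<partial>M)
        + (\<integral>x. G x \<bullet> ((\<psi> x * b' (\<phi> j x)) *\<^sub>R (D\<phi> j x - G x)) \<partial>M))"
      using sqi_inner_integrable[OF su(2) sD] sqi_inner_integrable[OF su(2) spb[OF su(2)]]
        sqi_inner_integrable[OF su(2) spb[OF sqi_diff[OF sp(2) su(2)]]]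
      by (subst Bochner_Integration.integral_add, simp, intro Bochner_Integration.integrable_add, simp, simp,
          subst Bochner_Integration.integral_add) auto
    finally show ?thesis by (simp add: power2_norm_eq_inner)
  qed
  have l1: "(\<lambda>j. \<integral>x. G x \<bullet> (b (\<phi> j x) *\<^sub>R D\<psi> x) \<partial>M) \<longlonglongrightarrow> (\<integral>x. G x \<bullet> (b (u x) *\<^sub>R D\<psi> x) \<partial>M)"
  proof (rule integral_dominated_convergence[where w="\<lambda>x. norm (G x) * C"])
    show "integrable M (\<lambda>x. norm (G x) * C)" using sqi_integrable_L1(1)[OF su(2)] by auto
    show "AE x in M. (\<lambda>j. G x \<bullet> (b (\<phi> j x) *\<^sub>R D\<psi> x)) \<longlonglongrightarrow> G x \<bullet> (b (u x) *\<^sub>R D\<psi> x)"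
      using bl by eventually_elim (intro tendsto_intros, auto)
    have "\<bar>G x \<bullet> (b (\<phi> j x) *\<^sub>R D\<psi> x)\<bar> \<le> norm (G x) * C" for j x
    proof -
      have "\<bar>G x \<bullet> (b (\<phi> j x) *\<^sub>R D\<psi> x)\<bar> \<le> norm (G x) * norm (b (\<phi> j x) *\<^sub>R D\<psi> x)" by (rule Cauchy_Schwarz_ineq2)
      also have "norm (b (\<phi> j x) *\<^sub>R D\<psi> x) \<le> 1 * C" unfolding norm_scaleR by (intro mult_mono) (use bb C in auto)
      finally show ?thesis by (simp add: mult_left_mono)
    qed
    then show "AE x in M. norm (G x \<bullet> (b (\<phi> j x) *\<^sub>R D\<psi> x)) \<le> norm (G x) * C" for j by simp
  qed measurable
  have l3: "(\<lambda>j. \<integral>x. G x \<bullet> ((\<psi> x * b' (\<phi> j x)) *\<^sub>R (D\<phi> j x - G x)) \<partial>M) \<longlonglongrightarrow> 0"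
  proof (rule Lim_null_comparison)
    show "(\<lambda>j. nrm2 M G * (\<bar>C * (1/\<epsilon>)\<bar> * nrm2 M (\<lambda>x. D\<phi> j x - G x))) \<longlonglongrightarrow> 0"
      using tendsto_mult_left[OF tendsto_mult_left[OF *(3), of "\<bar>C * (1/\<epsilon>)\<bar>"], of "nrm2 M G"] by simp
    have "\<bar>\<integral>x. G x \<bullet> ((\<psi> x * b' (\<phi> j x)) *\<^sub>R (D\<phi> j x - G x)) \<partial>M\<bar> \<le> nrm2 M G * (\<bar>C * (1/\<epsilon>)\<bar> * nrm2 M (\<lambda>x. D\<phi> j x - G x))" for j
    proof -
      have "\<bar>\<psi> x\<bar> * \<bar>b' (\<phi> j x)\<bar> \<le> C * (1/\<epsilon>)" for x
        using C bb(2,3) by (intro mult_mono) (auto simp: abs_of_nonneg)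
      then have "nrm2 M (\<lambda>x. (\<psi> x * b' (\<phi> j x)) *\<^sub>R (D\<phi> j x - G x)) \<le> \<bar>C * (1/\<epsilon>)\<bar> * nrm2 M (\<lambda>x. D\<phi> j x - G x)"
        by (intro sqi_bounded_mult(2)[OF sqi_diff[OF sp(2) su(2)]]) (auto simp: abs_mult)
      from mult_left_mono[OF this nrm2_nonneg[of M G]]
      show ?thesis using sqi_CS[OF su(2) spb[OF sqi_diff[OF sp(2)[of j] su(2)], of j]] by linarith
    qed
    then show "\<forall>\<^sub>F j in sequentially. norm (\<integral>x. G x \<bullet> ((\<psi> x * b' (\<phi> j x)) *\<^sub>R (D\<phi> j x - G x)) \<partial>M)
        \<le> nrm2 M G * (\<bar>C * (1/\<epsilon>)\<bar> * nrm2 M (\<lambda>x. D\<phi> j x - G x))" by simp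
  qed
  have gI: "integrable M (\<lambda>x. \<bar>g x - k x\<bar> * C)" using gk by auto
  have gpb: "norm ((g x - k x) * (b s * \<psi> x)) \<le> \<bar>g x - k x\<bar> * C" for x s
  proof -
    have "\<bar>b s\<bar> * \<bar>\<psi> x\<bar> \<le> 1 * C" using bb C by (intro mult_mono) auto
    then show ?thesis by (auto simp: abs_mult intro!: mult_left_mono)
  qed
  have gm [measurable]: "g \<in> borel_measurable M" "k \<in> borel_measurable M" using gk by auto
  have l4: "(\<lambda>j. \<integral>x. (g x - k x) * (b (\<phi> j x) * \<psi> x) \<partial>M) \<longlonglongrightarrow> (\<integral>x. (g x - k x) * (b (u x) * \<psi> x) \<partial>M)"
  proof (rule integral_dominated_convergence[OF _ _ gI])
    show "AE x in M. (\<lambda>j. (g x - k x) * (b (\<phi> j x) * \<psi> x)) \<longlonglongrightarrow> (g x - k x) * (b (u x) * \<psi> x)"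
      using bl by eventually_elim (intro tendsto_intros, auto)
    show "AE x in M. norm ((g x - k x) * (b (\<phi> j x) * \<psi> x)) \<le> \<bar>g x - k x\<bar> * C" for j using gpb by simp
  qed measurable
  have "(\<integral>x. G x \<bullet> (b (u x) *\<^sub>R D\<psi> x) \<partial>M) + 0 \<le> (\<integral>x. (g x - k x) * (b (u x) * \<psi> x) \<partial>M)"
  proof (rule LIMSEQ_le[OF tendsto_add[OF l1 l3] l4])
    have "0 \<le> (\<integral>x. (\<psi> x * b' (\<phi> j x)) * (norm (G x))\<^sup>2 \<partial>M)" for j
      using pos bb by (intro integral_nonneg_AE) auto
    then show "\<exists>N. \<forall>n\<ge>N. (\<integral>x. G x \<bullet> (b (\<phi> n x) *\<^sub>R D\<psi> x) \<partial>M)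
        + (\<integral>x. G x \<bullet> ((\<psi> x * b' (\<phi> n x)) *\<^sub>R (D\<phi> n x - G x)) \<partial>M) \<le> (\<integral>x. (g x - k x) * (b (\<phi> n x) * \<psi> x) \<partial>M)"
      using e1 by (intro exI[of _ 0] allI impI) (smt (verit))
  qed
  also have "\<dots> \<le> (\<integral>x. \<bar>g x\<bar> * \<psi> x \<partial>M)"
  proof (rule integral_mono_AE)
    show "integrable M (\<lambda>x. (g x - k x) * (b (u x) * \<psi> x))"
    proof (rule Bochner_Integration.integrable_bound[OF gI])
      show "AE x in M. norm ((g x - k x) * (b (u x) * \<psi> x)) \<le> norm (\<bar>g x - k x\<bar> * C)"
        using order_trans[OF gpb abs_ge_self] unfolding real_norm_def by (intro AE_I2)
    qed measurable
    show "integrable M (\<lambda>x. \<bar>g x\<bar> * \<psi> x)" by (rule integrable_mult_test[OF integrable_abs[OF gk(1)] t])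
    show "AE x in M. (g x - k x) * (b (u x) * \<psi> x) \<le> \<bar>g x\<bar> * \<psi> x"
      using sg
    proof eventually_elim
      case (elim x)
      have "g x * b (u x) \<le> \<bar>g x\<bar> * 1"
        using abs_ge_self[of "g x * b (u x)"] mult_left_mono[OF bb(1)[of "u x"] abs_ge_zero[of "g x"]]
        unfolding abs_mult by linarith
      moreover have "0 \<le> k x * b (u x)" unfolding b_def using rsgn_mult_nonneg[OF elim] .
      ultimately have "(g x - k x) * b (u x) \<le> \<bar>g x\<bar>" by (simp add: left_diff_distrib)
      from mult_right_mono[OF this pos[of x]] show ?case by (simp add: mult.assoc)
    qed
  qed
  finally show ?thesis unfolding b_def by (simp add: inner_commute)
qed

end

text \<open>The regularised absolute value lies between \<bar>u\<bar> - \<epsilon> and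
  \<bar>u\<bar>, so its estimate carries over with a loss proportional to \<epsilon>. Balls may
  cross the boundary, because \<bar>u\<bar> extended by zero is still a subsolution.\<close>

lemma Av_abs_le_mono:
  assumes W: "W u G" and eq: "weq G (\<lambda>x. g x - k x)" and k: "integrable M k"
    and sg: "AE x in M. 0 \<le> k x * u x"
    and g: "morrey \<theta> g K" and th: "\<theta> > 0" and s: "0 < s" "s \<le> r" "r \<le> 1"
  shows "Av (\<lambda>x. \<bar>u x\<bar>) s x \<le> Av (\<lambda>x. \<bar>u x\<bar>) r x + K / (6 * \<theta>) * r powr \<theta>"
proof (rule field_le_epsilon)
  fix e :: real assume e: "e > 0"
  let ?c = "bump_mass TYPE('a)"
  have c: "?c > 0" by (rule bump_mass_pos)
  \<comment> \<open>Subtracting the constant \<epsilon> lowers a mean by at most \<epsilon> times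
    the mass of the kernel, that is by e.\<close>
  define \<epsilon> where "\<epsilon> = e / ?c"
  have \<epsilon>: "\<epsilon> > 0" using e c by (simp add: \<epsilon>_def)
  have uI: "integrable M u" using sqi_integrable_L1(1)[OF W_sqi(1)[OF W]] .
  have gI: "integrable M g" using g by (simp add: morrey_def)
  note WB = W_rabs[OF \<epsilon> W]
  have BI: "integrable M (\<lambda>x. rabs \<epsilon> (u x))" using sqi_integrable_L1(1)[OF W_sqi(1)[OF WB]] .
  have "Av (\<lambda>x. rabs \<epsilon> (u x)) s x \<le> Av (\<lambda>x. rabs \<epsilon> (u x)) r x + K / (6 * \<theta>) * r powr \<theta>"
    by (rule Av_le_mono[OF BI W_sqi(2)[OF WB] subset_UNIV W_ibp[OF WB] kato[OF \<epsilon> W eq gI k sg] g th s])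
  also have "Av (\<lambda>x. rabs \<epsilon> (u x)) r x \<le> Av (\<lambda>x. \<bar>u x\<bar>) r x"
    using rabs_bounds[OF \<epsilon>] s uI BI by (intro Av_mono) auto
  finally have 1: "Av (\<lambda>x. rabs \<epsilon> (u x)) s x \<le> Av (\<lambda>x. \<bar>u x\<bar>) r x + K / (6 * \<theta>) * r powr \<theta>" by simp
  have "Av (\<lambda>x. \<bar>u x\<bar> - \<bar>\<epsilon>\<bar>) s x \<le> Av (\<lambda>x. rabs \<epsilon> (u x)) s x"
    using rabs_bounds[OF \<epsilon>] s uI BI \<epsilon> by (intro Av_mono) auto
  moreover have "Av (\<lambda>x. \<bar>u x\<bar> - \<bar>\<epsilon>\<bar>) s x = Av (\<lambda>x. \<bar>u x\<bar>) s x - Av (\<lambda>x. \<bar>\<epsilon>\<bar>) s x"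
    using uI by (intro Av_diff) auto
  moreover have "Av (\<lambda>x. \<bar>\<epsilon>\<bar>) s x \<le> \<epsilon> * ?c"
    using \<epsilon> s by (intro Av_const_le) auto
  ultimately show "Av (\<lambda>x. \<bar>u x\<bar>) s x \<le> Av (\<lambda>x. \<bar>u x\<bar>) r x + K / (6 * \<theta>) * r powr \<theta> + e"
    using 1 c by (simp add: \<epsilon>_def)
qed

text \<open>Means over small balls are compared with the mean of radius 1, where the kernel is at
  most 1 and the mean at most the L^1 norm; small radii recover u almost everywhere. The term k
  enters only through its sign.\<close>

lemma Linfty_bound:
  assumes W: "W u G" and eq: "weq G (\<lambda>x. g x - k x)" and k: "integrable M k"
    and sg: "AE x in M. 0 \<le> k x * u x"
    and g: "morrey \<theta> g K" and th: "\<theta> > 0"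
  shows "AE x in M. \<bar>u x\<bar> \<le> ((\<integral>x. \<bar>u x\<bar> \<partial>M) + K / (6 * \<theta>)) / bump_mass TYPE('a)"
proof -
  let ?c = "bump_mass TYPE('a)"
  have c: "?c > 0" by (rule bump_mass_pos)
  have uI: "integrable M u" using sqi_integrable_L1(1)[OF W_sqi(1)[OF W]] .
  obtain s where s: "\<And>k::nat. 0 < s k" "s \<longlonglongrightarrow> 0" "AE x in M. (\<lambda>k. Av u (s k) x) \<longlonglongrightarrow> ?c * u x"
    by (rule Av_AE_tendsto[OF W], rule that)
  have "\<forall>\<^sub>F k in sequentially. s k < 1" using s(2) by (intro order_tendstoD) auto
  have bound: "\<forall>\<^sub>F k in sequentially. \<bar>Av u (s k) x\<bar> \<le> (\<integral>x. \<bar>u x\<bar> \<partial>M) + K / (6 * \<theta>)" for x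
    using \<open>\<forall>\<^sub>F k in sequentially. s k < 1\<close>
  proof eventually_elim
    case (elim k)
    have "\<bar>Av u (s k) x\<bar> \<le> Av (\<lambda>x. \<bar>u x\<bar>) (s k) x" by (rule Av_abs[OF uI s(1)])
    also have "\<dots> \<le> Av (\<lambda>x. \<bar>u x\<bar>) 1 x + K / (6 * \<theta>) * 1 powr \<theta>"
      using elim by (intro Av_abs_le_mono[OF W eq assms(3) sg g th s(1)]) auto
    also have "Av (\<lambda>x. \<bar>u x\<bar>) 1 x \<le> (\<integral>x. \<bar>u x\<bar> \<partial>M)"
    proof -
      have "(\<integral>\<xi>. \<bar>u \<xi>\<bar> * bump 2 x 1 \<xi> \<partial>M) \<le> (\<integral>\<xi>. \<bar>u \<xi>\<bar> \<partial>M)"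
        using integrable_bump[OF integrable_abs[OF uI], of 2 x 1] uI bump_le[of 2 x 1]
        by (intro integral_mono) (auto intro: mult_left_le)
      then show ?thesis by (simp add: Av_def)
    qed
    finally show ?case by simp
  qed
  show ?thesis
    using s(3)
  proof eventually_elim
    case (elim x)
    have "\<bar>?c * u x\<bar> \<le> (\<integral>x. \<bar>u x\<bar> \<partial>M) + K / (6 * \<theta>)"
      by (rule tendsto_upperbound[OF tendsto_rabs[OF elim] bound]) simp
    then show ?case using c by (simp add: abs_mult pos_le_divide_eq mult.commute)
  qed
qed

text \<open>Inside \<Omega> the equation itself is available and not only an inequality, so both u
  and - u satisfy the mean value inequality. Hence the means of u converge as the radius
  shrinks.\<close>

lemma Av_interior_Cauchy:
  assumes W: "W u G" and eq: "weq G g" and g: "morrey \<theta> g K" and th: "\<theta> > 0"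
    and s: "0 < s" "s \<le> r" "r \<le> 1" and x: "cball x r \<subseteq> \<Omega>"
  shows "\<bar>Av u s x - Av u r x\<bar> \<le> K / (6 * \<theta>) * r powr \<theta>"
proof -
  have gI: "integrable M g" using g by (simp add: morrey_def)
  have uI: "integrable M u" using sqi_integrable_L1(1)[OF W_sqi(1)[OF W]] .
  have sub: "(\<integral>x. (c *\<^sub>R G x) \<bullet> D\<psi> x \<partial>M) \<le> (\<integral>x. \<bar>g x\<bar> * \<psi> x \<partial>M)"
    if t: "test_fun \<Omega> \<psi> D\<psi>" "\<And>x. 0 \<le> \<psi> x" and c: "\<bar>c\<bar> = 1" for c \<psi> D\<psi>
  proof -
    have "(\<integral>x. (c *\<^sub>R G x) \<bullet> D\<psi> x \<partial>M) = (\<integral>x. c * g x * \<psi> x \<partial>M)"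
      using weqD[OF weq_scale[OF eq] t(1), of c] by simp
    also have "\<dots> \<le> (\<integral>x. \<bar>g x\<bar> * \<psi> x \<partial>M)"
    proof (rule integral_mono)
      show "integrable M (\<lambda>x. c * g x * \<psi> x)" "integrable M (\<lambda>x. \<bar>g x\<bar> * \<psi> x)"
        using gI by (auto intro!: integrable_mult_test[OF _ t(1)])
      show "c * g x * \<psi> x \<le> \<bar>g x\<bar> * \<psi> x" for x
        using c t(2)[of x] abs_ge_self[of "c * g x"] by (intro mult_right_mono) (auto simp: abs_mult)
    qed
    finally show ?thesis .
  qed
  have "Av (\<lambda>x. c * u x) s x \<le> Av (\<lambda>x. c * u x) r x + K / (6 * \<theta>) * r powr \<theta>" if c: "\<bar>c\<bar> = 1" for c
    by (rule Av_le_mono[OF _ W_sqi(2)[OF W_scale[OF W]] x W_ibp[OF W_scale[OF W]] sub g th s])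
      (use uI c in auto)
  from this[of 1] this[of "-1"] show ?thesis by (auto simp: Av_def)
qed

end

section \<open>Regularity up to the boundary\<close>

text \<open>What is used of the Lipschitz boundary: at every small scale the exterior contains a
  ball of comparable radius.\<close>

definition exterior_thick :: "'a::euclidean_space set \<Rightarrow> bool" where
  "exterior_thick \<Omega> \<longleftrightarrow> (\<forall>p\<in>frontier \<Omega>. \<exists>r0>0. \<exists>c>0. c \<le> 1 \<and>
     (\<forall>r. 0 < r \<and> r \<le> r0 \<longrightarrow> (\<exists>q. ball q (c * r) \<subseteq> ball p r - \<Omega>)))"

text \<open>A Lipschitz domain satisfies an exterior cone condition, and the cone contains a ball at every scale.\<close>
lemma lipschitz_domain_exterior_thick:
  fixes \<Omega> :: "'a::euclidean_space set"
  assumes "lipschitz_domain \<Omega>"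
  shows "exterior_thick \<Omega>"
  unfolding exterior_thick_def
proof
  fix p assume p: "p \<in> frontier \<Omega>"
  obtain r0 e h L where r0: "r0 > 0" and e: "norm (e::'a) = 1" and h: "L-lipschitz_on UNIV (h :: 'a \<Rightarrow> real)"
    and eq: "\<Omega> \<inter> ball p r0 = {x \<in> ball p r0. x \<bullet> e < h (x - (x \<bullet> e) *\<^sub>R e)}"
  proof -
    have "\<forall>p\<in>frontier \<Omega>. \<exists>r>0. \<exists>e::'a. \<exists>h::'a \<Rightarrow> real. \<exists>L. norm e = 1 \<and> L-lipschitz_on UNIV h \<and>
        \<Omega> \<inter> ball p r = {x \<in> ball p r. x \<bullet> e < h (x - (x \<bullet> e) *\<^sub>R e)}"
      using assms unfolding lipschitz_domain_def by (elim conjE)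
    from bspec[OF this p] show ?thesis using that by (elim exE conjE)
  qed
  have L: "L \<ge> 0" using h by (rule lipschitz_on_nonneg)
  have "open \<Omega>" using assms unfolding lipschitz_domain_def by (elim conjE)
  then have pn: "p \<notin> \<Omega>" using p frontier_disjoint_eq[of \<Omega>] by blast
  have ph: "h (p - (p \<bullet> e) *\<^sub>R e) \<le> p \<bullet> e"
  proof (rule ccontr)
    assume "\<not> ?thesis"
    then have "p \<in> {x \<in> ball p r0. x \<bullet> e < h (x - (x \<bullet> e) *\<^sub>R e)}" using r0 by simp
    then show False using eq pn by blast
  qed
  \<comment> \<open>The ball sits at height r/2 above p. A point within c r of its centre keeps
    height r/2 - c r, while h varies by at most L (2 c r); the identity
    \<open>c * (1 + 2 * L) = 1/2\<close> balances the two.\<close>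
  define c where "c = 1 / (2 * (2 * L + 1))"
  have c: "c > 0" "c \<le> 1/2" "c * (1 + 2 * L) = 1/2" using L by (auto simp: c_def field_simps)
  have "\<exists>q. ball q (c * r) \<subseteq> ball p r - \<Omega>" if r: "0 < r" "r \<le> r0" for r
  proof (intro exI subsetI)
    fix x assume x: "x \<in> ball (p + (r/2) *\<^sub>R e) (c * r)"
    define d where "d = x - (p + (r/2) *\<^sub>R e)"
    have d: "norm d < c * r" using x by (simp add: d_def dist_norm norm_minus_commute)
    have xp: "x = p + (r/2) *\<^sub>R e + d" by (simp add: d_def)
    have ee: "e \<bullet> e = 1" using e by (simp add: norm_eq_1)
    have de: "\<bar>d \<bullet> e\<bar> \<le> norm d" using Cauchy_Schwarz_ineq2[of d e] e by simp
    have "norm (x - p) \<le> norm ((r/2) *\<^sub>R e) + norm d" unfolding xp using norm_triangle_ineq[of "(r/2) *\<^sub>R e" d] by simp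
    also have "\<dots> < r/2 + c * r" using d r e by simp
    also have "\<dots> \<le> r"
    proof -
      have "c * r \<le> 1/2 * r" using c(2) r by (intro mult_right_mono) auto
      then show ?thesis by linarith
    qed
    finally have xb: "x \<in> ball p r" by (simp add: dist_norm norm_minus_commute)
    have xe: "x \<bullet> e = p \<bullet> e + r/2 + d \<bullet> e" unfolding xp by (simp add: inner_add_left ee)
    have "(x - (x \<bullet> e) *\<^sub>R e) - (p - (p \<bullet> e) *\<^sub>R e) = d - (d \<bullet> e) *\<^sub>R e"
      unfolding xe by (simp add: xp algebra_simps)
    then have "dist (x - (x \<bullet> e) *\<^sub>R e) (p - (p \<bullet> e) *\<^sub>R e) = norm (d - (d \<bullet> e) *\<^sub>R e)" by (simp add: dist_norm)
    also have "\<dots> \<le> norm d + \<bar>d \<bullet> e\<bar>" using norm_triangle_ineq4[of d "(d \<bullet> e) *\<^sub>R e"] e by simp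
    also have "\<dots> \<le> 2 * (c * r)" using d de by linarith
    finally have "dist (h (x - (x \<bullet> e) *\<^sub>R e)) (h (p - (p \<bullet> e) *\<^sub>R e)) \<le> L * (2 * (c * r))"
      using lipschitz_onD[OF h, of "x - (x \<bullet> e) *\<^sub>R e" "p - (p \<bullet> e) *\<^sub>R e"] L
      by (meson UNIV_I mult_left_mono order_trans)
    then have "h (x - (x \<bullet> e) *\<^sub>R e) \<le> p \<bullet> e + L * (2 * (c * r))" using ph by (simp add: dist_real_def)
    also have "L * (2 * (c * r)) = r/2 - c * r"
    proof -
      have "L * (2 * (c * r)) + c * r = (c * (1 + 2 * L)) * r" by (simp add: algebra_simps)
      then show ?thesis using c(3) by simp
    qed
    also have "p \<bullet> e + (r/2 - c * r) \<le> x \<bullet> e" using xe d de by linarith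
    finally have "\<not> x \<bullet> e < h (x - (x \<bullet> e) *\<^sub>R e)" by simp
    moreover have "x \<in> ball p r0" using xb r by auto
    ultimately have "x \<notin> \<Omega>" using eq by blast
    then show "x \<in> ball p r - \<Omega>" using xb by blast
  qed
  then show "\<exists>r0>0. \<exists>c>0. c \<le> 1 \<and> (\<forall>r. 0 < r \<and> r \<le> r0 \<longrightarrow> (\<exists>q. ball q (c * r) \<subseteq> ball p r - \<Omega>))"
    using r0 c by (intro exI[of _ r0] conjI exI[of _ c]) auto
qed

context bounded_open
begin

text \<open>Points of the exterior ball are within 2 r of x, where the kernel of radius 4 r has base
  at least r^2 and so dominates the small kernel of radius c r. A fixed fraction of the mass is thus
  lost to the exterior.\<close>

lemma integral_bump_exterior:
  assumes r: "r > 0" and x: "x \<in> ball p r" and c: "0 < c" "c \<le> 1" and q: "ball q (c * r) \<subseteq> ball p r - \<Omega>"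
  shows "(\<integral>\<xi>. bump 2 x (4 * r) \<xi> \<partial>M) \<le> (4 * r) ^ (DIM('a) + 4) * bump_mass TYPE('a) * (1 - (c/4) ^ (DIM('a) + 4))"
proof -
  let ?R = "4 * r" and ?m = "bump_mass TYPE('a)" and ?n = "DIM('a) + 4"
  have R: "?R > 0" and cr: "c * r > 0" using r c by auto
  have b1: "integrable lborel (bump 2 x ?R)" and b2: "integrable lborel (bump 2 q (c * r))"
    using R cr by (auto intro!: bump_integrable)
  have i1: "integrable lborel (\<lambda>\<xi>. indicator \<Omega> \<xi> * bump 2 x ?R \<xi>)"
    using integrable_mult_indicator[of \<Omega> lborel "bump 2 x ?R"] b1 by simp
  have "(\<integral>\<xi>. bump 2 x ?R \<xi> \<partial>M) + (c * r) ^ ?n * ?m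
      = (\<integral>\<xi>. indicator \<Omega> \<xi> * bump 2 x ?R \<xi> \<partial>lborel) + (\<integral>\<xi>. bump 2 q (c * r) \<xi> \<partial>lborel)"
    using integral_lebesgue_eq_lborel[OF borel_measurable_times[OF borel_measurable_indicator[OF sets_\<Omega>(2)]
      borel_measurable_continuous_onI[OF continuous_bump[of 2 x ?R]]]] bump_integral[OF cr, of q]
    by (simp add: integral_restrict_space)
  also have "\<dots> = (\<integral>\<xi>. indicator \<Omega> \<xi> * bump 2 x ?R \<xi> + bump 2 q (c * r) \<xi> \<partial>lborel)"
    using i1 b2 by simp
  also have "\<dots> \<le> (\<integral>\<xi>. bump 2 x ?R \<xi> \<partial>lborel)"
  proof (rule integral_mono)
    show "integrable lborel (\<lambda>\<xi>. indicator \<Omega> \<xi> * bump 2 x ?R \<xi> + bump 2 q (c * r) \<xi>)" using i1 b2 by simp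
    fix \<xi>
    show "indicator \<Omega> \<xi> * bump 2 x ?R \<xi> + bump 2 q (c * r) \<xi> \<le> bump 2 x ?R \<xi>"
    proof (cases "\<xi> \<in> ball q (c * r)")
      case False
      then show ?thesis using bump_zero[OF cr _ False, of 2] by (simp add: indicator_def)
    next
      case True
      then have "\<xi> \<in> ball p r" "\<xi> \<notin> \<Omega>" using q by auto
      then have "norm (\<xi> - x) \<le> 2 * r"
        using x dist_triangle[of \<xi> x p] by (simp add: dist_norm norm_minus_commute)
      then have "(norm (\<xi> - x))\<^sup>2 \<le> (2 * r)\<^sup>2" by (intro power_mono) auto
      then have m: "r\<^sup>2 \<le> ?R\<^sup>2 - (norm (\<xi> - x))\<^sup>2"
        using zero_le_power2[of r] unfolding power_mult_distrib by (simp, linarith)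
      have "bump 2 q (c * r) \<xi> \<le> (c * r) ^ 4" using bump_le[of 2 q "c * r" \<xi>] by simp
      also have "\<dots> \<le> (1 * r) ^ 4" using c r by (intro power_mono mult_right_mono) auto
      also have "\<dots> = (r\<^sup>2)\<^sup>2" by simp
      also have "\<dots> \<le> bump 2 x ?R \<xi>" unfolding bump_def using m by (intro power_mono) auto
      finally show ?thesis using \<open>\<xi> \<notin> \<Omega>\<close> by simp
    qed
  qed (rule b1)
  also have "\<dots> = ?R ^ ?n * ?m" by (rule bump_integral[OF R])
  finally have "(\<integral>\<xi>. bump 2 x ?R \<xi> \<partial>M) \<le> ?R ^ ?n * ?m - (c * r) ^ ?n * ?m" by simp
  also have "(c * r) ^ ?n = ?R ^ ?n * (c/4) ^ ?n"
    unfolding power_mult_distrib[symmetric] by (rule arg_cong[where f="\<lambda>t. t ^ ?n"]) simp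
  also have "?R ^ ?n * ?m - ?R ^ ?n * (c/4) ^ ?n * ?m = ?R ^ ?n * ?m * (1 - (c/4) ^ ?n)"
    by (simp only: right_diff_distrib mult_1_right mult_ac)
  finally show ?thesis .
qed

text \<open>The infimum of all S with P S is at most 1 - t times itself, hence 0. In the application
  P S says that S bounds the function near a boundary point.\<close>

lemma contraction_imp_zero:
  fixes P :: "real \<Rightarrow> bool"
  assumes B: "P B" and t: "0 < t" "t \<le> 1" and nn: "\<And>S. P S \<Longrightarrow> S \<ge> 0"
    and step: "\<And>S \<eta>. P S \<Longrightarrow> \<eta> > 0 \<Longrightarrow> P ((1 - t) * S + \<eta>)"
    and mono: "\<And>S S'. P S \<Longrightarrow> S \<le> S' \<Longrightarrow> P S'" and e: "e > 0"
  shows "P e"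
proof -
  define I where "I = Inf {S. P S}"
  have bdd: "bdd_below {S. P S}" using nn by (auto simp: bdd_below_def)
  have ne: "{S. P S} \<noteq> {}" using B by auto
  have I0: "I \<ge> 0" unfolding I_def using ne nn by (intro cInf_greatest) auto
  have le: "I \<le> (1 - t) * I + \<eta>" if \<eta>: "\<eta> > 0" for \<eta>
  proof -
    obtain S where S: "P S" "S < I + \<eta>/2"
      using cInf_lessD[OF ne, of "I + \<eta>/2"] \<eta> unfolding I_def by auto
    have "I \<le> (1 - t) * S + \<eta>/2"
      unfolding I_def using step[OF S(1), of "\<eta>/2"] \<eta> bdd by (intro cInf_lower) auto
    also have "(1 - t) * S \<le> (1 - t) * (I + \<eta>/2)" using S t by (intro mult_left_mono) auto
    also have "(1 - t) * (I + \<eta>/2) \<le> (1 - t) * I + \<eta>/2" using t \<eta> mult_right_mono[of "1 - t" 1 "\<eta>/2"] by (simp add: algebra_simps)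
    finally show ?thesis by simp
  qed
  have "t * I \<le> 0"
  proof (rule field_le_epsilon)
    fix \<eta> :: real assume "\<eta> > 0"
    from le[OF this] show "t * I \<le> 0 + \<eta>" by (simp add: left_diff_distrib)
  qed
  then have "I = 0" using I0 t by (simp add: mult_le_0_iff)
  then have "\<exists>S\<in>{S. P S}. S < e" using cInf_lessD[OF ne, of e] e unfolding I_def by simp
  then obtain S where S: "P S" "S < e" by blast
  show ?thesis by (rule mono[OF S(1)]) (use S(2) in simp)
qed

text \<open>The continuous representative is the limit of the means, attained at a locally uniform
  rate in the interior. At a boundary point the kernels lose a fixed fraction of their mass to the
  exterior, so every local bound improves by a fixed factor, up to a vanishing Morrey term.\<close>

lemma regularity:
  assumes W: "W u G" and eq: "weq G g" and g: "morrey \<theta> g K" and th: "\<theta> > 0"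
    and B: "AE x in M. \<bar>u x\<bar> \<le> B" and thick: "exterior_thick \<Omega>"
  obtains y where "continuous_on (closure \<Omega>) y" "\<And>x. x \<notin> \<Omega> \<Longrightarrow> y x = 0" "AE x in M. u x = y x"
proof -
  let ?c = "bump_mass TYPE('a)" and ?n = "DIM('a) + 4"
  have c: "?c > 0" by (rule bump_mass_pos)
  have uI: "integrable M u" using sqi_integrable_L1(1)[OF W_sqi(1)[OF W]] .
  define D where "D = \<bar>K\<bar> / (6 * \<theta>)"
  have D0: "D \<ge> 0" using th by (simp add: D_def)
  have KD: "K / (6 * \<theta>) \<le> D" using th by (simp add: D_def divide_right_mono)
  define l where "l x = lim (\<lambda>k. Av u (inverse (real (Suc k))) x)" for x
  have powr0: "((\<lambda>s. D * s powr \<theta>) \<longlongrightarrow> 0) (at_right 0)"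
  proof -
    have "((\<lambda>s. D * s powr \<theta>) \<longlongrightarrow> D * 0 powr \<theta>) (at_right 0)"
      using th by (intro tendsto_intros tendsto_powr') (auto intro: eventually_mono[OF eventually_at_right_less])
    then show ?thesis by simp
  qed
  have small: "\<exists>d>0. \<forall>s. 0 < s \<longrightarrow> s < d \<longrightarrow> D * s powr \<theta> < e" if "e > 0" for e
    using order_tendstoD(2)[OF powr0 that] unfolding eventually_at_right_field by auto
  have cau: "\<bar>Av u s x - Av u r x\<bar> \<le> D * r powr \<theta>" if "0 < s" "s \<le> r" "r \<le> 1" "cball x r \<subseteq> \<Omega>" for s r x
    using Av_interior_Cauchy[OF W eq g th that] mult_right_mono[OF KD, of "r powr \<theta>"] by simp
  have rad: "\<exists>r>0. r \<le> 1 \<and> cball x r \<subseteq> \<Omega>" if "x \<in> \<Omega>" for x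
  proof -
    obtain r where "r > 0" "cball x r \<subseteq> \<Omega>" using open_\<Omega> \<open>x \<in> \<Omega>\<close> open_contains_cball by blast
    then show ?thesis by (intro exI[of _ "min r 1"]) auto
  qed
  have conv: "(\<lambda>k. Av u (inverse (real (Suc k))) x) \<longlonglongrightarrow> l x" if x: "x \<in> \<Omega>" for x
  proof -
    obtain r where r: "r > 0" "r \<le> 1" "cball x r \<subseteq> \<Omega>" using rad[OF x] by blast
    have "Cauchy (\<lambda>k. Av u (inverse (real (Suc k))) x)"
    proof (rule metric_CauchyI)
      fix e :: real assume e: "e > 0"
      then obtain d where d: "d > 0" "\<And>s. 0 < s \<Longrightarrow> s < d \<Longrightarrow> D * s powr \<theta> < e/2" using small[of "e/2"] by auto
      define s where "s = min r (d/2)"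
      have s: "0 < s" "s < d" "s \<le> r" "s \<le> 1" using r d by (auto simp: s_def)
      have cs: "cball x s \<subseteq> \<Omega>" using r(3) s(3) by auto
      obtain N where N: "inverse (real (Suc N)) < s" using reals_Archimedean[OF s(1)] by auto
      have "\<bar>Av u (inverse (real (Suc k))) x - Av u s x\<bar> < e/2" if "k \<ge> N" for k
      proof -
        have "inverse (real (Suc k)) \<le> inverse (real (Suc N))" using that by (intro le_imp_inverse_le) auto
        then have "inverse (real (Suc k)) \<le> s" using N by linarith
        then show ?thesis using cau[of "inverse (real (Suc k))" s x] s(4) cs d(2)[OF s(1,2)] by simp
      qed
      then have "dist (Av u (inverse (real (Suc m))) x) (Av u (inverse (real (Suc k))) x) < e" if "m \<ge> N" "k \<ge> N" for m k
        using that unfolding dist_real_def by (smt (verit) field_sum_of_halves)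
      then show "\<exists>N. \<forall>m\<ge>N. \<forall>n\<ge>N. dist (Av u (inverse (real (Suc m))) x) (Av u (inverse (real (Suc n))) x) < e" by blast
    qed
    then show ?thesis unfolding l_def using Cauchy_convergent convergent_LIMSEQ_iff by blast
  qed
  have lA: "\<bar>l x - Av u s x\<bar> \<le> D * s powr \<theta>" if s01: "0 < s" "s \<le> 1" "cball x s \<subseteq> \<Omega>" for s x
  proof -
    have x: "x \<in> \<Omega>" using s01 by auto
    obtain N where N: "inverse (real (Suc N)) < s" using reals_Archimedean[OF s01(1)] by auto
    have "\<bar>Av u (inverse (real (Suc k))) x - Av u s x\<bar> \<le> D * s powr \<theta>" if "k \<ge> N" for k
    proof -
      have "inverse (real (Suc k)) \<le> inverse (real (Suc N))" using that by (intro le_imp_inverse_le) auto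
      then have "inverse (real (Suc k)) \<le> s" using N by linarith
      then show ?thesis using cau[of "inverse (real (Suc k))" s x] \<open>s \<le> 1\<close> \<open>cball x s \<subseteq> \<Omega>\<close> by simp
    qed
    then have ev: "\<forall>\<^sub>F k in sequentially. \<bar>Av u (inverse (real (Suc k))) x - Av u s x\<bar> \<le> D * s powr \<theta>"
      by (auto simp: eventually_sequentially)
    show ?thesis
      by (rule tendsto_upperbound[OF tendsto_rabs[OF tendsto_diff[OF conv[OF x] tendsto_const]] ev]) simp
  qed
  \<comment> \<open>The means carry the mass of the kernel, hence the division. The value 0 outside
    \<Omega> is the boundary value.\<close>
  define y where "y x = (if x \<in> \<Omega> then l x / ?c else 0)" for x
  have y0: "y x = 0" if "x \<notin> \<Omega>" for x using that by (simp add: y_def)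
  \<comment> \<open>The radii along which the means recover u almost everywhere differ from the
    radii 1/(k+1) that define \<open>l\<close>, but at an interior point all sequences of radii
    tending to 0 give the same limit.\<close>
  have yu: "AE x in M. u x = y x"
  proof -
    obtain s where s: "\<And>k::nat. 0 < s k" "s \<longlonglongrightarrow> 0" "AE x in M. (\<lambda>k. Av u (s k) x) \<longlonglongrightarrow> ?c * u x"
      by (rule Av_AE_tendsto[OF W], rule that)
    have "(\<lambda>k. Av u (s k) x) \<longlonglongrightarrow> l x" if x: "x \<in> \<Omega>" for x
    proof -
      obtain r where r: "r > 0" "r \<le> 1" "cball x r \<subseteq> \<Omega>" using rad[OF x] by blast
      have "filterlim s (at_right 0) sequentially"
        using s(1) by (intro tendsto_imp_filterlim_at_right[OF s(2)]) simp
      then have "(\<lambda>k. D * s k powr \<theta>) \<longlonglongrightarrow> 0" by (rule filterlim_compose[OF powr0])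
      moreover have "\<forall>\<^sub>F k in sequentially. norm (Av u (s k) x - l x) \<le> D * s k powr \<theta>"
        using order_tendstoD(2)[OF s(2) r(1)]
      proof eventually_elim
        case (elim k)
        then have "cball x (s k) \<subseteq> \<Omega>" using r by auto
        then show ?case using lA[of "s k" x] s(1)[of k] elim r by (simp add: abs_minus_commute)
      qed
      ultimately have "(\<lambda>k. Av u (s k) x - l x) \<longlonglongrightarrow> 0" by (rule Lim_null_comparison[rotated])
      then show ?thesis by (simp add: LIM_zero_iff)
    qed
    then have "x \<in> \<Omega> \<Longrightarrow> (\<lambda>k. Av u (s k) x) \<longlonglongrightarrow> ?c * u x \<Longrightarrow> u x = y x" for x
      using LIMSEQ_unique c by (fastforce simp: y_def)
    then show ?thesis using s(3) by (auto elim!: AE_mp)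
  qed
  \<comment> \<open>Unlike \<open>lA\<close>, this bound admits balls that leave \<Omega>, as the
    boundary argument requires.\<close>
  have bnd: "\<bar>y x\<bar> \<le> (Av (\<lambda>x. \<bar>u x\<bar>) R x + D * R powr \<theta>) / ?c" if x: "x \<in> \<Omega>" and R: "0 < R" "R \<le> 1" for x R
  proof -
    have "\<bar>Av u s x\<bar> \<le> Av (\<lambda>x. \<bar>u x\<bar>) R x + D * R powr \<theta>" if s: "0 < s" "s \<le> R" for s
    proof -
      have "Av (\<lambda>x. \<bar>u x\<bar>) s x \<le> Av (\<lambda>x. \<bar>u x\<bar>) R x + K / (6 * \<theta>) * R powr \<theta>"
        by (rule Av_abs_le_mono[where k="\<lambda>x. 0", OF W _ _ _ g th s R(2)]) (use eq in auto)
      then show ?thesis using Av_abs[OF uI s(1), of x] mult_right_mono[OF KD, of "R powr \<theta>"] by simp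
    qed
    moreover obtain N where N: "inverse (real (Suc N)) < R" using reals_Archimedean[OF R(1)] by auto
    moreover have "inverse (real (Suc k)) \<le> inverse (real (Suc N))" if "k \<ge> N" for k
      using that by (intro le_imp_inverse_le) auto
    ultimately have ev: "\<forall>\<^sub>F k in sequentially. \<bar>Av u (inverse (real (Suc k))) x\<bar> \<le> Av (\<lambda>x. \<bar>u x\<bar>) R x + D * R powr \<theta>"
      unfolding eventually_sequentially by (intro exI[of _ N]) (smt (verit) inverse_positive_iff_positive of_nat_0_less_iff zero_less_Suc)
    have "\<bar>l x\<bar> \<le> Av (\<lambda>x. \<bar>u x\<bar>) R x + D * R powr \<theta>"
      by (rule tendsto_upperbound[OF tendsto_rabs[OF conv[OF x]] ev]) simp
    then show ?thesis using c x by (simp add: y_def abs_divide divide_right_mono)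
  qed
  have int_cont: "isCont y x0" if x0: "x0 \<in> \<Omega>" for x0
    unfolding isCont_def
  proof (rule tendstoI)
    fix e :: real assume e: "e > 0"
    obtain r where r: "r > 0" "r \<le> 1" "cball x0 r \<subseteq> \<Omega>" using rad[OF x0] by blast
    have ec: "?c * e / 3 > 0" using c e by simp
    obtain d where d: "d > 0" "\<And>s. 0 < s \<Longrightarrow> s < d \<Longrightarrow> D * s powr \<theta> < ?c * e / 3" using small[OF ec] by auto
    \<comment> \<open>A single radius serves all x within r/2 of x0: there the limits are uniformly
      close to the mean of radius s, which is continuous.\<close>
    define s where "s = min (r/2) (d/2)"
    have s: "0 < s" "s < d" "s \<le> r/2" "s \<le> 1" using r d by (auto simp: s_def)
    have "isCont (Av u s) x0" using continuous_Av[OF uI, of s] by (simp add: continuous_on_eq_continuous_at)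
    then have "\<forall>\<^sub>F x in at x0. dist (Av u s x) (Av u s x0) < ?c * e / 3" using ec unfolding isCont_def tendsto_iff by blast
    moreover have "\<forall>\<^sub>F x in at x0. dist x x0 < r/2" unfolding eventually_at using r(1) by (intro exI[of _ "r/2"]) simp
    ultimately show "\<forall>\<^sub>F x in at x0. dist (y x) (y x0) < e"
    proof eventually_elim
      case (elim x)
      have "cball x s \<subseteq> cball x0 r"
        using elim(2) s(3) by (intro cball_subset_cball_iff[THEN iffD2] disjI1) (simp add: dist_commute)
      moreover have "cball x0 s \<subseteq> cball x0 r" using s(3) r(1) by (intro subset_cball) linarith
      ultimately have "cball x s \<subseteq> \<Omega>" "cball x0 s \<subseteq> \<Omega>" using r(3) by blast+
      then have "\<bar>l x - Av u s x\<bar> < ?c * e / 3" "\<bar>l x0 - Av u s x0\<bar> < ?c * e / 3" "x \<in> \<Omega>"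
        using lA[of s x] lA[of s x0] d(2)[OF s(1,2)] s by auto
      then have "\<bar>l x - l x0\<bar> < ?c * e" using elim(1) unfolding dist_real_def by linarith
      then show ?case using \<open>x \<in> \<Omega>\<close> x0 c
        by (simp add: y_def dist_real_def abs_divide pos_divide_less_eq mult.commute flip: diff_divide_distrib)
    qed
  qed
  have bdry: "\<exists>r>0. \<forall>x\<in>ball p r. \<bar>y x\<bar> \<le> e" if p: "p \<in> frontier \<Omega>" and e: "e > 0" for p e
  proof -
    obtain r0 k where r0: "r0 > 0" and k: "0 < k" "k \<le> 1"
      and q: "\<And>r. 0 < r \<Longrightarrow> r \<le> r0 \<Longrightarrow> \<exists>q. ball q (k * r) \<subseteq> ball p r - \<Omega>"
      using thick p unfolding exterior_thick_def by metis
    define t where "t = (k/4) ^ ?n"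
    have t: "0 < t" "t \<le> 1" using k unfolding t_def by (auto intro: power_le_one)
    define P where "P S \<longleftrightarrow> S \<ge> 0 \<and> (\<exists>r>0. \<forall>x\<in>ball p r. \<bar>y x\<bar> \<le> S)" for S
    have "P e"
    proof (rule contraction_imp_zero[OF _ t])
      define B' where "B' = \<bar>B\<bar> + D / ?c"
      have "\<bar>y x\<bar> \<le> B'" for x
      proof (cases "x \<in> \<Omega>")
        case True
        have "Av (\<lambda>x. \<bar>u x\<bar>) 1 x \<le> \<bar>B\<bar> * ?c"
        proof (rule Av_const_le)
          show "AE x in M. \<bar>u x\<bar> \<le> \<bar>B\<bar>" using B by eventually_elim auto
        qed (use uI in auto)
        then have "(Av (\<lambda>x. \<bar>u x\<bar>) 1 x + D) / ?c \<le> (\<bar>B\<bar> * ?c + D) / ?c" using c by (intro divide_right_mono) auto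
        also have "\<dots> = B'" using c by (simp add: B'_def add_divide_distrib)
        finally show ?thesis using bnd[OF True, of 1] by simp
      qed (use y0 D0 c in \<open>simp add: B'_def\<close>)
      then show "P B'" unfolding P_def using D0 c by (auto simp: B'_def intro: exI[of _ 1])
      fix S \<eta> :: real assume S: "P S" and \<eta>: "\<eta> > 0"
      then obtain r1 where r1: "r1 > 0" "\<And>x. x \<in> ball p r1 \<Longrightarrow> \<bar>y x\<bar> \<le> S" and S0: "S \<ge> 0" unfolding P_def by blast
      have ec: "?c * \<eta> > 0" using c \<eta> by simp
      obtain d where d: "d > 0" "\<And>s. 0 < s \<Longrightarrow> s < d \<Longrightarrow> D * s powr \<theta> < ?c * \<eta>" using small[OF ec] by auto
      \<comment> \<open>With r1/5, a ball of radius 4 r about a point of \<open>ball p r\<close>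
        stays where the bound S is known. The other entries provide the exterior ball, a small
        Morrey term and a radius 4 r of at most 1.\<close>
      define r where "r = Min {r0, r1/5, d/5, 1/4}"
      have r: "r > 0" "r \<le> r0" "5 * r \<le> r1" "4 * r < d" "4 * r \<le> 1"
        using r0 r1 d unfolding r_def by (auto simp: min_def)
      obtain q' where q': "ball q' (k * r) \<subseteq> ball p r - \<Omega>" using q[OF r(1,2)] by blast
      have "\<bar>y x\<bar> \<le> (1 - t) * S + \<eta>" if x: "x \<in> ball p r" for x
      proof (cases "x \<in> \<Omega>")
        case True
        have R: "0 < 4 * r" using r by simp
        have "(\<integral>\<xi>. \<bar>u \<xi>\<bar> * bump 2 x (4 * r) \<xi> \<partial>M) \<le> (\<integral>\<xi>. S * bump 2 x (4 * r) \<xi> \<partial>M)"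
        proof (rule integral_mono_AE)
          show "integrable M (\<lambda>\<xi>. \<bar>u \<xi>\<bar> * bump 2 x (4 * r) \<xi>)" "integrable M (\<lambda>\<xi>. S * bump 2 x (4 * r) \<xi>)"
            using integrable_bump[OF integrable_abs[OF uI]] integrable_bump[of "\<lambda>_. S"] by auto
          show "AE \<xi> in M. \<bar>u \<xi>\<bar> * bump 2 x (4 * r) \<xi> \<le> S * bump 2 x (4 * r) \<xi>"
            using yu
          proof eventually_elim
            case (elim \<xi>)
            show ?case
            proof (cases "\<xi> \<in> ball x (4 * r)")
              case True
              then have "\<xi> \<in> ball p r1" using x r dist_triangle[of p \<xi> x] by (simp add: dist_commute)
              then show ?thesis using r1(2) elim by (intro mult_right_mono) auto
            next
              case False
              then show ?thesis using bump_zero[OF R _ False, of 2] by simp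
            qed
          qed
        qed
        also have "\<dots> = S * (\<integral>\<xi>. bump 2 x (4 * r) \<xi> \<partial>M)" by simp
        also have "\<dots> \<le> S * ((4 * r) ^ ?n * ?c * (1 - t))"
          unfolding t_def by (intro mult_left_mono integral_bump_exterior[OF r(1) x k q'] S0)
        finally have "Av (\<lambda>x. \<bar>u x\<bar>) (4 * r) x \<le> S * ((4 * r) ^ ?n * ?c * (1 - t)) / (4 * r) ^ ?n"
          unfolding Av_def using R by (intro divide_right_mono) auto
        also have "\<dots> = ?c * ((1 - t) * S)" using R by simp
        finally have "Av (\<lambda>x. \<bar>u x\<bar>) (4 * r) x \<le> ?c * ((1 - t) * S)" .
        then have "Av (\<lambda>x. \<bar>u x\<bar>) (4 * r) x + D * (4 * r) powr \<theta> \<le> ?c * ((1 - t) * S + \<eta>)"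
          using d(2)[OF R r(4)] by (simp add: distrib_left)
        then have "(Av (\<lambda>x. \<bar>u x\<bar>) (4 * r) x + D * (4 * r) powr \<theta>) / ?c \<le> (1 - t) * S + \<eta>"
          using c by (simp add: pos_divide_le_eq mult.commute)
        then show ?thesis using bnd[OF True R r(5)] by simp
      next
        case False
        have "0 \<le> (1 - t) * S" using t S0 by simp
        then show ?thesis using y0[OF False] \<eta> by simp
      qed
      then show "P ((1 - t) * S + \<eta>)" unfolding P_def using r(1) t S0 \<eta> by (intro conjI add_nonneg_nonneg) auto
    qed (use e in \<open>auto simp: P_def intro: order_trans\<close>)
    then show ?thesis by (simp add: P_def)
  qed
  have "continuous_on (closure \<Omega>) y"
    unfolding continuous_on_eq_continuous_within
  proof
    fix x assume x: "x \<in> closure \<Omega>"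
    show "continuous (at x within closure \<Omega>) y"
    proof (cases "x \<in> \<Omega>")
      case True
      then show ?thesis using int_cont continuous_at_imp_continuous_at_within by blast
    next
      case False
      then have xf: "x \<in> frontier \<Omega>" using x open_\<Omega> by (simp add: frontier_def interior_open)
      show ?thesis unfolding continuous_within tendsto_iff
      proof (intro allI impI)
        fix e :: real assume "e > 0"
        then have "e/2 > 0" by simp
        then obtain r where r: "r > 0" "\<forall>z\<in>ball x r. \<bar>y z\<bar> \<le> e/2" using bdry[OF xf] by blast
        have "\<bar>y z\<bar> < e" if "dist z x < r" for z
          using r(2)[rule_format, of z] that \<open>e > 0\<close> by (auto simp: dist_commute)
        then show "\<forall>\<^sub>F z in at x within closure \<Omega>. dist (y z) (y x) < e"
          using r(1) y0[OF False] unfolding eventually_at by (intro exI[of _ r]) (simp add: dist_real_def)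
      qed
    qed
  qed
  then show ?thesis using that y0 yu by blast
qed

end

section \<open>Semilinear equation\<close>

context bounded_open
begin

lemma AE_M_iff: "(AE x in M. P x) \<longleftrightarrow> (AE x in lebesgue. x \<in> \<Omega> \<longrightarrow> P x)"
  by (rule AE_restrict_space_iff) simp

lemma id_meas_M: "(\<lambda>x. x) \<in> borel_measurable M"
  using id_borel_measurable_lebesgue_on[of \<Omega>] by (simp add: id_def)

lemma morrey_nonneg: "morrey \<theta> g K \<Longrightarrow> K \<ge> 0"
proof -
  assume g: "morrey \<theta> g K"
  have "0 \<le> (\<integral>\<xi>. indicator (ball undefined 1) \<xi> * \<bar>g \<xi>\<bar> \<partial>M)" by (intro integral_nonneg_AE) auto
  also have "\<dots> \<le> K * 1 ^ DIM('a) * 1 powr (\<theta> - 2)" using g unfolding morrey_def by (metis less_numeral_extra(1) order_refl)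
  finally show ?thesis by simp
qed

lemma integrable_ball:
  fixes g :: "'a \<Rightarrow> real"
  assumes "integrable M g"
  shows "integrable M (\<lambda>\<xi>. indicator (ball x s) \<xi> * \<bar>g \<xi>\<bar>)"
proof (rule Bochner_Integration.integrable_bound[OF assms])
  have [measurable]: "g \<in> borel_measurable M" using assms by auto
  show "(\<lambda>\<xi>. indicator (ball x s) \<xi> * \<bar>g \<xi>\<bar>) \<in> borel_measurable M" by measurable
  show "AE \<xi> in M. norm (indicator (ball x s) \<xi> * \<bar>g \<xi>\<bar>) \<le> norm (g \<xi>)"
    by (intro AE_I2) (simp add: indicator_def)
qed

lemma morrey_weaken:
  assumes "morrey \<theta> g K" "\<theta>' \<le> \<theta>"
  shows "morrey \<theta>' g K"
proof -
  have "K * s ^ DIM('a) * s powr (\<theta> - 2) \<le> K * s ^ DIM('a) * s powr (\<theta>' - 2)" if "0 < s" "s \<le> 1" for s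
    using that morrey_nonneg[OF assms(1)] assms(2) by (intro mult_left_mono powr_mono') auto
  then show ?thesis using assms(1) unfolding morrey_def by (meson order_trans)
qed

lemma morrey_mono:
  assumes "morrey \<theta> g K" "integrable M h" "AE x in M. \<bar>h x\<bar> \<le> \<bar>g x\<bar>"
  shows "morrey \<theta> h K"
proof -
  have g: "integrable M g" using assms(1) by (simp add: morrey_def)
  have "(\<integral>\<xi>. indicator (ball x s) \<xi> * \<bar>h \<xi>\<bar> \<partial>M) \<le> (\<integral>\<xi>. indicator (ball x s) \<xi> * \<bar>g \<xi>\<bar> \<partial>M)" for x s
    by (rule integral_mono_AE[OF integrable_ball[OF assms(2)] integrable_ball[OF g]])
      (use assms(3) in \<open>eventually_elim, auto simp: indicator_def\<close>)
  then show ?thesis using assms unfolding morrey_def by (meson order_trans)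
qed

lemma morrey_add:
  assumes "morrey \<theta> g K" "morrey \<theta> h L"
  shows "morrey \<theta> (\<lambda>x. g x + h x) (K + L)"
proof -
  have I: "integrable M g" "integrable M h" using assms by (auto simp: morrey_def)
  have "(\<integral>\<xi>. indicator (ball x s) \<xi> * \<bar>g \<xi> + h \<xi>\<bar> \<partial>M) \<le> (K + L) * s ^ DIM('a) * s powr (\<theta> - 2)"
    if s: "0 < s" "s \<le> 1" for x s
  proof -
    have "(\<integral>\<xi>. indicator (ball x s) \<xi> * \<bar>g \<xi> + h \<xi>\<bar> \<partial>M)
        \<le> (\<integral>\<xi>. indicator (ball x s) \<xi> * \<bar>g \<xi>\<bar> + indicator (ball x s) \<xi> * \<bar>h \<xi>\<bar> \<partial>M)"
      using integrable_ball[OF I(1)] integrable_ball[OF I(2)] integrable_ball[of "\<lambda>x. g x + h x" x s] I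
      by (intro integral_mono) (auto simp: indicator_def)
    also have "\<dots> = (\<integral>\<xi>. indicator (ball x s) \<xi> * \<bar>g \<xi>\<bar> \<partial>M) + (\<integral>\<xi>. indicator (ball x s) \<xi> * \<bar>h \<xi>\<bar> \<partial>M)"
      using integrable_ball[OF I(1)] integrable_ball[OF I(2)] by simp
    also have "\<dots> \<le> K * s ^ DIM('a) * s powr (\<theta> - 2) + L * s ^ DIM('a) * s powr (\<theta> - 2)"
      using assms s unfolding morrey_def by (intro add_mono) auto
    finally show ?thesis by (simp add: distrib_right)
  qed
  then show ?thesis using I unfolding morrey_def by auto
qed

lemma morrey_uminus: "morrey \<theta> g K \<Longrightarrow> morrey \<theta> (\<lambda>x. - g x) K"
  by (rule morrey_mono) (auto simp: morrey_def)

lemma measure_M_ball_le: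
  assumes "s > 0"
  shows "(\<integral>\<xi>. indicator (ball x s) \<xi> \<partial>M) \<le> 2 ^ DIM('a) * s ^ DIM('a)"
proof -
  let ?S = "\<Sum>b\<in>(Basis::'a set). s *\<^sub>R b"
  have "(\<integral>\<xi>. indicator (ball x s) \<xi> \<partial>M) = (\<integral>\<xi>. indicat_real (\<Omega> \<inter> ball x s) \<xi> \<partial>lebesgue)"
  proof -
    have "(\<lambda>\<xi>. indicat_real \<Omega> \<xi> *\<^sub>R indicat_real (ball x s) \<xi>) = indicat_real (\<Omega> \<inter> ball x s)"
      by (auto simp: indicator_def)
    then show ?thesis using integral_restrict_space[of \<Omega> lebesgue "indicat_real (ball x s)"] sets_\<Omega>(1)
      by (metis Int_UNIV_right space_completion space_lborel space_borel)
  qed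
  also have "\<dots> = measure lebesgue (\<Omega> \<inter> ball x s)" by simp
  also have "\<dots> \<le> measure lebesgue (cbox (x - ?S) (x + ?S))"
  proof (rule measure_mono_fmeasurable)
    show "\<Omega> \<inter> ball x s \<subseteq> cbox (x - ?S) (x + ?S)"
    proof
      fix \<xi> assume "\<xi> \<in> \<Omega> \<inter> ball x s"
      then have "norm (\<xi> - x) < s" by (simp add: dist_norm norm_minus_commute)
      then have "\<bar>(\<xi> - x) \<bullet> b\<bar> \<le> s" if "b \<in> Basis" for b using Basis_le_norm[OF that, of "\<xi> - x"] by linarith
      then show "\<xi> \<in> cbox (x - ?S) (x + ?S)" by (auto simp: mem_box inner_simps abs_le_iff)
          (smt (verit) inner_commute)+
    qed
  qed (auto intro: open_\<Omega>)
  also have "\<dots> = (2 * s) ^ DIM('a)"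
    using assms by (simp add: measure_completion measure_lborel_cbox_eq inner_simps)
  finally show ?thesis by (simp add: power_mult_distrib)
qed

end

section \<open>Elliptic estimates in dimensions two and three, and growth of the
  nonlinearity\<close>

locale semilinear = bounded_open \<Omega> for \<Omega> :: "'a::euclidean_space set" +
  fixes f :: "'a \<Rightarrow> real \<Rightarrow> real"
  assumes dim: "DIM('a) = 2 \<or> DIM('a) = 3"
    and thick: "exterior_thick \<Omega>"
    and f_borel: "(\<lambda>(x, y). f x y) \<in> borel_measurable (restrict_space borel (\<Omega> \<times> UNIV))"
    and f_C2: "\<forall>x\<in>\<Omega>. \<forall>y. (f x has_real_derivative fy f x y) (at y) \<and>
                   (fy f x has_real_derivative fyy f x y) (at y)"
    and f0: "\<exists>p. p > real DIM('a) / 2 \<and> set_integrable lebesgue \<Omega> (\<lambda>x. \<bar>f x 0\<bar> powr p)"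
    and f_mono: "AE x in lebesgue. x \<in> \<Omega> \<longrightarrow> (\<forall>y. fy f x y \<ge> 0)"
    and f_bound: "\<forall>M. \<exists>C. AE x in lebesgue. x \<in> \<Omega> \<longrightarrow>
                    (\<forall>y. \<bar>y\<bar> \<le> M \<longrightarrow> \<bar>fy f x y\<bar> + \<bar>fyy f x y\<bar> \<le> C)"
    and f_cont: "\<forall>M. \<forall>\<rho>>0. \<exists>\<epsilon>>0. AE x in lebesgue. x \<in> \<Omega> \<longrightarrow>
                   (\<forall>y1 y2. \<bar>y1\<bar> \<le> M \<and> \<bar>y2\<bar> \<le> M \<and> \<bar>y2 - y1\<bar> < \<epsilon> \<longrightarrow>
                      \<bar>fyy f x y2 - fyy f x y1\<bar> \<le> \<rho>)"
begin

definition Cm :: real where "Cm = sqrt (2 ^ DIM('a))"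
text \<open>Factor from the L^2 norm of the data to the sup norm of the solution: the first summand
  bounds the L^1 norm through the Poincare inequality, the second is the Morrey term 1/(6 \<theta>)
  at \<theta> = 1/2.\<close>

definition Cinf :: real where
  "Cinf = (sqrt (measure M (space M)) * CP\<^sup>2 + Cm / 3) / bump_mass TYPE('a)"

lemma Cinf_nonneg: "Cinf \<ge> 0"
  unfolding Cinf_def Cm_def using bump_mass_pos[where 'a='a] by auto

text \<open>Cauchy-Schwarz against the indicator of the ball gives the power n/2 of s. For s \<le> 1
  this is at most the power n - 3/2, because n \<le> 3.\<close>

lemma L2_morrey:
  assumes v: "sqi M v"
  shows "morrey (1/2) v (Cm * nrm2 M v)"
  unfolding morrey_def
proof (intro conjI allI impI)
  show "integrable M v" by (rule sqi_integrable_L1(1)[OF v])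
  fix x s assume s: "0 < (s::real)" "s \<le> 1"
  let ?n = "DIM('a)"
  have si: "sqi M (indicat_real (ball x s))"
    by (rule sqi_AE_bounded(1)[where C=1]) (auto simp: indicator_def)
  have "(nrm2 M (indicat_real (ball x s)))\<^sup>2 = (\<integral>\<xi>. indicator (ball x s) \<xi> \<partial>M)"
    unfolding nrm2_power2 by (intro arg_cong[where f="integral\<^sup>L M"] ext) (simp add: indicator_def)
  also have "\<dots> \<le> 2 ^ ?n * s ^ ?n" by (rule measure_M_ball_le[OF s(1)])
  finally have "nrm2 M (indicat_real (ball x s)) \<le> sqrt (2 ^ ?n * s ^ ?n)" by (rule real_le_rsqrt)
  also have "\<dots> = Cm * s powr (?n / 2)"
    using s by (simp add: Cm_def real_sqrt_mult powr_half_sqrt[symmetric] powr_realpow[symmetric] powr_powr)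
  also have "\<dots> \<le> Cm * (s ^ ?n * s powr (1/2 - 2))"
  proof -
    have "s ^ ?n * s powr (1/2 - 2) = s powr (?n + (1/2 - 2))"
      using s by (simp add: powr_realpow[symmetric] powr_add[symmetric])
    moreover have "s powr (?n / 2) \<le> s powr (?n + (1/2 - 2))"
      using s dim by (intro powr_mono') auto
    ultimately show ?thesis by (simp add: Cm_def mult_left_mono)
  qed
  finally have b: "nrm2 M (indicat_real (ball x s)) \<le> Cm * (s ^ ?n * s powr (1/2 - 2))" .
  have "(\<integral>\<xi>. indicator (ball x s) \<xi> * \<bar>v \<xi>\<bar> \<partial>M) \<le> nrm2 M (indicat_real (ball x s)) * nrm2 M (\<lambda>x. norm (v x))"
    using sqi_CS_mult[OF si sqi_norm[OF v]] by simp
  also have "\<dots> \<le> Cm * (s ^ ?n * s powr (1/2 - 2)) * nrm2 M v"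
    unfolding nrm2_norm by (intro mult_right_mono b) simp
  finally show "(\<integral>\<xi>. indicator (ball x s) \<xi> * \<bar>v \<xi>\<bar> \<partial>M) \<le> Cm * nrm2 M v * s ^ ?n * s powr (1/2 - 2)"
    by (simp only: mult_ac)
qed

text \<open>Tested with u, the term k has a favourable sign and drops out, so the constants do not
  depend on it. This uniformity serves linearised equations at varying states and differences of
  states alike.\<close>

lemma weq_bounds:
  assumes W: "W u G" and eq: "weq G (\<lambda>x. g x - k x)" and g: "sqi M g" and k: "sqi M k"
    and sg: "AE x in M. 0 \<le> k x * u x"
  shows "nrm2 M G \<le> CP * nrm2 M g" "nrm2 M u \<le> CP\<^sup>2 * nrm2 M g" "AE x in M. \<bar>u x\<bar> \<le> Cinf * nrm2 M g"
proof -
  note sW = W_sqi[OF W]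
  have "(nrm2 M G)\<^sup>2 = (\<integral>x. (g x - k x) * u x \<partial>M)"
    using weq_W[OF eq sW(2) sqi_diff[OF g k] W] by (simp add: nrm2_power2 power2_norm_eq_inner)
  also have "\<dots> \<le> (\<integral>x. g x * u x \<partial>M)"
    by (rule integral_mono_AE[OF sqi_mult_integrable[OF sqi_diff[OF g k] sW(1)] sqi_mult_integrable[OF g sW(1)]])
      (use sg in \<open>eventually_elim, auto simp: left_diff_distrib\<close>)
  also have "\<dots> \<le> nrm2 M g * nrm2 M u" using sqi_CS_mult[OF g sW(1)] by simp
  also have "\<dots> \<le> nrm2 M g * (CP * nrm2 M G)" by (intro mult_left_mono W_poincare[OF W]) simp
  finally have *: "nrm2 M G * nrm2 M G \<le> nrm2 M G * (CP * nrm2 M g)" by (simp add: power2_eq_square mult_ac)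
  show 1: "nrm2 M G \<le> CP * nrm2 M g"
  proof (cases "nrm2 M G = 0")
    case False
    then have "nrm2 M G > 0" using nrm2_nonneg[of M G] by linarith
    then show ?thesis using * mult_le_cancel_left_pos by blast
  qed (use CP(1) in simp)
  have "nrm2 M u \<le> CP * nrm2 M G" by (rule W_poincare[OF W])
  also have "\<dots> \<le> CP * (CP * nrm2 M g)" using 1 CP(1) by (intro mult_left_mono) auto
  finally show 2: "nrm2 M u \<le> CP\<^sup>2 * nrm2 M g" by (simp add: power2_eq_square)
  have "(\<integral>x. \<bar>u x\<bar> \<partial>M) \<le> sqrt (measure M (space M)) * nrm2 M u"
    using sqi_integrable_L1(2)[OF sW(1)] by simp
  also have "\<dots> \<le> sqrt (measure M (space M)) * (CP\<^sup>2 * nrm2 M g)" by (intro mult_left_mono 2) simp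
  finally have 3: "(\<integral>x. \<bar>u x\<bar> \<partial>M) \<le> sqrt (measure M (space M)) * (CP\<^sup>2 * nrm2 M g)" .
  have "AE x in M. \<bar>u x\<bar> \<le> ((\<integral>x. \<bar>u x\<bar> \<partial>M) + Cm * nrm2 M g / (6 * (1/2))) / bump_mass TYPE('a)"
    by (rule Linfty_bound[OF W eq sqi_integrable_L1(1)[OF k] sg L2_morrey[OF g]]) simp
  moreover have "((\<integral>x. \<bar>u x\<bar> \<partial>M) + Cm * nrm2 M g / (6 * (1/2))) / bump_mass TYPE('a) \<le> Cinf * nrm2 M g"
  proof -
    have "Cinf * nrm2 M g = (sqrt (measure M (space M)) * (CP\<^sup>2 * nrm2 M g) + Cm * nrm2 M g / (6 * (1/2))) / bump_mass TYPE('a)"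
      by (simp add: Cinf_def field_simps)
    then show ?thesis using 3 bump_mass_pos[where 'a='a] by (simp add: divide_right_mono)
  qed
  ultimately show "AE x in M. \<bar>u x\<bar> \<le> Cinf * nrm2 M g" by (auto elim!: AE_mp)
qed

lemma f_meas:
  assumes "c \<in> borel_measurable M"
  shows "(\<lambda>x. f x (c x)) \<in> borel_measurable M"
proof -
  have "(\<lambda>x. (x, c x)) \<in> M \<rightarrow>\<^sub>M borel"
    by (rule borel_measurable_Pair[OF id_meas_M assms])
  then have "(\<lambda>x. (x, c x)) \<in> M \<rightarrow>\<^sub>M restrict_space borel (\<Omega> \<times> UNIV)"
    by (intro measurable_restrict_space2) auto
  from measurable_compose[OF this f_borel] show ?thesis by simp
qed

lemma difference_quotient_LIMSEQ:
  fixes g :: "real \<Rightarrow> real"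
  assumes "(g has_real_derivative D) (at y)"
  shows "(\<lambda>k. (g (y + inverse (real (Suc k))) - g y) / inverse (real (Suc k))) \<longlonglongrightarrow> D"
proof -
  have "filterlim (\<lambda>k. inverse (real (Suc k))) (at 0) sequentially"
    using LIMSEQ_inverse_real_of_nat by (auto simp: filterlim_at)
  then show ?thesis
    using filterlim_compose[OF assms[unfolded DERIV_def]] by blast
qed

text \<open>Borel measurability is assumed of f; its derivative inherits measurability as a limit of
  difference quotients.\<close>

lemma fy_meas:
  assumes "c \<in> borel_measurable M"
  shows "(\<lambda>x. fy f x (c x)) \<in> borel_measurable M"
proof (rule borel_measurable_LIMSEQ_real)
  show "(\<lambda>k. (f x (c x + inverse (real (Suc k))) - f x (c x)) / inverse (real (Suc k))) \<longlonglongrightarrow> fy f x (c x)"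
    if "x \<in> space M" for x
    using that f_C2 by (intro difference_quotient_LIMSEQ) auto
  show "(\<lambda>x. (f x (c x + inverse (real (Suc k))) - f x (c x)) / inverse (real (Suc k))) \<in> borel_measurable M" for k
    using assms by (intro borel_measurable_divide borel_measurable_diff f_meas borel_measurable_add) auto
qed

lemma fyy_meas:
  assumes "c \<in> borel_measurable M"
  shows "(\<lambda>x. fyy f x (c x)) \<in> borel_measurable M"
proof (rule borel_measurable_LIMSEQ_real)
  show "(\<lambda>k. (fy f x (c x + inverse (real (Suc k))) - fy f x (c x)) / inverse (real (Suc k))) \<longlonglongrightarrow> fyy f x (c x)"
    if "x \<in> space M" for x
    using that f_C2 by (intro difference_quotient_LIMSEQ) auto
  show "(\<lambda>x. (fy f x (c x + inverse (real (Suc k))) - fy f x (c x)) / inverse (real (Suc k))) \<in> borel_measurable M" for k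
    using assms by (intro borel_measurable_divide borel_measurable_diff fy_meas borel_measurable_add) auto
qed

lemma f_props:
  obtains C where "C \<ge> 0"
    "AE x in M. x \<in> \<Omega> \<and> (\<forall>t. \<bar>t\<bar> \<le> m \<longrightarrow> 0 \<le> fy f x t \<and> fy f x t \<le> C \<and> \<bar>fyy f x t\<bar> \<le> C)"
proof -
  obtain C where C: "AE x in M. \<forall>y. \<bar>y\<bar> \<le> m \<longrightarrow> \<bar>fy f x y\<bar> + \<bar>fyy f x y\<bar> \<le> C"
    using f_bound unfolding AE_M_iff by blast
  have p: "AE x in M. \<forall>y. fy f x y \<ge> 0" using f_mono unfolding AE_M_iff .
  have s: "AE x in M. x \<in> \<Omega>" by (rule AE_I2) simp
  have "AE x in M. x \<in> \<Omega> \<and> (\<forall>t. \<bar>t\<bar> \<le> m \<longrightarrow> 0 \<le> fy f x t \<and> fy f x t \<le> \<bar>C\<bar> \<and> \<bar>fyy f x t\<bar> \<le> \<bar>C\<bar>)"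
    using C p s
  proof eventually_elim
    case (elim x)
    have "0 \<le> fy f x t \<and> fy f x t \<le> \<bar>C\<bar> \<and> \<bar>fyy f x t\<bar> \<le> \<bar>C\<bar>" if "\<bar>t\<bar> \<le> m" for t
      using elim(1)[rule_format, OF that] elim(2)[rule_format, of t] by auto
    then show ?case using elim(3) by blast
  qed
  then show ?thesis by (intro that[of "\<bar>C\<bar>"]) auto
qed

lemma f_mvt:
  assumes x: "x \<in> \<Omega>" and b: "\<forall>t. \<bar>t\<bar> \<le> m \<longrightarrow> 0 \<le> fy f x t \<and> fy f x t \<le> C"
    and st: "\<bar>s\<bar> \<le> m" "\<bar>t\<bar> \<le> m" "s \<le> t"
  shows "0 \<le> f x t - f x s \<and> f x t - f x s \<le> C * (t - s)"
proof (cases "s = t")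
  case False
  then have "s < t" using st by simp
  then obtain z where z: "s < z" "z < t" "f x t - f x s = (t - s) * fy f x z"
    using MVT2[of s t "f x" "fy f x"] f_C2 x by blast
  then have "\<bar>z\<bar> \<le> m" using st by auto
  then have "0 \<le> fy f x z" "fy f x z \<le> C" using b by auto
  then show ?thesis using z st mult_left_mono[of "fy f x z" C "t - s"] by (simp add: mult.commute)
qed simp

lemma f_lip:
  assumes x: "x \<in> \<Omega>" and b: "\<forall>t. \<bar>t\<bar> \<le> m \<longrightarrow> 0 \<le> fy f x t \<and> fy f x t \<le> C"
    and st: "\<bar>s\<bar> \<le> m" "\<bar>t\<bar> \<le> m"
  shows "\<bar>f x t - f x s\<bar> \<le> C * \<bar>t - s\<bar>" "0 \<le> (f x t - f x s) * (t - s)"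
  using f_mvt[OF x b st] f_mvt[OF x b st(2,1)] by (cases "s \<le> t"; auto simp: abs_if zero_le_mult_iff)+

text \<open>Young's inequality with a weight depending on the radius plays the part of Holder's: for
  the weight a = \<open>s powr (n - 2 + \<theta>)\<close> both resulting terms are of order a, as
  long as \<theta> \<le> 2 - n/p.\<close>

lemma f0_morrey: "\<exists>\<theta>>0. \<theta> \<le> 1/2 \<and> (\<exists>K. morrey \<theta> (\<lambda>x. f x 0) K)"
proof -
  let ?n = "DIM('a)"
  obtain p where p: "p > real ?n / 2" and I: "integrable M (\<lambda>x. \<bar>f x 0\<bar> powr p)"
    using f0 by (auto simp: set_integrable_eq_lebesgue_on)
  have p1: "p > 1" using p dim by auto
  \<comment> \<open>Positive because p > n/2. The cap 1/2 lets square integrable data share the same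
    Morrey exponent.\<close>
  define \<theta> where "\<theta> = min (1/2) (2 - ?n / p)"
  have n2: "?n / p < 2" using p p1 by (simp add: field_simps)
  have th: "\<theta> > 0" "\<theta> \<le> 1/2" "\<theta> \<le> 2 - ?n / p" using n2 by (simp_all add: \<theta>_def min_def)
  have fm: "(\<lambda>x. f x 0) \<in> borel_measurable M" by (rule f_meas) simp
  define K where "K = (\<integral>x. \<bar>f x 0\<bar> powr p \<partial>M) + 2 ^ ?n"
  \<comment> \<open>Below the threshold \<open>a powr (- 1 / (p - 1))\<close> the second term
    suffices, above it the first.\<close>
  have young: "t \<le> a * t powr p + a powr (- 1 / (p - 1))" if "t \<ge> 0" "a > 0" for t a :: real
  proof (cases "t \<le> a powr (- 1 / (p - 1))")
    case True
    then show ?thesis using that by (simp add: add_increasing)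
  next
    case False
    have tp: "t > 0" using False powr_ge_zero[of a "- 1 / (p - 1)"] by linarith
    have "(a powr (- 1 / (p - 1))) powr (p - 1) \<le> t powr (p - 1)" using False p1 by (intro powr_mono2) auto
    moreover have "(a powr (- 1 / (p - 1))) powr (p - 1) = 1 / a"
      unfolding powr_powr using p1 that(2) by (simp add: powr_minus_divide)
    ultimately have "1 / a \<le> t powr (p - 1)" by (simp only:)
    then have "1 \<le> a * t powr (p - 1)" using that(2) by (simp add: pos_divide_le_eq mult.commute)
    then have "t * 1 \<le> t * (a * t powr (p - 1))" using tp by (intro mult_left_mono) auto
    also have "t * (a * t powr (p - 1)) = a * t powr p"
      using powr_mult_base[of t "p - 1"] tp by (simp add: mult.left_commute)
    finally show ?thesis using powr_ge_zero[of a "- 1 / (p - 1)"] by linarith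
  qed
  have fI: "integrable M (\<lambda>x. f x 0)"
  proof (rule Bochner_Integration.integrable_bound[OF _ fm])
    show "integrable M (\<lambda>x. \<bar>f x 0\<bar> powr p + 1)" using I by auto
    show "AE x in M. norm (f x 0) \<le> norm (\<bar>f x 0\<bar> powr p + 1)"
      using young[OF abs_ge_zero, of 1] by (auto intro!: AE_I2 intro: order_trans)
  qed
  have "(\<integral>\<xi>. indicator (ball x s) \<xi> * \<bar>f \<xi> 0\<bar> \<partial>M) \<le> K * s ^ ?n * s powr (\<theta> - 2)" if s: "0 < s" "s \<le> 1" for x s
  proof -
    define a where "a = s powr (real ?n - 2 + \<theta>)"
    have a: "a > 0" using s by (simp add: a_def)
    have "(\<integral>\<xi>. indicator (ball x s) \<xi> * \<bar>f \<xi> 0\<bar> \<partial>M)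
        \<le> (\<integral>\<xi>. a * \<bar>f \<xi> 0\<bar> powr p + a powr (- 1 / (p - 1)) * indicator (ball x s) \<xi> \<partial>M)"
    proof (rule integral_mono)
      show "integrable M (\<lambda>\<xi>. indicator (ball x s) \<xi> * \<bar>f \<xi> 0\<bar>)" by (rule integrable_ball[OF fI])
      have "integrable M (indicat_real (ball x s))"
        by (rule integrable_const_bound[where B=1]) (auto simp: indicator_def)
      then show "integrable M (\<lambda>\<xi>. a * \<bar>f \<xi> 0\<bar> powr p + a powr (- 1 / (p - 1)) * indicator (ball x s) \<xi>)" using I by auto
      show "indicator (ball x s) \<xi> * \<bar>f \<xi> 0\<bar> \<le> a * \<bar>f \<xi> 0\<bar> powr p + a powr (- 1 / (p - 1)) * indicator (ball x s) \<xi>" for \<xi>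
        using young[OF abs_ge_zero a, of "f \<xi> 0"] a by (auto simp: indicator_def)
    qed
    also have "\<dots> = a * (\<integral>\<xi>. \<bar>f \<xi> 0\<bar> powr p \<partial>M) + a powr (- 1 / (p - 1)) * (\<integral>\<xi>. indicator (ball x s) \<xi> \<partial>M)"
    proof -
      have "integrable M (indicat_real (ball x s))"
        by (rule integrable_const_bound[where B=1]) (auto simp: indicator_def)
      then show ?thesis using I by simp
    qed
    also have "\<dots> \<le> a * (\<integral>\<xi>. \<bar>f \<xi> 0\<bar> powr p \<partial>M) + a powr (- 1 / (p - 1)) * (2 ^ ?n * s ^ ?n)"
      by (intro add_left_mono mult_left_mono measure_M_ball_le s) auto
    also have "a powr (- 1 / (p - 1)) * (2 ^ ?n * s ^ ?n) \<le> 2 ^ ?n * a"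
    proof -
      have "a powr (- 1 / (p - 1)) * s ^ ?n = s powr ((real ?n - 2 + \<theta>) * (- 1 / (p - 1)) + ?n)"
        unfolding a_def powr_powr powr_realpow[OF s(1), symmetric] powr_add[symmetric] ..
      also have "\<dots> \<le> a" unfolding a_def
      proof (rule powr_mono')
        have "\<theta> * p \<le> (2 - ?n / p) * p" using th(3) p1 by (intro mult_right_mono) auto
        then have "\<theta> * p \<le> 2 * p - ?n" using p1 by (simp add: left_diff_distrib)
        then have "(real ?n - 2 + \<theta>) \<le> (2 - \<theta>) * (p - 1)" by (simp add: algebra_simps)
        then have "(real ?n - 2 + \<theta>) / (p - 1) \<le> 2 - \<theta>" using p1 by (simp add: pos_divide_le_eq)
        then show "real ?n - 2 + \<theta> \<le> (real ?n - 2 + \<theta>) * (- 1 / (p - 1)) + ?n" by simp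
      qed (use s in auto)
      finally have "2 ^ ?n * (a powr (- 1 / (p - 1)) * s ^ ?n) \<le> 2 ^ ?n * a" by (intro mult_left_mono) auto
      then show ?thesis by (simp only: mult_ac)
    qed
    also have "a * (\<integral>\<xi>. \<bar>f \<xi> 0\<bar> powr p \<partial>M) + 2 ^ ?n * a = K * a" by (simp add: K_def algebra_simps)
    also have "a = s ^ ?n * s powr (\<theta> - 2)"
      unfolding a_def powr_realpow[OF s(1), symmetric] powr_add[symmetric] by (simp add: algebra_simps)
    finally show ?thesis by (simp add: mult.assoc)
  qed
  then show ?thesis using th fI unfolding morrey_def by blast
qed

lemma truncation_L1:
  assumes g: "integrable M g"
  shows "(\<lambda>k. \<integral>x. \<bar>max (- real k) (min (real k) (g x)) - g x\<bar> \<partial>M) \<longlonglongrightarrow> 0"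
proof -
  have gm [measurable]: "g \<in> borel_measurable M" using g by auto
  have "(\<lambda>k. \<integral>x. \<bar>max (- real k) (min (real k) (g x)) - g x\<bar> \<partial>M) \<longlonglongrightarrow> (\<integral>x. 0 \<partial>M)"
  proof (rule integral_dominated_convergence[where w="\<lambda>x. \<bar>g x\<bar>"])
    show "AE x in M. (\<lambda>k. \<bar>max (- real k) (min (real k) (g x)) - g x\<bar>) \<longlonglongrightarrow> 0"
    proof (rule AE_I2)
      fix x
      obtain N where N: "\<bar>g x\<bar> \<le> real N" using real_arch_simple by blast
      have "\<forall>\<^sub>F k in sequentially. \<bar>max (- real k) (min (real k) (g x)) - g x\<bar> = 0"
        using eventually_ge_at_top[of N]
      proof eventually_elim
        case (elim k)
        then have "real N \<le> real k" by simp
        then show ?case using N by (auto simp: max_def min_def)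
      qed
      then show "(\<lambda>k. \<bar>max (- real k) (min (real k) (g x)) - g x\<bar>) \<longlonglongrightarrow> 0" by (rule tendsto_eventually)
    qed
    show "AE x in M. norm (\<bar>max (- real k) (min (real k) (g x)) - g x\<bar>) \<le> \<bar>g x\<bar>" for k
      by (intro AE_I2) (auto simp: max_def min_def)
  qed (use g in auto)
  then show ?thesis by simp
qed

text \<open>The right-hand side need not act on the energy space a priori, so it is truncated; the
  \<open>L\<^sup>\<infinity>\<close> bound, uniform in the truncation, makes the solutions a Cauchy sequence.\<close>
lemma poisson_morrey:
  assumes g: "morrey \<theta> g K" and th: "\<theta> > 0"
  shows "\<exists>y G B. W y G \<and> weq G g \<and> (AE x in M. \<bar>y x\<bar> \<le> B)"
proof -
  let ?c = "bump_mass TYPE('a)"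
  have c: "?c > 0" by (rule bump_mass_pos)
  have K: "K \<ge> 0" by (rule morrey_nonneg[OF g])
  have gI: "integrable M g" using g by (simp add: morrey_def)
  have gm [measurable]: "g \<in> borel_measurable M" using gI by auto
  define T where "T k x = max (- real k) (min (real k) (g x))" for k x
  have Tm [measurable]: "T k \<in> borel_measurable M" for k unfolding T_def by measurable
  have Tg: "\<bar>T k x\<bar> \<le> \<bar>g x\<bar>" for k x by (auto simp: T_def max_def min_def)
  have Tsq: "sqi M (T k)" for k
    by (rule sqi_AE_bounded(1)[where C="real k"]) (auto simp: T_def max_def min_def)
  have TI: "integrable M (T k)" for k by (rule sqi_integrable_L1(1)[OF Tsq])
  have Tmor: "morrey \<theta> (T k) K" for k by (rule morrey_mono[OF g TI]) (simp add: Tg)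
  have "\<exists>u G. W u G \<and> weq G (T k)" for k
  proof -
    obtain u G where "W u G" "weq G (\<lambda>x. T k x - 0 * u x)" using solve_linear[of 0 "T k"] Tsq[of k] by blast
    then show ?thesis by auto
  qed
  then obtain y G where W: "\<And>k. W (y k) (G k)" and eq: "\<And>k. weq (G k) (T k)" by metis
  note sy = W_sqi[OF W]
  define m where "m = sqrt (measure M (space M))"
  have m: "m \<ge> 0" by (simp add: m_def)
  define X where "X k = ((\<integral>x. \<bar>y k x\<bar> \<partial>M) + K / (6 * \<theta>)) / ?c" for k
  have Xb: "AE x in M. \<bar>y k x\<bar> \<le> X k" for k
    unfolding X_def by (rule Linfty_bound[where k="\<lambda>x. 0", OF W _ _ _ Tmor th]) (use eq in auto)
  have X0: "X k \<ge> 0" for k unfolding X_def using K th c by (intro divide_nonneg_pos add_nonneg_nonneg integral_nonneg_AE) auto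
  define I where "I = (\<integral>x. \<bar>g x\<bar> \<partial>M)"
  have I0: "I \<ge> 0" unfolding I_def by (intro integral_nonneg_AE) auto
  \<comment> \<open>Coefficients of the inequality X^2 \<le> a X + b for the gradient norm X, which
    comes from testing with the solution and bounding its sup norm by its own L^1 norm. It keeps X
    bounded uniformly in the truncation.\<close>
  define a b where "a = m * CP * I / ?c" and "b = K / (6 * \<theta>) * I / ?c"
  have ab: "a \<ge> 0" "b \<ge> 0" using m CP(1) I0 c K th by (auto simp: a_def b_def)
  have l1: "(\<integral>x. \<bar>y k x\<bar> \<partial>M) \<le> m * CP * nrm2 M (G k)" for k
  proof -
    have "(\<integral>x. \<bar>y k x\<bar> \<partial>M) \<le> m * nrm2 M (y k)" using sqi_integrable_L1(2)[OF sy(1)[of k]] by (simp add: m_def)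
    also have "\<dots> \<le> m * (CP * nrm2 M (G k))" by (intro mult_left_mono W_poincare[OF W] m)
    finally show ?thesis by (simp add: mult.assoc)
  qed
  have energy: "\<bar>\<integral>x. h x * v x \<partial>M\<bar> \<le> B * (\<integral>x. \<bar>h x\<bar> \<partial>M)"
    if h: "sqi M h" and v: "sqi M v" and B: "AE x in M. \<bar>v x\<bar> \<le> B"
    for h v :: "'a \<Rightarrow> real" and B
  proof -
    have hI: "integrable M (\<lambda>x. B * \<bar>h x\<bar>)"
      by (rule integrable_mult_right[OF integrable_abs[OF sqi_integrable_L1(1)[OF h]]])
    have "\<bar>\<integral>x. h x * v x \<partial>M\<bar> \<le> (\<integral>x. \<bar>h x * v x\<bar> \<partial>M)" using integral_norm_bound[of M "\<lambda>x. h x * v x"] by simp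
    also have "\<dots> \<le> (\<integral>x. B * \<bar>h x\<bar> \<partial>M)"
      by (rule integral_mono_AE[OF integrable_abs[OF sqi_mult_integrable[OF h v]] hI])
        (use B in \<open>eventually_elim, simp add: abs_mult mult.commute[of "\<bar>h _\<bar>"] mult_right_mono\<close>)
    finally show ?thesis by simp
  qed
  have N: "nrm2 M (G k) \<le> a + b + 1" for k
  proof (rule ccontr)
    assume "\<not> ?thesis"
    then have big: "nrm2 M (G k) > a + b + 1" by simp
    have "(nrm2 M (G k))\<^sup>2 = (\<integral>x. T k x * y k x \<partial>M)"
      using weq_W[OF eq sy(2) Tsq W] by (simp add: nrm2_power2 power2_norm_eq_inner)
    also have "\<dots> \<le> X k * (\<integral>x. \<bar>T k x\<bar> \<partial>M)" using energy[OF Tsq[of k] sy(1)[of k] Xb[of k]] by simp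
    also have "\<dots> \<le> X k * I"
      unfolding I_def using TI gI Tg by (intro mult_left_mono integral_mono X0) auto
    also have "\<dots> \<le> ((m * CP * nrm2 M (G k) + K / (6 * \<theta>)) / ?c) * I"
      unfolding X_def using l1[of k] c I0 by (intro mult_right_mono divide_right_mono) auto
    also have "\<dots> = a * nrm2 M (G k) + b" unfolding a_def b_def add_divide_distrib distrib_right by simp
    finally have "nrm2 M (G k) * nrm2 M (G k) \<le> a * nrm2 M (G k) + b" by (simp add: power2_eq_square)
    moreover have "(a + b + 1) * nrm2 M (G k) < nrm2 M (G k) * nrm2 M (G k)" using big ab by (intro mult_strict_right_mono) auto
    moreover have "b * 1 \<le> b * nrm2 M (G k)" using big ab by (intro mult_left_mono) auto
    ultimately show False using big ab by (simp add: algebra_simps)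
  qed
  define Y where "Y = (m * CP * (a + b + 1) + K / (6 * \<theta>)) / ?c"
  have XY: "X k \<le> Y" for k
  proof -
    have "m * CP * nrm2 M (G k) \<le> m * CP * (a + b + 1)" using N m CP(1) by (intro mult_left_mono) auto
    then show ?thesis unfolding X_def Y_def using l1[of k] c by (intro divide_right_mono) auto
  qed
  have Y0: "Y \<ge> 0" using X0[of 0] XY[of 0] by simp
  have yb: "AE x in M. \<bar>y k x\<bar> \<le> Y" for k using Xb[of k] XY[of k] by (auto elim!: AE_mp)
  define t where "t k = (\<integral>x. \<bar>T k x - g x\<bar> \<partial>M)" for k
  have t0: "t \<longlonglongrightarrow> 0" unfolding t_def[abs_def] T_def using truncation_L1[OF gI] .
  \<comment> \<open>The energy of a difference pairs its uniformly bounded sup norm with the L^1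
    distance of the truncated data, which tends to 0.\<close>
  have diff: "(nrm2 M (\<lambda>x. G k x - G l x))\<^sup>2 \<le> 2 * Y * (t k + t l)" for k l
  proof -
    have Wd: "W (\<lambda>x. y k x - y l x) (\<lambda>x. G k x - G l x)" by (rule W_diff[OF W W])
    have eqd: "weq (\<lambda>x. G k x - G l x) (\<lambda>x. T k x - T l x)" by (intro weq_diff sy TI eq)
    have bd: "AE x in M. \<bar>y k x - y l x\<bar> \<le> 2 * Y" using yb[of k] yb[of l] by eventually_elim linarith
    have "(nrm2 M (\<lambda>x. G k x - G l x))\<^sup>2 = (\<integral>x. (T k x - T l x) * (y k x - y l x) \<partial>M)"
      using weq_W[OF eqd W_sqi(2)[OF Wd] sqi_diff[OF Tsq Tsq] Wd] by (simp add: nrm2_power2 power2_norm_eq_inner)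
    also have "\<dots> \<le> 2 * Y * (\<integral>x. \<bar>T k x - T l x\<bar> \<partial>M)"
      using energy[OF sqi_diff[OF Tsq[of k] Tsq[of l]] W_sqi(1)[OF Wd] bd] by simp
    also have "(\<integral>x. \<bar>T k x - T l x\<bar> \<partial>M) \<le> (\<integral>x. \<bar>T k x - g x\<bar> + \<bar>T l x - g x\<bar> \<partial>M)"
      using TI gI by (intro integral_mono) auto
    also have "\<dots> = t k + t l" unfolding t_def using TI gI by simp
    finally show ?thesis using Y0 by (simp add: mult_left_mono)
  qed
  have C: "\<exists>N. \<forall>k\<ge>N. \<forall>l\<ge>N. nrm2 M (\<lambda>x. G k x - G l x) \<le> e" if e: "e > 0" for e
  proof -
    have "e\<^sup>2 / (4 * Y + 1) > 0" using e Y0 by simp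
    then have "\<forall>\<^sub>F k in sequentially. t k < e\<^sup>2 / (4 * Y + 1)" using t0 by (intro order_tendstoD)
    then obtain N where N: "\<And>k. k \<ge> N \<Longrightarrow> t k < e\<^sup>2 / (4 * Y + 1)" by (auto simp: eventually_sequentially)
    have "nrm2 M (\<lambda>x. G k x - G l x) \<le> e" if "k \<ge> N" "l \<ge> N" for k l
    proof -
      have "2 * Y * (t k + t l) \<le> 2 * Y * (2 * (e\<^sup>2 / (4 * Y + 1)))"
        using N[OF that(1)] N[OF that(2)] Y0 by (intro mult_left_mono) auto
      also have "\<dots> = e\<^sup>2 * (4 * Y / (4 * Y + 1))" by simp
      also have "\<dots> \<le> e\<^sup>2 * 1" using Y0 by (intro mult_left_mono) auto
      finally have "(nrm2 M (\<lambda>x. G k x - G l x))\<^sup>2 \<le> e\<^sup>2" using diff[of k l] by simp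
      then show ?thesis by (rule power2_le_imp_le) (use e in simp)
    qed
    then show ?thesis by blast
  qed
  obtain v H where vH: "W v H" "(\<lambda>k. nrm2 M (\<lambda>x. y k x - v x)) \<longlonglongrightarrow> 0" "(\<lambda>k. nrm2 M (\<lambda>x. G k x - H x)) \<longlonglongrightarrow> 0"
    using W_complete[OF W C] by blast
  have "weq H g" unfolding weq_def
  proof (intro allI impI)
    fix \<phi> D\<phi> assume ts: "test_fun \<Omega> \<phi> D\<phi>"
    obtain B where B: "B \<ge> 0" "\<And>x. \<bar>\<phi> x\<bar> \<le> B" using test_fun_bounded[OF ts] by metis
    have "(\<lambda>k. \<integral>x. G k x \<bullet> D\<phi> x \<partial>M) \<longlonglongrightarrow> (\<integral>x. H x \<bullet> D\<phi> x \<partial>M)"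
      by (rule nrm2_inner_tendsto[OF sy(2) W_sqi(2)[OF vH(1)] vH(3) test_fun_sqi(2)[OF ts]])
    then have 1: "(\<lambda>k. \<integral>x. T k x * \<phi> x \<partial>M) \<longlonglongrightarrow> (\<integral>x. H x \<bullet> D\<phi> x \<partial>M)" using weqD[OF eq ts] by simp
    have "(\<lambda>k. (\<integral>x. T k x * \<phi> x \<partial>M) - (\<integral>x. g x * \<phi> x \<partial>M)) \<longlonglongrightarrow> 0"
    proof (rule Lim_null_comparison)
      show "(\<lambda>k. B * t k) \<longlonglongrightarrow> 0" using tendsto_mult_left[OF t0, of B] by simp
      have "\<bar>(\<integral>x. T k x * \<phi> x \<partial>M) - (\<integral>x. g x * \<phi> x \<partial>M)\<bar> \<le> B * t k" for k
      proof -
        have "(\<integral>x. T k x * \<phi> x \<partial>M) - (\<integral>x. g x * \<phi> x \<partial>M) = (\<integral>x. (T k x - g x) * \<phi> x \<partial>M)"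
          using integrable_mult_test[OF TI[of k] ts] integrable_mult_test[OF gI ts] by (simp add: left_diff_distrib)
        also have "\<bar>\<dots>\<bar> \<le> (\<integral>x. B * \<bar>T k x - g x\<bar> \<partial>M)"
        proof (rule integral_abs_bound_integral)
          show "integrable M (\<lambda>x. (T k x - g x) * \<phi> x)" by (rule integrable_mult_test[OF _ ts]) (use TI gI in auto)
          show "\<bar>(T k x - g x) * \<phi> x\<bar> \<le> B * \<bar>T k x - g x\<bar>" for x
            using mult_left_mono[OF B(2)[of x], of "\<bar>T k x - g x\<bar>"] by (simp add: abs_mult mult.commute)
        qed (use TI gI in auto)
        finally show ?thesis by (simp add: t_def)
      qed
      then show "\<forall>\<^sub>F k in sequentially. norm ((\<integral>x. T k x * \<phi> x \<partial>M) - (\<integral>x. g x * \<phi> x \<partial>M)) \<le> B * t k" by simp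
    qed
    then have "(\<lambda>k. \<integral>x. T k x * \<phi> x \<partial>M) \<longlonglongrightarrow> (\<integral>x. g x * \<phi> x \<partial>M)" by (simp add: LIM_zero_iff)
    then show "(\<integral>x. H x \<bullet> D\<phi> x \<partial>M) = (\<integral>x. g x * \<phi> x \<partial>M)" using 1 LIMSEQ_unique by blast
  qed
  moreover have "AE x in M. \<bar>v x\<bar> \<le> ((\<integral>x. \<bar>v x\<bar> \<partial>M) + K / (6 * \<theta>)) / ?c"
    by (rule Linfty_bound[where k="\<lambda>x. 0", OF vH(1) _ _ _ g th]) (use \<open>weq H g\<close> in auto)
  ultimately show ?thesis using vH(1) by blast
qed

end

definition clp :: "real \<Rightarrow> real \<Rightarrow> real" where "clp m t = max (- m) (min m t)"

lemma clp_props: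
  assumes "m \<ge> 0"
  shows "\<bar>clp m t\<bar> \<le> m" "\<bar>t\<bar> \<le> m \<Longrightarrow> clp m t = t" "s \<le> t \<Longrightarrow> clp m s \<le> clp m t"
    "s \<le> t \<Longrightarrow> clp m t - clp m s \<le> t - s"
  using assms by (auto simp: clp_def max_def min_def)

lemma clp_meas [measurable]: "clp m \<in> borel_measurable borel"
  unfolding clp_def[abs_def] by measurable

context bounded_open
begin

lemma meas_M_continuous_on:
  fixes y :: "'a \<Rightarrow> 'b::euclidean_space"
  assumes "continuous_on (closure \<Omega>) y"
  shows "y \<in> borel_measurable M"
  using continuous_imp_measurable_on_sets_lebesgue[OF continuous_on_subset[OF assms closure_subset] sets_\<Omega>(1)] .

lemma continuous_zero_bounded:
  assumes "continuous_on (closure \<Omega>) y" "\<And>x. x \<notin> \<Omega> \<Longrightarrow> y x = (0::real)"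
  obtains B where "B \<ge> 0" "\<And>x. \<bar>y x\<bar> \<le> B"
proof -
  have "compact (closure \<Omega>)" using bounded_\<Omega> by (simp add: compact_closure)
  then have "bounded (y ` closure \<Omega>)" using assms(1) by (intro compact_imp_bounded compact_continuous_image)
  then obtain B where B: "\<And>x. x \<in> closure \<Omega> \<Longrightarrow> \<bar>y x\<bar> \<le> B" by (auto simp: bounded_iff)
  show ?thesis
  proof (rule that[of "\<bar>B\<bar>"])
    show "\<bar>y x\<bar> \<le> \<bar>B\<bar>" for x
    proof (cases "x \<in> \<Omega>")
      case True
      then have "x \<in> closure \<Omega>" using closure_subset by blast
      from B[OF this] show ?thesis by linarith
    qed (use assms(2) in simp)
  qed simp
qed

text \<open>The set where the bound fails is open, and a nonempty open set is not null.\<close>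

lemma AE_le_everywhere:
  assumes c: "continuous_on \<Omega> d" and ae: "AE x in M. \<bar>d x :: real\<bar> \<le> C" and x: "x \<in> \<Omega>"
  shows "\<bar>d x\<bar> \<le> C"
proof (rule ccontr)
  assume n: "\<not> ?thesis"
  define S where "S = \<Omega> \<inter> (\<lambda>x. \<bar>d x\<bar>) -` {C<..}"
  have "continuous_on \<Omega> (\<lambda>x. \<bar>d x\<bar>)" using c by (intro continuous_intros)
  then have S: "open S" unfolding S_def using open_\<Omega> by (intro continuous_open_preimage) auto
  have "AE x\<in>S in lebesgue. x \<in> {}"
    using ae unfolding AE_M_iff by eventually_elim (auto simp: S_def)
  then have "x \<in> {}" by (rule mem_closed_if_AE_lebesgue_open[OF S closed_empty]) (use x n in \<open>auto simp: S_def\<close>)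
  then show False by simp
qed

end

section \<open>Existence, uniqueness and Lipschitz dependence of states\<close>

context semilinear
begin

text \<open>The datum \<open>f x 0\<close> is merely integrable; subtracting it leaves a bounded
  function as long as y is bounded.\<close>

lemma f_shift:
  assumes y: "y \<in> borel_measurable M" and B: "AE x in M. \<bar>y x\<bar> \<le> B" "B \<ge> 0"
  shows "sqi M (\<lambda>x. f x (y x) - f x 0)" "integrable M (\<lambda>x. f x (y x))"
proof -
  obtain C where C: "C \<ge> 0" "AE x in M. x \<in> \<Omega> \<and> (\<forall>t. \<bar>t\<bar> \<le> B \<longrightarrow> 0 \<le> fy f x t \<and> fy f x t \<le> C \<and> \<bar>fyy f x t\<bar> \<le> C)"
    by (rule f_props[of B], rule that)
  show 1: "sqi M (\<lambda>x. f x (y x) - f x 0)"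
  proof (rule sqi_AE_bounded(1)[where C="C * B"])
    show "(\<lambda>x. f x (y x) - f x 0) \<in> borel_measurable M" by (intro borel_measurable_diff f_meas y) simp
    show "AE x in M. norm (f x (y x) - f x 0) \<le> C * B"
      using C(2) B(1)
    proof eventually_elim
      case (elim x)
      have "\<bar>f x (y x) - f x 0\<bar> \<le> C * \<bar>y x - 0\<bar>" by (rule f_lip(1)[of x B]) (use elim B(2) in auto)
      also have "\<dots> \<le> C * B" using elim C(1) by (intro mult_left_mono) auto
      finally show ?case by simp
    qed
  qed
  obtain \<theta> K where "morrey \<theta> (\<lambda>x. f x 0) K" using f0_morrey by blast
  then have "integrable M (\<lambda>x. f x 0)" by (simp add: morrey_def)
  then have "integrable M (\<lambda>x. (f x (y x) - f x 0) + f x 0)"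
    using sqi_integrable_L1(1)[OF 1] by (intro Bochner_Integration.integrable_add)
  then show "integrable M (\<lambda>x. f x (y x))" by simp
qed

text \<open>The gradient is kept as data, and v is a right-hand side on all of \<Omega>; in the
  applications it is a control extended by zero.\<close>

definition is_state :: "('a \<Rightarrow> real) \<Rightarrow> ('a \<Rightarrow> real) \<Rightarrow> ('a \<Rightarrow> 'a) \<Rightarrow> bool" where
  "is_state v y G \<longleftrightarrow> continuous_on (closure \<Omega>) y \<and> (\<forall>x. x \<notin> \<Omega> \<longrightarrow> y x = 0) \<and> W y G \<and>
     weq G (\<lambda>x. v x - f x (y x))"

text \<open>The linear part carries the integrable datum \<open>f x 0\<close>; the remaining nonlinear equation has
  bounded data, and its \<open>L\<^sup>\<infinity>\<close> bound does not depend on the truncation level, which can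
  therefore be chosen above it.\<close>
lemma state_exists:
  assumes v: "sqi M v"
  shows "\<exists>y G. is_state v y G"
proof -
  obtain \<theta> K where th: "\<theta> > 0" "\<theta> \<le> 1/2" and f0m: "morrey \<theta> (\<lambda>x. f x 0) K" using f0_morrey by blast
  have f0I: "integrable M (\<lambda>x. f x 0)" using f0m by (simp add: morrey_def)
  define g0 where "g0 x = v x + - f x 0" for x
  have g0m: "morrey \<theta> g0 (Cm * nrm2 M v + K)" unfolding g0_def
    by (intro morrey_add morrey_uminus f0m morrey_weaken[OF L2_morrey[OF v] th(2)])
  have g0I: "integrable M g0" using g0m by (simp add: morrey_def)
  obtain y0 G0 B where y0: "W y0 G0" "weq G0 g0" "AE x in M. \<bar>y0 x\<bar> \<le> B"
    using poisson_morrey[OF g0m th(1)] by blast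
  define B0 where "B0 = \<bar>B\<bar>"
  have B0: "B0 \<ge> 0" "AE x in M. \<bar>y0 x\<bar> \<le> B0" using y0(3) by (auto simp: B0_def elim!: AE_mp)
  have y0m [measurable]: "y0 \<in> borel_measurable M" using W_sqi(1)[OF y0(1)] by auto
  \<comment> \<open>With y = y0 + w, the equation for w has the zero order term f (y0 + w) - f (y0),
    which vanishes at w = 0, and the bounded datum gp.\<close>
  define gp where "gp x = - (f x (y0 x) - f x 0)" for x
  have gps: "sqi M gp" unfolding gp_def[abs_def] by (rule sqi_uminus[OF f_shift(1)[OF y0m B0(2,1)]])
  \<comment> \<open>The second summand will bound w whatever the truncation, so the clamping at
    level m turns out to be inactive.\<close>
  define m where "m = B0 + Cinf * nrm2 M gp"
  have M1: "Cinf * nrm2 M gp \<ge> 0" using Cinf_nonneg by simp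
  have m: "m \<ge> 0" "B0 \<le> m" using B0 M1 by (auto simp: m_def)
  obtain C where C: "C \<ge> 0" "AE x in M. x \<in> \<Omega> \<and> (\<forall>t. \<bar>t\<bar> \<le> m \<longrightarrow> 0 \<le> fy f x t \<and> fy f x t \<le> C \<and> \<bar>fyy f x t\<bar> \<le> C)"
    by (rule f_props[of m], rule that)
  define h where "h x t = f x (clp m (y0 x + t)) - f x (clp m (y0 x))" for x t
  have hm: "(\<lambda>x. h x (w x)) \<in> borel_measurable M" if [measurable]: "w \<in> borel_measurable M" for w
    unfolding h_def by (intro borel_measurable_diff f_meas) measurable
  have hl: "AE x in M. \<forall>s t. s \<le> t \<longrightarrow> 0 \<le> h x t - h x s \<and> h x t - h x s \<le> C * (t - s)"
    using C(2)
  proof eventually_elim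
    case (elim x)
    show ?case
    proof (intro allI impI)
      fix s t :: real assume st: "s \<le> t"
      have "0 \<le> f x (clp m (y0 x + t)) - f x (clp m (y0 x + s)) \<and>
          f x (clp m (y0 x + t)) - f x (clp m (y0 x + s)) \<le> C * (clp m (y0 x + t) - clp m (y0 x + s))"
        by (rule f_mvt[of x m]) (use elim clp_props[OF m(1)] st in auto)
      moreover have "C * (clp m (y0 x + t) - clp m (y0 x + s)) \<le> C * (t - s)"
        using clp_props(4)[OF m(1), of "y0 x + s" "y0 x + t"] st C(1) by (intro mult_left_mono) auto
      ultimately show "0 \<le> h x t - h x s \<and> h x t - h x s \<le> C * (t - s)" by (simp add: h_def)
    qed
  qed
  obtain w Gw where w: "W w Gw" "weq Gw (\<lambda>x. gp x - h x (w x))"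
    by (rule solve_monotone[OF C(1) gps hm hl], simp, simp add: h_def, rule that)
  have wm [measurable]: "w \<in> borel_measurable M" using W_sqi(1)[OF w(1)] by auto
  have hs: "sqi M (\<lambda>x. h x (w x))"
  proof (rule sqi_bound(1)[OF W_sqi(1)[OF w(1)] hm[OF wm], of C])
    show "AE x in M. norm (h x (w x)) \<le> C * norm (w x)"
      using hl
    proof eventually_elim
      case (elim x)
      have "h x 0 = 0" by (simp add: h_def)
      then show ?case using elim[rule_format, of 0 "w x"] elim[rule_format, of "w x" 0]
        by (cases "0 \<le> w x") auto
    qed
  qed
  have hsg: "AE x in M. 0 \<le> h x (w x) * w x"
    using hl
  proof eventually_elim
    case (elim x)
    have "h x 0 = 0" by (simp add: h_def)
    then show ?case using elim[rule_format, of 0 "w x"] elim[rule_format, of "w x" 0]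
      by (cases "0 \<le> w x") (auto simp: zero_le_mult_iff)
  qed
  have wb: "AE x in M. \<bar>w x\<bar> \<le> Cinf * nrm2 M gp" by (rule weq_bounds(3)[OF w gps hs hsg])
  define y where "y x = y0 x + w x" for x
  define G where "G x = G0 x + Gw x" for x
  have W: "W y G" unfolding y_def G_def by (rule W_add[OF y0(1) w(1)])
  have ym [measurable]: "y \<in> borel_measurable M" using W_sqi(1)[OF W] by auto
  have yb: "AE x in M. \<bar>y x\<bar> \<le> m" using B0(2) wb by eventually_elim (simp add: y_def m_def)
  note fs = f_shift[OF ym yb m(1)]
  have rI: "integrable M (\<lambda>x. v x - f x (y x))" using sqi_integrable_L1(1)[OF v] fs(2) by auto
  have eq: "weq G (\<lambda>x. v x - f x (y x))"
  proof (rule weq_cong_AE[OF _ _ rI])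
    show "weq G (\<lambda>x. g0 x + (gp x - h x (w x)))" unfolding G_def
      by (rule weq_add[OF W_sqi(2)[OF y0(1)] W_sqi(2)[OF w(1)] g0I sqi_integrable_L1(1)[OF sqi_diff[OF gps hs]] y0(2) w(2)])
    show "integrable M (\<lambda>x. g0 x + (gp x - h x (w x)))"
      using g0I sqi_integrable_L1(1)[OF sqi_diff[OF gps hs]] by auto
    show "AE x in M. g0 x + (gp x - h x (w x)) = v x - f x (y x)"
      using B0(2) wb
    proof eventually_elim
      case (elim x)
      have "\<bar>y0 x\<bar> \<le> m" "\<bar>y0 x + w x\<bar> \<le> m" using elim m(2) by (auto simp: m_def)
      then show ?case by (simp add: g0_def gp_def h_def y_def clp_props(2)[OF m(1)])
    qed
  qed
  \<comment> \<open>Regularity is applied to the full equation: \<open>f x (y x)\<close> differs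
    from \<open>f x 0\<close> by a square integrable function, so the right-hand side is still
    Morrey.\<close>
  have rm: "morrey \<theta> (\<lambda>x. v x - f x (y x)) (Cm * nrm2 M v + K + Cm * nrm2 M (\<lambda>x. f x (y x) - f x 0))"
  proof -
    have "morrey \<theta> (\<lambda>x. g0 x + - (f x (y x) - f x 0)) (Cm * nrm2 M v + K + Cm * nrm2 M (\<lambda>x. f x (y x) - f x 0))"
      by (intro morrey_add g0m morrey_uminus morrey_weaken[OF L2_morrey[OF fs(1)] th(2)])
    then show ?thesis by (simp add: g0_def)
  qed
  obtain yc where yc: "continuous_on (closure \<Omega>) yc" "\<And>x. x \<notin> \<Omega> \<Longrightarrow> yc x = 0" "AE x in M. y x = yc x"
    by (rule regularity[OF W eq rm th(1) yb thick], rule that)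
  have ycm: "yc \<in> borel_measurable M" by (rule meas_M_continuous_on[OF yc(1)])
  have ycb: "AE x in M. \<bar>yc x\<bar> \<le> m" using yb yc(3) by eventually_elim auto
  have Wc: "W yc G" by (rule W_cong_AE[OF W ycm yc(3)])
  have "weq G (\<lambda>x. v x - f x (yc x))"
  proof (rule weq_cong_AE[OF eq rI])
    show "integrable M (\<lambda>x. v x - f x (yc x))"
      using sqi_integrable_L1(1)[OF v] f_shift(2)[OF ycm ycb m(1)] by auto
    show "AE x in M. v x - f x (y x) = v x - f x (yc x)" using yc(3) by eventually_elim simp
  qed
  then show ?thesis using yc(1,2) Wc unfolding is_state_def by blast
qed

lemma is_state_meas: "is_state v y G \<Longrightarrow> y \<in> borel_measurable M"
  unfolding is_state_def using meas_M_continuous_on by blast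

lemma is_state_bounded:
  assumes "is_state v y G"
  obtains B where "B \<ge> 0" "\<And>x. \<bar>y x\<bar> \<le> B"
  using assms continuous_zero_bounded[of y] unfolding is_state_def by blast

text \<open>Monotonicity of f gives the zero order term of the difference equation the sign of y1 -
  y2, so both Lipschitz constants are independent of the states. Continuity upgrades the sup bound
  from almost everywhere to everywhere.\<close>

lemma is_state_diff:
  assumes s1: "is_state v1 y1 G1" and s2: "is_state v2 y2 G2" and v: "sqi M v1" "sqi M v2"
  shows "weq (\<lambda>x. G1 x - G2 x) (\<lambda>x. (v1 x - v2 x) - (f x (y1 x) - f x (y2 x)))"
    "sqi M (\<lambda>x. f x (y1 x) - f x (y2 x))"
    "nrm2 M (\<lambda>x. y1 x - y2 x) \<le> CP\<^sup>2 * nrm2 M (\<lambda>x. v1 x - v2 x)"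
    "\<And>x. \<bar>y1 x - y2 x\<bar> \<le> Cinf * nrm2 M (\<lambda>x. v1 x - v2 x)"
proof -
  obtain B1 where B1: "B1 \<ge> 0" "\<And>x. \<bar>y1 x\<bar> \<le> B1" by (rule is_state_bounded[OF s1], rule that)
  obtain B2 where B2: "B2 \<ge> 0" "\<And>x. \<bar>y2 x\<bar> \<le> B2" by (rule is_state_bounded[OF s2], rule that)
  define B where "B = max B1 B2"
  have B: "B \<ge> 0" "\<bar>y1 x\<bar> \<le> B" "\<bar>y2 x\<bar> \<le> B" for x
    using B1(1) order_trans[OF B1(2)[of x] max.cobounded1[of B1 B2]] order_trans[OF B2(2)[of x] max.cobounded2[of B2 B1]]
    by (simp_all add: B_def)
  obtain C where C: "C \<ge> 0" "AE x in M. x \<in> \<Omega> \<and> (\<forall>t. \<bar>t\<bar> \<le> B \<longrightarrow> 0 \<le> fy f x t \<and> fy f x t \<le> C \<and> \<bar>fyy f x t\<bar> \<le> C)"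
    by (rule f_props[of B], rule that)
  note m = is_state_meas[OF s1] is_state_meas[OF s2]
  note W1 = s1[unfolded is_state_def, THEN conjunct2, THEN conjunct2, THEN conjunct1]
    and W2 = s2[unfolded is_state_def, THEN conjunct2, THEN conjunct2, THEN conjunct1]
  note e1 = s1[unfolded is_state_def, THEN conjunct2, THEN conjunct2, THEN conjunct2]
    and e2 = s2[unfolded is_state_def, THEN conjunct2, THEN conjunct2, THEN conjunct2]
  have I: "integrable M (\<lambda>x. f x (y1 x))" "integrable M (\<lambda>x. f x (y2 x))"
    using f_shift(2)[OF m(1), of B] f_shift(2)[OF m(2), of B] B by auto
  have vI: "integrable M v1" "integrable M v2" using sqi_integrable_L1(1) v by auto
  have "weq (\<lambda>x. G1 x - G2 x) (\<lambda>x. (v1 x - f x (y1 x)) - (v2 x - f x (y2 x)))"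
    by (intro weq_diff W_sqi[OF W1] W_sqi[OF W2] e1 e2 Bochner_Integration.integrable_diff I vI)
  then show eq: "weq (\<lambda>x. G1 x - G2 x) (\<lambda>x. (v1 x - v2 x) - (f x (y1 x) - f x (y2 x)))"
    by (simp add: algebra_simps)
  have Wd: "W (\<lambda>x. y1 x - y2 x) (\<lambda>x. G1 x - G2 x)" by (rule W_diff[OF W1 W2])
  show sk: "sqi M (\<lambda>x. f x (y1 x) - f x (y2 x))"
  proof (rule sqi_bound(1)[OF W_sqi(1)[OF Wd], of _ C])
    show "(\<lambda>x. f x (y1 x) - f x (y2 x)) \<in> borel_measurable M" using I by auto
    show "AE x in M. norm (f x (y1 x) - f x (y2 x)) \<le> C * norm (y1 x - y2 x)"
      using C(2)
    proof eventually_elim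
      case (elim x)
      show ?case using f_lip(1)[of x B C "y2 x" "y1 x"] elim B by auto
    qed
  qed
  have sg: "AE x in M. 0 \<le> (f x (y1 x) - f x (y2 x)) * (y1 x - y2 x)"
    using C(2)
  proof eventually_elim
    case (elim x)
    show ?case using f_lip(2)[of x B C "y2 x" "y1 x"] elim B by auto
  qed
  note b = weq_bounds[OF Wd eq sqi_diff[OF v] sk sg]
  show "nrm2 M (\<lambda>x. y1 x - y2 x) \<le> CP\<^sup>2 * nrm2 M (\<lambda>x. v1 x - v2 x)" by (rule b(2))
  show "\<bar>y1 x - y2 x\<bar> \<le> Cinf * nrm2 M (\<lambda>x. v1 x - v2 x)" for x
  proof (cases "x \<in> \<Omega>")
    case True
    have "continuous_on \<Omega> (\<lambda>x. y1 x - y2 x)"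
      using s1 s2 unfolding is_state_def
      by (intro continuous_on_diff) (auto intro: continuous_on_subset[OF _ closure_subset])
    then show ?thesis by (rule AE_le_everywhere[OF _ b(3) True])
  next
    case False
    then have "y1 x = 0" "y2 x = 0" using s1 s2 unfolding is_state_def by auto
    then show ?thesis using Cinf_nonneg by simp
  qed
qed

lemma is_state_unique:
  assumes "is_state v y1 G1" "is_state v y2 G2" "sqi M v"
  shows "y1 = y2"
  using is_state_diff(4)[OF assms(1,2,3,3)] by (simp add: fun_eq_iff)

end

section \<open>Controls on the subdomain and the control-to-state map\<close>

locale control_problem = semilinear +
  fixes \<omega> :: "'a set"
  assumes open_\<omega>: "open \<omega>" and \<omega>_sub: "\<omega> \<subseteq> \<Omega>"
begin

abbreviation N where "N \<equiv> lebesgue_on \<omega>"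

text \<open>Controls live on \<omega> and equations on \<Omega>; extension by zero brings both to
  the same measure.\<close>

definition ext :: "('a \<Rightarrow> real) \<Rightarrow> 'a \<Rightarrow> real" where
  "ext u x = indicator \<omega> x * u x"

lemma sets_\<omega> [simp]: "\<omega> \<in> sets lebesgue" "\<omega> \<in> sets borel" using open_\<omega> by auto

sublocale N: bounded_open \<omega>
  using open_\<omega> \<omega>_sub bounded_\<Omega> bounded_subset by unfold_locales auto

lemma integral_N:
  fixes g :: "'a \<Rightarrow> real"
  shows "(\<integral>x. g x \<partial>N) = (\<integral>x. indicator \<omega> x * g x \<partial>M)"
proof -
  have "(\<lambda>x. indicat_real \<Omega> x *\<^sub>R (indicator \<omega> x * g x)) = (\<lambda>x. indicator \<omega> x *\<^sub>R g x)"
    using \<omega>_sub by (auto simp: indicator_def fun_eq_iff)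
  then show ?thesis by (simp add: integral_restrict_space)
qed

lemma integrable_N_iff:
  fixes g :: "'a \<Rightarrow> real"
  shows "integrable N g \<longleftrightarrow> integrable M (\<lambda>x. indicator \<omega> x * g x)"
proof -
  have "(\<lambda>x. indicat_real \<Omega> x *\<^sub>R (indicator \<omega> x * g x)) = (\<lambda>x. indicator \<omega> x *\<^sub>R g x)"
    using \<omega>_sub by (auto simp: indicator_def fun_eq_iff)
  then show ?thesis by (simp add: integrable_restrict_space)
qed

lemma meas_N_iff:
  fixes g :: "'a \<Rightarrow> real"
  shows "g \<in> borel_measurable N \<longleftrightarrow> (\<lambda>x. indicator \<omega> x * g x) \<in> borel_measurable M"
proof -
  have "(\<lambda>x. indicat_real \<Omega> x *\<^sub>R (indicator \<omega> x * g x)) = (\<lambda>x. indicator \<omega> x *\<^sub>R g x)"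
    using \<omega>_sub by (auto simp: indicator_def fun_eq_iff)
  then show ?thesis by (simp add: borel_measurable_restrict_space_iff)
qed

lemma ext_sq: "(norm (ext u x))\<^sup>2 = indicator \<omega> x * (norm (u x))\<^sup>2"
  by (simp add: ext_def indicator_def)

lemma sqi_ext: "sqi N u \<longleftrightarrow> sqi M (ext u)"
proof -
  have "(\<lambda>x. indicator \<omega> x * u x) = ext u" by (simp add: ext_def fun_eq_iff)
  then show ?thesis unfolding sqi_def ext_sq integrable_N_iff meas_N_iff by (simp only:)
qed

lemma nrm2_ext: "nrm2 M (ext u) = nrm2 N u"
  unfolding nrm2_def ext_sq integral_N ..

lemma set_integral_\<omega>_mult:
  "(LINT x:\<omega>|lebesgue. u x * g x) = (\<integral>x. ext u x * g x \<partial>M)"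
  by (simp add: set_integral_eq_lebesgue_on integral_N ext_def mult.assoc)

lemma state_sol_iff:
  assumes u: "L2 \<omega> u"
  shows "state_sol \<Omega> \<omega> f u y \<longleftrightarrow> (\<exists>G. is_state (ext u) y G)"
proof -
  have us: "sqi M (ext u)" using u by (simp add: L2_iff_sqi sqi_ext)
  have "(\<forall>\<phi> D\<phi>. test_fun \<Omega> \<phi> D\<phi> \<longrightarrow> (LINT x:\<Omega>|lebesgue. G x \<bullet> D\<phi> x + f x (y x) * \<phi> x) = (LINT x:\<omega>|lebesgue. u x * \<phi> x))
      \<longleftrightarrow> weq G (\<lambda>x. ext u x - f x (y x))"
    if y: "continuous_on (closure \<Omega>) y" "\<forall>x. x \<notin> \<Omega> \<longrightarrow> y x = 0" and W: "W y G" for G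
  proof -
    obtain B where B: "B \<ge> 0" "\<And>x. \<bar>y x\<bar> \<le> B" using continuous_zero_bounded[OF y(1)] y(2) by blast
    have I: "integrable M (\<lambda>x. f x (y x))"
      by (rule f_shift(2)[OF meas_M_continuous_on[OF y(1)], of B]) (use B in auto)
    have "((LINT x:\<Omega>|lebesgue. G x \<bullet> D\<phi> x + f x (y x) * \<phi> x) = (LINT x:\<omega>|lebesgue. u x * \<phi> x))
        \<longleftrightarrow> ((\<integral>x. G x \<bullet> D\<phi> x \<partial>M) = (\<integral>x. (ext u x - f x (y x)) * \<phi> x \<partial>M))"
      if t: "test_fun \<Omega> \<phi> D\<phi>" for \<phi> D\<phi>
    proof -
      have "(LINT x:\<Omega>|lebesgue. G x \<bullet> D\<phi> x + f x (y x) * \<phi> x) = (\<integral>x. G x \<bullet> D\<phi> x \<partial>M) + (\<integral>x. f x (y x) * \<phi> x \<partial>M)"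
        using sqi_inner_integrable[OF W_sqi(2)[OF W] test_fun_sqi(2)[OF t]] integrable_mult_test[OF I t]
        by (simp add: set_integral_eq_lebesgue_on)
      moreover have "(\<integral>x. (ext u x - f x (y x)) * \<phi> x \<partial>M) = (\<integral>x. ext u x * \<phi> x \<partial>M) - (\<integral>x. f x (y x) * \<phi> x \<partial>M)"
        using integrable_mult_test[OF I t] integrable_mult_test[OF sqi_integrable_L1(1)[OF us] t]
        by (simp add: left_diff_distrib)
      ultimately show ?thesis unfolding set_integral_\<omega>_mult by linarith
    qed
    then show ?thesis unfolding weq_def by blast
  qed
  then show ?thesis unfolding state_sol_def is_state_def H01_iff_W by blast
qed

text \<open>Existence and uniqueness make the description operator in \<open>Sop\<close> denote the
  state.\<close>

lemma Sop_state:
  assumes u: "L2 \<omega> u"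
  obtains G where "is_state (ext u) (Sop \<Omega> \<omega> f u) G"
proof -
  have us: "sqi M (ext u)" using u by (simp add: L2_iff_sqi sqi_ext)
  obtain y G where y: "is_state (ext u) y G" using state_exists[OF us] by blast
  have "Sop \<Omega> \<omega> f u = y"
    unfolding Sop_def state_sol_iff[OF u]
    by (rule the_equality) (use y is_state_unique[OF _ _ us] in blast)+
  then show ?thesis using that y by simp
qed

end

section \<open>Linearized equation\<close>

lemma quadratic_remainder_DERIV:
  fixes g :: "real \<Rightarrow> real"
  assumes d: "d > 0" and b: "\<And>s. \<bar>s\<bar> < d \<Longrightarrow> \<bar>g (t + s) - g t - s * L\<bar> \<le> K * s\<^sup>2"
  shows "(g has_real_derivative L) (at t)"
proof -
  have "((\<lambda>h. (g (t + h) - g t) / h - L) \<longlongrightarrow> 0) (at 0)"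
  proof (rule Lim_null_comparison)
    have "\<forall>\<^sub>F h in at 0. \<bar>h\<bar> < d \<and> h \<noteq> 0"
      unfolding eventually_at using d by (intro exI[of _ d]) auto
    then show "\<forall>\<^sub>F h in at 0. norm ((g (t + h) - g t) / h - L) \<le> K * \<bar>h\<bar>"
    proof eventually_elim
      case (elim h)
      have "(g (t + h) - g t) / h - L = (g (t + h) - g t - h * L) / h" using elim by (simp add: field_simps)
      then have "norm ((g (t + h) - g t) / h - L) = \<bar>g (t + h) - g t - h * L\<bar> / \<bar>h\<bar>" by (simp add: abs_divide)
      also have "\<dots> \<le> (K * h\<^sup>2) / \<bar>h\<bar>" using b[of h] elim by (intro divide_right_mono) auto
      also have "\<dots> = K * \<bar>h\<bar>" using elim by (simp add: power2_eq_square abs_if)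
      finally show ?case .
    qed
    have "((\<lambda>h. K * \<bar>h\<bar>) \<longlongrightarrow> K * \<bar>0\<bar>) (at 0)" by (intro tendsto_intros)
    then show "((\<lambda>h. K * \<bar>h\<bar>) \<longlongrightarrow> 0) (at 0)" by simp
  qed
  then show ?thesis by (simp add: DERIV_def LIM_zero_iff)
qed

text \<open>The increments e k may vanish, so Caratheodory's continuous slope is used instead of a
  quotient by e k.\<close>

lemma DERIV_along_sequence:
  fixes g :: "real \<Rightarrow> real"
  assumes g: "(g has_real_derivative D) (at y)" and t: "t \<longlonglongrightarrow> 0" "\<And>k. t k \<noteq> 0"
    and e: "(\<lambda>k. e k / t k) \<longlonglongrightarrow> z"
  shows "(\<lambda>k. (g (y + e k) - g y) / t k) \<longlonglongrightarrow> D * z"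
proof -
  obtain q where q: "\<And>w. g w - g y = q w * (w - y)" "isCont q y" "q y = D"
    using g unfolding CARAT_DERIV by blast
  have "(\<lambda>k. (e k / t k) * t k) \<longlonglongrightarrow> z * 0" by (intro tendsto_mult e t(1))
  then have e0: "(\<lambda>k. y + e k) \<longlonglongrightarrow> y + 0" using t(2) by (intro tendsto_add tendsto_const) simp
  have "(\<lambda>k. q (y + e k) * (e k / t k)) \<longlonglongrightarrow> q y * z"
    using isCont_tendsto_compose[OF q(2), of "\<lambda>k. y + e k"] e0 by (intro tendsto_mult e) simp
  then show ?thesis using q by simp
qed

lemma sqi_bilinear_bound:
  fixes a b c :: "'c \<Rightarrow> real"
  assumes c: "c \<in> borel_measurable M" "AE x in M. \<bar>c x\<bar> \<le> C" and a: "sqi M a" and b: "sqi M b"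
  shows "integrable M (\<lambda>x. c x * (a x * b x))" "\<bar>\<integral>x. c x * (a x * b x) \<partial>M\<bar> \<le> \<bar>C\<bar> * (nrm2 M a * nrm2 M b)"
proof -
  note ca = sqi_bounded_mult_real[OF a c]
  show "integrable M (\<lambda>x. c x * (a x * b x))" using sqi_mult_integrable[OF ca(1) b] by (simp add: mult.assoc)
  have "\<bar>\<integral>x. c x * (a x * b x) \<partial>M\<bar> \<le> nrm2 M (\<lambda>x. c x * a x) * nrm2 M b"
    using sqi_CS_mult[OF ca(1) b] by (simp add: mult.assoc)
  also have "\<dots> \<le> (\<bar>C\<bar> * nrm2 M a) * nrm2 M b" by (intro mult_right_mono ca(2)) simp
  finally show "\<bar>\<integral>x. c x * (a x * b x) \<partial>M\<bar> \<le> \<bar>C\<bar> * (nrm2 M a * nrm2 M b)" by (simp add: mult.assoc)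
qed

context semilinear
begin

text \<open>What a state must provide as a coefficient: the linear theory at y uses only
  measurability and boundedness.\<close>

definition bdm :: "('a \<Rightarrow> real) \<Rightarrow> bool" where
  "bdm y \<longleftrightarrow> y \<in> borel_measurable M \<and> (\<exists>B. \<forall>x. \<bar>y x\<bar> \<le> B)"

lemma is_state_bdm:
  assumes "is_state v y G" shows "bdm y"
proof -
  obtain B where B: "B \<ge> 0" "\<And>x. \<bar>y x\<bar> \<le> B" by (rule is_state_bounded[OF assms], rule that)
  show ?thesis unfolding bdm_def using is_state_meas[OF assms] B(2) by (intro conjI exI[of _ B] allI)
qed

lemma bdm_sqi: "bdm y \<Longrightarrow> sqi M y"
  unfolding bdm_def by (elim conjE exE, rule sqi_AE_bounded(1)) auto

lemma fy_bounds:
  assumes "bdm y"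
  obtains C where "C \<ge> 0" "AE x in M. 0 \<le> fy f x (y x) \<and> fy f x (y x) \<le> C" "AE x in M. \<bar>fyy f x (y x)\<bar> \<le> C"
proof -
  obtain B where B: "\<And>x. \<bar>y x\<bar> \<le> B" using assms unfolding bdm_def by blast
  obtain C where C: "C \<ge> 0" "AE x in M. x \<in> \<Omega> \<and> (\<forall>t. \<bar>t\<bar> \<le> B \<longrightarrow> 0 \<le> fy f x t \<and> fy f x t \<le> C \<and> \<bar>fyy f x t\<bar> \<le> C)"
    by (rule f_props[of B], rule that)
  show ?thesis
  proof (rule that[OF C(1)])
    show "AE x in M. 0 \<le> fy f x (y x) \<and> fy f x (y x) \<le> C" using C(2) by eventually_elim (use B in auto)
    show "AE x in M. \<bar>fyy f x (y x)\<bar> \<le> C" using C(2) by eventually_elim (use B in auto)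
  qed
qed

text \<open>The operator is symmetric, so one relation describes linearised states and adjoint
  states.\<close>

definition lin :: "('a \<Rightarrow> real) \<Rightarrow> ('a \<Rightarrow> real) \<Rightarrow> ('a \<Rightarrow> real) \<Rightarrow> bool" where
  "lin y z g \<longleftrightarrow> (\<exists>G. W z G \<and> weq G (\<lambda>x. g x - fy f x (y x) * z x))"

lemma lin_sqi: "lin y z g \<Longrightarrow> sqi M z"
  unfolding lin_def using W_sqi by blast

lemma fy_mult_sqi:
  assumes y: "bdm y" and z: "sqi M z"
  shows "sqi M (\<lambda>x. fy f x (y x) * z x)"
proof -
  obtain C where C: "C \<ge> 0" "AE x in M. 0 \<le> fy f x (y x) \<and> fy f x (y x) \<le> C" by (rule fy_bounds[OF y], rule that)
  have "AE x in M. \<bar>fy f x (y x)\<bar> \<le> C" using C(2) by eventually_elim auto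
  then show ?thesis using sqi_bounded_mult_real(1)[OF z fy_meas] y unfolding bdm_def by blast
qed

lemma lin_exists:
  assumes y: "bdm y" and g: "sqi M g"
  shows "\<exists>z. lin y z g"
proof -
  have ym: "y \<in> borel_measurable M" using y by (simp add: bdm_def)
  obtain C where C: "C \<ge> 0" "AE x in M. 0 \<le> fy f x (y x) \<and> fy f x (y x) \<le> C" by (rule fy_bounds[OF y], rule that)
  define h where "h x t = fy f x (y x) * t" for x t
  have hm: "(\<lambda>x. h x (w x)) \<in> borel_measurable M" if "w \<in> borel_measurable M" for w
    unfolding h_def using that by (intro borel_measurable_times fy_meas ym)
  have hl: "AE x in M. \<forall>s t. s \<le> t \<longrightarrow> 0 \<le> h x t - h x s \<and> h x t - h x s \<le> C * (t - s)"
    using C(2) by eventually_elim (auto simp: h_def mult_right_mono mult_left_mono simp flip: right_diff_distrib)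
  obtain z G where "W z G" "weq G (\<lambda>x. g x - h x (z x))"
    by (rule solve_monotone[OF C(1) g hm hl], simp, simp add: h_def, rule that)
  then show ?thesis unfolding lin_def h_def by blast
qed

lemma lin_bounds:
  assumes y: "bdm y" and z: "lin y z g" and g: "sqi M g"
  shows "nrm2 M z \<le> CP\<^sup>2 * nrm2 M g" "AE x in M. \<bar>z x\<bar> \<le> Cinf * nrm2 M g"
proof -
  obtain G where G: "W z G" "weq G (\<lambda>x. g x - fy f x (y x) * z x)" using z unfolding lin_def by blast
  obtain C where C: "C \<ge> 0" "AE x in M. 0 \<le> fy f x (y x) \<and> fy f x (y x) \<le> C" by (rule fy_bounds[OF y], rule that)
  have sg: "AE x in M. 0 \<le> fy f x (y x) * z x * z x"
    using C(2) by eventually_elim (simp add: mult.assoc)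
  note b = weq_bounds[OF G g fy_mult_sqi[OF y W_sqi(1)[OF G(1)]] sg]
  show "nrm2 M z \<le> CP\<^sup>2 * nrm2 M g" "AE x in M. \<bar>z x\<bar> \<le> Cinf * nrm2 M g" using b(2,3) .
qed

lemma lin_diff_scale:
  assumes y: "bdm y" and z: "lin y z g" "sqi M g" and w: "lin y w h" "sqi M h"
  shows "lin y (\<lambda>x. z x - t * w x) (\<lambda>x. g x - t * h x)"
proof -
  obtain G where G: "W z G" "weq G (\<lambda>x. g x - fy f x (y x) * z x)" using z unfolding lin_def by blast
  obtain H where H: "W w H" "weq H (\<lambda>x. h x - fy f x (y x) * w x)" using w unfolding lin_def by blast
  note sG = W_sqi[OF G(1)] and sH = W_sqi[OF H(1)]
  have "weq (\<lambda>x. G x - t *\<^sub>R H x) (\<lambda>x. (g x - fy f x (y x) * z x) - t * (h x - fy f x (y x) * w x))"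
    by (intro weq_diff sG sqi_scaleR sH weq_scale G(2) H(2) integrable_mult_right sqi_integrable_L1(1) sqi_diff z w fy_mult_sqi y)
  then have "weq (\<lambda>x. G x - t *\<^sub>R H x) (\<lambda>x. (g x - t * h x) - fy f x (y x) * (z x - t * w x))"
    by (simp add: algebra_simps)
  then show ?thesis using W_diff[OF G(1) W_scale[OF H(1)]] unfolding lin_def by blast
qed

text \<open>Each equation is tested with the solution of the other, and the bilinear form is
  symmetric.\<close>

lemma lin_duality:
  assumes y: "bdm y" and z: "lin y z g" "sqi M g" and w: "lin y w h" "sqi M h"
  shows "(\<integral>x. g x * w x \<partial>M) = (\<integral>x. h x * z x \<partial>M)"
proof -
  obtain G where G: "W z G" "weq G (\<lambda>x. g x - fy f x (y x) * z x)" using z unfolding lin_def by blast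
  obtain H where H: "W w H" "weq H (\<lambda>x. h x - fy f x (y x) * w x)" using w unfolding lin_def by blast
  note sG = W_sqi[OF G(1)] and sH = W_sqi[OF H(1)]
  note cz = fy_mult_sqi[OF y sG(1)] and cw = fy_mult_sqi[OF y sH(1)]
  have "(\<integral>x. (g x - fy f x (y x) * z x) * w x \<partial>M) = (\<integral>x. (h x - fy f x (y x) * w x) * z x \<partial>M)"
    using weq_W[OF G(2) sG(2) sqi_diff[OF z(2) cz] H(1)] weq_W[OF H(2) sH(2) sqi_diff[OF w(2) cw] G(1)]
    by (simp add: inner_commute)
  moreover have "(\<integral>x. (g x - fy f x (y x) * z x) * w x \<partial>M) = (\<integral>x. g x * w x \<partial>M) - (\<integral>x. fy f x (y x) * z x * w x \<partial>M)"
    using sqi_mult_integrable[OF z(2) sH(1)] sqi_mult_integrable[OF cz sH(1)] by (simp add: left_diff_distrib)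
  moreover have "(\<integral>x. (h x - fy f x (y x) * w x) * z x \<partial>M) = (\<integral>x. h x * z x \<partial>M) - (\<integral>x. fy f x (y x) * w x * z x \<partial>M)"
    using sqi_mult_integrable[OF w(2) sG(1)] sqi_mult_integrable[OF cw sG(1)] by (simp add: left_diff_distrib)
  moreover have "(\<integral>x. fy f x (y x) * w x * z x \<partial>M) = (\<integral>x. fy f x (y x) * z x * w x \<partial>M)"
    by (simp add: mult_ac)
  ultimately show ?thesis by linarith
qed

text \<open>A change of the linearisation point is absorbed into the datum, so that equations at
  different states can be compared through one operator.\<close>

lemma lin_change_base:
  assumes z: "lin y' z g"
  shows "lin y z (\<lambda>x. g x - (fy f x (y' x) - fy f x (y x)) * z x)"
  using z unfolding lin_def by (simp add: algebra_simps)

text \<open>The increment may be negative or zero, so the intermediate point is located only by its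
  distance from y and its modulus.\<close>

lemma f_taylor2:
  assumes x: "x \<in> \<Omega>"
  shows "\<exists>t. \<bar>t - y\<bar> \<le> \<bar>e\<bar> \<and> \<bar>t\<bar> \<le> max \<bar>y\<bar> \<bar>y + e\<bar> \<and>
    f x (y + e) - f x y - fy f x y * e = fyy f x t / 2 * e\<^sup>2"
proof (cases "e = 0")
  case True
  then show ?thesis by (intro exI[of _ y]) auto
next
  case False
  define df where "df k = (if k = 0 then f x else if k = 1 then fy f x else fyy f x)" for k :: nat
  have d: "\<forall>m t. m < 2 \<and> min y (y + e) \<le> t \<and> t \<le> max y (y + e) \<longrightarrow> (df m has_real_derivative df (Suc m) t) (at t)"
  proof (intro allI impI)
    fix m :: nat and t assume "m < 2 \<and> min y (y + e) \<le> t \<and> t \<le> max y (y + e)"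
    then have "m = 0 \<or> m = 1" by auto
    then show "(df m has_real_derivative df (Suc m) t) (at t)" using f_C2 x by (auto simp: df_def)
  qed
  have "\<exists>t. (if y + e < y then y + e < t \<and> t < y else y < t \<and> t < y + e) \<and>
    f x (y + e) = (\<Sum>m<2. df m y / fact m * (y + e - y) ^ m) + df 2 t / fact 2 * (y + e - y)\<^sup>2"
    by (rule Taylor[of 2 df "f x" "min y (y + e)" "max y (y + e)" y "y + e"]) (use d False in \<open>auto simp: df_def\<close>)
  then obtain t where t: "if y + e < y then y + e < t \<and> t < y else y < t \<and> t < y + e"
    "f x (y + e) = (\<Sum>m<2. df m y / fact m * (y + e - y) ^ m) + df 2 t / fact 2 * (y + e - y)\<^sup>2" by blast
  have "f x (y + e) - f x y - fy f x y * e = fyy f x t / 2 * e\<^sup>2"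
    using t(2) by (simp add: df_def numeral_2_eq_2)
  moreover have "\<bar>t - y\<bar> \<le> \<bar>e\<bar>" "\<bar>t\<bar> \<le> max \<bar>y\<bar> \<bar>y + e\<bar>" using t(1) by (auto split: if_splits)
  ultimately show ?thesis by blast
qed

lemma fy_lip:
  assumes x: "x \<in> \<Omega>" and b: "\<forall>t. \<bar>t\<bar> \<le> m \<longrightarrow> \<bar>fyy f x t\<bar> \<le> C" and st: "\<bar>s\<bar> \<le> m" "\<bar>t\<bar> \<le> m"
  shows "\<bar>fy f x t - fy f x s\<bar> \<le> C * \<bar>t - s\<bar>"
proof -
  have "norm (fy f x t - fy f x s) \<le> C * norm (t - s)"
  proof (rule field_differentiable_bound[where S="{-m..m}" and f'="fyy f x"])
    show "(fy f x has_real_derivative fyy f x z) (at z within {- m..m})" for z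
      using f_C2 x has_field_derivative_at_within by blast
  qed (use b st in auto)
  then show ?thesis by simp
qed

end

context control_problem
begin

lemma lin_sol_iff:
  assumes v: "L2 \<omega> v" and y: "bdm y"
  shows "lin_sol \<Omega> \<omega> f y v z \<longleftrightarrow> lin y z (ext v)"
proof -
  have vs: "sqi M (ext v)" using v by (simp add: L2_iff_sqi sqi_ext)
  have "(\<forall>\<phi> D\<phi>. test_fun \<Omega> \<phi> D\<phi> \<longrightarrow> (LINT x:\<Omega>|lebesgue. G x \<bullet> D\<phi> x + fy f x (y x) * z x * \<phi> x) = (LINT x:\<omega>|lebesgue. v x * \<phi> x))
      \<longleftrightarrow> weq G (\<lambda>x. ext v x - fy f x (y x) * z x)" if W: "W z G" for G
  proof -
    have I: "integrable M (\<lambda>x. fy f x (y x) * z x)" by (rule sqi_integrable_L1(1)[OF fy_mult_sqi[OF y W_sqi(1)[OF W]]])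
    have "((LINT x:\<Omega>|lebesgue. G x \<bullet> D\<phi> x + fy f x (y x) * z x * \<phi> x) = (LINT x:\<omega>|lebesgue. v x * \<phi> x))
        \<longleftrightarrow> ((\<integral>x. G x \<bullet> D\<phi> x \<partial>M) = (\<integral>x. (ext v x - fy f x (y x) * z x) * \<phi> x \<partial>M))"
      if t: "test_fun \<Omega> \<phi> D\<phi>" for \<phi> D\<phi>
    proof -
      have "(LINT x:\<Omega>|lebesgue. G x \<bullet> D\<phi> x + fy f x (y x) * z x * \<phi> x) = (\<integral>x. G x \<bullet> D\<phi> x \<partial>M) + (\<integral>x. fy f x (y x) * z x * \<phi> x \<partial>M)"
        using sqi_inner_integrable[OF W_sqi(2)[OF W] test_fun_sqi(2)[OF t]] integrable_mult_test[OF I t]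
        by (simp add: set_integral_eq_lebesgue_on)
      moreover have "(\<integral>x. (ext v x - fy f x (y x) * z x) * \<phi> x \<partial>M) = (\<integral>x. ext v x * \<phi> x \<partial>M) - (\<integral>x. fy f x (y x) * z x * \<phi> x \<partial>M)"
        using integrable_mult_test[OF I t] integrable_mult_test[OF sqi_integrable_L1(1)[OF vs] t]
        by (simp add: left_diff_distrib)
      ultimately show ?thesis unfolding set_integral_\<omega>_mult by linarith
    qed
    then show ?thesis unfolding weq_def by blast
  qed
  then show ?thesis unfolding lin_sol_def lin_def H01_iff_W by blast
qed

lemma adj_sol_imp_lin:
  assumes y: "bdm y" and yd: "sqi M yd" and a: "adj_sol \<Omega> f y yd p"
  shows "lin y p (\<lambda>x. y x - yd x)"
proof -
  have ys: "sqi M (\<lambda>x. y x - yd x)" by (rule sqi_diff[OF bdm_sqi[OF y] yd])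
  obtain G where W: "W p G" and e: "\<And>\<phi> D\<phi>. test_fun \<Omega> \<phi> D\<phi> \<Longrightarrow>
        (LINT x:\<Omega>|lebesgue. G x \<bullet> D\<phi> x + fy f x (y x) * p x * \<phi> x) = (LINT x:\<Omega>|lebesgue. (y x - yd x) * \<phi> x)"
    using a unfolding adj_sol_def H01_iff_W by blast
  have I: "integrable M (\<lambda>x. fy f x (y x) * p x)" by (rule sqi_integrable_L1(1)[OF fy_mult_sqi[OF y W_sqi(1)[OF W]]])
  have "weq G (\<lambda>x. (y x - yd x) - fy f x (y x) * p x)" unfolding weq_def
  proof (intro allI impI)
    fix \<phi> D\<phi> assume t: "test_fun \<Omega> \<phi> D\<phi>"
    have "(LINT x:\<Omega>|lebesgue. G x \<bullet> D\<phi> x + fy f x (y x) * p x * \<phi> x) = (\<integral>x. G x \<bullet> D\<phi> x \<partial>M) + (\<integral>x. fy f x (y x) * p x * \<phi> x \<partial>M)"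
      using sqi_inner_integrable[OF W_sqi(2)[OF W] test_fun_sqi(2)[OF t]] integrable_mult_test[OF I t]
      by (simp add: set_integral_eq_lebesgue_on)
    moreover have "(\<integral>x. ((y x - yd x) - fy f x (y x) * p x) * \<phi> x \<partial>M) = (\<integral>x. (y x - yd x) * \<phi> x \<partial>M) - (\<integral>x. fy f x (y x) * p x * \<phi> x \<partial>M)"
      using integrable_mult_test[OF I t] integrable_mult_test[OF sqi_integrable_L1(1)[OF ys] t]
      by (subst left_diff_distrib) simp
    moreover have "(LINT x:\<Omega>|lebesgue. (y x - yd x) * \<phi> x) = (\<integral>x. (y x - yd x) * \<phi> x \<partial>M)"
      by (simp add: set_integral_eq_lebesgue_on)
    ultimately show "(\<integral>x. G x \<bullet> D\<phi> x \<partial>M) = (\<integral>x. ((y x - yd x) - fy f x (y x) * p x) * \<phi> x \<partial>M)"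
      using e[OF t] by linarith
  qed
  then show ?thesis using W unfolding lin_def by blast
qed

end

section \<open>Expansion of the cost\<close>

locale cost_problem = control_problem +
  fixes yd :: "'a \<Rightarrow> real" and \<beta> \<gamma> :: real
  assumes yd: "sqi M yd" and beta: "\<beta> \<ge> 0"
begin

abbreviation S where "S u \<equiv> Sop \<Omega> \<omega> f u"
abbreviation F where "F u \<equiv> Fcost \<Omega> \<omega> f yd \<beta> \<gamma> u"

definition dS :: "('a \<Rightarrow> real) \<Rightarrow> ('a \<Rightarrow> real) \<Rightarrow> 'a \<Rightarrow> real" where
  "dS u v x = S (\<lambda>x. u x + v x) x - S u x"

definition rem :: "('a \<Rightarrow> real) \<Rightarrow> ('a \<Rightarrow> real) \<Rightarrow> 'a \<Rightarrow> real" where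
  "rem u v x = f x (S (\<lambda>x. u x + v x) x) - f x (S u x) - fy f x (S u x) * dS u v x"

text \<open>The derivative of F at u in direction v, when \<phi> is the adjoint state of u; see
  \<open>F1_eq\<close>.\<close>

definition Lf :: "('a \<Rightarrow> real) \<Rightarrow> ('a \<Rightarrow> real) \<Rightarrow> ('a \<Rightarrow> real) \<Rightarrow> real" where
  "Lf u \<phi> v = (\<integral>x. ext v x * \<phi> x \<partial>M) + \<beta> * (\<integral>x. u x \<partial>N) * (\<integral>x. v x \<partial>N) + \<gamma> * (\<integral>x. u x * v x \<partial>N)"

lemma S_state:
  assumes "sqi N u"
  obtains G where "is_state (ext u) (S u) G"
  using Sop_state[of u] assms by (auto simp: L2_iff_sqi)

lemma S_bdm: "sqi N u \<Longrightarrow> bdm (S u)"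
  using S_state is_state_bdm by metis

lemma S_minus_yd: "sqi N u \<Longrightarrow> sqi M (\<lambda>x. S u x - yd x)"
  by (rule sqi_diff[OF bdm_sqi[OF S_bdm] yd])

lemma ext_add_scale: "ext (\<lambda>x. t * v x) = (\<lambda>x. t * ext v x)" "ext (\<lambda>x. u x + v x) = (\<lambda>x. ext u x + ext v x)"
  by (auto simp: ext_def fun_eq_iff distrib_left)

text \<open>Subtracting two state equations and linearising at u moves the Taylor remainder
  \<open>rem\<close> to the right-hand side, so the state increment solves a linear equation
  exactly.\<close>

lemma dS_props:
  assumes u: "sqi N u" and v: "sqi N v"
  shows "lin (S u) (dS u v) (\<lambda>x. ext v x - rem u v x)" "sqi M (rem u v)" "sqi M (dS u v)"
    "nrm2 M (dS u v) \<le> CP\<^sup>2 * nrm2 N v" "\<bar>dS u v x\<bar> \<le> Cinf * nrm2 N v"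
proof -
  have uv: "sqi N (\<lambda>x. u x + v x)" by (rule sqi_add[OF u v])
  obtain G1 where G1: "is_state (ext (\<lambda>x. u x + v x)) (S (\<lambda>x. u x + v x)) G1" by (rule S_state[OF uv])
  obtain G2 where G2: "is_state (ext u) (S u) G2" by (rule S_state[OF u])
  have e: "sqi M (ext (\<lambda>x. u x + v x))" "sqi M (ext u)" using u uv by (auto simp: sqi_ext)
  have ev: "(\<lambda>x. ext (\<lambda>x. u x + v x) x - ext u x) = ext v" by (simp add: ext_add_scale)
  note d = is_state_diff[OF G1 G2 e]
  have W: "W (dS u v) (\<lambda>x. G1 x - G2 x)"
    using W_diff[of "S (\<lambda>x. u x + v x)" G1 "S u" G2] G1 G2 unfolding is_state_def dS_def[abs_def] by blast
  show s: "sqi M (dS u v)" by (rule W_sqi(1)[OF W])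
  have "rem u v = (\<lambda>x. (f x (S (\<lambda>x. u x + v x) x) - f x (S u x)) - fy f x (S u x) * dS u v x)"
    by (simp add: rem_def fun_eq_iff)
  then show "sqi M (rem u v)" using sqi_diff[OF d(2) fy_mult_sqi[OF S_bdm[OF u] s]] by simp
  have "weq (\<lambda>x. G1 x - G2 x) (\<lambda>x. (ext v x - rem u v x) - fy f x (S u x) * dS u v x)"
  proof -
    have "(\<lambda>x. (ext v x - rem u v x) - fy f x (S u x) * dS u v x)
        = (\<lambda>x. (ext (\<lambda>x. u x + v x) x - ext u x) - (f x (S (\<lambda>x. u x + v x) x) - f x (S u x)))"
      by (simp add: rem_def ext_add_scale fun_eq_iff)
    then show ?thesis using d(1) by (simp only:)
  qed
  then show "lin (S u) (dS u v) (\<lambda>x. ext v x - rem u v x)" using W unfolding lin_def by blast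
  show "nrm2 M (dS u v) \<le> CP\<^sup>2 * nrm2 N v" using d(3) unfolding ev nrm2_ext dS_def[abs_def] .
  show "\<bar>dS u v x\<bar> \<le> Cinf * nrm2 N v" using d(4)[of x] unfolding ev nrm2_ext dS_def .
qed

text \<open>For perturbations of norm at most 1 all states lie in one interval [-m, m], on which f
  has uniform derivative bounds. The remainder is quadratic because one factor of the increment is
  bounded in sup norm and the other in L^2.\<close>

lemma state_expansion:
  assumes u: "sqi N u"
  obtains C where "C \<ge> 0" "AE x in M. \<bar>fyy f x (S u x)\<bar> \<le> C"
    "\<And>v. sqi N v \<Longrightarrow> nrm2 N v \<le> 1 \<Longrightarrow> nrm2 M (rem u v) \<le> C * (nrm2 N v)\<^sup>2"
    "\<And>v. sqi N v \<Longrightarrow> nrm2 N v \<le> 1 \<Longrightarrow> AE x in M. \<bar>fy f x (S (\<lambda>x. u x + v x) x) - fy f x (S u x)\<bar> \<le> C * \<bar>dS u v x\<bar>"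
proof -
  obtain B where B: "\<And>x. \<bar>S u x\<bar> \<le> B" using S_bdm[OF u] unfolding bdm_def by blast
  have B0: "B \<ge> 0" using B[of undefined] by linarith
  define m where "m = B + Cinf"
  have m: "B \<le> m" using Cinf_nonneg by (simp add: m_def)
  obtain C0 where C0: "C0 \<ge> 0" "AE x in M. x \<in> \<Omega> \<and> (\<forall>t. \<bar>t\<bar> \<le> m \<longrightarrow> 0 \<le> fy f x t \<and> fy f x t \<le> C0 \<and> \<bar>fyy f x t\<bar> \<le> C0)"
    by (rule f_props[of m], rule that)
  have Sb: "\<bar>S (\<lambda>x. u x + v x) x\<bar> \<le> m" if v: "sqi N v" "nrm2 N v \<le> 1" for v x
  proof -
    have "\<bar>dS u v x\<bar> \<le> Cinf" using dS_props(5)[OF u v(1), of x] mult_left_mono[OF v(2) Cinf_nonneg] by linarith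
    then show ?thesis using B[of x] unfolding dS_def m_def by linarith
  qed
  show ?thesis
  \<comment> \<open>One constant for all conclusions: C0 covers the pointwise bounds, and
    \<open>C0 * (Cinf * CP\<^sup>2)\<close> the remainder.\<close>
  proof (rule that[of "C0 * (1 + Cinf * CP\<^sup>2)"])
    have K: "1 \<le> 1 + Cinf * CP\<^sup>2" using Cinf_nonneg by simp
    have CC: "C0 \<le> C0 * (1 + Cinf * CP\<^sup>2)" using mult_left_mono[OF K C0(1)] by simp
    then show "0 \<le> C0 * (1 + Cinf * CP\<^sup>2)" using C0(1) by linarith
    show "AE x in M. \<bar>fyy f x (S u x)\<bar> \<le> C0 * (1 + Cinf * CP\<^sup>2)"
      using C0(2)
    proof eventually_elim
      case (elim x)
      have "\<bar>S u x\<bar> \<le> m" using B[of x] m by linarith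
      then show ?case using elim CC by (meson order_trans)
    qed
    fix v :: "'a \<Rightarrow> real" assume v: "sqi N v" "nrm2 N v \<le> 1"
    note d = dS_props[OF u v(1)]
    show "AE x in M. \<bar>fy f x (S (\<lambda>x. u x + v x) x) - fy f x (S u x)\<bar> \<le> C0 * (1 + Cinf * CP\<^sup>2) * \<bar>dS u v x\<bar>"
      using C0(2)
    proof eventually_elim
      case (elim x)
      have "\<bar>fy f x (S (\<lambda>x. u x + v x) x) - fy f x (S u x)\<bar> \<le> C0 * \<bar>S (\<lambda>x. u x + v x) x - S u x\<bar>"
        by (rule fy_lip[of x m]) (use elim Sb[OF v, of x] B[of x] m in auto)
      also have "\<dots> \<le> C0 * (1 + Cinf * CP\<^sup>2) * \<bar>dS u v x\<bar>" unfolding dS_def by (intro mult_right_mono CC) simp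
      finally show ?case .
    qed
    have R: "AE x in M. norm (rem u v x) \<le> C0 * (Cinf * nrm2 N v) * norm (dS u v x)"
      using C0(2)
    proof eventually_elim
      case (elim x)
      obtain t where t: "\<bar>t\<bar> \<le> max \<bar>S u x\<bar> \<bar>S u x + dS u v x\<bar>"
        "f x (S u x + dS u v x) - f x (S u x) - fy f x (S u x) * dS u v x = fyy f x t / 2 * (dS u v x)\<^sup>2"
        using f_taylor2[of x "S u x" "dS u v x"] elim by blast
      have eq: "S u x + dS u v x = S (\<lambda>x. u x + v x) x" by (simp add: dS_def)
      have "\<bar>t\<bar> \<le> m" using t(1) Sb[OF v, of x] B[of x] m unfolding eq by linarith
      then have ft: "\<bar>fyy f x t\<bar> \<le> C0" using elim by blast
      have "rem u v x = fyy f x t / 2 * (dS u v x)\<^sup>2" using t(2) unfolding eq rem_def .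
      then have "\<bar>rem u v x\<bar> = \<bar>fyy f x t\<bar> / 2 * (\<bar>dS u v x\<bar> * \<bar>dS u v x\<bar>)"
        by (simp only: abs_mult abs_divide power2_eq_square abs_numeral)
      also have "\<dots> \<le> C0 * ((Cinf * nrm2 N v) * \<bar>dS u v x\<bar>)"
        using ft d(5)[of x] C0(1) by (intro mult_mono mult_right_mono) auto
      finally show ?case by (simp add: mult.assoc)
    qed
    have "nrm2 M (rem u v) \<le> \<bar>C0 * (Cinf * nrm2 N v)\<bar> * nrm2 M (dS u v)"
      by (rule sqi_bound(2)[OF d(3) sqi_meas[OF d(2)] R])
    also have "\<dots> = C0 * (Cinf * nrm2 N v) * nrm2 M (dS u v)" using C0(1) Cinf_nonneg by simp
    also have "\<dots> \<le> C0 * (Cinf * nrm2 N v) * (CP\<^sup>2 * nrm2 N v)"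
      using C0(1) Cinf_nonneg by (intro mult_left_mono d(4)) auto
    also have "\<dots> = C0 * (Cinf * CP\<^sup>2) * (nrm2 N v)\<^sup>2" by (simp add: power2_eq_square mult_ac)
    also have "\<dots> \<le> C0 * (1 + Cinf * CP\<^sup>2) * (nrm2 N v)\<^sup>2" using C0(1) by (intro mult_right_mono mult_left_mono) auto
    finally show "nrm2 M (rem u v) \<le> C0 * (1 + Cinf * CP\<^sup>2) * (nrm2 N v)\<^sup>2" .
  qed
qed

lemma Fcost_eq:
  "F u = 1/2 * (nrm2 M (\<lambda>x. S u x - yd x))\<^sup>2 + \<beta>/2 * (\<integral>x. u x \<partial>N)\<^sup>2 + \<gamma>/2 * (nrm2 N u)\<^sup>2"
  unfolding Fcost_def by (simp add: set_integral_eq_lebesgue_on nrm2_power2)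

text \<open>An exact identity: the adjoint equation trades the pairing of the misfit with the state
  increment for the pairing of \<phi> with v, minus that of \<phi> with the remainder.\<close>

lemma cost_diff:
  assumes u: "sqi N u" and v: "sqi N v" and p: "lin (S u) \<phi> (\<lambda>x. S u x - yd x)"
  shows "F (\<lambda>x. u x + v x) - F u = Lf u \<phi> v + ((nrm2 M (dS u v))\<^sup>2 - 2 * (\<integral>x. \<phi> x * rem u v x \<partial>M)
    + \<beta> * (\<integral>x. v x \<partial>N)\<^sup>2 + \<gamma> * (nrm2 N v)\<^sup>2) / 2"
proof -
  note d = dS_props[OF u v] and sy = S_minus_yd[OF u] and ph = lin_sqi[OF p]
  have ev: "sqi M (ext v)" using v by (simp add: sqi_ext)
  have "(\<lambda>x. S (\<lambda>x. u x + v x) x - yd x) = (\<lambda>x. (S u x - yd x) + dS u v x)" by (simp add: dS_def)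
  then have 1: "(nrm2 M (\<lambda>x. S (\<lambda>x. u x + v x) x - yd x))\<^sup>2
     = (nrm2 M (\<lambda>x. S u x - yd x))\<^sup>2 + 2 * (\<integral>x. (S u x - yd x) * dS u v x \<partial>M) + (nrm2 M (dS u v))\<^sup>2"
    using nrm2_add_power2[OF sy d(3)] by simp
  have "(\<integral>x. (S u x - yd x) * dS u v x \<partial>M) = (\<integral>x. (ext v x - rem u v x) * \<phi> x \<partial>M)"
    by (rule lin_duality[OF S_bdm[OF u] p sy d(1) sqi_diff[OF ev d(2)]])
  also have "\<dots> = (\<integral>x. ext v x * \<phi> x \<partial>M) - (\<integral>x. \<phi> x * rem u v x \<partial>M)"
    using sqi_mult_integrable[OF ev ph] sqi_mult_integrable[OF d(2) ph]
    by (simp add: left_diff_distrib mult.commute[of "\<phi> _"])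
  finally have 2: "(\<integral>x. (S u x - yd x) * dS u v x \<partial>M) = (\<integral>x. ext v x * \<phi> x \<partial>M) - (\<integral>x. \<phi> x * rem u v x \<partial>M)" .
  have 3: "(nrm2 N (\<lambda>x. u x + v x))\<^sup>2 = (nrm2 N u)\<^sup>2 + 2 * (\<integral>x. u x * v x \<partial>N) + (nrm2 N v)\<^sup>2"
    using nrm2_add_power2[OF u v] by simp
  have 4: "(\<integral>x. u x + v x \<partial>N) = (\<integral>x. u x \<partial>N) + (\<integral>x. v x \<partial>N)"
    using N.sqi_integrable_L1(1)[OF u] N.sqi_integrable_L1(1)[OF v] by simp
  show ?thesis unfolding Fcost_eq 1 2 3 4 Lf_def by (simp add: power2_sum field_simps)
qed

lemma integral_N_bound:
  assumes "sqi N v"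
  shows "(\<integral>x. v x \<partial>N)\<^sup>2 \<le> measure N (space N) * (nrm2 N v)\<^sup>2"
proof -
  have "\<bar>\<integral>x. v x \<partial>N\<bar> \<le> sqrt (measure N (space N)) * nrm2 N v"
    using order_trans[OF integral_norm_bound N.sqi_integrable_L1(2)[OF assms]] by simp
  from power_mono[OF this, of 2] show ?thesis by (simp add: power_mult_distrib)
qed

lemma cost_first_order:
  assumes u: "sqi N u" and p: "lin (S u) \<phi> (\<lambda>x. S u x - yd x)"
  obtains K where "\<And>v. sqi N v \<Longrightarrow> nrm2 N v \<le> 1 \<Longrightarrow> \<bar>F (\<lambda>x. u x + v x) - F u - Lf u \<phi> v\<bar> \<le> K * (nrm2 N v)\<^sup>2"
proof -
  obtain C where C: "C \<ge> 0" "\<And>v. sqi N v \<Longrightarrow> nrm2 N v \<le> 1 \<Longrightarrow> nrm2 M (rem u v) \<le> C * (nrm2 N v)\<^sup>2"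
    by (rule state_expansion[OF u], rule that)
  define K where "K = ((CP\<^sup>2)\<^sup>2 + 2 * (nrm2 M \<phi> * C) + \<beta> * measure N (space N) + \<bar>\<gamma>\<bar>) / 2"
  show ?thesis
  proof (rule that[of K])
    fix v :: "'a \<Rightarrow> real" assume v: "sqi N v" "nrm2 N v \<le> 1"
    note d = dS_props[OF u v(1)]
    let ?n = "(nrm2 N v)\<^sup>2"
    have 1: "(nrm2 M (dS u v))\<^sup>2 \<le> (CP\<^sup>2)\<^sup>2 * ?n" using power_mono[OF d(4), of 2] by (simp add: power_mult_distrib)
    have "\<bar>\<integral>x. \<phi> x * rem u v x \<partial>M\<bar> \<le> nrm2 M \<phi> * nrm2 M (rem u v)" by (rule sqi_CS_mult[OF lin_sqi[OF p] d(2)])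
    also have "\<dots> \<le> nrm2 M \<phi> * (C * ?n)" by (intro mult_left_mono C(2) v) simp
    finally have 2: "\<bar>\<integral>x. \<phi> x * rem u v x \<partial>M\<bar> \<le> nrm2 M \<phi> * C * ?n" by simp
    have 3: "\<beta> * (\<integral>x. v x \<partial>N)\<^sup>2 \<le> \<beta> * (measure N (space N) * ?n)" by (intro mult_left_mono integral_N_bound v beta)
    have 4: "\<bar>\<gamma> * ?n\<bar> = \<bar>\<gamma>\<bar> * ?n" by (simp add: abs_mult)
    have 5: "0 \<le> \<beta> * (\<integral>x. v x \<partial>N)\<^sup>2" "0 \<le> (nrm2 M (dS u v))\<^sup>2" using beta by auto
    have "\<bar>F (\<lambda>x. u x + v x) - F u - Lf u \<phi> v\<bar> = \<bar>(nrm2 M (dS u v))\<^sup>2 - 2 * (\<integral>x. \<phi> x * rem u v x \<partial>M)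
      + \<beta> * (\<integral>x. v x \<partial>N)\<^sup>2 + \<gamma> * ?n\<bar> / 2" using cost_diff[OF u v(1) p] by simp
    also have "\<dots> \<le> ((CP\<^sup>2)\<^sup>2 * ?n + 2 * (nrm2 M \<phi> * C * ?n) + \<beta> * (measure N (space N) * ?n) + \<bar>\<gamma>\<bar> * ?n) / 2"
      using 1 2 3 4 5 by (intro divide_right_mono) linarith+
    also have "\<dots> = K * ?n" by (simp add: K_def field_simps)
    finally show "\<bar>F (\<lambda>x. u x + v x) - F u - Lf u \<phi> v\<bar> \<le> K * ?n" .
  qed
qed

section \<open>Derivatives of the cost along lines\<close>

lemma Lf_scale: "Lf u \<phi> (\<lambda>x. s * v x) = s * Lf u \<phi> v"
  unfolding Lf_def ext_add_scale by (simp add: distrib_left mult_ac)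

text \<open>The first order expansion is available at every control, hence at every point of the
  line. The second derivative needs the formula for all t.\<close>

lemma DERIV_F:
  assumes u: "sqi N u" and v: "sqi N v"
    and p: "lin (S (\<lambda>x. u x + t * v x)) \<phi> (\<lambda>x. S (\<lambda>x. u x + t * v x) x - yd x)"
  shows "((\<lambda>t. F (\<lambda>x. u x + t * v x)) has_real_derivative Lf (\<lambda>x. u x + t * v x) \<phi> v) (at t)"
proof -
  let ?u = "\<lambda>x. u x + t * v x"
  have ut: "sqi N ?u" by (intro sqi_add u sqi_mult v)
  obtain K where K: "\<And>v. sqi N v \<Longrightarrow> nrm2 N v \<le> 1 \<Longrightarrow> \<bar>F (\<lambda>x. ?u x + v x) - F ?u - Lf ?u \<phi> v\<bar> \<le> K * (nrm2 N v)\<^sup>2"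
    by (rule cost_first_order[OF ut p], rule that)
  show ?thesis
  \<comment> \<open>This radius keeps the norm of s v at most 1, and is meaningful also when v
    vanishes.\<close>
  proof (rule quadratic_remainder_DERIV[where d="1 / (nrm2 N v + 1)" and K="K * (nrm2 N v)\<^sup>2"])
    show "0 < 1 / (nrm2 N v + 1)" by (intro divide_pos_pos add_nonneg_pos) auto
    fix s assume s: "\<bar>s\<bar> < 1 / (nrm2 N v + 1)"
    have "\<bar>s\<bar> * (nrm2 N v + 1) \<le> 1" using s nrm2_nonneg[of N v] by (simp add: pos_less_divide_eq)
    then have "nrm2 N (\<lambda>x. s * v x) \<le> 1" unfolding nrm2_mult by (simp add: distrib_left)
    from K[OF sqi_mult[OF v] this]
    have "\<bar>F (\<lambda>x. ?u x + s * v x) - F ?u - s * Lf ?u \<phi> v\<bar> \<le> K * (\<bar>s\<bar> * nrm2 N v)\<^sup>2"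
      unfolding Lf_scale nrm2_mult .
    moreover have "(\<lambda>x. ?u x + s * v x) = (\<lambda>x. u x + (t + s) * v x)" by (simp add: algebra_simps)
    ultimately show "\<bar>F (\<lambda>x. u x + (t + s) * v x) - F ?u - s * Lf ?u \<phi> v\<bar> \<le> K * (nrm2 N v)\<^sup>2 * s\<^sup>2"
      by (simp add: power_mult_distrib mult_ac)
  qed
qed

lemma F1_eq:
  assumes u: "sqi N u" and v: "sqi N v" and p: "lin (S u) \<phi> (\<lambda>x. S u x - yd x)"
  shows "F1 \<Omega> \<omega> f yd \<beta> \<gamma> u v = Lf u \<phi> v"
  unfolding F1_def using DERIV_imp_deriv[OF DERIV_F[OF u v, of 0 \<phi>]] p by simp

text \<open>By duality with the fixed linearised state z, the increment of the pairing of v with the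
  adjoint state becomes the integral of \<open>D k\<close> times z. There the new adjoint state
  occurs undifferentiated, so \<open>D k / X k\<close> can be shown to converge pointwise and is
  dominated by a constant.\<close>

lemma adjoint_path_derivative_seq:
  assumes u: "sqi N u" and v: "sqi N v" and p: "lin (S u) \<phi> (\<lambda>x. S u x - yd x)"
    and z: "lin (S u) z (ext v)"
    and P: "\<And>k. lin (S (\<lambda>x. u x + X k * v x)) (\<Phi> k) (\<lambda>x. S (\<lambda>x. u x + X k * v x) x - yd x)"
    and X: "X \<longlonglongrightarrow> 0" "\<And>k. X k \<noteq> 0" "\<And>k. \<bar>X k\<bar> * nrm2 N v \<le> 1"
  shows "(\<lambda>k. ((\<integral>x. ext v x * \<Phi> k x \<partial>M) - (\<integral>x. ext v x * \<phi> x \<partial>M)) / X k)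
    \<longlonglongrightarrow> (\<integral>x. (z x - fyy f x (S u x) * z x * \<phi> x) * z x \<partial>M)"
proof -
  define y where "y = S u"
  define Y where "Y k = S (\<lambda>x. u x + X k * v x)" for k
  define \<eta> where "\<eta> k = dS u (\<lambda>x. X k * v x)" for k
  define R where "R k = rem u (\<lambda>x. X k * v x)" for k
  define n where "n = nrm2 N v"
  have n0: "n \<ge> 0" by (simp add: n_def)
  have vk: "sqi N (\<lambda>x. X k * v x)" and nk: "nrm2 N (\<lambda>x. X k * v x) = \<bar>X k\<bar> * n" and nk1: "nrm2 N (\<lambda>x. X k * v x) \<le> 1" for k
    using sqi_mult[OF v] X(3)[of k] by (simp_all add: nrm2_mult n_def)
  have uk: "sqi N (\<lambda>x. u x + X k * v x)" for k by (intro sqi_add u vk)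
  have ev: "sqi M (ext v)" using v by (simp add: sqi_ext)
  have yb: "bdm y" and Yb: "bdm (Y k)" for k unfolding y_def Y_def by (rule S_bdm[OF u], rule S_bdm[OF uk])
  have ym: "y \<in> borel_measurable M" and Ym: "Y k \<in> borel_measurable M" for k using yb Yb[of k] by (auto simp: bdm_def)
  have Yeq: "Y k x = y x + \<eta> k x" for k x by (simp add: Y_def y_def \<eta>_def dS_def)
  note d = dS_props[OF u vk, folded \<eta>_def R_def y_def, unfolded nk]
  obtain C where C: "C \<ge> 0" "AE x in M. \<bar>fyy f x (S u x)\<bar> \<le> C"
    "\<And>v. sqi N v \<Longrightarrow> nrm2 N v \<le> 1 \<Longrightarrow> nrm2 M (rem u v) \<le> C * (nrm2 N v)\<^sup>2"
    "\<And>v. sqi N v \<Longrightarrow> nrm2 N v \<le> 1 \<Longrightarrow> AE x in M. \<bar>fy f x (S (\<lambda>x. u x + v x) x) - fy f x (S u x)\<bar> \<le> C * \<bar>dS u v x\<bar>"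
    by (rule state_expansion[OF u], rule that)
  have CR: "nrm2 M (R k) \<le> C * (\<bar>X k\<bar> * n)\<^sup>2" for k using C(3)[OF vk nk1, of k] unfolding nk R_def .
  have Cc: "AE x in M. \<bar>fy f x (Y k x) - fy f x (y x)\<bar> \<le> C * \<bar>\<eta> k x\<bar>" for k
    using C(4)[OF vk nk1, of k] unfolding Y_def y_def \<eta>_def .
  note p' = p[folded y_def] and z' = z[folded y_def] and P' = P[folded Y_def]
  note sz = lin_sqi[OF z] and sp = lin_sqi[OF p] and sP = lin_sqi[OF P]
  have sy: "sqi M (\<lambda>x. y x - yd x)" and sY: "sqi M (\<lambda>x. Y k x - yd x)" for k
    unfolding y_def Y_def by (rule S_minus_yd[OF u], rule S_minus_yd[OF uk])
  define Z where "Z = Cinf * n"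
  have Z0: "Z \<ge> 0" using Cinf_nonneg n0 by (simp add: Z_def)
  have zb: "AE x in M. \<bar>z x\<bar> \<le> Z" using lin_bounds(2)[OF yb z' ev] by (simp add: Z_def n_def nrm2_ext)
  have eb: "\<bar>\<eta> k x / X k\<bar> \<le> Z" for k x
  proof -
    have "\<bar>\<eta> k x\<bar> \<le> Z * \<bar>X k\<bar>" using d(5)[of k x] by (simp add: Z_def mult_ac)
    then show ?thesis using X(2)[of k] by (simp add: abs_divide pos_divide_le_eq)
  qed
  \<comment> \<open>A common sup bound for all adjoint states: the misfit changes by at most
    \<open>CP\<^sup>2\<close> in L^2 when the perturbation has norm at most 1.\<close>
  define P1 where "P1 = Cinf * (nrm2 M (\<lambda>x. y x - yd x) + CP\<^sup>2)"
  have P10: "P1 \<ge> 0" using Cinf_nonneg by (simp add: P1_def)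
  have Pb: "AE x in M. \<bar>\<Phi> k x\<bar> \<le> P1" for k
  proof -
    have "nrm2 M (\<lambda>x. Y k x - yd x) \<le> nrm2 M (\<lambda>x. y x - yd x) + nrm2 M (\<eta> k)"
      using nrm2_triangle[OF sy d(3)[of k]] by (simp add: Yeq algebra_simps)
    also have "nrm2 M (\<eta> k) \<le> CP\<^sup>2 * 1"
      using d(4)[of k] mult_left_mono[OF nk1[of k, unfolded nk], of "CP\<^sup>2"] by simp
    finally have "Cinf * nrm2 M (\<lambda>x. Y k x - yd x) \<le> P1" unfolding P1_def using Cinf_nonneg by (intro mult_left_mono) auto
    then show ?thesis using lin_bounds(2)[OF Yb P' sY, of k] by (auto elim!: AE_mp)
  qed
  have sc: "sqi M (\<lambda>x. (fy f x (Y k x) - fy f x (y x)) * \<Phi> k x)" for k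
    using sqi_diff[OF fy_mult_sqi[OF Yb[of k] sP[of k]] fy_mult_sqi[OF yb sP[of k]]] by (simp add: left_diff_distrib)
  \<comment> \<open>Datum of the equation, linearised at y, that the difference of the two adjoint
    states satisfies.\<close>
  define D where "D k x = \<eta> k x - (fy f x (Y k x) - fy f x (y x)) * \<Phi> k x" for k x
  have sD: "sqi M (D k)" for k unfolding D_def by (rule sqi_diff[OF d(3) sc])
  have linP: "lin y (\<Phi> k) (\<lambda>x. (Y k x - yd x) - (fy f x (Y k x) - fy f x (y x)) * \<Phi> k x)" for k
    by (rule lin_change_base[OF P'])
  have sq: "sqi M (\<lambda>x. (Y k x - yd x) - (fy f x (Y k x) - fy f x (y x)) * \<Phi> k x)" for k by (rule sqi_diff[OF sY sc])
  have eqD: "(\<lambda>x. ((Y k x - yd x) - (fy f x (Y k x) - fy f x (y x)) * \<Phi> k x) - 1 * (y x - yd x)) = D k" for k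
    by (simp add: fun_eq_iff D_def Yeq)
  have diff: "(\<integral>x. ext v x * \<Phi> k x \<partial>M) - (\<integral>x. ext v x * \<phi> x \<partial>M) = (\<integral>x. D k x * z x \<partial>M)" for k
  proof -
    have "(\<integral>x. ext v x * \<Phi> k x \<partial>M) = (\<integral>x. ((Y k x - yd x) - (fy f x (Y k x) - fy f x (y x)) * \<Phi> k x) * z x \<partial>M)"
      by (rule lin_duality[OF yb z' ev linP sq])
    moreover have "(\<integral>x. ext v x * \<phi> x \<partial>M) = (\<integral>x. (y x - yd x) * z x \<partial>M)"
      by (rule lin_duality[OF yb z' ev p' sy])
    moreover have "D k x * z x = ((Y k x - yd x) - (fy f x (Y k x) - fy f x (y x)) * \<Phi> k x) * z x - (y x - yd x) * z x" for x
      using fun_cong[OF eqD[of k], of x] by (metis left_diff_distrib mult_1)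
    ultimately show ?thesis
      using sqi_mult_integrable[OF sq[of k] sz] sqi_mult_integrable[OF sy sz] by simp
  qed
  \<comment> \<open>The difference of \<eta> k and X k times z solves the linearised equation with
    datum minus the remainder, which is quadratic in X k.\<close>
  have E1: "AE x in M. \<forall>k. \<bar>\<eta> k x / X k - z x\<bar> \<le> Cinf * C * n\<^sup>2 * \<bar>X k\<bar>"
    unfolding AE_all_countable
  proof
    fix k
    have l: "lin y (\<lambda>x. \<eta> k x - X k * z x) (\<lambda>x. (ext (\<lambda>x. X k * v x) x - R k x) - X k * ext v x)"
      by (rule lin_diff_scale[OF yb d(1) _ z' ev], rule sqi_diff[OF _ d(2)]) (use vk in \<open>simp add: sqi_ext\<close>)
    have "(\<lambda>x. (ext (\<lambda>x. X k * v x) x - R k x) - X k * ext v x) = (\<lambda>x. - R k x)" by (simp add: ext_add_scale)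
    then have "AE x in M. \<bar>\<eta> k x - X k * z x\<bar> \<le> Cinf * nrm2 M (R k)"
      using lin_bounds(2)[OF yb l] sqi_uminus[OF d(2)[of k]] by (simp add: nrm2_uminus)
    then show "AE x in M. \<bar>\<eta> k x / X k - z x\<bar> \<le> Cinf * C * n\<^sup>2 * \<bar>X k\<bar>"
    proof eventually_elim
      case (elim x)
      have "\<eta> k x / X k - z x = (\<eta> k x - X k * z x) / X k" using X(2)[of k] by (simp add: field_simps)
      then have "\<bar>\<eta> k x / X k - z x\<bar> = \<bar>\<eta> k x - X k * z x\<bar> / \<bar>X k\<bar>" by (simp add: abs_divide)
      also have "\<dots> \<le> Cinf * (C * (\<bar>X k\<bar> * n)\<^sup>2) / \<bar>X k\<bar>"
        using elim mult_left_mono[OF CR[of k] Cinf_nonneg] by (intro divide_right_mono) auto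
      also have "\<dots> = Cinf * C * n\<^sup>2 * \<bar>X k\<bar>" using X(2)[of k] by (simp add: power2_eq_square)
      finally show ?case .
    qed
  qed
  have E2: "AE x in M. \<forall>k. \<bar>\<Phi> k x - \<phi> x\<bar> \<le> Cinf * ((1 + C * P1) * (CP\<^sup>2 * n)) * \<bar>X k\<bar>"
    unfolding AE_all_countable
  proof
    fix k
    have "lin y (\<lambda>x. \<Phi> k x - 1 * \<phi> x) (D k)"
      using lin_diff_scale[OF yb linP sq p' sy, of k 1] unfolding eqD .
    from lin_bounds(2)[OF yb this sD]
    have 1: "AE x in M. \<bar>\<Phi> k x - \<phi> x\<bar> \<le> Cinf * nrm2 M (D k)" by simp
    have "AE x in M. norm (D k x) \<le> (1 + C * P1) * norm (\<eta> k x)"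
      using Cc[of k] Pb[of k]
    proof eventually_elim
      case (elim x)
      have "\<bar>(fy f x (Y k x) - fy f x (y x)) * \<Phi> k x\<bar> \<le> (C * \<bar>\<eta> k x\<bar>) * P1"
        unfolding abs_mult using elim C(1) by (intro mult_mono) auto
      then have "\<bar>D k x\<bar> \<le> \<bar>\<eta> k x\<bar> + (C * \<bar>\<eta> k x\<bar>) * P1" unfolding D_def by linarith
      then show ?case by (simp add: algebra_simps)
    qed
    then have "nrm2 M (D k) \<le> \<bar>1 + C * P1\<bar> * nrm2 M (\<eta> k)" by (rule sqi_bound(2)[OF d(3) sqi_meas[OF sD]])
    also have "\<dots> \<le> (1 + C * P1) * (CP\<^sup>2 * (\<bar>X k\<bar> * n))"
      using C(1) P10 d(4)[of k] by (intro mult_mono) auto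
    finally have "Cinf * nrm2 M (D k) \<le> Cinf * ((1 + C * P1) * (CP\<^sup>2 * (\<bar>X k\<bar> * n)))"
      by (rule mult_left_mono[OF _ Cinf_nonneg])
    also have "\<dots> = Cinf * ((1 + C * P1) * (CP\<^sup>2 * n)) * \<bar>X k\<bar>" by (simp only: mult_ac)
    finally have "Cinf * nrm2 M (D k) \<le> Cinf * ((1 + C * P1) * (CP\<^sup>2 * n)) * \<bar>X k\<bar>" .
    then show "AE x in M. \<bar>\<Phi> k x - \<phi> x\<bar> \<le> Cinf * ((1 + C * P1) * (CP\<^sup>2 * n)) * \<bar>X k\<bar>"
      using 1 by (auto elim!: AE_mp)
  qed
  have X0: "(\<lambda>k. c * \<bar>X k\<bar>) \<longlonglongrightarrow> 0" for c
    using tendsto_mult_left[OF tendsto_rabs_zero[OF X(1)], of c] by simp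
  have E3: "AE x in M. (\<lambda>k. D k x / X k) \<longlonglongrightarrow> z x - fyy f x (y x) * z x * \<phi> x"
    using E1 E2 AE_space
  proof eventually_elim
    case (elim x)
    have x: "x \<in> \<Omega>" using elim(3) by simp
    have "(\<lambda>k. \<eta> k x / X k - z x) \<longlonglongrightarrow> 0"
      by (rule Lim_null_comparison[OF _ X0[of "Cinf * C * n\<^sup>2"]]) (use elim(1) in simp)
    then have l1: "(\<lambda>k. \<eta> k x / X k) \<longlonglongrightarrow> z x" by (simp add: LIM_zero_iff)
    have "(\<lambda>k. \<Phi> k x - \<phi> x) \<longlonglongrightarrow> 0"
      by (rule Lim_null_comparison[OF _ X0[of "Cinf * ((1 + C * P1) * (CP\<^sup>2 * n))"]]) (use elim(2) in simp)
    then have l2: "(\<lambda>k. \<Phi> k x) \<longlonglongrightarrow> \<phi> x" by (simp add: LIM_zero_iff)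
    have l3: "(\<lambda>k. (fy f x (y x + \<eta> k x) - fy f x (y x)) / X k) \<longlonglongrightarrow> fyy f x (y x) * z x"
      by (rule DERIV_along_sequence[OF _ X(1,2) l1]) (use f_C2 x in blast)
    have "(\<lambda>k. \<eta> k x / X k - (fy f x (y x + \<eta> k x) - fy f x (y x)) / X k * \<Phi> k x)
        \<longlonglongrightarrow> z x - fyy f x (y x) * z x * \<phi> x" by (intro tendsto_intros l1 l2 l3)
    moreover have "\<eta> k x / X k - (fy f x (y x + \<eta> k x) - fy f x (y x)) / X k * \<Phi> k x = D k x / X k" for k
      using X(2)[of k] by (simp add: D_def Yeq field_simps)
    ultimately show ?case by (simp only:)
  qed
  have "(\<lambda>k. \<integral>x. D k x / X k * z x \<partial>M) \<longlonglongrightarrow> (\<integral>x. (z x - fyy f x (y x) * z x * \<phi> x) * z x \<partial>M)"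
  proof (rule integral_dominated_convergence[where w="\<lambda>_. (Z + C * Z * P1) * Z"])
    show "AE x in M. (\<lambda>k. D k x / X k * z x) \<longlonglongrightarrow> (z x - fyy f x (y x) * z x * \<phi> x) * z x"
      using E3 by eventually_elim (intro tendsto_intros)
    show "AE x in M. norm (D k x / X k * z x) \<le> (Z + C * Z * P1) * Z" for k
      using Cc[of k] Pb[of k] zb
    proof eventually_elim
      case (elim x)
      have "\<bar>(fy f x (Y k x) - fy f x (y x)) * \<Phi> k x\<bar> \<le> (C * \<bar>\<eta> k x\<bar>) * P1"
        unfolding abs_mult using elim C(1) by (intro mult_mono) auto
      then have "\<bar>D k x\<bar> \<le> \<bar>\<eta> k x\<bar> * (1 + C * P1)" unfolding D_def by (simp add: algebra_simps)
      then have "\<bar>D k x / X k\<bar> \<le> \<bar>\<eta> k x\<bar> * (1 + C * P1) / \<bar>X k\<bar>"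
        unfolding abs_divide by (intro divide_right_mono) auto
      also have "\<dots> = \<bar>\<eta> k x / X k\<bar> * (1 + C * P1)" by (simp add: abs_divide)
      also have "\<dots> \<le> Z * (1 + C * P1)" using eb[of k x] C(1) P10 by (intro mult_right_mono) auto
      finally have "\<bar>D k x / X k\<bar> \<le> Z + C * Z * P1" by (simp add: algebra_simps)
      then have "\<bar>D k x / X k\<bar> * \<bar>z x\<bar> \<le> (Z + C * Z * P1) * Z" using elim C(1) Z0 P10 by (intro mult_mono) auto
      then show ?case by (simp add: abs_mult)
    qed
    show "(\<lambda>x. (z x - fyy f x (y x) * z x * \<phi> x) * z x) \<in> borel_measurable M"
      using sqi_meas[OF sz] sqi_meas[OF sp] fyy_meas[OF ym] by measurable
    show "(\<lambda>x. D k x / X k * z x) \<in> borel_measurable M" for k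
      using sqi_meas[OF sz] sqi_meas[OF sD[of k]] by measurable
  qed simp
  moreover have "((\<integral>x. ext v x * \<Phi> k x \<partial>M) - (\<integral>x. ext v x * \<phi> x \<partial>M)) / X k = (\<integral>x. D k x / X k * z x \<partial>M)" for k
    unfolding diff by simp
  ultimately show ?thesis unfolding y_def by (simp only:)
qed

text \<open>The second derivative of F at u in direction v, when z is the linearised state and
  \<phi> the adjoint state; see \<open>F2_eq\<close>.\<close>

definition Q :: "('a \<Rightarrow> real) \<Rightarrow> ('a \<Rightarrow> real) \<Rightarrow> ('a \<Rightarrow> real) \<Rightarrow> ('a \<Rightarrow> real) \<Rightarrow> real" where
  "Q u \<phi> z v = (nrm2 M z)\<^sup>2 - (\<integral>x. fyy f x (S u x) * \<phi> x * (z x * z x) \<partial>M)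
     + \<beta> * (\<integral>x. v x \<partial>N)\<^sup>2 + \<gamma> * (nrm2 N v)\<^sup>2"

lemma adjoint_bounded:
  assumes u: "sqi N u" and p: "lin (S u) \<phi> (\<lambda>x. S u x - yd x)"
  obtains C where "C \<ge> 0" "(\<lambda>x. fyy f x (S u x) * \<phi> x) \<in> borel_measurable M"
    "AE x in M. \<bar>fyy f x (S u x) * \<phi> x\<bar> \<le> C" "AE x in M. \<bar>\<phi> x\<bar> \<le> C"
proof -
  have m: "S u \<in> borel_measurable M" using S_bdm[OF u] by (simp add: bdm_def)
  obtain C where C: "C \<ge> 0" "AE x in M. 0 \<le> fy f x (S u x) \<and> fy f x (S u x) \<le> C" "AE x in M. \<bar>fyy f x (S u x)\<bar> \<le> C"
    by (rule fy_bounds[OF S_bdm[OF u]], rule that)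
  define P where "P = Cinf * nrm2 M (\<lambda>x. S u x - yd x)"
  have P: "P \<ge> 0" "AE x in M. \<bar>\<phi> x\<bar> \<le> P"
    using Cinf_nonneg lin_bounds(2)[OF S_bdm[OF u] p S_minus_yd[OF u]] by (auto simp: P_def)
  show ?thesis
  proof (rule that[of "C * P + P"])
    show "0 \<le> C * P + P" using C P by simp
    show "(\<lambda>x. fyy f x (S u x) * \<phi> x) \<in> borel_measurable M"
      by (rule borel_measurable_times[OF fyy_meas[OF m] sqi_meas[OF lin_sqi[OF p]]])
    show "AE x in M. \<bar>fyy f x (S u x) * \<phi> x\<bar> \<le> C * P + P"
      using C(3) P(2)
    proof eventually_elim
      case (elim x)
      have "\<bar>fyy f x (S u x)\<bar> * \<bar>\<phi> x\<bar> \<le> C * P" using elim C(1) by (intro mult_mono) auto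
      then show ?case using P(1) by (simp add: abs_mult)
    qed
    show "AE x in M. \<bar>\<phi> x\<bar> \<le> C * P + P" using P(2)
    proof eventually_elim
      case (elim x)
      have "0 \<le> C * P" using C(1) P(1) by simp
      then show ?case using elim by linarith
    qed
  qed
qed

text \<open>Since \<open>F2\<close> is a derivative of a derivative, the first one must be known
  around t = 0 and not merely at 0. An adjoint state is therefore selected for every t, and only its
  pairing with v is differentiated.\<close>

lemma F2_eq:
  assumes u: "sqi N u" and v: "sqi N v" and p: "lin (S u) \<phi> (\<lambda>x. S u x - yd x)"
    and z: "lin (S u) z (ext v)"
  shows "F2 \<Omega> \<omega> f yd \<beta> \<gamma> u v = Q u \<phi> z v"
proof -
  have ut: "sqi N (\<lambda>x. u x + t * v x)" for t by (intro sqi_add u sqi_mult v)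
  have "\<forall>t. \<exists>p. lin (S (\<lambda>x. u x + t * v x)) p (\<lambda>x. S (\<lambda>x. u x + t * v x) x - yd x)"
    using lin_exists[OF S_bdm[OF ut] S_minus_yd[OF ut]] by blast
  then obtain \<Phi> where \<Phi>: "\<And>t. lin (S (\<lambda>x. u x + t * v x)) (\<Phi> t) (\<lambda>x. S (\<lambda>x. u x + t * v x) x - yd x)" by metis
  define a where "a t = (\<integral>x. ext v x * \<Phi> t x \<partial>M)" for t
  have Lt: "Lf (\<lambda>x. u x + t * v x) (\<Phi> t) v = a t + (\<beta> * (\<integral>x. u x \<partial>N) * (\<integral>x. v x \<partial>N) + \<gamma> * (\<integral>x. u x * v x \<partial>N))
     + t * (\<beta> * (\<integral>x. v x \<partial>N)\<^sup>2 + \<gamma> * (nrm2 N v)\<^sup>2)" for t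
  proof -
    have "(\<integral>x. u x + t * v x \<partial>N) = (\<integral>x. u x \<partial>N) + t * (\<integral>x. v x \<partial>N)"
      using N.sqi_integrable_L1(1)[OF u] N.sqi_integrable_L1(1)[OF v] by simp
    moreover have "(\<integral>x. (u x + t * v x) * v x \<partial>N) = (\<integral>x. u x * v x \<partial>N) + t * (nrm2 N v)\<^sup>2"
    proof -
      have "(nrm2 N v)\<^sup>2 = (\<integral>x. v x * v x \<partial>N)" unfolding nrm2_power2 by (simp add: power2_eq_square)
      then show ?thesis using sqi_mult_integrable[OF u v] sqi_mult_integrable[OF v v]
        by (simp add: distrib_right mult.assoc)
    qed
    ultimately show ?thesis unfolding Lf_def a_def by (simp add: algebra_simps power2_eq_square)
  qed
  have dF: "deriv (\<lambda>t. F (\<lambda>x. u x + t * v x)) = (\<lambda>t. a t + (\<beta> * (\<integral>x. u x \<partial>N) * (\<integral>x. v x \<partial>N) + \<gamma> * (\<integral>x. u x * v x \<partial>N))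
     + t * (\<beta> * (\<integral>x. v x \<partial>N)\<^sup>2 + \<gamma> * (nrm2 N v)\<^sup>2))"
    using DERIV_imp_deriv[OF DERIV_F[OF u v \<Phi>]] unfolding Lt by blast
  define I where "I = (\<integral>x. (z x - fyy f x (S u x) * z x * \<phi> x) * z x \<partial>M)"
  \<comment> \<open>The adjoint state selected at t = 0 may differ from the given \<phi> as a
    representative; duality shows that both have the same pairing with v.\<close>
  have \<Phi>0: "a 0 = (\<integral>x. ext v x * \<phi> x \<partial>M)"
    using lin_duality[OF S_bdm[OF u] z _ \<Phi>[of 0, simplified] S_minus_yd[OF u]]
      lin_duality[OF S_bdm[OF u] z _ p S_minus_yd[OF u]] v unfolding a_def by (simp add: sqi_ext)
  have "(a has_real_derivative I) (at 0)"
    unfolding DERIV_def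
  proof (subst tendsto_at_iff_sequentially, intro allI impI)
    fix X :: "nat \<Rightarrow> real" assume X: "\<forall>i. X i \<in> UNIV - {0}" "X \<longlonglongrightarrow> 0"
    have "(\<lambda>k. \<bar>X k\<bar> * nrm2 N v) \<longlonglongrightarrow> \<bar>0\<bar> * nrm2 N v" by (intro tendsto_intros X)
    then have "\<forall>\<^sub>F k in sequentially. \<bar>X k\<bar> * nrm2 N v < 1" by (intro order_tendstoD) auto
    then obtain n where n: "\<And>k. k \<ge> n \<Longrightarrow> \<bar>X k\<bar> * nrm2 N v < 1" by (auto simp: eventually_sequentially)
    have "(\<lambda>k. ((\<integral>x. ext v x * \<Phi> (X (k + n)) x \<partial>M) - (\<integral>x. ext v x * \<phi> x \<partial>M)) / X (k + n)) \<longlonglongrightarrow> I"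
      unfolding I_def
    proof (rule adjoint_path_derivative_seq[OF u v p z \<Phi>])
      show "(\<lambda>k. X (k + n)) \<longlonglongrightarrow> 0" by (rule LIMSEQ_ignore_initial_segment[OF X(2)])
      show "X (k + n) \<noteq> 0" "\<bar>X (k + n)\<bar> * nrm2 N v \<le> 1" for k using X(1) n[of "k + n"] by auto
    qed
    then have "(\<lambda>k. (a (0 + X (k + n)) - a 0) / X (k + n)) \<longlonglongrightarrow> I" unfolding \<Phi>0 by (simp add: a_def)
    then have "(\<lambda>k. (a (0 + X k) - a 0) / X k) \<longlonglongrightarrow> I" by (rule LIMSEQ_offset)
    then show "((\<lambda>h. (a (0 + h) - a 0) / h) \<circ> X) \<longlonglongrightarrow> I" by (simp add: comp_def)
  qed
  then have "(deriv (\<lambda>t. F (\<lambda>x. u x + t * v x)) has_real_derivative I + 0 + (\<beta> * (\<integral>x. v x \<partial>N)\<^sup>2 + \<gamma> * (nrm2 N v)\<^sup>2)) (at 0)"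
    unfolding dF by (intro DERIV_add DERIV_const) (auto intro!: derivative_eq_intros)
  then have "F2 \<Omega> \<omega> f yd \<beta> \<gamma> u v = I + (\<beta> * (\<integral>x. v x \<partial>N)\<^sup>2 + \<gamma> * (nrm2 N v)\<^sup>2)"
    unfolding F2_def using DERIV_imp_deriv by force
  moreover have "I = (nrm2 M z)\<^sup>2 - (\<integral>x. fyy f x (S u x) * \<phi> x * (z x * z x) \<partial>M)"
  proof -
    obtain C where C: "C \<ge> 0" "(\<lambda>x. fyy f x (S u x) * \<phi> x) \<in> borel_measurable M"
      "AE x in M. \<bar>fyy f x (S u x) * \<phi> x\<bar> \<le> C" by (rule adjoint_bounded[OF u p], rule that)
    have "I = (\<integral>x. (norm (z x))\<^sup>2 - fyy f x (S u x) * \<phi> x * (z x * z x) \<partial>M)"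
      unfolding I_def by (intro arg_cong[where f="integral\<^sup>L M"] ext) (simp add: power2_eq_square algebra_simps)
    also have "\<dots> = (nrm2 M z)\<^sup>2 - (\<integral>x. fyy f x (S u x) * \<phi> x * (z x * z x) \<partial>M)"
      unfolding nrm2_power2
      by (rule Bochner_Integration.integral_diff[OF sqi_integrable[OF lin_sqi[OF z]] sqi_bilinear_bound(1)[OF C(2,3) lin_sqi[OF z] lin_sqi[OF z]]])
    finally show ?thesis .
  qed
  ultimately show ?thesis by (simp add: Q_def)
qed

text \<open>The estimate used off the cone. The term of unknown sign is controlled by the sup bound
  of the adjoint state, at the price of a multiple of the squared norm of z.\<close>

lemma Q_lower_bound:
  assumes u: "sqi N u" and p: "lin (S u) \<phi> (\<lambda>x. S u x - yd x)"
  obtains C where "C \<ge> 0" "\<And>z v. sqi M z \<Longrightarrow> \<gamma> * (nrm2 N v)\<^sup>2 - C * (nrm2 M z)\<^sup>2 \<le> Q u \<phi> z v"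
proof -
  obtain C where C: "C \<ge> 0" "(\<lambda>x. fyy f x (S u x) * \<phi> x) \<in> borel_measurable M"
    "AE x in M. \<bar>fyy f x (S u x) * \<phi> x\<bar> \<le> C" by (rule adjoint_bounded[OF u p], rule that)
  show ?thesis
  proof (rule that[OF C(1)])
    fix z v :: "'a \<Rightarrow> real" assume z: "sqi M z"
    have "\<bar>\<integral>x. fyy f x (S u x) * \<phi> x * (z x * z x) \<partial>M\<bar> \<le> C * (nrm2 M z)\<^sup>2"
      using sqi_bilinear_bound(2)[OF C(2,3) z z] C(1) by (simp add: power2_eq_square)
    moreover have "0 \<le> \<beta> * (\<integral>x. v x \<partial>N)\<^sup>2" using beta by simp
    moreover have "0 \<le> (nrm2 M z)\<^sup>2" by simp
    ultimately show "\<gamma> * (nrm2 N v)\<^sup>2 - C * (nrm2 M z)\<^sup>2 \<le> Q u \<phi> z v" unfolding Q_def by linarith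
  qed
qed

text \<open>The intermediate point of the Taylor formula is within Cinf times the norm of v of the
  state, so the uniform modulus of continuity of \<open>fyy\<close> applies at almost every point
  with the same radius.\<close>

lemma rem_second_order:
  assumes u: "sqi N u" and \<rho>: "\<rho> > 0"
  obtains e where "e > 0" "\<And>v. sqi N v \<Longrightarrow> nrm2 N v \<le> e \<Longrightarrow>
    AE x in M. \<bar>rem u v x - fyy f x (S u x) / 2 * (dS u v x)\<^sup>2\<bar> \<le> \<rho> * (dS u v x)\<^sup>2"
proof -
  obtain B where B: "\<And>x. \<bar>S u x\<bar> \<le> B" using S_bdm[OF u] unfolding bdm_def by blast
  define m where "m = B + Cinf"
  obtain \<epsilon> where \<epsilon>: "\<epsilon> > 0" "AE x in M. \<forall>y1 y2. \<bar>y1\<bar> \<le> m \<and> \<bar>y2\<bar> \<le> m \<and> \<bar>y2 - y1\<bar> < \<epsilon> \<longrightarrow> \<bar>fyy f x y2 - fyy f x y1\<bar> \<le> \<rho>"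
    using f_cont \<rho> unfolding AE_M_iff by blast
  \<comment> \<open>The entry 1 keeps all states in [-m, m]; the other makes the increment smaller
    than \<epsilon>.\<close>
  define e where "e = min 1 (\<epsilon> / (2 * (Cinf + 1)))"
  show ?thesis
  proof (rule that[of e])
    show "e > 0" using \<epsilon>(1) Cinf_nonneg by (simp add: e_def)
    fix v :: "'a \<Rightarrow> real" assume v: "sqi N v" "nrm2 N v \<le> e"
    have "nrm2 N v \<le> 1" using v(2) by (simp add: e_def)
    then have d1: "\<bar>dS u v x\<bar> \<le> Cinf" for x using dS_props(5)[OF u v(1), of x] mult_left_mono[OF _ Cinf_nonneg, of "nrm2 N v" 1] by simp
    have d2: "\<bar>dS u v x\<bar> < \<epsilon>" for x
    proof -
      have "\<bar>dS u v x\<bar> \<le> Cinf * nrm2 N v" by (rule dS_props(5)[OF u v(1)])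
      also have "\<dots> \<le> Cinf * (\<epsilon> / (2 * (Cinf + 1)))" using v(2) Cinf_nonneg by (intro mult_left_mono) (auto simp: e_def)
      also have "\<dots> = (\<epsilon> / 2) * (Cinf / (Cinf + 1))" using Cinf_nonneg by (simp add: field_simps)
      also have "\<dots> \<le> (\<epsilon> / 2) * 1" using Cinf_nonneg \<epsilon>(1) by (intro mult_left_mono) auto
      finally show ?thesis using \<epsilon>(1) by simp
    qed
    show "AE x in M. \<bar>rem u v x - fyy f x (S u x) / 2 * (dS u v x)\<^sup>2\<bar> \<le> \<rho> * (dS u v x)\<^sup>2"
      using \<epsilon>(2) AE_space
    proof eventually_elim
      case (elim x)
      then have x: "x \<in> \<Omega>" by simp
      obtain t where t: "\<bar>t - S u x\<bar> \<le> \<bar>dS u v x\<bar>" "\<bar>t\<bar> \<le> max \<bar>S u x\<bar> \<bar>S u x + dS u v x\<bar>"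
        "f x (S u x + dS u v x) - f x (S u x) - fy f x (S u x) * dS u v x = fyy f x t / 2 * (dS u v x)\<^sup>2"
        using f_taylor2[OF x, of "S u x" "dS u v x"] by blast
      have "\<bar>t\<bar> \<le> m" "\<bar>S u x\<bar> \<le> m" "\<bar>t - S u x\<bar> < \<epsilon>"
        using t(1,2) d1[of x] d2[of x] B[of x] Cinf_nonneg unfolding m_def by linarith+
      then have b: "\<bar>fyy f x t - fyy f x (S u x)\<bar> \<le> \<rho>" using elim(1) by blast
      have "rem u v x - fyy f x (S u x) / 2 * (dS u v x)\<^sup>2 = (fyy f x t - fyy f x (S u x)) / 2 * (dS u v x)\<^sup>2"
 (is "?l = ?r")
        using t(3) by (simp add: rem_def dS_def algebra_simps diff_divide_distrib)
      then have "\<bar>?l\<bar> = \<bar>?r\<bar>" by (rule arg_cong)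
      also have "\<bar>?r\<bar> = \<bar>fyy f x t - fyy f x (S u x)\<bar> / 2 * (dS u v x)\<^sup>2" by (simp add: abs_mult)
      also have "\<dots> \<le> \<rho> * (dS u v x)\<^sup>2" using b \<rho> by (intro mult_right_mono) auto
      finally show ?case .
    qed
  qed
qed

text \<open>The error has three parts. Replacing the state increment by z in the two quadratic
  integrals costs terms cubic in the norm of v; replacing \<open>rem\<close> by its quadratic part
  costs a multiple of r.\<close>

lemma cost_second_order:
  assumes u: "sqi N u" and p: "lin (S u) \<phi> (\<lambda>x. S u x - yd x)" and \<rho>: "\<rho> > 0"
  obtains e where "e > 0" "\<And>v z. sqi N v \<Longrightarrow> nrm2 N v \<le> e \<Longrightarrow> lin (S u) z (ext v) \<Longrightarrow>
    \<bar>F (\<lambda>x. u x + v x) - F u - Lf u \<phi> v - Q u \<phi> z v / 2\<bar> \<le> \<rho> * (nrm2 N v)\<^sup>2"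
proof -
  obtain C where C: "C \<ge> 0" "\<And>v. sqi N v \<Longrightarrow> nrm2 N v \<le> 1 \<Longrightarrow> nrm2 M (rem u v) \<le> C * (nrm2 N v)\<^sup>2"
    by (rule state_expansion[OF u], rule that)
  obtain P where P: "P \<ge> 0" "(\<lambda>x. fyy f x (S u x) * \<phi> x) \<in> borel_measurable M"
    "AE x in M. \<bar>fyy f x (S u x) * \<phi> x\<bar> \<le> P" "AE x in M. \<bar>\<phi> x\<bar> \<le> P" by (rule adjoint_bounded[OF u p], rule that)
  \<comment> \<open>The factor a compares the squared norm of the increment with that of v, and b
    collects the cubic terms. Then r is chosen for P a r \<le> \<rho>/2, and the radius e for b n
    \<le> \<rho>/2.\<close>
  define a where "a = (CP\<^sup>2)\<^sup>2"
  define b where "b = (1 + P) * (CP\<^sup>2 * C * (2 * CP\<^sup>2)) / 2"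
  have ab: "a \<ge> 0" "b \<ge> 0" using P C by (auto simp: a_def b_def)
  define r where "r = \<rho> / (2 * (P * a + 1))"
  have r: "r > 0" using \<rho> P(1) ab(1) unfolding r_def by (intro divide_pos_pos mult_pos_pos add_nonneg_pos) auto
  obtain e0 where e0: "e0 > 0" "\<And>v. sqi N v \<Longrightarrow> nrm2 N v \<le> e0 \<Longrightarrow>
    AE x in M. \<bar>rem u v x - fyy f x (S u x) / 2 * (dS u v x)\<^sup>2\<bar> \<le> r * (dS u v x)\<^sup>2"
    by (rule rem_second_order[OF u r], rule that)
  define e where "e = min (min e0 1) (\<rho> / (2 * (b + 1)))"
  show ?thesis
  proof (rule that[of e])
    show "e > 0" using e0(1) \<rho> ab(2) by (simp add: e_def)
    fix v z :: "'a \<Rightarrow> real" assume v: "sqi N v" "nrm2 N v \<le> e" and z: "lin (S u) z (ext v)"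
    define n where "n = nrm2 N v"
    have n: "n \<ge> 0" "n \<le> e0" "n \<le> 1" "n \<le> \<rho> / (2 * (b + 1))" using v(2) by (auto simp: n_def e_def)
    note d = dS_props[OF u v(1), folded n_def] and sz = lin_sqi[OF z] and sp = lin_sqi[OF p]
    have ev: "sqi M (ext v)" using v by (simp add: sqi_ext)
    let ?h = "dS u v" and ?R = "rem u v"
    have nz: "nrm2 M z \<le> CP\<^sup>2 * n" using lin_bounds(1)[OF S_bdm[OF u] z ev] by (simp add: nrm2_ext n_def)
    have "lin (S u) (\<lambda>x. ?h x - 1 * z x) (\<lambda>x. (ext v x - ?R x) - 1 * ext v x)"
      by (rule lin_diff_scale[OF S_bdm[OF u] d(1) sqi_diff[OF ev d(2)] z ev])
    then have "lin (S u) (\<lambda>x. ?h x - z x) (\<lambda>x. - ?R x)" by simp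
    from lin_bounds(1)[OF S_bdm[OF u] this sqi_uminus[OF d(2)]]
    have hz: "nrm2 M (\<lambda>x. ?h x - z x) \<le> CP\<^sup>2 * (C * n\<^sup>2)"
      using mult_left_mono[OF C(2)[OF v(1)], of "CP\<^sup>2"] n(3) by (simp add: nrm2_uminus n_def)
    have sm: "sqi M (\<lambda>x. ?h x - z x)" and spl: "sqi M (\<lambda>x. ?h x + z x)" using sqi_diff[OF d(3) sz] sqi_add[OF d(3) sz] .
    have hp: "nrm2 M (\<lambda>x. ?h x + z x) \<le> 2 * CP\<^sup>2 * n" using nrm2_triangle[OF d(3) sz] nz d(4) by linarith
    \<comment> \<open>Bound for a difference of squares: one factor is quadratic in n, the other
      linear.\<close>
    have prod: "nrm2 M (\<lambda>x. ?h x - z x) * nrm2 M (\<lambda>x. ?h x + z x) \<le> CP\<^sup>2 * C * (2 * CP\<^sup>2) * n\<^sup>2 * n"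
    proof -
      have "nrm2 M (\<lambda>x. ?h x - z x) * nrm2 M (\<lambda>x. ?h x + z x) \<le> (CP\<^sup>2 * (C * n\<^sup>2)) * (2 * CP\<^sup>2 * n)"
        using hz hp C(1) by (intro mult_mono) auto
      then show ?thesis by (simp add: mult_ac)
    qed
    have A: "\<bar>(nrm2 M ?h)\<^sup>2 - (nrm2 M z)\<^sup>2\<bar> \<le> CP\<^sup>2 * C * (2 * CP\<^sup>2) * n\<^sup>2 * n"
    proof -
      have "(nrm2 M ?h)\<^sup>2 - (nrm2 M z)\<^sup>2 = (\<integral>x. (norm (?h x))\<^sup>2 - (norm (z x))\<^sup>2 \<partial>M)"
        unfolding nrm2_power2 by (rule Bochner_Integration.integral_diff[OF sqi_integrable[OF d(3)] sqi_integrable[OF sz], symmetric])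
      also have "\<dots> = (\<integral>x. (?h x - z x) * (?h x + z x) \<partial>M)"
        by (intro arg_cong[where f="integral\<^sup>L M"] ext) (simp add: power2_eq_square algebra_simps)
      finally show ?thesis using sqi_CS_mult[OF sm spl] prod by linarith
    qed
    define J1 where "J1 = (\<integral>x. fyy f x (S u x) * \<phi> x * (?h x * ?h x) \<partial>M)"
    define J2 where "J2 = (\<integral>x. fyy f x (S u x) * \<phi> x * (z x * z x) \<partial>M)"
    note I1 = sqi_bilinear_bound(1)[OF P(2,3) d(3) d(3)] and I2 = sqi_bilinear_bound(1)[OF P(2,3) sz sz]
    have Bd: "\<bar>J1 - J2\<bar> \<le> P * (CP\<^sup>2 * C * (2 * CP\<^sup>2) * n\<^sup>2 * n)"
    proof -
      have "J1 - J2 = (\<integral>x. fyy f x (S u x) * \<phi> x * (?h x * ?h x) - fyy f x (S u x) * \<phi> x * (z x * z x) \<partial>M)"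
        unfolding J1_def J2_def using Bochner_Integration.integral_diff[OF I1 I2] by simp
      also have "\<dots> = (\<integral>x. fyy f x (S u x) * \<phi> x * ((?h x - z x) * (?h x + z x)) \<partial>M)"
        by (intro arg_cong[where f="integral\<^sup>L M"] ext) (simp add: algebra_simps)
      finally have "\<bar>J1 - J2\<bar> \<le> \<bar>P\<bar> * (nrm2 M (\<lambda>x. ?h x - z x) * nrm2 M (\<lambda>x. ?h x + z x))"
        using sqi_bilinear_bound(2)[OF P(2,3) sm spl] by simp
      also have "\<dots> \<le> P * (CP\<^sup>2 * C * (2 * CP\<^sup>2) * n\<^sup>2 * n)" unfolding abs_of_nonneg[OF P(1)] by (rule mult_left_mono[OF prod P(1)])
      finally show ?thesis .
    qed
    have Ce: "\<bar>(\<integral>x. \<phi> x * ?R x \<partial>M) - J1 / 2\<bar> \<le> P * r * (a * n\<^sup>2)"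
    proof -
      have Ir: "integrable M (\<lambda>x. \<phi> x * ?R x)" by (rule sqi_mult_integrable[OF sp d(2)])
      have Ih: "integrable M (\<lambda>x. P * r * (norm (?h x))\<^sup>2)" using sqi_integrable[OF d(3)] by simp
      have "(\<integral>x. \<phi> x * ?R x \<partial>M) - J1 / 2 = (\<integral>x. \<phi> x * ?R x - fyy f x (S u x) * \<phi> x * (?h x * ?h x) / 2 \<partial>M)" (is "?l = ?r")
        unfolding J1_def using Ir I1 by simp
      then have "\<bar>?l\<bar> = \<bar>?r\<bar>" by (rule arg_cong)
      also have "\<bar>?r\<bar> \<le> (\<integral>x. \<bar>\<phi> x * ?R x - fyy f x (S u x) * \<phi> x * (?h x * ?h x) / 2\<bar> \<partial>M)"
        using integral_norm_bound[of M "\<lambda>x. \<phi> x * ?R x - fyy f x (S u x) * \<phi> x * (?h x * ?h x) / 2"] by simp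
      also have "\<dots> \<le> (\<integral>x. P * r * (norm (?h x))\<^sup>2 \<partial>M)"
      proof (rule integral_mono_AE[OF _ Ih])
        show "integrable M (\<lambda>x. \<bar>\<phi> x * ?R x - fyy f x (S u x) * \<phi> x * (?h x * ?h x) / 2\<bar>)" using Ir I1 by simp
        show "AE x in M. \<bar>\<phi> x * ?R x - fyy f x (S u x) * \<phi> x * (?h x * ?h x) / 2\<bar> \<le> P * r * (norm (?h x))\<^sup>2"
          using e0(2)[OF v(1) n(2)[unfolded n_def]] P(4)
        proof eventually_elim
          case (elim x)
          have "\<phi> x * ?R x - fyy f x (S u x) * \<phi> x * (?h x * ?h x) / 2 = \<phi> x * (?R x - fyy f x (S u x) / 2 * (?h x)\<^sup>2)" (is "?a = ?b")
            by (simp add: power2_eq_square algebra_simps)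
          then have "\<bar>?a\<bar> = \<bar>?b\<bar>" by (rule arg_cong)
          also have "\<bar>?b\<bar> \<le> P * (r * (?h x)\<^sup>2)" unfolding abs_mult using elim P(1) by (intro mult_mono) auto
          finally show ?case by simp
        qed
      qed
      also have "\<dots> = P * r * (nrm2 M ?h)\<^sup>2" by (simp add: nrm2_power2)
      also have "(nrm2 M ?h)\<^sup>2 \<le> a * n\<^sup>2" using power_mono[OF d(4), of 2] by (simp add: a_def power_mult_distrib)
      finally show ?thesis using P(1) r by (simp add: mult_left_mono)
    qed
    have id: "F (\<lambda>x. u x + v x) - F u - Lf u \<phi> v - Q u \<phi> z v / 2
        = ((nrm2 M ?h)\<^sup>2 - (nrm2 M z)\<^sup>2) / 2 - ((\<integral>x. \<phi> x * ?R x \<partial>M) - J1 / 2) - (J1 - J2) / 2"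
      using cost_diff[OF u v(1) p] unfolding Q_def J2_def by (simp add: field_simps)
    have gen: "d = A / 2 - B - E / 2 \<Longrightarrow> \<bar>A\<bar> \<le> a' \<Longrightarrow> \<bar>B\<bar> \<le> b' \<Longrightarrow> \<bar>E\<bar> \<le> e' \<Longrightarrow> \<bar>d\<bar> \<le> a' / 2 + b' + e' / 2"
      for d A B E a' b' e' :: real by linarith
    have "\<bar>F (\<lambda>x. u x + v x) - F u - Lf u \<phi> v - Q u \<phi> z v / 2\<bar>
        \<le> (CP\<^sup>2 * C * (2 * CP\<^sup>2) * n\<^sup>2 * n) / 2 + P * r * (a * n\<^sup>2) + P * (CP\<^sup>2 * C * (2 * CP\<^sup>2) * n\<^sup>2 * n) / 2"
      by (rule gen[OF id A Ce Bd])
    also have "\<dots> = b * n * n\<^sup>2 + (P * a * r) * n\<^sup>2" by (simp add: b_def field_simps)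
    also have "\<dots> \<le> (\<rho>/2) * n\<^sup>2 + (\<rho>/2) * n\<^sup>2"
    proof (intro add_mono mult_right_mono)
      have "b * n \<le> b * (\<rho> / (2 * (b + 1)))" using n(4) ab by (intro mult_left_mono) auto
      also have "\<dots> = \<rho>/2 * (b / (b + 1))" using ab by (simp add: field_simps)
      also have "\<dots> \<le> \<rho>/2 * 1" using ab \<rho> by (intro mult_left_mono) auto
      finally show "b * n \<le> \<rho>/2" by simp
      have Pa: "P * a \<ge> 0" using P(1) ab by simp
      have "P * a * r = \<rho>/2 * (P * a / (P * a + 1))" using Pa by (simp add: r_def field_simps)
      also have "\<dots> \<le> \<rho>/2 * 1" using Pa \<rho> by (intro mult_left_mono) (auto simp: divide_le_eq_1)
      finally show "P * a * r \<le> \<rho>/2" by simp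
    qed auto
    finally show "\<bar>F (\<lambda>x. u x + v x) - F u - Lf u \<phi> v - Q u \<phi> z v / 2\<bar> \<le> \<rho> * (nrm2 N v)\<^sup>2"
      by (simp add: n_def)
  qed
qed

end

section \<open>Vector measures\<close>

context bounded_open
begin

text \<open>Scalar counterpart of \<open>vmeasure\<close>, satisfied by its components. The value 0
  off \<open>bsets\<close> makes equality of measures equality of functions.\<close>

definition smeas :: "('a set \<Rightarrow> real) \<Rightarrow> bool" where
  "smeas \<nu> \<longleftrightarrow> (\<forall>A. A \<notin> bsets \<Omega> \<longrightarrow> \<nu> A = 0) \<and>
     (\<forall>F::nat \<Rightarrow> 'a set. range F \<subseteq> bsets \<Omega> \<and> disjoint_family F \<longrightarrow> (\<lambda>i. \<nu> (F i)) sums \<nu> (\<Union>i. F i))"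

lemma sigma_algebra_bsets: "sigma_algebra \<Omega> (bsets \<Omega>)"
proof -
  have "bsets \<Omega> = sets (restrict_space borel \<Omega>)"
    by (auto simp: bsets_def sets_restrict_space_iff)
  then show ?thesis using sets.sigma_algebra_axioms[of "restrict_space borel \<Omega>"] by simp
qed

lemma sigma_sets_bsets: "sigma_sets \<Omega> (bsets \<Omega>) = bsets \<Omega>"
  using sigma_algebra.sigma_sets_eq[OF sigma_algebra_bsets] .

lemma bsets_subset: "bsets \<Omega> \<subseteq> Pow \<Omega>" by (auto simp: bsets_def)

lemma bsets_closed [simp]:
  "{} \<in> bsets \<Omega>" "\<Omega> \<in> bsets \<Omega>"
  "A \<in> bsets \<Omega> \<Longrightarrow> B \<in> bsets \<Omega> \<Longrightarrow> A \<union> B \<in> bsets \<Omega>"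
  "A \<in> bsets \<Omega> \<Longrightarrow> B \<in> bsets \<Omega> \<Longrightarrow> A \<inter> B \<in> bsets \<Omega>"
  "A \<in> bsets \<Omega> \<Longrightarrow> B \<in> bsets \<Omega> \<Longrightarrow> A - B \<in> bsets \<Omega>"
  by (auto simp: bsets_def)

lemma smeas_sums:
  "smeas \<nu> \<Longrightarrow> range F \<subseteq> bsets \<Omega> \<Longrightarrow> disjoint_family F \<Longrightarrow> (\<lambda>i::nat. \<nu> (F i)) sums \<nu> (\<Union>i. F i)"
  unfolding smeas_def by blast

lemma smeas_empty:
  assumes "smeas \<nu>" shows "\<nu> {} = 0"
proof -
  have "(\<lambda>i::nat. \<nu> {}) sums \<nu> {}"
    using smeas_sums[OF assms, of "\<lambda>_. {}"] by (simp add: disjoint_family_on_def)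
  then have "(\<lambda>i::nat. \<nu> {}) \<longlonglongrightarrow> 0" by (intro summable_LIMSEQ_zero) (auto simp: sums_iff)
  then show ?thesis by (simp add: LIMSEQ_const_iff)
qed

lemma smeas_Un:
  assumes "smeas \<nu>" "A \<in> bsets \<Omega>" "B \<in> bsets \<Omega>" "A \<inter> B = {}"
  shows "\<nu> (A \<union> B) = \<nu> A + \<nu> B"
proof -
  let ?F = "binaryset A B"
  have "(\<lambda>i. \<nu> (?F i)) sums \<nu> (\<Union>i. ?F i)"
    by (rule smeas_sums[OF assms(1)])
      (use assms in \<open>auto simp: range_binaryset_eq disjoint_family_on_def binaryset_def\<close>)
  moreover have "(\<lambda>i. \<nu> (?F i)) sums (\<nu> A + \<nu> B)"
    using binaryset_sums[of \<nu> A B] smeas_empty[OF assms(1)] by simp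
  ultimately show ?thesis using sums_unique2 by (simp add: UN_binaryset_eq) blast
qed

lemma smeas_split:
  assumes "smeas \<nu>" "A \<in> bsets \<Omega>" "B \<in> bsets \<Omega>"
  shows "\<nu> A = \<nu> (A \<inter> B) + \<nu> (A - B)"
  using smeas_Un[OF assms(1), of "A \<inter> B" "A - B"] assms by (simp add: Int_Diff_Un Int_Diff_disjoint)

lemma smeas_lin:
  assumes "smeas \<nu>" "smeas \<mu>" shows "smeas (\<lambda>A. \<nu> A + c * \<mu> A)"
  using assms unfolding smeas_def by (auto intro!: sums_add sums_mult)

lemma smeas_uminus: "smeas \<nu> \<Longrightarrow> smeas (\<lambda>A. - \<nu> A)"
  unfolding smeas_def by (auto intro!: sums_minus)

text \<open>If a set has subsets of arbitrarily large mass, one can split off a piece of mass at least 1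
  and keep the property; the pieces contradict countable additivity.\<close>
lemma smeas_bounded:
  assumes s: "smeas \<nu>"
  obtains C where "\<And>A. \<bar>\<nu> A\<bar> \<le> C"
proof -
  define bad where "bad E \<longleftrightarrow> E \<in> bsets \<Omega> \<and> (\<forall>C. \<exists>B\<in>bsets \<Omega>. B \<subseteq> E \<and> \<bar>\<nu> B\<bar> > C)" for E
  have step: "\<exists>E'. bad E' \<and> E' \<subseteq> E \<and> \<bar>\<nu> (E - E')\<bar> \<ge> 1" if bE: "bad E" for E
  proof -
    have E: "E \<in> bsets \<Omega>" using bE by (simp add: bad_def)
    \<comment> \<open>A subset of mass beyond \<bar>\<nu> E\<bar> + 1 leaves a complement of mass at
      least 1. So whichever of the two parts stays bad, the discarded one has mass at least
      1.\<close>
    obtain B where B: "B \<in> bsets \<Omega>" "B \<subseteq> E" "\<bar>\<nu> B\<bar> > \<bar>\<nu> E\<bar> + 1" using bE unfolding bad_def by blast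
    have e: "\<nu> E = \<nu> B + \<nu> (E - B)" using smeas_split[OF s E B(1)] B(2) by (simp add: Int_absorb1)
    have EB: "E - B \<in> bsets \<Omega>" using E B by simp
    have "bad B \<or> bad (E - B)"
    proof (rule ccontr)
      assume "\<not> ?thesis"
      then obtain C1 C2 where C1: "\<And>D. D \<in> bsets \<Omega> \<Longrightarrow> D \<subseteq> B \<Longrightarrow> \<bar>\<nu> D\<bar> \<le> C1"
        and C2: "\<And>D. D \<in> bsets \<Omega> \<Longrightarrow> D \<subseteq> E - B \<Longrightarrow> \<bar>\<nu> D\<bar> \<le> C2"
        using B(1) EB unfolding bad_def by (meson not_le)
      obtain D where D: "D \<in> bsets \<Omega>" "D \<subseteq> E" "\<bar>\<nu> D\<bar> > C1 + C2" using bE unfolding bad_def by blast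
      have "\<nu> D = \<nu> (D \<inter> B) + \<nu> (D - B)" by (rule smeas_split[OF s D(1) B(1)])
      moreover have "\<bar>\<nu> (D \<inter> B)\<bar> \<le> C1" using D(1) B(1) by (intro C1) auto
      moreover have "\<bar>\<nu> (D - B)\<bar> \<le> C2" using D(1,2) B(1) by (intro C2) auto
      ultimately show False using D(3) by linarith
    qed
    then show ?thesis
    proof
      assume "bad B"
      moreover have "\<bar>\<nu> (E - B)\<bar> \<ge> 1" using e B(3) by linarith
      ultimately show ?thesis using B(2) by blast
    next
      assume "bad (E - B)"
      moreover have "E - (E - B) = B" using B(2) by blast
      moreover have "\<bar>\<nu> B\<bar> \<ge> 1" using B(3) by linarith
      ultimately show ?thesis by (metis Diff_subset)
    qed
  qed
  have "\<not> bad \<Omega>"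
  proof
    assume b: "bad \<Omega>"
    obtain g where g: "\<And>E. bad E \<Longrightarrow> bad (g E)" "\<And>E. bad E \<Longrightarrow> g E \<subseteq> E" "\<And>E. bad E \<Longrightarrow> \<bar>\<nu> (E - g E)\<bar> \<ge> 1"
      using step by metis
    define E where "E n = (g ^^ n) \<Omega>" for n
    have bE: "bad (E n)" for n by (induction n) (auto simp: E_def b g(1))
    have ES: "E (Suc n) = g (E n)" for n by (simp add: E_def)
    have dec: "E (Suc n) \<subseteq> E n" for n unfolding ES by (rule g(2)[OF bE])
    have anti: "E m \<subseteq> E n" if "n \<le> m" for m n using that by (induction rule: dec_induct) (use dec in blast)+
    \<comment> \<open>The discarded pieces are disjoint, yet their masses stay away from 0.\<close>
    define F where "F n = E n - E (Suc n)" for n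
    have Fb: "range F \<subseteq> bsets \<Omega>" using bE unfolding F_def bad_def by auto
    have "F m \<inter> F n = {}" if "m < n" for m n using anti[of "Suc m" n] that unfolding F_def by fastforce
    then have Fd: "disjoint_family F" unfolding disjoint_family_on_def
      by (metis Int_commute linorder_neqE_nat)
    have "(\<lambda>i. \<nu> (F i)) \<longlonglongrightarrow> 0" using smeas_sums[OF s Fb Fd] by (intro summable_LIMSEQ_zero) (auto simp: sums_iff)
    then have "\<forall>\<^sub>F i in sequentially. \<bar>\<nu> (F i)\<bar> < 1" by (auto simp: tendsto_iff dist_real_def)
    then obtain i where "\<bar>\<nu> (F i)\<bar> < 1" by (auto simp: eventually_sequentially)
    then show False using g(3)[OF bE[of i]] unfolding F_def ES by simp
  qed
  then obtain C where C: "\<And>B. B \<in> bsets \<Omega> \<Longrightarrow> B \<subseteq> \<Omega> \<Longrightarrow> \<bar>\<nu> B\<bar> \<le> C"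
    unfolding bad_def by (meson bsets_closed(2) not_le)
  show ?thesis
  proof (rule that[of "\<bar>C\<bar>"])
    show "\<bar>\<nu> A\<bar> \<le> \<bar>C\<bar>" for A
    proof (cases "A \<in> bsets \<Omega>")
      case True
      then have "A \<subseteq> \<Omega>" by (auto simp: bsets_def)
      from C[OF True this] show ?thesis by linarith
    qed (use s in \<open>auto simp: smeas_def\<close>)
  qed
qed

lemma spos_bdd:
  assumes "smeas \<nu>" shows "bdd_above {\<nu> B | B. B \<in> bsets \<Omega> \<and> B \<subseteq> A}"
proof -
  obtain C where "\<And>A. \<bar>\<nu> A\<bar> \<le> C" by (rule smeas_bounded[OF assms], rule that)
  then show ?thesis by (intro bdd_aboveI[of _ C]) (auto simp: abs_le_iff)
qed

lemma spos_upper: "smeas \<nu> \<Longrightarrow> B \<in> bsets \<Omega> \<Longrightarrow> B \<subseteq> A \<Longrightarrow> \<nu> B \<le> spos \<Omega> \<nu> A"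
  unfolding spos_def by (rule cSup_upper[OF _ spos_bdd]) auto

lemma spos_least:
  assumes "\<And>B. B \<in> bsets \<Omega> \<Longrightarrow> B \<subseteq> A \<Longrightarrow> \<nu> B \<le> c"
  shows "spos \<Omega> \<nu> A \<le> c"
proof -
  have "{\<nu> B | B. B \<in> bsets \<Omega> \<and> B \<subseteq> A} \<noteq> {}" using bsets_closed(1) by blast
  then show ?thesis unfolding spos_def by (rule cSup_least) (use assms in auto)
qed

lemma spos_nonneg: "smeas \<nu> \<Longrightarrow> 0 \<le> spos \<Omega> \<nu> A"
  using spos_upper[of \<nu> "{}" A] smeas_empty[of \<nu>] by simp

lemma spos_mono: "smeas \<nu> \<Longrightarrow> A \<subseteq> B \<Longrightarrow> spos \<Omega> \<nu> A \<le> spos \<Omega> \<nu> B"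
  by (rule spos_least) (auto intro: spos_upper)

lemma spos_superadd:
  assumes s: "smeas \<nu>" and A: "A \<inter> B = {}"
  shows "spos \<Omega> \<nu> A + spos \<Omega> \<nu> B \<le> spos \<Omega> \<nu> (A \<union> B)"
proof -
  have "spos \<Omega> \<nu> A \<le> spos \<Omega> \<nu> (A \<union> B) - spos \<Omega> \<nu> B"
  proof (rule spos_least)
    fix C assume C: "C \<in> bsets \<Omega>" "C \<subseteq> A"
    have "spos \<Omega> \<nu> B \<le> spos \<Omega> \<nu> (A \<union> B) - \<nu> C"
    proof (rule spos_least)
      fix D assume D: "D \<in> bsets \<Omega>" "D \<subseteq> B"
      have "C \<inter> D = {}" using C(2) D(2) A by blast
      then have "\<nu> C + \<nu> D = \<nu> (C \<union> D)" using smeas_Un[OF s C(1) D(1)] by simp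
      also have "\<dots> \<le> spos \<Omega> \<nu> (A \<union> B)" using C D by (intro spos_upper[OF s]) auto
      finally show "\<nu> D \<le> spos \<Omega> \<nu> (A \<union> B) - \<nu> C" by simp
    qed
    then show "\<nu> C \<le> spos \<Omega> \<nu> (A \<union> B) - spos \<Omega> \<nu> B" by simp
  qed
  then show ?thesis by simp
qed

text \<open>The positive variation is countably additive: superadditivity on finite unions gives one
  inequality, cutting each competitor B along the pieces F i gives the other.\<close>

lemma emeasure_spos:
  assumes s: "smeas \<nu>" and A: "A \<in> bsets \<Omega>"
  shows "emeasure (spos_measure \<Omega> \<nu>) A = ennreal (spos \<Omega> \<nu> A)"
  unfolding spos_measure_def
proof (rule emeasure_measure_of_sigma[OF sigma_algebra_bsets _ _ A])
  show "positive (bsets \<Omega>) (\<lambda>A. ennreal (spos \<Omega> \<nu> A))"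
  proof -
    have "spos \<Omega> \<nu> {} \<le> 0" by (rule spos_least) (simp add: smeas_empty[OF s])
    then show ?thesis by (simp add: positive_def ennreal_neg)
  qed
  show "countably_additive (bsets \<Omega>) (\<lambda>A. ennreal (spos \<Omega> \<nu> A))"
    unfolding countably_additive_def
  proof (intro allI impI)
    fix F :: "nat \<Rightarrow> 'a set"
    assume F: "range F \<subseteq> bsets \<Omega>" "disjoint_family F" "(\<Union>i. F i) \<in> bsets \<Omega>"
    let ?U = "\<Union>i. F i"
    have fin: "(\<Sum>i<n. spos \<Omega> \<nu> (F i)) \<le> spos \<Omega> \<nu> (\<Union>i<n. F i)" for n
    proof (induction n)
      case 0 then show ?case using spos_nonneg[OF s, of "{}"] by simp
    next
      case (Suc n)
      have "F i \<inter> F n = {}" if "i < n" for i using F(2) that unfolding disjoint_family_on_def by simp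
      then have "(\<Union>i<n. F i) \<inter> F n = {}" by blast
      from spos_superadd[OF s this] Suc show ?case by (simp add: lessThan_Suc Un_commute)
    qed
    have fin2: "(\<Sum>i<n. spos \<Omega> \<nu> (F i)) \<le> spos \<Omega> \<nu> ?U" for n
      by (rule order_trans[OF fin spos_mono[OF s]]) auto
    have sm: "summable (\<lambda>i. spos \<Omega> \<nu> (F i))"
      by (rule summableI_nonneg_bounded[OF spos_nonneg[OF s] fin2])
    have le: "(\<Sum>i. spos \<Omega> \<nu> (F i)) \<le> spos \<Omega> \<nu> ?U" by (rule suminf_le_const[OF sm fin2])
    have ge: "spos \<Omega> \<nu> ?U \<le> (\<Sum>i. spos \<Omega> \<nu> (F i))"
    proof (rule spos_least)
      fix B assume B: "B \<in> bsets \<Omega>" "B \<subseteq> ?U"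
      have "(\<lambda>i. \<nu> (B \<inter> F i)) sums \<nu> (\<Union>i. B \<inter> F i)"
        by (rule smeas_sums[OF s]) (use F B in \<open>auto simp: disjoint_family_on_def\<close>)
      moreover have "(\<Union>i. B \<inter> F i) = B" using B(2) by blast
      ultimately have sB: "(\<lambda>i. \<nu> (B \<inter> F i)) sums \<nu> B" by simp
      have "\<nu> B = (\<Sum>i. \<nu> (B \<inter> F i))" using sB by (simp add: sums_iff)
      also have "\<dots> \<le> (\<Sum>i. spos \<Omega> \<nu> (F i))"
      proof (rule suminf_le[OF _ _ sm])
        show "\<nu> (B \<inter> F i) \<le> spos \<Omega> \<nu> (F i)" for i
        using B(1) F(1) by (intro spos_upper[OF s] bsets_closed(4) Int_lower2) auto
        show "summable (\<lambda>i. \<nu> (B \<inter> F i))" using sB by (simp add: sums_iff)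
      qed
      finally show "\<nu> B \<le> (\<Sum>i. spos \<Omega> \<nu> (F i))" .
    qed
    show "(\<Sum>i. ennreal (spos \<Omega> \<nu> (F i))) = ennreal (spos \<Omega> \<nu> ?U)"
      using suminf_ennreal_eq[OF spos_nonneg[OF s] summable_sums[OF sm]] order_antisym[OF le ge] by simp
  qed
qed

lemma spos_measure_sets [simp]: "sets (spos_measure \<Omega> \<nu>) = bsets \<Omega>" "space (spos_measure \<Omega> \<nu>) = \<Omega>"
  unfolding spos_measure_def using bsets_subset by (simp_all add: sigma_sets_bsets)

lemma measure_spos: "smeas \<nu> \<Longrightarrow> A \<in> bsets \<Omega> \<Longrightarrow> measure (spos_measure \<Omega> \<nu>) A = spos \<Omega> \<nu> A"
  unfolding measure_def by (simp add: emeasure_spos spos_nonneg)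

lemma finite_spos: "smeas \<nu> \<Longrightarrow> finite_measure (spos_measure \<Omega> \<nu>)"
  by (rule finite_measureI) (simp add: emeasure_spos)

text \<open>For B inside A the value at B is the value at A minus that at A - B; taking suprema
  relates the two variations directly, without a Hahn set. The opposite inequality is the same one
  for - \<nu>.\<close>

lemma jordan:
  assumes s: "smeas \<nu>" and A: "A \<in> bsets \<Omega>"
  shows "\<nu> A = spos \<Omega> \<nu> A - spos \<Omega> (\<lambda>A. - \<nu> A) A"
proof -
  have le: "spos \<Omega> \<mu> A \<le> \<mu> A + spos \<Omega> (\<lambda>A. - \<mu> A) A" if m: "smeas \<mu>" for \<mu>
  proof (rule spos_least)
    fix B assume B: "B \<in> bsets \<Omega>" "B \<subseteq> A"
    have "\<mu> A = \<mu> B + \<mu> (A - B)" using smeas_split[OF m A B(1)] B(2) by (simp add: Int_absorb1)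
    moreover have "- \<mu> (A - B) \<le> spos \<Omega> (\<lambda>A. - \<mu> A) A"
      using A B by (intro spos_upper[OF smeas_uminus[OF m]]) auto
    ultimately show "\<mu> B \<le> \<mu> A + spos \<Omega> (\<lambda>A. - \<mu> A) A" by simp
  qed
  show ?thesis using le[OF s] le[OF smeas_uminus[OF s]] by simp
qed

definition bmeas :: "('a \<Rightarrow> real) \<Rightarrow> bool" where
  "bmeas z \<longleftrightarrow> z \<in> borel_measurable (restrict_space borel \<Omega>) \<and> (\<exists>K. \<forall>x\<in>\<Omega>. \<bar>z x\<bar> \<le> K)"

lemma bmeas_spos: "bmeas z \<Longrightarrow> z \<in> borel_measurable (spos_measure \<Omega> \<nu>)"
proof -
  have "sets (spos_measure \<Omega> \<nu>) = sets (restrict_space borel \<Omega>)"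
    by (auto simp: bsets_def sets_restrict_space_iff)
  then show "bmeas z \<Longrightarrow> ?thesis" unfolding bmeas_def using measurable_cong_sets by blast
qed

lemma bmeas_integrable: "bmeas z \<Longrightarrow> smeas \<nu> \<Longrightarrow> integrable (spos_measure \<Omega> \<nu>) z"
proof -
  assume z: "bmeas z" and s: "smeas \<nu>"
  interpret finite_measure "spos_measure \<Omega> \<nu>" by (rule finite_spos[OF s])
  obtain K where "\<forall>x\<in>\<Omega>. \<bar>z x\<bar> \<le> K" using z unfolding bmeas_def by blast
  then show ?thesis using bmeas_spos[OF z] by (intro integrable_const_bound[where B=K] AE_I2) auto
qed

text \<open>A linear relation among finite measures passes to simple functions and then, by
  dominated convergence, to bounded measurable ones.\<close>

lemma integral_lin_comb_zero:
  fixes m :: "nat \<Rightarrow> 'a measure" and c :: "nat \<Rightarrow> real"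
  assumes fin: "\<And>i. i < n \<Longrightarrow> finite_measure (m i)" and sets: "\<And>i. i < n \<Longrightarrow> sets (m i) = bsets \<Omega>"
    and eq: "\<And>A. A \<in> bsets \<Omega> \<Longrightarrow> (\<Sum>i<n. c i * measure (m i) A) = 0" and z: "bmeas z"
  shows "(\<Sum>i<n. c i * (\<integral>x. z x \<partial>m i)) = 0"
proof -
  let ?R = "restrict_space borel \<Omega>"
  have sR: "sets ?R = bsets \<Omega>" "space ?R = \<Omega>"
    by (auto simp: bsets_def sets_restrict_space_iff space_restrict_space)
  have zR: "z \<in> borel_measurable ?R" using z by (simp add: bmeas_def)
  obtain K where K: "\<And>x. x \<in> \<Omega> \<Longrightarrow> \<bar>z x\<bar> \<le> K" using z unfolding bmeas_def by blast
  obtain g where g: "\<And>k. simple_function ?R (g k)" "\<And>x. x \<in> \<Omega> \<Longrightarrow> (\<lambda>k. g k x) \<longlonglongrightarrow> z x"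
    "\<And>k x. x \<in> \<Omega> \<Longrightarrow> dist (g k x) 0 \<le> 2 * dist (z x) 0"
    using borel_measurable_implies_sequence_metric[OF zR, of 0] unfolding sR(2) by blast
  have sp: "space (m i) = \<Omega>" if "i < n" for i using sets_eq_imp_space_eq[of "m i" ?R] sets[OF that] sR by simp
  have sf: "simple_function (m i) (g k)" if "i < n" for i k
    using g(1)[of k] sets[OF that] sp[OF that] sR unfolding simple_function_def by simp
  have simp0: "(\<Sum>i<n. c i * (\<integral>x. g k x \<partial>m i)) = 0" for k
  proof -
    have e: "(\<integral>x. g k x \<partial>m i) = (\<Sum>y\<in>g k ` \<Omega>. measure (m i) {x \<in> \<Omega>. g k x = y} * y)" if i: "i < n" for i
    proof -
      interpret finite_measure "m i" by (rule fin[OF i])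
      have "Bochner_Integration.simple_bochner_integrable (m i) (g k)"
        using sf[OF i, of k] by (auto simp: simple_bochner_integrable.simps)
      from simple_bochner_integrable_eq_integral[OF this] show ?thesis
        by (simp add: simple_bochner_integral_def sp[OF i])
    qed
    have "(\<Sum>i<n. c i * (\<integral>x. g k x \<partial>m i)) = (\<Sum>i<n. \<Sum>y\<in>g k ` \<Omega>. y * (c i * measure (m i) {x \<in> \<Omega>. g k x = y}))"
      by (intro sum.cong refl) (simp add: e sum_distrib_left mult_ac)
    also have "\<dots> = (\<Sum>y\<in>g k ` \<Omega>. y * (\<Sum>i<n. c i * measure (m i) {x \<in> \<Omega>. g k x = y}))"
      by (subst sum.swap) (simp add: sum_distrib_left)
    also have "\<dots> = 0"
    proof (intro sum.neutral ballI)
      fix y assume "y \<in> g k ` \<Omega>"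
      have "{x \<in> \<Omega>. g k x = y} \<in> bsets \<Omega>"
      proof -
        have "g k -` {y} \<inter> space ?R \<in> sets ?R" using g(1)[of k] by (rule simple_functionD(2))
        moreover have "g k -` {y} \<inter> space ?R = {x \<in> \<Omega>. g k x = y}" unfolding sR by auto
        ultimately show ?thesis unfolding sR by simp
      qed
      from eq[OF this] show "y * (\<Sum>i<n. c i * measure (m i) {x \<in> \<Omega>. g k x = y}) = 0" by simp
    qed
    finally show ?thesis .
  qed
  have lim: "(\<lambda>k. \<integral>x. g k x \<partial>m i) \<longlonglongrightarrow> (\<integral>x. z x \<partial>m i)" if i: "i < n" for i
  proof (rule integral_dominated_convergence[where w="\<lambda>_. 2 * K"])
    interpret finite_measure "m i" by (rule fin[OF i])
    show "integrable (m i) (\<lambda>_. 2 * K)" by simp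
    show "z \<in> borel_measurable (m i)" using zR sets[OF i] sR measurable_cong_sets[of "m i" ?R] by blast
    show "g k \<in> borel_measurable (m i)" for k using sf[OF i] by (rule borel_measurable_simple_function)
    show "AE x in m i. (\<lambda>k. g k x) \<longlonglongrightarrow> z x" using g(2) sp[OF i] by (intro AE_I2) simp
    show "AE x in m i. norm (g k x) \<le> 2 * K" for k
    proof (intro AE_I2)
      fix x assume "x \<in> space (m i)"
      then have "x \<in> \<Omega>" using sp[OF i] by simp
      then show "norm (g k x) \<le> 2 * K" using g(3)[of x k] K[of x] by simp
    qed
  qed
  have "(\<lambda>k. \<Sum>i<n. c i * (\<integral>x. g k x \<partial>m i)) \<longlonglongrightarrow> (\<Sum>i<n. c i * (\<integral>x. z x \<partial>m i))"
    by (intro tendsto_sum tendsto_mult_left lim) simp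
  then show ?thesis unfolding simp0 using LIMSEQ_const_iff by metis
qed

text \<open>Positive variations are not additive in the measure, but by \<open>jordan\<close> the
  six variations involved satisfy one linear relation on sets, and integrals obey the same
  relation.\<close>

lemma sint_lin:
  assumes s: "smeas \<nu>" "smeas \<mu>" and z: "bmeas z"
  shows "sint \<Omega> (\<lambda>A. \<nu> A + c * \<mu> A) z = sint \<Omega> \<nu> z + c * sint \<Omega> \<mu> z"
proof -
  let ?n = "\<lambda>A. \<nu> A + c * \<mu> A"
  \<comment> \<open>The positive and negative variations of the combination, of \<nu> and of \<mu>,
    with matching coefficients in d.\<close>
  define m where "m i = spos_measure \<Omega> ([?n, \<lambda>A. - ?n A, \<nu>, \<lambda>A. - \<nu> A, \<mu>, \<lambda>A. - \<mu> A] ! i)" for i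
  define d where "d i = [1, - 1, - 1, 1, - c, c] ! i" for i
  have sn: "smeas ?n" by (rule smeas_lin[OF s])
  have 6: "{..<6::nat} = {0,1,2,3,4,5}" by auto
  have sm: "smeas ([?n, \<lambda>A. - ?n A, \<nu>, \<lambda>A. - \<nu> A, \<mu>, \<lambda>A. - \<mu> A] ! i)" if "i < 6" for i
  proof -
    have "i \<in> {0,1,2,3,4,5}" using that 6 by blast
    then show ?thesis using sn s smeas_uminus[OF sn] smeas_uminus[OF s(1)] smeas_uminus[OF s(2)] by auto
  qed
  have "(\<Sum>i<6. d i * (\<integral>x. z x \<partial>m i)) = 0"
  proof (rule integral_lin_comb_zero[OF _ _ _ z])
    show "finite_measure (m i)" if "i < 6" for i unfolding m_def by (rule finite_spos[OF sm[OF that]])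
    show "sets (m i) = bsets \<Omega>" for i unfolding m_def by simp
    fix A assume A: "A \<in> bsets \<Omega>"
    have e: "measure (m i) A = spos \<Omega> ([?n, \<lambda>A. - ?n A, \<nu>, \<lambda>A. - \<nu> A, \<mu>, \<lambda>A. - \<mu> A] ! i) A" if "i < 6" for i
      unfolding m_def by (rule measure_spos[OF sm[OF that] A])
    have "(\<Sum>i<6. d i * measure (m i) A) = (\<Sum>i<6. d i * spos \<Omega> ([?n, \<lambda>A. - ?n A, \<nu>, \<lambda>A. - \<nu> A, \<mu>, \<lambda>A. - \<mu> A] ! i) A)"
      by (intro sum.cong refl) (simp add: e)
    also have "\<dots> = (spos \<Omega> ?n A - spos \<Omega> (\<lambda>A. - ?n A) A) - (spos \<Omega> \<nu> A - spos \<Omega> (\<lambda>A. - \<nu> A) A)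
        - c * (spos \<Omega> \<mu> A - spos \<Omega> (\<lambda>A. - \<mu> A) A)"
      unfolding 6 d_def by (simp add: algebra_simps)
    also have "\<dots> = 0" using jordan[OF sn A] jordan[OF s(1) A] jordan[OF s(2) A] by simp
    finally show "(\<Sum>i<6. d i * measure (m i) A) = 0" .
  qed
  moreover have "(\<Sum>i<6. d i * (\<integral>x. z x \<partial>m i)) = sint \<Omega> ?n z - sint \<Omega> \<nu> z - c * sint \<Omega> \<mu> z"
    unfolding 6 d_def m_def sint_def by (simp add: algebra_simps)
  ultimately show ?thesis by simp
qed

lemma sint_bound:
  assumes s: "smeas \<nu>" and z: "bmeas z" "\<And>x. x \<in> \<Omega> \<Longrightarrow> \<bar>z x\<bar> \<le> 1"
  shows "\<bar>sint \<Omega> \<nu> z\<bar> \<le> spos \<Omega> \<nu> \<Omega> + spos \<Omega> (\<lambda>A. - \<nu> A) \<Omega>"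
proof -
  have b: "\<bar>\<integral>x. z x \<partial>spos_measure \<Omega> \<mu>\<bar> \<le> spos \<Omega> \<mu> \<Omega>" if m: "smeas \<mu>" for \<mu>
  proof -
    interpret finite_measure "spos_measure \<Omega> \<mu>" by (rule finite_spos[OF m])
    have "\<bar>\<integral>x. z x \<partial>spos_measure \<Omega> \<mu>\<bar> \<le> (\<integral>x. \<bar>z x\<bar> \<partial>spos_measure \<Omega> \<mu>)"
      using integral_norm_bound[of "spos_measure \<Omega> \<mu>" z] by simp
    also have "\<dots> \<le> (\<integral>x. 1 \<partial>spos_measure \<Omega> \<mu>)"
      using z(2) bmeas_integrable[OF z(1) m] by (intro integral_mono) auto
    also have "\<dots> = spos \<Omega> \<mu> \<Omega>" using measure_spos[OF m, of \<Omega>] by simp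
    finally show ?thesis .
  qed
  show ?thesis unfolding sint_def using b[OF s] b[OF smeas_uminus[OF s]] by linarith
qed

section \<open>Vector measures and convexity of their norm\<close>

lemma vmeasure_component: "vmeasure \<Omega> \<mu> \<Longrightarrow> smeas (\<lambda>A. \<mu> A \<bullet> b)"
  unfolding vmeasure_def smeas_def
  by (auto intro: bounded_linear.sums[OF bounded_linear_inner_left])

lemma vmeasure_lin:
  assumes "vmeasure \<Omega> \<nu>" "vmeasure \<Omega> \<mu>" shows "vmeasure \<Omega> (\<lambda>A. \<nu> A + c *\<^sub>R \<mu> A)"
  using assms unfolding vmeasure_def
  by (auto intro!: sums_add bounded_linear.sums[OF bounded_linear_scaleR_right])

lemma C0_bmeas:
  assumes "C0 \<Omega> z" "\<forall>x\<in>closure \<Omega>. infnorm (z x) \<le> 1" "b \<in> Basis"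
  shows "bmeas (\<lambda>x. z x \<bullet> b)" "x \<in> \<Omega> \<Longrightarrow> \<bar>z x \<bullet> b\<bar> \<le> 1"
proof -
  have b: "\<bar>z x \<bullet> b\<bar> \<le> 1" if "x \<in> \<Omega>" for x
  proof -
    have "x \<in> closure \<Omega>" using that closure_subset by blast
    then have "infnorm (z x) \<le> 1" using assms(2) by blast
    then show ?thesis using Basis_le_infnorm[OF assms(3), of "z x"] by linarith
  qed
  then show "x \<in> \<Omega> \<Longrightarrow> \<bar>z x \<bullet> b\<bar> \<le> 1" .
  have "continuous_on \<Omega> z"
    by (rule continuous_on_subset[OF assms(1)[unfolded C0_def, THEN conjunct1] closure_subset])
  then have "continuous_on \<Omega> (\<lambda>x. z x \<bullet> b)" by (intro continuous_intros)
  then show "bmeas (\<lambda>x. z x \<bullet> b)" unfolding bmeas_def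
    using b by (intro conjI exI[of _ 1] ballI borel_measurable_continuous_on_restrict)
qed

lemma test_fun_bmeas:
  assumes "test_fun U \<phi> D\<phi>" shows "bmeas \<phi>"
proof -
  obtain C where "\<And>x. \<bar>\<phi> x\<bar> \<le> C" using test_fun_bounded[OF assms] by metis
  moreover have "\<phi> \<in> borel_measurable (restrict_space borel \<Omega>)"
    using test_funD(2)[OF assms] by (intro borel_measurable_continuous_on_restrict) (auto intro: continuous_on_subset)
  ultimately show ?thesis unfolding bmeas_def by blast
qed

definition adm :: "('a \<Rightarrow> 'a) set" where
  "adm = {z. C0 \<Omega> z \<and> (\<forall>x\<in>closure \<Omega>. infnorm (z x) \<le> 1)}"

lemma gnorm_eq: "gnorm \<Omega> \<mu> = (SUP z\<in>adm. vint \<Omega> \<mu> z)"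
  unfolding gnorm_def adm_def by (rule arg_cong[where f=Sup]) auto

lemma adm_ne: "adm \<noteq> {}"
proof -
  have "(\<lambda>x. 0) \<in> adm" by (simp add: adm_def C0_def infnorm_0)
  then show ?thesis by blast
qed

lemma vint_lin:
  assumes "vmeasure \<Omega> \<nu>" "vmeasure \<Omega> \<mu>" "z \<in> adm"
  shows "vint \<Omega> (\<lambda>A. \<nu> A + c *\<^sub>R \<mu> A) z = vint \<Omega> \<nu> z + c * vint \<Omega> \<mu> z"
proof -
  have "sint \<Omega> (\<lambda>A. (\<nu> A + c *\<^sub>R \<mu> A) \<bullet> b) (\<lambda>x. z x \<bullet> b)
      = sint \<Omega> (\<lambda>A. \<nu> A \<bullet> b) (\<lambda>x. z x \<bullet> b) + c * sint \<Omega> (\<lambda>A. \<mu> A \<bullet> b) (\<lambda>x. z x \<bullet> b)" if b: "b \<in> Basis" for b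
  proof -
    have "bmeas (\<lambda>x. z x \<bullet> b)" using assms(3) by (intro C0_bmeas(1)[OF _ _ b]) (auto simp: adm_def)
    from sint_lin[OF vmeasure_component[OF assms(1), of b] vmeasure_component[OF assms(2), of b] this, of c]
    show ?thesis by (simp add: inner_add_left)
  qed
  then show ?thesis unfolding vint_def by (simp add: sum.distrib sum_distrib_left)
qed

text \<open>The variations of the components bound the pairing uniformly over admissible fields;
  without this the supremum in \<open>gnorm\<close> would carry no information.\<close>

lemma vint_bdd:
  assumes "vmeasure \<Omega> \<mu>" shows "bdd_above ((\<lambda>z. vint \<Omega> \<mu> z) ` adm)"
proof (rule bdd_aboveI2)
  fix z assume z: "z \<in> adm"
  show "vint \<Omega> \<mu> z \<le> (\<Sum>b\<in>Basis. spos \<Omega> (\<lambda>A. \<mu> A \<bullet> b) \<Omega> + spos \<Omega> (\<lambda>A. - (\<mu> A \<bullet> b)) \<Omega>)"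
    unfolding vint_def
  proof (rule sum_mono)
    fix b :: 'a assume b: "b \<in> Basis"
    have "\<bar>sint \<Omega> (\<lambda>A. \<mu> A \<bullet> b) (\<lambda>x. z x \<bullet> b)\<bar> \<le> spos \<Omega> (\<lambda>A. \<mu> A \<bullet> b) \<Omega> + spos \<Omega> (\<lambda>A. - (\<mu> A \<bullet> b)) \<Omega>"
      using z by (intro sint_bound[OF vmeasure_component[OF assms]] C0_bmeas[OF _ _ b]) (auto simp: adm_def)
    then show "sint \<Omega> (\<lambda>A. \<mu> A \<bullet> b) (\<lambda>x. z x \<bullet> b) \<le> spos \<Omega> (\<lambda>A. \<mu> A \<bullet> b) \<Omega> + spos \<Omega> (\<lambda>A. - (\<mu> A \<bullet> b)) \<Omega>" by linarith
  qed
qed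

text \<open>Each pairing is affine in t, and the norm is their supremum. The form chosen says that
  difference quotients at \<nu> in the direction \<mu> are nondecreasing.\<close>

lemma gnorm_convex:
  assumes v: "vmeasure \<Omega> \<nu>" "vmeasure \<Omega> \<mu>" and t: "0 < t" "t \<le> s"
  shows "gnorm \<Omega> (\<lambda>A. \<nu> A + t *\<^sub>R \<mu> A) \<le> (1 - t / s) * gnorm \<Omega> \<nu> + t / s * gnorm \<Omega> (\<lambda>A. \<nu> A + s *\<^sub>R \<mu> A)"
  unfolding gnorm_eq
proof (rule cSUP_least[OF adm_ne])
  fix z assume z: "z \<in> adm"
  have s: "s > 0" "0 \<le> 1 - t / s" "0 \<le> t / s" using t by auto
  have "vint \<Omega> (\<lambda>A. \<nu> A + t *\<^sub>R \<mu> A) z = (1 - t / s) * vint \<Omega> \<nu> z + t / s * vint \<Omega> (\<lambda>A. \<nu> A + s *\<^sub>R \<mu> A) z"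
    using s by (simp add: vint_lin[OF v z] field_simps)
  also have "\<dots> \<le> (1 - t / s) * (SUP z\<in>adm. vint \<Omega> \<nu> z) + t / s * (SUP z\<in>adm. vint \<Omega> (\<lambda>A. \<nu> A + s *\<^sub>R \<mu> A) z)"
    by (intro add_mono mult_left_mono s cSUP_upper z vint_bdd v vmeasure_lin)
  finally show "vint \<Omega> (\<lambda>A. \<nu> A + t *\<^sub>R \<mu> A) z
      \<le> (1 - t / s) * (SUP z\<in>adm. vint \<Omega> \<nu> z) + t / s * (SUP z\<in>adm. vint \<Omega> (\<lambda>A. \<nu> A + s *\<^sub>R \<mu> A) z)" .
qed

end

section \<open>Gradient measures\<close>

context bounded_open
begin

text \<open>A generator for the Borel sets of \<Omega> that test functions can see: products of test
  functions make it stable under intersection, and it contains all balls whose closure lies in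
  \<Omega>.\<close>

definition supports :: "'a set set" where
  "supports = {{x. \<phi> x \<noteq> 0} |\<phi>. \<exists>D\<phi>. test_fun \<Omega> \<phi> D\<phi>}"

lemma supportsI: "test_fun \<Omega> \<phi> D\<phi> \<Longrightarrow> A = {x. \<phi> x \<noteq> 0} \<Longrightarrow> A \<in> supports"
  unfolding supports_def by blast

lemma supports_sub: "supports \<subseteq> bsets \<Omega>"
proof
  fix A assume "A \<in> supports"
  then obtain \<phi> D\<phi> where t: "test_fun \<Omega> \<phi> D\<phi>" "A = {x. \<phi> x \<noteq> 0}" unfolding supports_def by blast
  have "open {x. \<phi> x \<noteq> 0}" using open_Collect_neq[OF test_funD(2)[OF t(1)] continuous_on_const] .
  moreover have "{x. \<phi> x \<noteq> 0} \<subseteq> \<Omega>" using test_fun_zero(1)[OF t(1)] by blast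
  ultimately show "A \<in> bsets \<Omega>" using t(2) by (simp add: bsets_def)
qed

lemma supports_Int: "Int_stable supports"
proof (rule Int_stableI)
  fix A B assume "A \<in> supports" "B \<in> supports"
  then obtain \<phi> D\<phi> \<psi> D\<psi> where t: "test_fun \<Omega> \<phi> D\<phi>" "A = {x. \<phi> x \<noteq> 0}" "test_fun \<Omega> \<psi> D\<psi>" "B = {x. \<psi> x \<noteq> 0}"
    unfolding supports_def by blast
  have "A \<inter> B = {x. \<phi> x * \<psi> x \<noteq> 0}" using t by auto
  then show "A \<inter> B \<in> supports"
    by (rule supportsI[OF test_fun_mult[OF t(1) test_funD(1)[OF t(3)] test_funD(3)[OF t(3)]]])
qed

lemma ball_support: "s > 0 \<Longrightarrow> cball x s \<subseteq> \<Omega> \<Longrightarrow> ball x s \<in> supports"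
proof -
  assume s: "s > 0" "cball x s \<subseteq> \<Omega>"
  have "bump 3 x s \<xi> / 6 \<noteq> 0 \<longleftrightarrow> norm (\<xi> - x) < s" for \<xi>
  proof -
    have "bump 3 x s \<xi> / 6 \<noteq> 0 \<longleftrightarrow> (norm (\<xi> - x))\<^sup>2 < s\<^sup>2"
      unfolding bump_def by auto
    also have "\<dots> \<longleftrightarrow> norm (\<xi> - x) < s"
      using s(1) power2_less_imp_less[of "norm (\<xi> - x)" s] power_strict_mono[of "norm (\<xi> - x)" s 2] by auto
    finally show ?thesis .
  qed
  then have "ball x s = {\<xi>. bump 3 x s \<xi> / 6 \<noteq> 0}" by (simp add: ball_def dist_norm norm_minus_commute del: divide_eq_0_iff)
  then show "ball x s \<in> supports" by (rule supportsI[OF test_fun_bump3[OF s]])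
qed

lemma open_countable_Union_supports:
  assumes "open U" "U \<subseteq> \<Omega>"
  shows "\<exists>F. countable F \<and> F \<subseteq> supports \<and> \<Union>F = U"
proof -
  define B where "B = {ball x s | x s. s > 0 \<and> cball x s \<subseteq> U}"
  have "\<Union>B = U"
  proof
    show "\<Union>B \<subseteq> U" unfolding B_def using ball_subset_cball by blast
    show "U \<subseteq> \<Union>B"
    proof
      fix x assume "x \<in> U"
      then obtain s where "s > 0" "cball x s \<subseteq> U" using assms(1) open_contains_cball by blast
      then have "ball x s \<in> B" "x \<in> ball x s" unfolding B_def by auto
      then show "x \<in> \<Union>B" by blast
    qed
  qed
  moreover have "\<And>S. S \<in> B \<Longrightarrow> open S" unfolding B_def by auto
  ultimately obtain F where F: "F \<subseteq> B" "countable F" "\<Union>F = U" using Lindelof[of B] by metis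
  moreover have "B \<subseteq> supports" unfolding B_def using ball_support assms(2) by blast
  ultimately show ?thesis by blast
qed

lemma sigma_sets_supports: "sigma_sets \<Omega> supports = bsets \<Omega>"
proof
  show "sigma_sets \<Omega> supports \<subseteq> bsets \<Omega>"
    using sigma_algebra.sigma_sets_subset[OF sigma_algebra_bsets supports_sub] .
  have "bsets \<Omega> = (\<inter>) \<Omega> ` sigma_sets UNIV {S. open S}"
    using sets_restrict_space[of borel \<Omega>] open_\<Omega>
    by (auto simp: bsets_def sets_borel[symmetric] image_iff)
  also have "\<dots> = sigma_sets \<Omega> ((\<inter>) \<Omega> ` {S. open S})"
    by (rule sigma_sets_Int) (use open_\<Omega> in \<open>auto simp: sets_borel[symmetric]\<close>)
  also have "\<dots> \<subseteq> sigma_sets \<Omega> supports"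
  proof (rule sigma_sets_mono)
    show "(\<inter>) \<Omega> ` {S. open S} \<subseteq> sigma_sets \<Omega> supports"
    proof
      fix U assume "U \<in> (\<inter>) \<Omega> ` {S. open S}"
      then have "open U" "U \<subseteq> \<Omega>" using open_\<Omega> by auto
      from open_countable_Union_supports[OF this] obtain F where F: "countable F" "F \<subseteq> supports" "\<Union>F = U" by blast
      show "U \<in> sigma_sets \<Omega> supports"
        unfolding F(3)[symmetric] using F(1,2) by (intro sigma_sets_UNION) auto
    qed
  qed
  finally show "bsets \<Omega> \<subseteq> sigma_sets \<Omega> supports" .
qed

text \<open>If all test functions integrate to zero, the two variations agree on the generator
  \<open>supports\<close>, hence on all Borel sets, and the measure is their difference.\<close>

lemma smeas_zero:
  assumes s: "smeas \<nu>" and z: "\<And>\<phi> D\<phi>. test_fun \<Omega> \<phi> D\<phi> \<Longrightarrow> sint \<Omega> \<nu> \<phi> = 0" and A: "A \<in> bsets \<Omega>"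
  shows "\<nu> A = 0"
proof -
  let ?P = "spos_measure \<Omega> \<nu>" and ?Q = "spos_measure \<Omega> (\<lambda>A. - \<nu> A)"
  interpret P: finite_measure ?P by (rule finite_spos[OF s])
  interpret Q: finite_measure ?Q by (rule finite_spos[OF smeas_uminus[OF s]])
  obtain F where F: "countable F" "F \<subseteq> supports" "\<Union>F = \<Omega>"
    using open_countable_Union_supports[OF open_\<Omega> subset_refl] by blast
  have "?P = ?Q"
  proof (rule measure_eqI_generator_eq_countable)
    show "Int_stable supports" by (rule supports_Int)
    show "supports \<subseteq> Pow \<Omega>" using supports_sub bsets_subset by blast
    show "sets ?P = sigma_sets \<Omega> supports" "sets ?Q = sigma_sets \<Omega> supports" by (simp_all add: sigma_sets_supports)
    show "countable F" "F \<subseteq> supports" "\<Union>F = \<Omega>" by (fact F)+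
    show "\<And>a. a \<in> F \<Longrightarrow> emeasure ?P a \<noteq> \<infinity>" by simp
    fix X assume X: "X \<in> supports"
    then obtain \<phi> D\<phi> where t: "test_fun \<Omega> \<phi> D\<phi>" "X = {x. \<phi> x \<noteq> 0}" unfolding supports_def by blast
    \<comment> \<open>This is k \<phi>^2 / (1 + k \<phi>^2): a continuously differentiable function
      of \<phi> vanishing at 0, hence a test function, and it converges boundedly to the indicator
      of X.\<close>
    define \<psi> where "\<psi> k x = 1 - 1 / (1 + real k * (\<phi> x)\<^sup>2)" for k :: nat and x
    have pos: "1 + real k * r\<^sup>2 > 0" for k r by (intro add_pos_nonneg) auto
    have tp: "test_fun \<Omega> (\<psi> k) (\<lambda>x. (2 * real k * \<phi> x / (1 + real k * (\<phi> x)\<^sup>2)\<^sup>2) *\<^sub>R D\<phi> x)" for k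
      unfolding \<psi>_def
    proof (rule test_fun_compose[OF t(1), where \<beta> = "\<lambda>r. 1 - 1 / (1 + real k * r\<^sup>2)"])
      fix r :: real
      show "((\<lambda>r. 1 - 1 / (1 + real k * r\<^sup>2)) has_real_derivative 2 * real k * r / (1 + real k * r\<^sup>2)\<^sup>2) (at r)"
        using pos[of k r] by (auto intro!: derivative_eq_intros simp: power2_eq_square)
      show "continuous_on UNIV (\<lambda>r::real. 2 * real k * r / (1 + real k * r\<^sup>2)\<^sup>2)"
        using pos[of k] by (intro continuous_intros) (auto simp: less_imp_neq[symmetric])
    qed simp
    have lim: "(\<lambda>k. \<psi> k x) \<longlonglongrightarrow> indicator X x" for x
    proof (cases "\<phi> x = 0")
      case True then show ?thesis by (simp add: \<psi>_def t(2))
    next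
      case False
      then have p: "(\<phi> x)\<^sup>2 > 0" by simp
      have "filterlim (\<lambda>k. (\<phi> x)\<^sup>2 * real k) at_top sequentially"
        by (rule filterlim_tendsto_pos_mult_at_top[OF tendsto_const p filterlim_real_sequentially])
      then have "filterlim (\<lambda>k. 1 + (\<phi> x)\<^sup>2 * real k) at_top sequentially"
        by (rule filterlim_tendsto_add_at_top[OF tendsto_const])
      then have "(\<lambda>k. inverse (1 + (\<phi> x)\<^sup>2 * real k)) \<longlonglongrightarrow> 0"
        by (rule tendsto_inverse_0_at_top)
      from tendsto_diff[OF tendsto_const[of 1] this] False show ?thesis
        by (simp add: \<psi>_def t(2) divide_inverse mult.commute)
    qed
    have b: "\<bar>\<psi> k x\<bar> \<le> 1" for k x
    proof -
      have "1 / (1 + real k * (\<phi> x)\<^sup>2) \<le> 1" "1 / (1 + real k * (\<phi> x)\<^sup>2) \<ge> 0"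
        using pos[of k "\<phi> x"] by simp_all
      then show ?thesis unfolding \<psi>_def by linarith
    qed
    have XB: "X \<in> bsets \<Omega>" using supports_sub X by blast
    have conv: "(\<lambda>k. \<integral>x. \<psi> k x \<partial>spos_measure \<Omega> \<mu>) \<longlonglongrightarrow> measure (spos_measure \<Omega> \<mu>) X" if m: "smeas \<mu>" for \<mu>
    proof -
      interpret finite_measure "spos_measure \<Omega> \<mu>" by (rule finite_spos[OF m])
      have "(\<lambda>k. \<integral>x. \<psi> k x \<partial>spos_measure \<Omega> \<mu>) \<longlonglongrightarrow> (\<integral>x. indicator X x \<partial>spos_measure \<Omega> \<mu>)"
      proof (rule integral_dominated_convergence[where w="\<lambda>_. 1"])
        show "\<psi> k \<in> borel_measurable (spos_measure \<Omega> \<mu>)" for k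
          by (rule bmeas_spos[OF test_fun_bmeas[OF tp]])
        show "AE x in spos_measure \<Omega> \<mu>. (\<lambda>k. \<psi> k x) \<longlonglongrightarrow> indicator X x" using lim by (intro AE_I2)
        show "AE x in spos_measure \<Omega> \<mu>. norm (\<psi> k x) \<le> 1" for k using b by (intro AE_I2) simp
        show "(indicator X :: 'a \<Rightarrow> real) \<in> borel_measurable (spos_measure \<Omega> \<mu>)"
          using XB by (intro borel_measurable_indicator) simp
      qed simp
      moreover have "X \<inter> space (spos_measure \<Omega> \<mu>) = X" using XB sets.Int_space_eq2[of X "spos_measure \<Omega> \<mu>"] by simp
      ultimately show ?thesis by simp
    qed
    have "(\<integral>x. \<psi> k x \<partial>?P) = (\<integral>x. \<psi> k x \<partial>?Q)" for k using z[OF tp[of k]] unfolding sint_def by simp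
    then have "measure ?P X = measure ?Q X"
      using LIMSEQ_unique[OF conv[OF s], of "measure ?Q X"] conv[OF smeas_uminus[OF s]] by simp
    then show "emeasure ?P X = emeasure ?Q X" by (simp add: P.emeasure_eq_measure Q.emeasure_eq_measure)
  qed
  then show ?thesis
    using jordan[OF s A] measure_spos[OF s A] measure_spos[OF smeas_uminus[OF s] A] by simp
qed

text \<open>This gives the description operator in \<open>grad_meas\<close> its meaning. Each
  component of the difference integrates all test functions to zero.\<close>

lemma is_grad_meas_unique:
  assumes "is_grad_meas \<Omega> u \<mu>" "is_grad_meas \<Omega> u \<nu>" shows "\<mu> = \<nu>"
proof
  fix A
  have v: "vmeasure \<Omega> \<mu>" "vmeasure \<Omega> \<nu>" using assms by (auto simp: is_grad_meas_def)
  show "\<mu> A = \<nu> A"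
  proof (cases "A \<in> bsets \<Omega>")
    case True
    show ?thesis
    proof (rule euclidean_eqI)
      fix b :: 'a assume b: "b \<in> Basis"
      note s = vmeasure_component[OF v(1), of b] vmeasure_component[OF v(2), of b]
      have "sint \<Omega> (\<lambda>A. \<mu> A \<bullet> b + (- 1) * (\<nu> A \<bullet> b)) \<phi> = 0" if t: "test_fun \<Omega> \<phi> D\<phi>" for \<phi> D\<phi>
      proof -
        have "sint \<Omega> (\<lambda>A. \<mu> A \<bullet> b) \<phi> = sint \<Omega> (\<lambda>A. \<nu> A \<bullet> b) \<phi>"
        proof -
          have "(LINT x:\<Omega>|lebesgue. u x * (D\<phi> x \<bullet> b)) = - sint \<Omega> (\<lambda>A. \<mu> A \<bullet> b) \<phi>"
            using assms(1) t b unfolding is_grad_meas_def by blast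
          moreover have "(LINT x:\<Omega>|lebesgue. u x * (D\<phi> x \<bullet> b)) = - sint \<Omega> (\<lambda>A. \<nu> A \<bullet> b) \<phi>"
            using assms(2) t b unfolding is_grad_meas_def by blast
          ultimately show ?thesis by simp
        qed
        then show ?thesis using sint_lin[OF s test_fun_bmeas[OF t], of "- 1"] by simp
      qed
      from smeas_zero[OF smeas_lin[OF s] this True] show "\<mu> A \<bullet> b = \<nu> A \<bullet> b" by simp
    qed
  qed (use v in \<open>simp add: vmeasure_def\<close>)
qed

section \<open>Linearity of the gradient measure, and directional derivatives of G\<close>

lemma grad_meas_eq: "is_grad_meas \<Omega> u \<mu> \<Longrightarrow> grad_meas \<Omega> u = \<mu>"
  unfolding grad_meas_def using is_grad_meas_unique by (intro the_equality)

lemma BV_grad_meas: "BV \<Omega> u \<Longrightarrow> is_grad_meas \<Omega> u (grad_meas \<Omega> u)"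
proof -
  assume "BV \<Omega> u"
  then obtain \<mu> where "is_grad_meas \<Omega> u \<mu>" unfolding BV_def by blast
  then show ?thesis using grad_meas_eq by simp
qed

lemma BV_vmeasure: "BV \<Omega> u \<Longrightarrow> vmeasure \<Omega> (grad_meas \<Omega> u)"
  using BV_grad_meas unfolding is_grad_meas_def by blast

lemma BV_integrable: "BV \<Omega> u \<Longrightarrow> integrable M u"
  unfolding BV_def by (simp add: set_integrable_eq_lebesgue_on sets_\<Omega>)

lemma is_grad_meas_lin:
  assumes u: "BV \<Omega> u" and v: "BV \<Omega> v"
  shows "is_grad_meas \<Omega> (\<lambda>x. u x + t * v x) (\<lambda>A. grad_meas \<Omega> u A + t *\<^sub>R grad_meas \<Omega> v A)"
  unfolding is_grad_meas_def
proof (intro conjI allI impI ballI vmeasure_lin BV_vmeasure u v)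
  fix \<phi> D\<phi> and b :: 'a assume tf: "test_fun \<Omega> \<phi> D\<phi>" and b: "b \<in> Basis"
  obtain C where C: "\<And>x. norm (D\<phi> x) \<le> C" using test_fun_bounded[OF tf] by metis
  have i: "integrable M (\<lambda>x. w x * (D\<phi> x \<bullet> b))" if w: "BV \<Omega> w" for w
  proof (rule Bochner_Integration.integrable_bound)
    show "integrable M (\<lambda>x. C * w x)" using BV_integrable[OF w] by simp
    have "(\<lambda>x. D\<phi> x \<bullet> b) \<in> borel_measurable M"
      using test_funD(3)[OF tf] sets_\<Omega> by (intro continuous_measurable_lebesgue_on continuous_intros)
    then show "(\<lambda>x. w x * (D\<phi> x \<bullet> b)) \<in> borel_measurable M"
      using BV_integrable[OF w] by (intro borel_measurable_times) auto
    have "\<bar>D\<phi> x \<bullet> b\<bar> \<le> \<bar>C\<bar>" for x using Basis_le_norm[OF b, of "D\<phi> x"] C[of x] by linarith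
    then show "AE x in M. norm (w x * (D\<phi> x \<bullet> b)) \<le> norm (C * w x)"
      using mult_left_mono[of "\<bar>D\<phi> _ \<bullet> b\<bar>" "\<bar>C\<bar>" "\<bar>w _\<bar>"] by (intro AE_I2) (simp add: abs_mult mult.commute)
  qed
  have e: "(\<integral>x. w x * (D\<phi> x \<bullet> b) \<partial>M) = - sint \<Omega> (\<lambda>A. grad_meas \<Omega> w A \<bullet> b) \<phi>" if w: "BV \<Omega> w" for w
    using BV_grad_meas[OF w] tf b unfolding is_grad_meas_def by (simp add: set_integral_eq_lebesgue_on sets_\<Omega>)
  have "(\<integral>x. (u x + t * v x) * (D\<phi> x \<bullet> b) \<partial>M) = (\<integral>x. u x * (D\<phi> x \<bullet> b) + t * (v x * (D\<phi> x \<bullet> b)) \<partial>M)"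
    by (simp add: algebra_simps)
  also have "\<dots> = (\<integral>x. u x * (D\<phi> x \<bullet> b) \<partial>M) + t * (\<integral>x. v x * (D\<phi> x \<bullet> b) \<partial>M)"
    using i[OF u] i[OF v] by simp
  also have "\<dots> = - sint \<Omega> (\<lambda>A. grad_meas \<Omega> u A \<bullet> b + t * (grad_meas \<Omega> v A \<bullet> b)) \<phi>"
    using sint_lin[OF vmeasure_component[OF BV_vmeasure[OF u], of b]
        vmeasure_component[OF BV_vmeasure[OF v], of b] test_fun_bmeas[OF tf], of t] e[OF u] e[OF v] by simp
  finally show "(LINT x:\<Omega>|lebesgue. (u x + t * v x) * (D\<phi> x \<bullet> b))
      = - sint \<Omega> (\<lambda>A. (grad_meas \<Omega> u A + t *\<^sub>R grad_meas \<Omega> v A) \<bullet> b) \<phi>"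
    by (simp add: set_integral_eq_lebesgue_on sets_\<Omega> inner_add_left)
qed

lemma grad_meas_lin:
  "BV \<Omega> u \<Longrightarrow> BV \<Omega> v \<Longrightarrow>
    grad_meas \<Omega> (\<lambda>x. u x + t * v x) = (\<lambda>A. grad_meas \<Omega> u A + t *\<^sub>R grad_meas \<Omega> v A)"
  by (rule grad_meas_eq[OF is_grad_meas_lin])

lemma BV_lin: "BV \<Omega> u \<Longrightarrow> BV \<Omega> v \<Longrightarrow> BV \<Omega> (\<lambda>x. u x + t * v x)"
proof -
  assume uv: "BV \<Omega> u" "BV \<Omega> v"
  have i: "integrable M (\<lambda>x. u x + t * v x)" using BV_integrable[OF uv(1)] BV_integrable[OF uv(2)] by simp
  then have "set_integrable lebesgue \<Omega> (\<lambda>x. u x + t * v x)" by (simp add: set_integrable_eq_lebesgue_on sets_\<Omega>)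
  moreover from this have "set_borel_measurable lebesgue \<Omega> (\<lambda>x. u x + t * v x)"
    unfolding set_integrable_def set_borel_measurable_def by (rule borel_measurable_integrable)
  ultimately show ?thesis unfolding BV_def using is_grad_meas_lin[OF uv] by blast
qed

text \<open>By convexity the difference quotients are nondecreasing in t, and L bounds them below.
  Hence the limit in \<open>Gdir\<close> exists and equals their infimum, which is at most the
  quotient at t = 1.\<close>

lemma Gdir_le:
  assumes u: "BV \<Omega> u" and v: "BV \<Omega> v"
    and L: "\<And>t. t > 0 \<Longrightarrow> Gfun \<Omega> u + t * L \<le> Gfun \<Omega> (\<lambda>x. u x + t * v x)"
  shows "Gdir \<Omega> u v \<le> Gfun \<Omega> (\<lambda>x. u x + v x) - Gfun \<Omega> u"
proof -
  define q where "q t = (Gfun \<Omega> (\<lambda>x. u x + t * v x) - Gfun \<Omega> u) / t" for t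
  have lb: "L \<le> q t" if "t > 0" for t
    using L[OF that] that unfolding q_def by (simp add: field_simps)
  have mono: "q t \<le> q s" if t: "0 < t" "t \<le> s" for t s
  proof -
    have "Gfun \<Omega> (\<lambda>x. u x + t * v x) \<le> (1 - t / s) * Gfun \<Omega> u + t / s * Gfun \<Omega> (\<lambda>x. u x + s * v x)"
      unfolding Gfun_def grad_meas_lin[OF u v] by (rule gnorm_convex[OF BV_vmeasure[OF u] BV_vmeasure[OF v] t])
    also have "\<dots> = Gfun \<Omega> u + t * q s" using t unfolding q_def by (simp add: field_simps)
    finally show ?thesis using t unfolding q_def[of t] by (simp add: pos_divide_le_eq mult.commute)
  qed
  define l where "l = Inf (q ` {0<..})"
  have bdd: "bdd_below (q ` {0<..})" using lb by (intro bdd_belowI2[where m=L]) auto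
  have le: "l \<le> q t" if "t > 0" for t unfolding l_def using that by (intro cINF_lower[OF bdd]) auto
  have "(q \<longlongrightarrow> l) (at_right 0)"
  proof (rule order_tendstoI)
    fix a assume "a < l"
    then show "eventually (\<lambda>t. a < q t) (at_right 0)"
      unfolding eventually_at_right_field using le by (intro exI[of _ 1]) (auto intro: less_le_trans)
  next
    fix a assume "l < a"
    then obtain s where s: "s > 0" "q s < a"
      unfolding l_def using cInf_lessD[of "q ` {0<..}" a] by auto
    then show "eventually (\<lambda>t. q t < a) (at_right 0)"
      unfolding eventually_at_right_field using mono by (intro exI[of _ s]) (meson le_less_trans less_imp_le)
  qed
  then have "Gdir \<Omega> u v = l"
    unfolding Gdir_def q_def[abs_def] by (intro tendsto_Lim) simp_all
  also have "l \<le> q 1" by (rule le) simp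
  finally show ?thesis unfolding q_def by simp
qed

text \<open>For t > 0 this supplies the lower bound L in \<open>Gdir_le\<close>; at t = 1 it
  converts the stationarity equation into an inequality for the increment of G.\<close>

lemma subgradient_Gfun:
  assumes u: "BV \<Omega> u" and v: "BV \<Omega> v" and s: "subdiff_g \<Omega> (grad_meas \<Omega> u) l"
  shows "Gfun \<Omega> u + t * l (grad_meas \<Omega> v) \<le> Gfun \<Omega> (\<lambda>x. u x + t * v x)"
proof -
  note vm = BV_vmeasure[OF u] BV_vmeasure[OF v]
  have "gnorm \<Omega> (grad_meas \<Omega> u) + l (\<lambda>A. (grad_meas \<Omega> u A + t *\<^sub>R grad_meas \<Omega> v A) - grad_meas \<Omega> u A)
      \<le> gnorm \<Omega> (\<lambda>A. grad_meas \<Omega> u A + t *\<^sub>R grad_meas \<Omega> v A)"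
    using s vmeasure_lin[OF vm, of t] unfolding subdiff_g_def by blast
  moreover have "l (\<lambda>A. t *\<^sub>R grad_meas \<Omega> v A) = t * l (grad_meas \<Omega> v)"
    using s vm(2) unfolding subdiff_g_def vdual_def by blast
  ultimately show ?thesis unfolding Gfun_def grad_meas_lin[OF u v] by simp
qed

end

section \<open>Sufficient second order condition\<close>

context cost_problem
begin

lemma first_order_inequality:
  assumes u: "BVL2 \<omega> ubar" and v: "BVL2 \<omega> v" and p: "lin (S ubar) \<phi> (\<lambda>x. S ubar x - yd x)"
    and l: "subdiff_g \<omega> (grad_meas \<omega> ubar) l"
    and foc: "\<alpha> * l (grad_meas \<omega> v)
       + (LINT x:\<omega>|lebesgue. (\<phi> x + \<gamma> * ubar x + \<beta> * (LINT z:\<omega>|lebesgue. ubar z)) * v x) = 0"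
    and \<alpha>: "\<alpha> > 0"
  shows "0 \<le> Lf ubar \<phi> v + \<alpha> * (Gfun \<omega> (\<lambda>x. ubar x + v x) - Gfun \<omega> ubar)"
proof -
  have su: "sqi N ubar" and sv: "sqi N v" using u v by (simp_all add: BVL2_def L2_iff_sqi)
  have sM: "sqi M \<phi>" by (rule lin_sqi[OF p])
  have "sqi M (ext \<phi>)"
  proof (rule sqi_bound(1)[OF sM, where C=1])
    show "ext \<phi> \<in> borel_measurable M" unfolding ext_def[abs_def]
      using sqi_meas[OF sM] by (intro borel_measurable_times borel_measurable_indicator) (auto simp: sets_restrict_space_iff sets_\<Omega> \<omega>_sub)
    show "AE x in M. norm (ext \<phi> x) \<le> 1 * norm (\<phi> x)" by (simp add: ext_def indicator_def)
  qed
  then have sp: "sqi N \<phi>" by (simp add: sqi_ext)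
  define m where "m = (\<integral>x. ubar x \<partial>N)"
  have i: "integrable N (\<lambda>x. \<phi> x * v x)" "integrable N (\<lambda>x. ubar x * v x)" "integrable N v"
    using sqi_mult_integrable[OF sp sv] sqi_mult_integrable[OF su sv] N.sqi_integrable_L1(1)[OF sv] by simp_all
  have "(LINT x:\<omega>|lebesgue. (\<phi> x + \<gamma> * ubar x + \<beta> * (LINT z:\<omega>|lebesgue. ubar z)) * v x)
      = (\<integral>x. \<phi> x * v x + \<gamma> * (ubar x * v x) + \<beta> * m * v x \<partial>N)"
    by (simp add: set_integral_eq_lebesgue_on m_def algebra_simps)
  also have "\<dots> = (\<integral>x. \<phi> x * v x \<partial>N) + \<gamma> * (\<integral>x. ubar x * v x \<partial>N) + \<beta> * m * (\<integral>x. v x \<partial>N)"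
    using i by simp
  also have "(\<integral>x. \<phi> x * v x \<partial>N) = (\<integral>x. ext v x * \<phi> x \<partial>M)"
    unfolding integral_N by (rule Bochner_Integration.integral_cong) (auto simp: ext_def)
  finally have "\<alpha> * l (grad_meas \<omega> v) + Lf ubar \<phi> v = 0"
    using foc unfolding Lf_def m_def by simp
  moreover have "Gfun \<omega> ubar + 1 * l (grad_meas \<omega> v) \<le> Gfun \<omega> (\<lambda>x. ubar x + 1 * v x)"
    using u v by (intro N.subgradient_Gfun l) (simp_all add: BVL2_def)
  then have "\<alpha> * l (grad_meas \<omega> v) \<le> \<alpha> * (Gfun \<omega> (\<lambda>x. ubar x + v x) - Gfun \<omega> ubar)"
    using \<alpha> by (intro mult_left_mono) auto
  ultimately show ?thesis by linarith
qed

lemma second_order_sufficiency: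
  assumes u: "BVL2 \<omega> ubar" and \<alpha>: "\<alpha> > 0" and \<gamma>: "\<gamma> > 0" and \<delta>: "\<delta> > 0" and \<tau>: "\<tau> > 0"
    and p: "lin (S ubar) \<phi> (\<lambda>x. S ubar x - yd x)"
    and l: "subdiff_g \<omega> (grad_meas \<omega> ubar) l"
    and foc: "\<And>v. BVL2 \<omega> v \<Longrightarrow> \<alpha> * l (grad_meas \<omega> v)
       + (LINT x:\<omega>|lebesgue. (\<phi> x + \<gamma> * ubar x + \<beta> * (LINT z:\<omega>|lebesgue. ubar z)) * v x) = 0"
    and ssc: "\<And>v z. BVL2 \<omega> v \<Longrightarrow> lin_sol \<Omega> \<omega> f (S ubar) v z \<Longrightarrow>
        F1 \<Omega> \<omega> f yd \<beta> \<gamma> ubar v + \<alpha> * Gdir \<omega> ubar v \<le> \<tau> * l2n \<Omega> z \<Longrightarrow>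
        \<delta> * (l2n \<omega> v)\<^sup>2 \<le> F2 \<Omega> \<omega> f yd \<beta> \<gamma> ubar v"
  obtains \<kappa> \<epsilon> where "\<kappa> > 0" "\<epsilon> > 0" "\<And>u. BVL2 \<omega> u \<Longrightarrow> l2n \<omega> (\<lambda>x. u x - ubar x) \<le> \<epsilon> \<Longrightarrow>
    Jcost \<Omega> \<omega> f yd \<alpha> \<beta> \<gamma> ubar + \<kappa> / 2 * (l2n \<omega> (\<lambda>x. u x - ubar x))\<^sup>2 \<le> Jcost \<Omega> \<omega> f yd \<alpha> \<beta> \<gamma> u"
proof -
  have su: "sqi N ubar" using u by (simp add: BVL2_def L2_iff_sqi)
  \<comment> \<open>Both cases below yield \<kappa> times the squared norm of v. The expansion error
    consumes half of it, and the other half is the growth claimed.\<close>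
  define \<kappa> where "\<kappa> = min \<delta> \<gamma> / 2"
  have \<kappa>: "\<kappa> > 0" "2 * \<kappa> \<le> \<delta>" "2 * \<kappa> \<le> \<gamma>" using \<gamma> \<delta> unfolding \<kappa>_def by auto
  obtain C where C: "C \<ge> 0" "\<And>z v. sqi M z \<Longrightarrow> \<gamma> * (nrm2 N v)\<^sup>2 - C * (nrm2 M z)\<^sup>2 \<le> Q ubar \<phi> z v"
    by (rule Q_lower_bound[OF su p], rule that)
  have "\<kappa> / 2 > 0" using \<kappa> by simp
  obtain e where e: "e > 0" "\<And>v z. sqi N v \<Longrightarrow> nrm2 N v \<le> e \<Longrightarrow> lin (S ubar) z (ext v) \<Longrightarrow>
    \<bar>F (\<lambda>x. ubar x + v x) - F ubar - Lf ubar \<phi> v - Q ubar \<phi> z v / 2\<bar> \<le> \<kappa> / 2 * (nrm2 N v)\<^sup>2"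
    by (rule cost_second_order[OF su p \<open>\<kappa> / 2 > 0\<close>], rule that)
  \<comment> \<open>The second entry forces C times the norm of z below \<tau>, so that the
    quadratic loss is absorbed by \<tau> times that norm; the summand 1 keeps the denominator
    positive.\<close>
  define \<epsilon> where "\<epsilon> = min e (\<tau> / (C * CP\<^sup>2 + 1))"
  have cc: "C * CP\<^sup>2 + 1 > 0" using C(1) by (intro add_nonneg_pos mult_nonneg_nonneg) auto
  have \<epsilon>: "\<epsilon> > 0" unfolding \<epsilon>_def using e(1) \<tau> cc by simp
  show ?thesis
  proof (rule that[OF \<kappa>(1) \<epsilon>])
    fix u' assume u': "BVL2 \<omega> u'" and n: "l2n \<omega> (\<lambda>x. u' x - ubar x) \<le> \<epsilon>"
    define v where "v x = u' x - ubar x" for x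
    have "BV \<omega> (\<lambda>x. u' x + (- 1) * ubar x)" using u u' by (intro N.BV_lin) (simp_all add: BVL2_def)
    then have bv: "BV \<omega> v" unfolding v_def by simp
    have sv: "sqi N v" unfolding v_def using u' by (intro sqi_diff su) (simp add: BVL2_def L2_iff_sqi)
    have bvl: "BVL2 \<omega> v" using bv sv by (simp add: BVL2_def L2_iff_sqi)
    have uv: "(\<lambda>x. ubar x + v x) = u'" by (simp add: v_def)
    have nv: "l2n \<omega> v = nrm2 N v" by (simp add: l2n_eq_nrm2)
    have n: "nrm2 N v \<le> e" "nrm2 N v \<le> \<tau> / (C * CP\<^sup>2 + 1)"
      using n unfolding v_def[symmetric] nv \<epsilon>_def by simp_all
    have sev: "sqi M (ext v)" using sv by (simp add: sqi_ext)
    obtain z where z: "lin (S ubar) z (ext v)" using lin_exists[OF S_bdm[OF su] sev] by blast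
    have zb: "nrm2 M z \<le> CP\<^sup>2 * nrm2 N v" using lin_bounds(1)[OF S_bdm[OF su] z sev] by (simp add: nrm2_ext)
    have zs: "lin_sol \<Omega> \<omega> f (S ubar) v z" using z lin_sol_iff[OF _ S_bdm[OF su]] bvl by (simp add: BVL2_def)
    have nz: "l2n \<Omega> z = nrm2 M z" by (simp add: l2n_eq_nrm2 sets_\<Omega>)
    define g where "g = Gfun \<omega> u' - Gfun \<omega> ubar"
    have first: "0 \<le> Lf ubar \<phi> v + \<alpha> * g"
      using first_order_inequality[OF u bvl p l foc[OF bvl] \<alpha>] unfolding uv g_def .
    have "Gdir \<omega> ubar v \<le> g"
    proof -
      have "Gdir \<omega> ubar v \<le> Gfun \<omega> (\<lambda>x. ubar x + v x) - Gfun \<omega> ubar"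
        using u bv N.subgradient_Gfun[OF _ bv l] by (intro N.Gdir_le[where L = "l (grad_meas \<omega> v)"]) (simp_all add: BVL2_def)
      then show ?thesis unfolding uv g_def .
    qed
    then have dir: "\<alpha> * Gdir \<omega> ubar v \<le> \<alpha> * g" using \<alpha> by simp
    have ex: "\<bar>F u' - F ubar - Lf ubar \<phi> v - Q ubar \<phi> z v / 2\<bar> \<le> \<kappa> / 2 * (nrm2 N v)\<^sup>2"
      using e(2)[OF sv n(1) z] unfolding uv .
    have main: "2 * \<kappa> * (nrm2 N v)\<^sup>2 / 2 \<le> Lf ubar \<phi> v + \<alpha> * g + Q ubar \<phi> z v / 2"
    proof (cases "Lf ubar \<phi> v + \<alpha> * Gdir \<omega> ubar v \<le> \<tau> * nrm2 M z")
      case True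
      then have "\<delta> * (nrm2 N v)\<^sup>2 \<le> Q ubar \<phi> z v"
        using ssc[OF bvl zs] unfolding F1_eq[OF su sv p] F2_eq[OF su sv p z] nv nz by simp
      moreover have "2 * \<kappa> * (nrm2 N v)\<^sup>2 \<le> \<delta> * (nrm2 N v)\<^sup>2" by (rule mult_right_mono[OF \<kappa>(2)]) simp
      ultimately show ?thesis using first by linarith
    next
      case False
      have nn: "0 \<le> nrm2 N v" "0 \<le> nrm2 M z" by simp_all
      have "C * nrm2 M z \<le> C * (CP\<^sup>2 * nrm2 N v)" by (rule mult_left_mono[OF zb C(1)])
      also have "\<dots> \<le> (C * CP\<^sup>2 + 1) * nrm2 N v" using nn by (simp add: algebra_simps)
      also have "\<dots> \<le> \<tau>" using n(2) cc by (simp add: pos_le_divide_eq mult.commute)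
      finally have "C * nrm2 M z * nrm2 M z \<le> \<tau> * nrm2 M z" using nn by (intro mult_right_mono)
      then have "C * (nrm2 M z)\<^sup>2 \<le> \<tau> * nrm2 M z" by (simp add: power2_eq_square mult.assoc)
      moreover have "0 \<le> \<tau> * nrm2 M z" using \<tau> nn by simp
      moreover have "2 * \<kappa> * (nrm2 N v)\<^sup>2 \<le> \<gamma> * (nrm2 N v)\<^sup>2" by (rule mult_right_mono[OF \<kappa>(3)]) simp
      ultimately show ?thesis using C(2)[OF lin_sqi[OF z], of v] False dir by linarith
    qed
    have "\<kappa> / 2 * (nrm2 N v)\<^sup>2 \<le> F u' - F ubar + \<alpha> * g" using ex main by (simp add: field_simps abs_le_iff)
    then show "Jcost \<Omega> \<omega> f yd \<alpha> \<beta> \<gamma> ubar + \<kappa> / 2 * (l2n \<omega> (\<lambda>x. u' x - ubar x))\<^sup>2 \<le> Jcost \<Omega> \<omega> f yd \<alpha> \<beta> \<gamma> u'"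
      unfolding v_def[symmetric] nv Jcost_def g_def by (simp add: algebra_simps)
  qed
qed

end

theorem theorem5p3:
  fixes \<Omega> \<omega> :: "'a::euclidean_space set"
    and f :: "'a \<Rightarrow> real \<Rightarrow> real"
    and yd ubar :: "'a \<Rightarrow> real"
    and \<alpha> \<beta> \<gamma> \<delta> \<tau> :: real
  assumes dim: "DIM('a) = 2 \<or> DIM('a) = 3"
    and dom: "lipschitz_domain \<Omega>"
    and omega: "open \<omega>" "\<omega> \<subseteq> \<Omega>"
    and alpha: "\<alpha> > 0" and beta: "\<beta> \<ge> 0" and gamma: "\<gamma> > 0"
    and yd: "L2 \<Omega> yd"
    and f_borel: "(\<lambda>(x, y). f x y) \<in> borel_measurable (restrict_space borel (\<Omega> \<times> UNIV))"
    and f_C2: "\<forall>x\<in>\<Omega>. \<forall>y. (f x has_real_derivative fy f x y) (at y) \<and>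
                   (fy f x has_real_derivative fyy f x y) (at y)"
    and f_C2': "\<forall>x\<in>\<Omega>. continuous_on UNIV (fyy f x)"
    and f0: "\<exists>p. p > real DIM('a) / 2 \<and> set_integrable lebesgue \<Omega> (\<lambda>x. \<bar>f x 0\<bar> powr p)"
    and f_mono: "AE x in lebesgue. x \<in> \<Omega> \<longrightarrow> (\<forall>y. fy f x y \<ge> 0)"
    and f_bound: "\<forall>M. \<exists>C. AE x in lebesgue. x \<in> \<Omega> \<longrightarrow>
                    (\<forall>y. \<bar>y\<bar> \<le> M \<longrightarrow> \<bar>fy f x y\<bar> + \<bar>fyy f x y\<bar> \<le> C)"
    and f_cont: "\<forall>M. \<forall>\<rho>>0. \<exists>\<epsilon>>0. AE x in lebesgue. x \<in> \<Omega> \<longrightarrow>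
                   (\<forall>y1 y2. \<bar>y1\<bar> \<le> M \<and> \<bar>y2\<bar> \<le> M \<and> \<bar>y2 - y1\<bar> < \<epsilon> \<longrightarrow>
                      \<bar>fyy f x y2 - fyy f x y1\<bar> \<le> \<rho>)"
    and ubar: "BVL2 \<omega> ubar"
    and foc: "\<exists>\<phi>bar lambar. adj_sol \<Omega> f (Sop \<Omega> \<omega> f ubar) yd \<phi>bar \<and>
                subdiff_g \<omega> (grad_meas \<omega> ubar) lambar \<and>
                (\<forall>v. BVL2 \<omega> v \<longrightarrow>
                   \<alpha> * lambar (grad_meas \<omega> v)
                   + (LINT x:\<omega>|lebesgue. (\<phi>bar x + \<gamma> * ubar x + \<beta> * (LINT z:\<omega>|lebesgue. ubar z)) * v x)
                   = 0)"
    and delta: "\<delta> > 0" and tau: "\<tau> > 0"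
    and ssc: "\<forall>v. BVL2 \<omega> v \<and>
                (\<exists>z. lin_sol \<Omega> \<omega> f (Sop \<Omega> \<omega> f ubar) v z \<and>
                   F1 \<Omega> \<omega> f yd \<beta> \<gamma> ubar v + \<alpha> * Gdir \<omega> ubar v \<le> \<tau> * l2n \<Omega> z)
              \<longrightarrow> F2 \<Omega> \<omega> f yd \<beta> \<gamma> ubar v \<ge> \<delta> * (l2n \<omega> v)\<^sup>2"
  shows "\<exists>\<kappa>>0. \<exists>\<epsilon>>0. \<forall>u. BVL2 \<omega> u \<and> l2n \<omega> (\<lambda>x. u x - ubar x) \<le> \<epsilon> \<longrightarrow>
           Jcost \<Omega> \<omega> f yd \<alpha> \<beta> \<gamma> ubar + \<kappa> / 2 * (l2n \<omega> (\<lambda>x. u x - ubar x))\<^sup>2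
             \<le> Jcost \<Omega> \<omega> f yd \<alpha> \<beta> \<gamma> u"
proof -
  obtain \<phi> l where a: "adj_sol \<Omega> f (Sop \<Omega> \<omega> f ubar) yd \<phi>" and l: "subdiff_g \<omega> (grad_meas \<omega> ubar) l"
    and foc': "\<And>v. BVL2 \<omega> v \<Longrightarrow> \<alpha> * l (grad_meas \<omega> v)
       + (LINT x:\<omega>|lebesgue. (\<phi> x + \<gamma> * ubar x + \<beta> * (LINT z:\<omega>|lebesgue. ubar z)) * v x) = 0"
    using foc by blast
  have \<Omega>: "open \<Omega>" "bounded \<Omega>" using dom by (auto simp: lipschitz_domain_def)
  \<comment> \<open>From here on the shape of the boundary enters only through the exterior
    balls.\<close>
  interpret cost_problem \<Omega> f \<omega> yd \<beta> \<gamma>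
  proof
    show "exterior_thick \<Omega>" by (rule lipschitz_domain_exterior_thick[OF dom])
    show "sqi (lebesgue_on \<Omega>) yd" using yd \<Omega> by (simp add: L2_iff_sqi)
  qed (fact \<Omega> dim omega beta f_borel f_C2 f0 f_mono f_bound f_cont)+
  have su: "sqi N ubar" using ubar by (simp add: BVL2_def L2_iff_sqi)
  show ?thesis
  proof (rule second_order_sufficiency[OF ubar alpha gamma delta tau adj_sol_imp_lin[OF S_bdm[OF su] _ a] l foc'])
    show "sqi M yd" by (rule local.yd)
    show "\<delta> * (l2n \<omega> v)\<^sup>2 \<le> F2 \<Omega> \<omega> f yd \<beta> \<gamma> ubar v"
      if "BVL2 \<omega> v" "lin_sol \<Omega> \<omega> f (S ubar) v z"
        "F1 \<Omega> \<omega> f yd \<beta> \<gamma> ubar v + \<alpha> * Gdir \<omega> ubar v \<le> \<tau> * l2n \<Omega> z" for v z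
      using ssc that by blast
    fix \<kappa> \<epsilon> :: real
    assume "\<kappa> > 0" "\<epsilon> > 0" "\<And>u. BVL2 \<omega> u \<Longrightarrow> l2n \<omega> (\<lambda>x. u x - ubar x) \<le> \<epsilon> \<Longrightarrow>
      Jcost \<Omega> \<omega> f yd \<alpha> \<beta> \<gamma> ubar + \<kappa> / 2 * (l2n \<omega> (\<lambda>x. u x - ubar x))\<^sup>2 \<le> Jcost \<Omega> \<omega> f yd \<alpha> \<beta> \<gamma> u"
    then show ?thesis by blast
  qed
qed

end
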